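(* Let $d\in\{2,3\}$, let $\Omega\subset\mathbb{R}^d$ be a bounded connected open polyhedral domain with Lipschitz boundary $\Gamma$, let $f\in L^2(\Omega;\mathbb{R}^d)$, let $\gamma>0$, and let $k\ge 1$ be an integer. Let $\sigma:\Omega\times\mathbb{R}^{d\times d}_{\rm sym}\to\mathbb{R}^{d\times d}_{\rm sym}$ be a stress-strain function satisfying Assumption (S) of the context, and let $(\mathcal{T}_h)_{h\in\mathcal{H}}$ be a regular mesh sequence of $\Omega$. Then, for all $h\in\mathcal{H}$, there exists at least one $\underline{u}_h\in\underline{U}_{h,0}^k$ such that $$\int_\Omega\sigma(\cdot,G_{{\rm s},h}^k\underline{u}_h):G_{{\rm s},h}^k\underline{v}_h+s_h(\underline{u}_h,\underline{v}_h)=\int_\Omega f\cdot v_h\qquad\forall\,\underline{v}_h\in\underline{U}_{h,0}^k.$$ Additionally, if $\sigma$ is strictly monotone, i.e., for a.e. $x\in\Omega$ and all $\tau,\eta\in\mathbb{R}^{d\times d}_{\rm sym}$ with $\tau\neq\eta$ one has $(\sigma(x,\tau)-\sigma(x,\eta)):(\tau-\eta)>0$, then the solution is unique.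
   Context: **Assumption (S).** $\sigma(x,\cdot)$ is continuous on $\mathbb{R}^{d\times d}_{\rm sym}$ for a.e. $x\in\Omega$; $\sigma(\cdot,\tau)$ is measurable on $\Omega$ for all $\tau\in\mathbb{R}^{d\times d}_{\rm sym}$; $\sigma(\cdot,0)\in L^2(\Omega;\mathbb{R}^{d\times d})$; and there exist $\overline\sigma,\underline\sigma\in(0,+\infty)$ such that for a.e. $x\in\Omega$ and all $\tau,\eta\in\mathbb{R}^{d\times d}_{\rm sym}$: (growth) $\|\sigma(x,\tau)-\sigma(x,0)\|_{d\times d}\le\overline\sigma\|\tau\|_{d\times d}$; (coercivity) $\sigma(x,\tau):\tau\ge\underline\sigma\|\tau\|_{d\times d}^2$; (monotonicity) $(\sigma(x,\tau)-\sigma(x,\eta)):(\tau-\eta)\ge0$. Here $\tau:\eta=\sum_{i,j}\tau_{i,j}\eta_{i,j}$ and $\|\tau\|_{d\times d}^2=\tau:\tau$. **Regular mesh sequence.** $\mathcal{H}\subset(0,+\infty)$ is a countable set having $0$ as its unique accumulation point. For each $h\in\mathcal{H}$, $\mathcal{T}_h$ is a finite collection of nonempty disjoint open connected polyhedral (polygonal if $d=2$) elements $T$ with $\overline\Omega=\bigcup_{T\in\mathcal{T}_h}\overline T$ and $h=\max_{T}h_T$, $h_T$ the diameter of $T$. $\mathcal{F}_h$ is a finite set of faces with disjoint interiors with $\bigcup_{F\in\mathcal{F}_h}F=\bigcup_{T\in\mathcal{T}_h}\partial T$; a face is a hyperplanar closed connected subset of $\overline\Omega$ of positive $(d-1)$-dimensional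 Hausdorff measure such that either there are distinct $T_1,T_2\in\mathcal{T}_h$ with $F\subset\partial T_1\cap\partial T_2$ (interface, $F\in\mathcal{F}_h^{\rm i}$) or there is $T\in\mathcal{T}_h$ with $F\subset\partial T\cap\Gamma$ (boundary face, $F\in\mathcal{F}_h^{\rm b}$). $h_F$ is the diameter of $F$, $\mathcal{F}_T=\{F\in\mathcal{F}_h: F\subset\partial T\}$, and $n_{TF}$ is the unit normal to $F\in\mathcal{F}_T$ pointing out of $T$. Regularity: each $\mathcal{T}_h$ admits a matching simplicial submesh $\mathfrak{T}_h$ (a conforming simplicial mesh of $\Omega$ each simplex of which is contained in exactly one element of $\mathcal{T}_h$ and each simplicial face of which that lies on the mesh skeleton is contained in exactly one face of $\mathcal{F}_h$), and there is $\varrho>0$ such that for all $h\in\mathcal{H}$: $\varrho h_S\le r_S$ for every $S\in\mathfrak{T}_h$ of diameter $h_S$ and inradius $r_S$, and $\varrho h_T\le h_S$ whenever $S\subset T$, $S\in\mathfrak{T}_h$, $T\in\mathcal{T}_h$. **Polynomials and projectors.** For $X$ an element or face, $\mathbb{P}^l(X;V)$ is the space of restrictions to $X$ of $V$-valued $d$-variate polynomials of total degree at most $l$; $\pi_X^l$ is the $L^2$-orthogonal projector onto it, acting componentwise. **Discrete unknowns.** $\underline{U}_h^k=\big(\prod_{T\in\mathcal{T}_h}\mathbb{P}^k(T;\mathbb{R}^d)\big)\times\big(\prod_{F\in\mathcal{F}_h}\mathbb{P}^k(F;\mathbb{R}^d)\big)$, with elements $\underline{v}_h=((v_T)_T,(v_F)_F)$;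 $v_h$ (not underlined) is the broken polynomial with $(v_h)_{|T}=v_T$. Restrictions to $T$: $\underline{U}_T^k$, $\underline{v}_T=(v_T,(v_F)_{F\in\mathcal{F}_T})$. $\underline{U}_{h,0}^k=\{\underline{v}_h\in\underline{U}_h^k: v_F=0\ \forall F\in\mathcal{F}_h^{\rm b}\}$. **Reconstructions.** $\nabla_{\rm s}$ is the symmetric gradient. $G_{{\rm s},T}^k:\underline{U}_T^k\to\mathbb{P}^k(T;\mathbb{R}^{d\times d}_{\rm sym})$ is defined by $$\int_TG_{{\rm s},T}^k\underline{v}_T:\tau=-\int_Tv_T\cdot(\nabla\cdot\tau)+\sum_{F\in\mathcal{F}_T}\int_Fv_F\cdot(\tau n_{TF})\quad\forall\tau\in\mathbb{P}^k(T;\mathbb{R}^{d\times d}_{\rm sym}),$$ and $(G_{{\rm s},h}^k\underline{v}_h)_{|T}=G_{{\rm s},T}^k\underline{v}_T$. $r_T^{k+1}:\underline{U}_T^k\to\mathbb{P}^{k+1}(T;\mathbb{R}^d)$ is defined by $\int_T(\nabla_{\rm s}r_T^{k+1}\underline{v}_T-G_{{\rm s},T}^k\underline{v}_T):\nabla_{\rm s}w=0$ for all $w\in\mathbb{P}^{k+1}(T;\mathbb{R}^d)$, $\int_Tr_T^{k+1}\underline{v}_T=\int_Tv_T$, and $\int_T\nabla_{\rm ss}r_T^{k+1}\underline{v}_T=\sum_{F\in\mathcal{F}_T}\int_F\frac12(n_{TF}\otimes v_F-v_F\otimes n_{TF})$, where $(\nabla_{\rm ss}w)_{ij}=\frac12(\partial_iw_j-\partial_jw_i)$.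 **Stabilization.** For $F\in\mathcal{F}_T$, $\Delta_{TF}^k\underline{v}_T=\pi_F^k(r_T^{k+1}\underline{v}_T-v_F)-\pi_T^k(r_T^{k+1}\underline{v}_T-v_T)$ (as a function on $F$); $s_T(\underline{u}_T,\underline{v}_T)=\sum_{F\in\mathcal{F}_T}\frac{\gamma}{h_F}\int_F\Delta_{TF}^k\underline{u}_T\cdot\Delta_{TF}^k\underline{v}_T$; $s_h(\underline{u}_h,\underline{v}_h)=\sum_{T\in\mathcal{T}_h}s_T(\underline{u}_T,\underline{v}_T)$. The parameter $\gamma$ may depend on $\overline\sigma,\underline\sigma$ but not on $h$. *)

theory Defs
  imports "HOL-Analysis.Analysis"
begin

section \<open>Domain\<close>

text \<open>Polyhedra need not be convex. Taking the interior of a finite union of convex polytopes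
  excludes slits, i.e. a polyhedral set lies on one side only of its flat boundary pieces.\<close>

definition polyhedral :: "(real^'n) set \<Rightarrow> bool" where
  "polyhedral A \<longleftrightarrow> (\<exists>\<P>. finite \<P> \<and> (\<forall>P\<in>\<P>. polytope P) \<and> A = interior (\<Union>\<P>))"

text \<open>Near each boundary point, \<open>A\<close> is the strict subgraph, in some direction \<open>e\<close>, of a Lipschitz
  function on the orthogonal complement of \<open>e\<close>.\<close>

definition lipschitz_boundary :: "(real^'n) set \<Rightarrow> bool" where
  "lipschitz_boundary A \<longleftrightarrow>
    (\<forall>x\<in>frontier A. \<exists>U e L. \<exists>\<phi> :: real^'n \<Rightarrow> real.
       open U \<and> x \<in> U \<and> norm e = 1 \<and> L-lipschitz_on {z. z \<bullet> e = 0} \<phi> \<and>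
       A \<inter> U = {y \<in> U. y \<bullet> e < \<phi> (y - (y \<bullet> e) *\<^sub>R e)})"

definition polyhedral_domain :: "(real^'n) set \<Rightarrow> bool" where
  "polyhedral_domain \<Omega> \<longleftrightarrow>
    \<Omega> \<noteq> {} \<and> open \<Omega> \<and> connected \<Omega> \<and> bounded \<Omega> \<and> polyhedral \<Omega> \<and> lipschitz_boundary \<Omega>"


section \<open>Stress-strain functions\<close>

text \<open>On matrices, \<open>\<bullet>\<close> and \<open>norm\<close> are the Frobenius inner product and norm.\<close>

definition sym_mats :: "(real^'n^'n) set" where
  "sym_mats = {A. transpose A = A}"

definition L2_on :: "(real^'n) set \<Rightarrow> (real^'n \<Rightarrow> 'b::euclidean_space) \<Rightarrow> bool" where
  "L2_on A f \<longleftrightarrow> f \<in> borel_measurable (lebesgue_on A) \<and>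
    integrable (lebesgue_on A) (\<lambda>x. (norm (f x))\<^sup>2)"

definition stress_strain :: "(real^'n) set \<Rightarrow> (real^'n \<Rightarrow> real^'n^'n \<Rightarrow> real^'n^'n) \<Rightarrow> bool" where
  "stress_strain \<Omega> \<sigma> \<longleftrightarrow>
    (\<forall>x\<in>\<Omega>. \<forall>\<tau>\<in>sym_mats. \<sigma> x \<tau> \<in> sym_mats) \<and>
    (AE x in lebesgue_on \<Omega>. continuous_on sym_mats (\<sigma> x)) \<and>
    (\<forall>\<tau>\<in>sym_mats. (\<lambda>x. \<sigma> x \<tau>) \<in> borel_measurable (lebesgue_on \<Omega>)) \<and>
    L2_on \<Omega> (\<lambda>x. \<sigma> x 0) \<and>
    (\<exists>c_up>0. \<exists>c_low>0. AE x in lebesgue_on \<Omega>. \<forall>\<tau>\<in>sym_mats. \<forall>\<eta>\<in>sym_mats.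
       norm (\<sigma> x \<tau> - \<sigma> x 0) \<le> c_up * norm \<tau> \<and>
       \<sigma> x \<tau> \<bullet> \<tau> \<ge> c_low * (norm \<tau>)\<^sup>2 \<and>
       (\<sigma> x \<tau> - \<sigma> x \<eta>) \<bullet> (\<tau> - \<eta>) \<ge> 0)"

definition strictly_monotone ::
  "(real^'n) set \<Rightarrow> (real^'n \<Rightarrow> real^'n^'n \<Rightarrow> real^'n^'n) \<Rightarrow> bool" where
  "strictly_monotone \<Omega> \<sigma> \<longleftrightarrow>
    (AE x in lebesgue_on \<Omega>. \<forall>\<tau>\<in>sym_mats. \<forall>\<eta>\<in>sym_mats.
       \<tau> \<noteq> \<eta> \<longrightarrow> (\<sigma> x \<tau> - \<sigma> x \<eta>) \<bullet> (\<tau> - \<eta>) > 0)"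


section \<open>Integration on faces\<close>

text \<open>The \<open>(d-1)\<close>-dimensional Lebesgue (= Hausdorff) measure on the hyperplane \<open>{x. a \<bullet> x = c}\<close>
  with unit normal \<open>a\<close>: a subset \<open>A\<close> of it is measured by the volume of the prism
  \<open>{x + t *\<^sub>R a | x t. x \<in> A \<and> 0 \<le> t \<le> 1}\<close> of height one over \<open>A\<close>.\<close>

definition hyperplane_measure :: "real^'n \<Rightarrow> real \<Rightarrow> (real^'n) measure" where
  "hyperplane_measure a c = completion
    (distr (restrict_space lborel {y. c \<le> a \<bullet> y \<and> a \<bullet> y \<le> c + 1}) borel
       (\<lambda>y. y - (a \<bullet> y - c) *\<^sub>R a))"

text \<open>For \<open>F\<close> contained in a hyperplane. The hyperplane is unique if \<open>F\<close> has positive measure,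
  and then the measure does not depend on the choice of the sign of \<open>a\<close>.\<close>

definition face_measure :: "(real^'n) set \<Rightarrow> (real^'n) measure" where
  "face_measure F =
    (let (a, c) = (SOME (a, c). norm a = 1 \<and> F \<subseteq> {x. a \<bullet> x = c})
     in restrict_space (hyperplane_measure a c) F)"


section \<open>Meshes\<close>

definition hyperplanar :: "(real^'n) set \<Rightarrow> bool" where
  "hyperplanar F \<longleftrightarrow> (\<exists>a c. a \<noteq> 0 \<and> F \<subseteq> {x. a \<bullet> x = c})"

definition is_interface :: "(real^'n) set set \<Rightarrow> (real^'n) set \<Rightarrow> bool" where
  "is_interface Th F \<longleftrightarrow>
    (\<exists>T1\<in>Th. \<exists>T2\<in>Th. T1 \<noteq> T2 \<and> F \<subseteq> frontier T1 \<inter> frontier T2)"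

definition is_boundary_face :: "(real^'n) set \<Rightarrow> (real^'n) set set \<Rightarrow> (real^'n) set \<Rightarrow> bool" where
  "is_boundary_face \<Omega> Th F \<longleftrightarrow> (\<exists>T\<in>Th. F \<subseteq> frontier T \<inter> frontier \<Omega>)"

definition is_face :: "(real^'n) set \<Rightarrow> (real^'n) set set \<Rightarrow> (real^'n) set \<Rightarrow> bool" where
  "is_face \<Omega> Th F \<longleftrightarrow>
    F \<subseteq> closure \<Omega> \<and> hyperplanar F \<and> closed F \<and> connected F \<and>
    emeasure (face_measure F) F > 0 \<and>
    (is_interface Th F \<or> is_boundary_face \<Omega> Th F)"

definition element_mesh :: "(real^'n) set \<Rightarrow> real \<Rightarrow> (real^'n) set set \<Rightarrow> bool" where
  "element_mesh \<Omega> h Th \<longleftrightarrow>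
    finite Th \<and> Th \<noteq> {} \<and>
    (\<forall>T\<in>Th. T \<noteq> {} \<and> open T \<and> connected T \<and> polyhedral T) \<and>
    pairwise disjnt Th \<and>
    closure \<Omega> = (\<Union>T\<in>Th. closure T) \<and>
    h = Max (diameter ` Th)"

text \<open>The null-overlap clause only matters for faces with a wild relative boundary (such as a
  closed connected planar set of positive area and empty relative interior), for which disjointness
  of the relative interiors alone would allow the skeleton to be covered twice.\<close>

definition face_mesh :: "(real^'n) set \<Rightarrow> (real^'n) set set \<Rightarrow> (real^'n) set set \<Rightarrow> bool" where
  "face_mesh \<Omega> Th Fh \<longleftrightarrow>
    finite Fh \<and> (\<forall>F\<in>Fh. is_face \<Omega> Th F) \<and>
    pairwise (\<lambda>F F'. rel_interior F \<inter> rel_interior F' = {} \<and>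
                     emeasure (face_measure F) (F \<inter> F') = 0) Fh \<and>
    \<Union>Fh = (\<Union>T\<in>Th. frontier T)"

text \<open>Simplices are represented by their closures; the open simplex is \<open>interior S\<close>.\<close>

definition matching_simplicial_submesh ::
  "(real^'n) set \<Rightarrow> (real^'n) set set \<Rightarrow> (real^'n) set set \<Rightarrow> (real^'n) set set \<Rightarrow> bool" where
  "matching_simplicial_submesh \<Omega> Th Fh Sh \<longleftrightarrow>
    triangulation Sh \<and> (\<forall>S\<in>Sh. int CARD('n) simplex S) \<and> \<Union>Sh = closure \<Omega> \<and>
    (\<forall>S\<in>Sh. \<exists>!T. T \<in> Th \<and> interior S \<subseteq> T) \<and>
    (\<forall>S\<in>Sh. \<forall>E. E facet_of S \<and> E \<subseteq> (\<Union>T\<in>Th. frontier T) \<longrightarrow> (\<exists>!F. F \<in> Fh \<and> E \<subseteq> F))"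

definition inradius :: "(real^'n) set \<Rightarrow> real" where
  "inradius S = Sup {r. 0 \<le> r \<and> (\<exists>x. cball x r \<subseteq> S)}"

definition regular_mesh_sequence ::
  "(real^'n) set \<Rightarrow> real set \<Rightarrow> (real \<Rightarrow> (real^'n) set set) \<Rightarrow> (real \<Rightarrow> (real^'n) set set) \<Rightarrow> bool"
where
  "regular_mesh_sequence \<Omega> H Th Fh \<longleftrightarrow>
    H \<subseteq> {0<..} \<and> countable H \<and> (\<forall>x. x islimpt H \<longleftrightarrow> x = 0) \<and>
    (\<forall>h\<in>H. element_mesh \<Omega> h (Th h) \<and> face_mesh \<Omega> (Th h) (Fh h)) \<and>
    (\<exists>\<rho>>0. \<forall>h\<in>H. \<exists>Sh. matching_simplicial_submesh \<Omega> (Th h) (Fh h) Sh \<and>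
       (\<forall>S\<in>Sh. \<rho> * diameter S \<le> inradius S) \<and>
       (\<forall>S\<in>Sh. \<forall>T\<in>Th h. interior S \<subseteq> T \<longrightarrow> \<rho> * diameter T \<le> diameter S))"

definition elt_faces :: "(real^'n) set set \<Rightarrow> (real^'n) set \<Rightarrow> (real^'n) set set" where
  "elt_faces Fh T = {F \<in> Fh. F \<subseteq> frontier T}"

text \<open>The unit normal to \<open>F\<close> at \<open>x \<in> F\<close> pointing out of \<open>T\<close>. For \<open>F \<in> elt_faces Fh T\<close> it exists
  at almost every \<open>x\<close>, and there it is constant if \<open>T\<close> stays on one side of \<open>F\<close>.\<close>

definition outward_normal :: "(real^'n) set \<Rightarrow> (real^'n) set \<Rightarrow> real^'n \<Rightarrow> real^'n" where
  "outward_normal T F x =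
    (THE n. norm n = 1 \<and> (\<forall>y\<in>F. n \<bullet> (y - x) = 0) \<and>
       (\<exists>\<epsilon>>0. \<forall>t\<in>{0<..<\<epsilon>}. x - t *\<^sub>R n \<in> T \<and> x + t *\<^sub>R n \<notin> T))"


section \<open>Polynomials, projectors and traces\<close>

definition polys :: "nat \<Rightarrow> 'v set \<Rightarrow> (real^'n \<Rightarrow> 'v::real_vector) set" where
  "polys l V =
    {\<lambda>x. \<Sum>\<alpha> | (\<Sum>i\<in>UNIV. \<alpha> i) \<le> l. (\<Prod>i\<in>UNIV. x $ i ^ \<alpha> i) *\<^sub>R c \<alpha>
      | c :: ('n \<Rightarrow> nat) \<Rightarrow> 'v. \<forall>\<alpha>. c \<alpha> \<in> V}"

text \<open>Restrictions take the value \<open>undefined\<close> outside \<open>X\<close>, so that equality of functions in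
  this space is equality on \<open>X\<close>.\<close>

definition poly_space :: "nat \<Rightarrow> (real^'n) set \<Rightarrow> 'v set \<Rightarrow> (real^'n \<Rightarrow> 'v::real_vector) set" where
  "poly_space l X V = (\<lambda>p. restrict p X) ` polys l V"

text \<open>\<open>M\<close> is the measure on the element or face \<open>X\<close>.\<close>

definition L2_proj ::
  "(real^'n) measure \<Rightarrow> (real^'n) set \<Rightarrow> nat \<Rightarrow> (real^'n \<Rightarrow> real) \<Rightarrow> real^'n \<Rightarrow> real" where
  "L2_proj M X l g = (THE p. p \<in> poly_space l X UNIV \<and>
     (\<forall>q\<in>poly_space l X UNIV. (\<integral>x. (g x - p x) * q x \<partial>M) = 0))"

definition vec_L2_proj ::
  "(real^'n) measure \<Rightarrow> (real^'n) set \<Rightarrow> nat \<Rightarrow> (real^'n \<Rightarrow> real^'n) \<Rightarrow> real^'n \<Rightarrow> real^'n" where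
  "vec_L2_proj M X l g = (\<lambda>x\<in>X. \<chi> i. L2_proj M X l (\<lambda>y. g y $ i) x)"

definition elt_proj :: "nat \<Rightarrow> (real^'n) set \<Rightarrow> (real^'n \<Rightarrow> real^'n) \<Rightarrow> real^'n \<Rightarrow> real^'n" where
  "elt_proj l T = vec_L2_proj (lebesgue_on T) T l"

definition face_proj :: "nat \<Rightarrow> (real^'n) set \<Rightarrow> (real^'n \<Rightarrow> real^'n) \<Rightarrow> real^'n \<Rightarrow> real^'n" where
  "face_proj l F = vec_L2_proj (face_measure F) F l"

text \<open>Elements are open, so element polynomials are evaluated on faces through their boundary
  values.\<close>

definition trace :: "(real^'n) set \<Rightarrow> (real^'n \<Rightarrow> 'v::t2_space) \<Rightarrow> real^'n \<Rightarrow> 'v" where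
  "trace T g x = Lim (at x within T) g"


section \<open>Differential operators\<close>

definition partial :: "'n \<Rightarrow> (real^'n \<Rightarrow> 'v::real_normed_vector) \<Rightarrow> real^'n \<Rightarrow> 'v" where
  "partial i w x = frechet_derivative w (at x) (axis i 1)"

definition sym_grad :: "(real^'n \<Rightarrow> real^'n) \<Rightarrow> real^'n \<Rightarrow> real^'n^'n" where
  "sym_grad w x = (\<chi> i j. (partial i w x $ j + partial j w x $ i) / 2)"

definition skew_grad :: "(real^'n \<Rightarrow> real^'n) \<Rightarrow> real^'n \<Rightarrow> real^'n^'n" where
  "skew_grad w x = (\<chi> i j. (partial i w x $ j - partial j w x $ i) / 2)"

definition divergence :: "(real^'n \<Rightarrow> real^'n^'n) \<Rightarrow> real^'n \<Rightarrow> real^'n" where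
  "divergence \<tau> x = (\<chi> i. \<Sum>j\<in>UNIV. partial j \<tau> x $ i $ j)"

definition outer :: "real^'n \<Rightarrow> real^'n \<Rightarrow> real^'n^'n" where
  "outer a b = (\<chi> i j. a $ i * b $ j)"


section \<open>Discrete unknowns\<close>

text \<open>A pair of the families \<open>(v\<^sub>T)\<^sub>T\<close> and \<open>(v\<^sub>F)\<^sub>F\<close>.\<close>

type_synonym 'n hybrid =
  "((real^'n) set \<Rightarrow> real^'n \<Rightarrow> real^'n) \<times> ((real^'n) set \<Rightarrow> real^'n \<Rightarrow> real^'n)"

definition hybrid_space ::
  "nat \<Rightarrow> (real^'n) set set \<Rightarrow> (real^'n) set set \<Rightarrow> 'n::finite hybrid set" where
  "hybrid_space k Th Fh =
    (\<Pi>\<^sub>E T\<in>Th. poly_space k T UNIV) \<times> (\<Pi>\<^sub>E F\<in>Fh. poly_space k F UNIV)"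

definition hybrid_space0 ::
  "(real^'n) set \<Rightarrow> nat \<Rightarrow> (real^'n) set set \<Rightarrow> (real^'n) set set \<Rightarrow> 'n::finite hybrid set" where
  "hybrid_space0 \<Omega> k Th Fh =
    {v \<in> hybrid_space k Th Fh. \<forall>F\<in>Fh. is_boundary_face \<Omega> Th F \<longrightarrow> (\<forall>x\<in>F. snd v F x = 0)}"

definition broken ::
  "(real^'n) set set \<Rightarrow> ((real^'n) set \<Rightarrow> real^'n \<Rightarrow> 'v::real_vector) \<Rightarrow> real^'n \<Rightarrow> 'v" where
  "broken Th w x = (\<Sum>T\<in>Th. if x \<in> T then w T x else 0)"


section \<open>Reconstructions and stabilization\<close>

definition strain_rec ::
  "nat \<Rightarrow> (real^'n) set set \<Rightarrow> 'n::finite hybrid \<Rightarrow> (real^'n) set \<Rightarrow> real^'n \<Rightarrow> real^'n^'n" where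
  "strain_rec k Fh v T = (THE G. G \<in> poly_space k T sym_mats \<and>
     (\<forall>\<tau>\<in>poly_space k T sym_mats.
        (\<integral>x. G x \<bullet> \<tau> x \<partial>lebesgue_on T) =
        - (\<integral>x. fst v T x \<bullet> divergence \<tau> x \<partial>lebesgue_on T)
        + (\<Sum>F\<in>elt_faces Fh T.
             \<integral>x. snd v F x \<bullet> (trace T \<tau> x *v outward_normal T F x) \<partial>face_measure F)))"

definition disp_rec ::
  "nat \<Rightarrow> (real^'n) set set \<Rightarrow> 'n::finite hybrid \<Rightarrow> (real^'n) set \<Rightarrow> real^'n \<Rightarrow> real^'n" where
  "disp_rec k Fh v T = (THE r. r \<in> poly_space (k + 1) T UNIV \<and>
     (\<forall>w\<in>poly_space (k + 1) T UNIV.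
        (\<integral>x. (sym_grad r x - strain_rec k Fh v T x) \<bullet> sym_grad w x \<partial>lebesgue_on T) = 0) \<and>
     (\<integral>x. r x \<partial>lebesgue_on T) = (\<integral>x. fst v T x \<partial>lebesgue_on T) \<and>
     (\<integral>x. skew_grad r x \<partial>lebesgue_on T) =
       (\<Sum>F\<in>elt_faces Fh T.
          \<integral>x. (1/2) *\<^sub>R (outer (outward_normal T F x) (snd v F x)
                        - outer (snd v F x) (outward_normal T F x)) \<partial>face_measure F))"

definition face_residual ::
  "nat \<Rightarrow> (real^'n) set set \<Rightarrow> 'n::finite hybrid \<Rightarrow> (real^'n) set \<Rightarrow> (real^'n) set
    \<Rightarrow> real^'n \<Rightarrow> real^'n" where
  "face_residual k Fh v T F x =
     face_proj k F (\<lambda>y. trace T (disp_rec k Fh v T) y - snd v F y) x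
     - trace T (elt_proj k T (\<lambda>y. disp_rec k Fh v T y - fst v T y)) x"

definition local_stab ::
  "real \<Rightarrow> nat \<Rightarrow> (real^'n) set set \<Rightarrow> 'n::finite hybrid \<Rightarrow> 'n hybrid \<Rightarrow> (real^'n) set \<Rightarrow> real" where
  "local_stab \<gamma> k Fh u v T =
     (\<Sum>F\<in>elt_faces Fh T. \<gamma> / diameter F *
        (\<integral>x. face_residual k Fh u T F x \<bullet> face_residual k Fh v T F x \<partial>face_measure F))"

definition stab ::
  "real \<Rightarrow> nat \<Rightarrow> (real^'n) set set \<Rightarrow> (real^'n) set set \<Rightarrow> 'n::finite hybrid \<Rightarrow> 'n hybrid \<Rightarrow> real" where
  "stab \<gamma> k Th Fh u v = (\<Sum>T\<in>Th. local_stab \<gamma> k Fh u v T)"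

definition discrete_solution ::
  "(real^'n) set \<Rightarrow> (real^'n \<Rightarrow> real^'n^'n \<Rightarrow> real^'n^'n) \<Rightarrow> (real^'n \<Rightarrow> real^'n) \<Rightarrow> real \<Rightarrow> nat
    \<Rightarrow> (real^'n) set set \<Rightarrow> (real^'n) set set \<Rightarrow> 'n::finite hybrid \<Rightarrow> bool" where
  "discrete_solution \<Omega> \<sigma> f \<gamma> k Th Fh u \<longleftrightarrow>
    u \<in> hybrid_space0 \<Omega> k Th Fh \<and>
    (\<forall>v\<in>hybrid_space0 \<Omega> k Th Fh.
       (\<integral>x. \<sigma> x (broken Th (strain_rec k Fh u) x) \<bullet> broken Th (strain_rec k Fh v) x
          \<partial>lebesgue_on \<Omega>)
       + stab \<gamma> k Th Fh u v
       = (\<integral>x. f x \<bullet> broken Th (fst v) x \<partial>lebesgue_on \<Omega>))"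

end

theory Submission
  imports Defs "HOL-Library.Function_Algebras" "HOL-Homology.Homology"
begin

text \<open>On the finite-dimensional space of unknowns, the form
  \<open>a(u, v) = \<integral> \<sigma>(\<cdot>, G u) : G v + s\<^sub>h(u, v)\<close> is continuous in \<open>u\<close> and linear in \<open>v\<close>, and it is coercive
  for the energy product \<open>(u, v) = \<integral> G u : G v + s\<^sub>h(u, v)\<close>. A continuous coercive map of
  Euclidean space has a zero, since otherwise the identity of a large sphere would be
  null-homotopic. For uniqueness, test the difference of two equations with the difference \<open>d\<close>
  of the solutions: strict monotonicity yields \<open>G d = 0\<close> and \<open>s\<^sub>h(d, d) = 0\<close>.

  It remains to see that \<open>G v = 0\<close> and \<open>s\<^sub>h(v, v) = 0\<close> imply \<open>v = 0\<close>. The reconstruction \<open>r\<^sub>T v\<close> is then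
  affine, so by \<open>k \<ge> 1\<close> the projectors fix it and the face residuals reduce to \<open>v\<^sub>T - v\<^sub>F\<close>. As they
  vanish, \<open>v\<^sub>T = v\<^sub>F\<close> on faces, and integration by parts in the definition of \<open>G\<close> shows that \<open>v\<^sub>T\<close> has
  zero symmetric gradient. In particular \<open>\<partial>\<^sub>i v\<^sub>i = 0\<close> on each element, and summing over the elements
  gives \<open>\<integral> v\<^sub>i \<partial>\<^sub>i \<phi> = 0\<close> for all \<open>C\<^sup>1\<close> functions \<open>\<phi>\<close>: the two contributions of an interface cancel and
  boundary faces carry \<open>v\<^sub>F = 0\<close>. Hence \<open>v\<^sub>i = 0\<close>. Integration by parts rests on the divergence
  theorem for a bounded open set whose frontier lies in finitely many hyperplanes.\<close>

text \<open>Restrictions equal \<open>undefined\<close> off their element or face, so the discrete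
  unknowns need not be closed under pointwise operations. Linear algebra therefore takes place on a
  model \<open>Z\<close>, which \<open>R\<close> maps onto them; pointwise operations on functions
  make \<open>Z\<close> a vector space. The reconstructions given by \<open>THE\<close> are Riesz
  representatives on polynomial spaces, hence linear on \<open>Z\<close>. With the energy product
  itself as inner product, coercivity holds with the constant \<open>min c 1\<close>, and the
  analysis is concentrated in its definiteness. There the obstacle is geometric. An element need not
  be convex, a face is any closed connected piece of a hyperplane with positive measure, and an
  element may lie on different sides of one face at different points. Normals are controlled only at
  generic points, those on a single hyperplane of the family, where the element is locally empty,
  full or a half-ball. The signed indicator \<open>jump\<close> records the side. The divergence
  theorem is first stated with \<open>jump\<close> over whole hyperplanes; only then are the
  hyperplanes cut into faces, up to null overlaps.\<close>

instantiation "fun" :: (type, real_vector) real_vector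
begin

definition scaleR_fun_def: "scaleR r f = (\<lambda>x. r *\<^sub>R f x)"

instance
  by intro_classes (simp_all add: scaleR_fun_def fun_eq_iff algebra_simps)

end

lemma scaleR_fun_apply [simp]: "(r *\<^sub>R f) x = r *\<^sub>R f x"
  by (simp add: scaleR_fun_def)

lemma sum_fun_apply: "(\<Sum>i\<in>I. f i) x = (\<Sum>i\<in>I. f i x)" for f :: "'i \<Rightarrow> 'a \<Rightarrow> 'b::real_vector"
  by (induction I rule: infinite_finite_induct) auto


section \<open>Finite-dimensional inner product spaces\<close>

text \<open>The spanning set may lie outside \<open>W\<close>. The ambient function types are
  infinite-dimensional, and in this form every subset of a finitely spanned set qualifies at
  once.\<close>

definition fin_dim :: "'a::real_vector set \<Rightarrow> bool" where
  "fin_dim W \<longleftrightarrow> (\<exists>B. finite B \<and> W \<subseteq> span B)"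

text \<open>The laws are imposed only on \<open>W\<close>, with the product as a parameter: one
  function type carries several products, such as the element L2 product and
  \<open>disp_form\<close>, and none of them is an inner product on the whole type.\<close>

locale inner_space =
  fixes W :: "'a::real_vector set" and q :: "'a \<Rightarrow> 'a \<Rightarrow> real"
  assumes subspace: "subspace W" and fin_dim: "fin_dim W"
    and sym: "u \<in> W \<Longrightarrow> v \<in> W \<Longrightarrow> q u v = q v u"
    and lin: "u \<in> W \<Longrightarrow> v \<in> W \<Longrightarrow> w \<in> W \<Longrightarrow> q (\<alpha> *\<^sub>R u + \<beta> *\<^sub>R v) w = \<alpha> * q u w + \<beta> * q v w"
    and nonneg: "u \<in> W \<Longrightarrow> q u u \<ge> 0"
    and definite: "u \<in> W \<Longrightarrow> q u u = 0 \<Longrightarrow> u = 0"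

text \<open>Linearity is asked on \<open>W\<close> alone, because outside it integrals may diverge
  and values of \<open>THE\<close> are unspecified.\<close>

definition lin_on :: "'a::real_vector set \<Rightarrow> ('a \<Rightarrow> 'b::real_vector) \<Rightarrow> bool" where
  "lin_on W L \<longleftrightarrow> (\<forall>u\<in>W. \<forall>v\<in>W. \<forall>\<alpha> \<beta>. L (\<alpha> *\<^sub>R u + \<beta> *\<^sub>R v) = \<alpha> *\<^sub>R L u + \<beta> *\<^sub>R L v)"

lemma lin_onI:
  "(\<And>u v \<alpha> \<beta>. u \<in> W \<Longrightarrow> v \<in> W \<Longrightarrow> L (\<alpha> *\<^sub>R u + \<beta> *\<^sub>R v) = \<alpha> *\<^sub>R L u + \<beta> *\<^sub>R L v) \<Longrightarrow> lin_on W L"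
  by (auto simp: lin_on_def)

lemma lin_onD:
  "lin_on W L \<Longrightarrow> u \<in> W \<Longrightarrow> v \<in> W \<Longrightarrow> L (\<alpha> *\<^sub>R u + \<beta> *\<^sub>R v) = \<alpha> *\<^sub>R L u + \<beta> *\<^sub>R L v"
  by (auto simp: lin_on_def)

lemma lin_on_0: "lin_on W L \<Longrightarrow> 0 \<in> W \<Longrightarrow> L 0 = 0"
  using lin_onD[of W L 0 0 0 0] by simp

lemma lin_on_scale: "lin_on W L \<Longrightarrow> subspace W \<Longrightarrow> u \<in> W \<Longrightarrow> L (c *\<^sub>R u) = c *\<^sub>R L u"
  using lin_onD[of W L u 0 c 0] by (simp add: subspace_0)

lemma lin_on_diff: "lin_on W L \<Longrightarrow> u \<in> W \<Longrightarrow> v \<in> W \<Longrightarrow> L (u - v) = L u - L v"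
  using lin_onD[of W L u v 1 "-1"] by simp

lemma lin_on_add: "lin_on W L \<Longrightarrow> u \<in> W \<Longrightarrow> v \<in> W \<Longrightarrow> L (u + v) = L u + L v"
  using lin_onD[of W L u v 1 1] by simp

lemma lin_on_sum:
  assumes "lin_on W L" "subspace W" "\<And>i. i \<in> I \<Longrightarrow> e i \<in> W"
  shows "L (\<Sum>i\<in>I. c i *\<^sub>R e i) = (\<Sum>i\<in>I. c i *\<^sub>R L (e i))"
  using assms(3)
proof (induction I rule: infinite_finite_induct)
  case (insert i I)
  then have "(\<Sum>i\<in>I. c i *\<^sub>R e i) \<in> W"
    by (intro subspace_sum[OF assms(2)] subspace_scale[OF assms(2)]) auto
  then show ?case
    using insert lin_onD[OF assms(1), of "e i" "\<Sum>i\<in>I. c i *\<^sub>R e i" "c i" 1] by simp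
qed (auto simp: lin_on_0[OF assms(1)] subspace_0[OF assms(2)])

lemma fin_dim_linear_image:
  assumes "fin_dim W" "linear f" shows "fin_dim (f ` W)"
proof -
  obtain B where "finite B" "W \<subseteq> span B" using assms by (auto simp: fin_dim_def)
  then have "finite (f ` B)" "f ` W \<subseteq> span (f ` B)"
    using linear_span_image[OF assms(2), of B] by auto
  then show ?thesis by (auto simp: fin_dim_def)
qed

text \<open>Meant for \<open>Z\<close>, whose members split into their element and face
  components.\<close>

lemma fin_dim_sum_image:
  assumes "finite I" "\<And>i. i \<in> I \<Longrightarrow> fin_dim (W i)" "\<And>x. x \<in> V \<Longrightarrow> \<exists>f. x = (\<Sum>i\<in>I. f i) \<and> (\<forall>i\<in>I. f i \<in> W i)"
  shows "fin_dim V"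
proof -
  have "\<forall>i\<in>I. \<exists>B. finite B \<and> W i \<subseteq> span B" using assms(2) by (auto simp: fin_dim_def)
  then obtain B where B: "\<And>i. i \<in> I \<Longrightarrow> finite (B i) \<and> W i \<subseteq> span (B i)" by metis
  have "V \<subseteq> span (\<Union>i\<in>I. B i)"
  proof
    fix x assume "x \<in> V"
    then obtain f where f: "x = (\<Sum>i\<in>I. f i)" "\<forall>i\<in>I. f i \<in> W i" using assms(3) by blast
    have "f i \<in> span (\<Union>i\<in>I. B i)" if "i \<in> I" for i
      using B[OF that] f(2) that span_mono[of "B i" "\<Union>i\<in>I. B i"] by blast
    then show "x \<in> span (\<Union>i\<in>I. B i)" unfolding f by (intro span_sum) auto
  qed
  then show ?thesis using B assms(1) unfolding fin_dim_def by (intro exI[of _ "\<Union>i\<in>I. B i"]) auto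
qed

context inner_space
begin

lemma lin_left: "w \<in> W \<Longrightarrow> lin_on W (\<lambda>u. q u w)"
  using lin by (auto simp: lin_on_def)

lemma lin_right: "w \<in> W \<Longrightarrow> lin_on W (q w)"
proof (rule lin_onI)
  fix u v \<alpha> \<beta> assume *: "w \<in> W" "u \<in> W" "v \<in> W"
  have "\<alpha> *\<^sub>R u + \<beta> *\<^sub>R v \<in> W" using * by (simp add: subspace subspace_add subspace_scale)
  then show "q w (\<alpha> *\<^sub>R u + \<beta> *\<^sub>R v) = \<alpha> *\<^sub>R q w u + \<beta> *\<^sub>R q w v"
    using * lin[of u v w \<alpha> \<beta>] sym[of w "\<alpha> *\<^sub>R u + \<beta> *\<^sub>R v"] sym[of w u] sym[of w v] by simp
qed

text \<open>Gram-Schmidt. The basis is indexed by natural numbers so that coordinate vectors become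
  points of \<open>nat \<Rightarrow> real\<close>, the type in which the spheres
  \<open>nsphere\<close> live.\<close>

lemma orthonormal_basis:
  obtains e :: "nat \<Rightarrow> 'a" and N where "\<And>i. i < N \<Longrightarrow> e i \<in> W"
    and "\<And>i j. i < N \<Longrightarrow> j < N \<Longrightarrow> q (e i) (e j) = (if i = j then 1 else 0)"
    and "\<And>u. u \<in> W \<Longrightarrow> u = (\<Sum>i<N. q u (e i) *\<^sub>R e i)"
proof -
  have *: "\<exists>(e :: nat \<Rightarrow> 'a) N. (\<forall>i<N. e i \<in> W) \<and> (\<forall>i<N. \<forall>j<N. q (e i) (e j) = (if i = j then 1 else 0))
     \<and> B \<subseteq> span (e ` {..<N})" if "finite B" "B \<subseteq> W" for B
    using that
  proof (induction B rule: finite_induct)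
    case empty
    show ?case by (rule exI, rule exI[of _ 0]) simp
  next
    case (insert b B)
    then have b: "b \<in> W" and BW: "B \<subseteq> W" by auto
    from insert.IH[OF BW] obtain e :: "nat \<Rightarrow> 'a" and N where E: "\<forall>i<N. e i \<in> W"
      "\<forall>i<N. \<forall>j<N. q (e i) (e j) = (if i = j then 1 else 0)"
      and sp: "B \<subseteq> span (e ` {..<N})"
      by blast
    note e = E(1)[rule_format] E(2)[rule_format]
    define s where "s = (\<Sum>i<N. q b (e i) *\<^sub>R e i)"
    define b' where "b' = b - s"
    have s: "s \<in> W" unfolding s_def
      by (auto intro!: subspace_sum[OF subspace] subspace_scale[OF subspace] e)
    have s_span: "s \<in> span (e ` {..<N})" unfolding s_def
      by (intro span_sum span_scale span_base) auto
    have b': "b' \<in> W" unfolding b'_def using b s by (simp add: subspace subspace_diff)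
    have ort: "q b' (e j) = 0" if "j < N" for j
    proof -
      have "q s (e j) = (\<Sum>i<N. q b (e i) *\<^sub>R q (e i) (e j))"
        unfolding s_def using e that by (intro lin_on_sum[OF lin_left subspace]) auto
      also have "\<dots> = (\<Sum>i<N. if i = j then q b (e i) else 0)"
        using e(2) that by (intro sum.cong) auto
      also have "\<dots> = q b (e j)" using that by simp
      finally show ?thesis
        unfolding b'_def using lin_on_diff[OF lin_left[OF e(1)[OF that]] b s] by simp
    qed
    show ?case
    \<comment> \<open>A vector dependent on the previous ones adds nothing, so \<open>N\<close>
      stays; otherwise the normalised remainder becomes the vector with index
      \<open>N\<close>.\<close>
    proof (cases "b' = 0")
      case True
      then have "b \<in> span (e ` {..<N})" using s_span by (simp add: b'_def)
      then have "insert b B \<subseteq> span (e ` {..<N})" using sp by simp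
      then show ?thesis using E by blast
    next
      case False
      define n where "n = sqrt (q b' b')"
      have n: "n > 0" "n * n = q b' b'"
        using False definite[OF b'] nonneg[OF b'] by (auto simp: n_def less_le)
      define e' where "e' = (\<lambda>i. if i = N then (1 / n) *\<^sub>R b' else e i)"
      have eW: "e' i \<in> W" if "i < Suc N" for i
        using that e b' by (auto simp: e'_def subspace subspace_scale less_Suc_eq)
      have q1: "q ((1/n) *\<^sub>R b') v = (1/n) * q b' v" if "v \<in> W" for v
        using lin_on_scale[OF lin_left[OF that] subspace b', of "1/n"] by simp
      have eN: "q (e' N) (e' N) = 1"
      proof -
        have "q (e' N) (e' N) = (1/n) * ((1/n) * q b' b')"
          using q1[of "e' N"] q1[OF b'] eW[of N] sym[of b' "e' N"] b' by (simp add: e'_def)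
        then show ?thesis using n(1) by (simp flip: n(2))
      qed
      have eNj: "q (e' N) (e j) = 0" if "j < N" for j
        using q1[OF e(1)[OF that]] ort[OF that] by (simp add: e'_def)
      have "q (e' i) (e' j) = (if i = j then 1 else 0)" if ij: "i < Suc N" "j < Suc N" for i j
      proof -
        consider "i = N" "j = N" | "i = N" "j < N" | "i < N" "j = N" | "i < N" "j < N"
          using ij less_Suc_eq by metis
        then show ?thesis
        proof cases
          case 1 then show ?thesis using eN by simp
        next
          case 2 then show ?thesis using eNj by (simp add: e'_def)
        next
          case 3 then show ?thesis using eNj sym[of "e i" "e' N"] eW[of N] e(1)[of i] by (simp add: e'_def)
        next
          case 4 then show ?thesis using e(2)[of i j] by (simp add: e'_def)
        qed
      qed
      moreover have "insert b B \<subseteq> span (e' ` {..<Suc N})"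
      proof -
        have sub: "e ` {..<N} \<subseteq> e' ` {..<Suc N}" by (auto simp: e'_def image_iff)
        then have "s \<in> span (e' ` {..<Suc N})" "B \<subseteq> span (e' ` {..<Suc N})"
          using s_span sp span_mono[OF sub] by blast+
        moreover have "n *\<^sub>R e' N \<in> span (e' ` {..<Suc N})" by (intro span_scale span_base) auto
        then have "b' \<in> span (e' ` {..<Suc N})" using n by (simp add: e'_def)
        ultimately show ?thesis using span_add[of b' "e' ` {..<Suc N}" s] by (auto simp: b'_def)
      qed
      ultimately show ?thesis using eW by blast
    qed
  qed
  obtain B0 where B0: "finite B0" "W \<subseteq> span B0" using fin_dim by (auto simp: fin_dim_def)
  \<comment> \<open>The spanning set \<open>B0\<close> may leave \<open>W\<close>, whereas
    Gram-Schmidt needs vectors of \<open>W\<close>. A maximal independent subset of \<open>W\<close>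
    is finite, being no larger than \<open>B0\<close>.\<close>
  obtain B where B: "B \<subseteq> W" "independent B" "W \<subseteq> span B"
    using maximal_independent_subset[of W] by blast
  have "finite B" using independent_span_bound[OF B0(1) B(2)] B B0 by blast
  from *[OF this B(1)] obtain e :: "nat \<Rightarrow> 'a" and N where E: "\<forall>i<N. e i \<in> W"
      "\<forall>i<N. \<forall>j<N. q (e i) (e j) = (if i = j then 1 else 0)"
      and sp: "B \<subseteq> span (e ` {..<N})" by blast
  note e = E(1)[rule_format] E(2)[rule_format]
  have W: "W \<subseteq> span (e ` {..<N})" using B(3) span_minimal[OF sp subspace_span] by simp
  have "u = (\<Sum>i<N. q u (e i) *\<^sub>R e i)" if u: "u \<in> W" for u
  proof -
    define s where "s = (\<Sum>i<N. q u (e i) *\<^sub>R e i)"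
    have s: "s \<in> W" unfolding s_def
       by (auto intro!: subspace_sum[OF subspace] subspace_scale[OF subspace] e)
    have d: "u - s \<in> W" using u s by (simp add: subspace subspace_diff)
    have ort: "q (u - s) (e j) = 0" if "j < N" for j
    proof -
      have "q s (e j) = (\<Sum>i<N. q u (e i) *\<^sub>R q (e i) (e j))"
        unfolding s_def using e that by (intro lin_on_sum[OF lin_left subspace]) auto
      also have "\<dots> = (\<Sum>i<N. if i = j then q u (e i) else 0)"
        using e(2) that by (intro sum.cong) auto
      also have "\<dots> = q u (e j)" using that by simp
      finally show ?thesis
        using lin_on_diff[OF lin_left[OF e(1)[OF that]] u s] by simp
    qed
    \<comment> \<open>The vectors orthogonal to the remainder form a subspace containing every
      \<open>e i\<close>, hence all of \<open>W\<close>; the remainder is then orthogonal to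
      itself.\<close>
    have "subspace {v \<in> W. q (u - s) v = 0}"
      using lin_right[OF d] lin_on_0[OF lin_right[OF d]] lin_on_add[OF lin_right[OF d]]
        lin_on_scale[OF lin_right[OF d] subspace] subspace
      by (auto simp: subspace_def)
    moreover have "e ` {..<N} \<subseteq> {v \<in> W. q (u - s) v = 0}" using e ort by auto
    ultimately have "span (e ` {..<N}) \<subseteq> {v \<in> W. q (u - s) v = 0}"
      by (rule span_minimal[rotated])
    then have "q (u - s) (u - s) = 0" using d W by auto
    then show ?thesis using definite[OF d] by (simp add: s_def)
  qed
  then show ?thesis using that e by blast
qed

lemma eq_if_q_eq:
  assumes "u \<in> W" "v \<in> W" "\<And>w. w \<in> W \<Longrightarrow> q u w = q v w" shows "u = v"
proof -
  have d: "u - v \<in> W" using assms by (simp add: subspace subspace_diff)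
  have "q (u - v) (u - v) = 0"
    using lin_on_diff[OF lin_left[OF d] assms(1,2)] assms(3)[OF d] by simp
  then show ?thesis using definite[OF d] by simp
qed

text \<open>Existence and uniqueness behind each \<open>THE\<close> that defines a projection or a
  reconstruction. In an orthonormal basis the representative has coordinates
  \<open>L (e i)\<close>.\<close>

lemma riesz:
  assumes "lin_on W L"
  shows "\<exists>!u. u \<in> W \<and> (\<forall>w\<in>W. q u w = L w)"
proof -
  obtain e :: "nat \<Rightarrow> 'a" and N where e: "\<And>i. i < N \<Longrightarrow> e i \<in> W"
    "\<And>i j. i < N \<Longrightarrow> j < N \<Longrightarrow> q (e i) (e j) = (if i = j then 1 else 0)"
    "\<And>u. u \<in> W \<Longrightarrow> u = (\<Sum>i<N. q u (e i) *\<^sub>R e i)" by (rule orthonormal_basis) (rule that)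
  define u where "u = (\<Sum>i<N. L (e i) *\<^sub>R e i)"
  have u: "u \<in> W" unfolding u_def
    by (auto intro!: subspace_sum[OF subspace] subspace_scale[OF subspace] e)
  have "q u w = L w" if "w \<in> W" for w
  proof -
    have "q u w = (\<Sum>i<N. L (e i) *\<^sub>R q (e i) w)"
      unfolding u_def using e that by (intro lin_on_sum[OF lin_left subspace]) auto
    also have "\<dots> = (\<Sum>i<N. q w (e i) *\<^sub>R L (e i))"
      using e that sym by (intro sum.cong) auto
    also have "\<dots> = L (\<Sum>i<N. q w (e i) *\<^sub>R e i)"
      using e by (intro lin_on_sum[OF assms subspace, symmetric]) auto
    also have "\<dots> = L w" using e(3)[OF that] by simp
    finally show ?thesis .
  qed
  with u show ?thesis by (intro ex1I[of _ u]) (auto intro: eq_if_q_eq)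
qed

end


section \<open>Zeros of coercive continuous maps\<close>

lemma continuous_map_powertop_component:
  "continuous_map X (powertop_real UNIV) f \<longleftrightarrow> (\<forall>i. continuous_map X euclideanreal (\<lambda>x. f x i))"
  by (simp add: continuous_map_componentwise_UNIV)

text \<open>If there were no zero, the normalised map would be a null-homotopic map of the sphere that is
  homotopic to the identity.\<close>

lemma coercive_zero_exists:
  fixes g :: "(nat \<Rightarrow> real) \<Rightarrow> nat \<Rightarrow> real"
  assumes cont: "continuous_map (powertop_real UNIV) (powertop_real UNIV) g"
    and R: "R > 0"
    and coerc: "\<And>c. (\<Sum>i<N. (c i)\<^sup>2) = R\<^sup>2 \<Longrightarrow> (\<Sum>i<N. g c i * c i) > 0"
  shows "\<exists>c. \<forall>i<N. g c i = 0"
proof (rule ccontr)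
  assume no: "\<not> ?thesis"
  \<comment> \<open>For \<open>N = 0\<close> any \<open>c\<close> is a zero, so \<open>N\<close> is
    positive, and the unit sphere in \<open>N\<close> variables is \<open>nsphere n\<close>.\<close>
  then obtain n where N: "N = Suc n" by (cases N) auto
  define S where "S = {x :: nat \<Rightarrow> real. (\<Sum>i\<le>n. x i ^ 2) = 1 \<and> (\<forall>i>n. x i = 0)}"
  have top: "topspace (nsphere n) = S"
    by (simp add: nsphere S_def)
  \<comment> \<open>Coordinates beyond \<open>n\<close> are cut off because points of
    \<open>nsphere n\<close> vanish there, whereas values of \<open>g\<close> may not.\<close>
  define nrm where "nrm y i = (if i \<le> n then y i / sqrt (\<Sum>i\<le>n. y i ^ 2) else 0)" for y :: "nat \<Rightarrow> real" and i
  have nrmS: "nrm y \<in> S" if "(\<Sum>i\<le>n. y i ^ 2) \<noteq> 0" for y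
  proof -
    have "(\<Sum>i\<le>n. y i ^ 2) \<ge> 0" by (simp add: sum_nonneg)
    then have "(\<Sum>i\<le>n. (nrm y i)\<^sup>2) = 1"
      using that by (simp add: nrm_def power_divide flip: sum_divide_distrib)
    then show ?thesis by (simp add: S_def nrm_def)
  qed
  have cnrm: "continuous_map X (nsphere n) (\<lambda>x. nrm (F x))"
    if "\<And>i. continuous_map X euclideanreal (\<lambda>x. F x i)" "\<And>x. x \<in> topspace X \<Longrightarrow> (\<Sum>i\<le>n. F x i ^ 2) \<noteq> 0"
    for X :: "'b topology" and F
  proof -
    have "continuous_map X euclideanreal (\<lambda>x. nrm (F x) i)" for i
      using that by (cases "i \<le> n") (auto simp: nrm_def intro!: continuous_intros that)
    moreover have "nrm (F x) \<in> S" if "x \<in> topspace X" for x using nrmS that \<open>\<And>x. x \<in> topspace X \<Longrightarrow> _\<close> by auto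
    ultimately show ?thesis
      by (auto simp: nsphere continuous_map_in_subtopology continuous_map_powertop_component S_def)
  qed
  have cs: "continuous_map (nsphere n) euclideanreal (\<lambda>x. x i)" for i
    unfolding nsphere by (intro continuous_map_from_subtopology continuous_map_product_projection) simp
  have g_i: "continuous_map (powertop_real UNIV) euclideanreal (\<lambda>x. g x i)" for i
    using cont by (simp add: continuous_map_powertop_component)
  \<comment> \<open>\<open>H\<close> shrinks the sphere of radius \<open>R\<close> to the origin;
    its values can be normalised because the first \<open>N\<close> components of \<open>g\<close>
    have no common zero. \<open>K\<close> runs straight from the identity to \<open>g\<close> on
    that sphere and avoids zero, as both ends have positive inner product with
    \<open>x\<close>.\<close>
  define H where "H = (\<lambda>(t::real, x::nat\<Rightarrow>real). g (\<lambda>i. t * R * x i))"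
  define K where "K = (\<lambda>(t::real, x::nat\<Rightarrow>real). (\<lambda>i. t * g (\<lambda>i. R * x i) i + (1 - t) * x i))"
  let ?I = "top_of_set {0..1::real}"
  let ?P = "prod_topology ?I (nsphere n)"
  have cfst: "continuous_map ?P euclideanreal fst"
    using continuous_map_fst[of ?I "nsphere n"] by (simp add: continuous_map_in_subtopology)
  have csnd: "continuous_map ?P euclideanreal (\<lambda>p. snd p i)" for i
    using continuous_map_compose[OF continuous_map_snd[of ?I "nsphere n"] cs[of i]] by (simp add: o_def)
  have cR: "continuous_map ?P (powertop_real UNIV) (\<lambda>p. \<lambda>i. R * snd p i)"
    by (auto simp: continuous_map_powertop_component intro!: continuous_intros csnd)
  have ctR: "continuous_map ?P (powertop_real UNIV) (\<lambda>p. \<lambda>i. fst p * R * snd p i)"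
    by (auto simp: continuous_map_powertop_component intro!: continuous_intros csnd cfst)
  have H_i: "continuous_map ?P euclideanreal (\<lambda>p. H p i)" for i
    using continuous_map_compose[OF ctR g_i[of i]] by (simp add: H_def o_def case_prod_unfold)
  have K_i: "continuous_map ?P euclideanreal (\<lambda>p. K p i)" for i
    using continuous_map_compose[OF cR g_i[of i]]
    by (auto simp: K_def o_def case_prod_unfold intro!: continuous_intros csnd cfst)
  have sumsq0: "(\<Sum>i\<le>n. y i ^ 2) \<noteq> 0" if "i \<le> n" "y i \<noteq> 0" for y :: "nat \<Rightarrow> real" and i
    using that by (auto simp: sum_nonneg_eq_0_iff)
  have H0: "(\<Sum>i\<le>n. H p i ^ 2) \<noteq> 0" for p
  proof -
    obtain i where "i < N" "H p i \<noteq> 0" using no by (auto simp: H_def case_prod_unfold)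
    then show ?thesis using sumsq0[of i "H p"] N by simp
  qed
  have K0: "(\<Sum>i\<le>n. K (t, x) i ^ 2) \<noteq> 0" if "t \<in> {0..1}" "x \<in> S" for t x
  proof
    assume "(\<Sum>i\<le>n. K (t, x) i ^ 2) = 0"
    then have z: "K (t, x) i = 0" if "i \<le> n" for i using sumsq0 that by blast
    have x1: "(\<Sum>i<N. x i ^ 2) = 1" using that by (simp add: S_def N lessThan_Suc_atMost)
    have "(\<Sum>i<N. (R * x i)\<^sup>2) = R\<^sup>2" using x1 by (simp add: power_mult_distrib flip: sum_distrib_left)
    from coerc[OF this] have pos: "(\<Sum>i<N. g (\<lambda>i. R * x i) i * x i) > 0"
      using R by (simp add: mult.left_commute zero_less_mult_iff flip: sum_distrib_left)
    have "0 = (\<Sum>i<N. K (t, x) i * x i)" using z N by simp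
    also have "\<dots> = t * (\<Sum>i<N. g (\<lambda>i. R * x i) i * x i) + (1 - t) * (\<Sum>i<N. x i ^ 2)"
      by (simp add: K_def sum_distrib_left algebra_simps power2_eq_square flip: sum.distrib)
    finally show False using pos x1 that
      by (smt (verit) atLeastAtMost_iff mult_nonneg_nonneg mult_pos_pos mult_cancel_left1 mult_zero_left)
  qed
  have "homotopic_with (\<lambda>_. True) (nsphere n) (nsphere n) (\<lambda>x. nrm (H (0, x))) (\<lambda>x. nrm (H (1, x)))"
    unfolding homotopic_with_def
    by (rule exI[of _ "\<lambda>p. nrm (H p)"]) (auto intro!: cnrm H_i H0)
  moreover have "homotopic_with (\<lambda>_. True) (nsphere n) (nsphere n) (\<lambda>x. nrm (K (0, x))) (\<lambda>x. nrm (K (1, x)))"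
    unfolding homotopic_with_def
    by (rule exI[of _ "\<lambda>p. nrm (K p)"]) (use K0 in \<open>fastforce intro!: cnrm K_i simp: top\<close>)
  \<comment> \<open>Both homotopies end in the normalised \<open>g\<close> on the sphere of radius
    \<open>R\<close>. Joined there, they lead from the identity to the map of \<open>H\<close> at
    time 0, which is constant.\<close>
  moreover have "(\<lambda>x. nrm (H (1, x))) = (\<lambda>x. nrm (K (1, x)))" by (simp add: H_def K_def)
  ultimately have *: "homotopic_with (\<lambda>_. True) (nsphere n) (nsphere n) (\<lambda>x. nrm (K (0, x))) (\<lambda>x. nrm (H (0, x)))"
    by (metis homotopic_with_trans homotopic_with_symD)
  have "nrm (K (0, x)) = x" if "x \<in> S" for x
    using that by (auto simp: K_def nrm_def S_def fun_eq_iff)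
  then have "homotopic_with (\<lambda>_. True) (nsphere n) (nsphere n) id (\<lambda>x. nrm (H (0, \<lambda>_. 0)))"
    by (intro homotopic_with_eq[OF *]) (auto simp: top H_def)
  then have "contractible_space (nsphere n)" unfolding contractible_space_def by blast
  then show False using non_contractible_space_nsphere by blast
qed

lemma powertop_real_eq_euclidean: "powertop_real UNIV = (euclidean :: ('i \<Rightarrow> real) topology)"
  by (simp add: euclidean_product_topology)

text \<open>In an orthonormal basis the equation asks for a zero of the map with components
  \<open>A (comb c) (e i) - L (e i)\<close>. Continuity is assumed sequentially in the coefficients,
  as \<open>'a\<close> is only a vector space.\<close>

theorem (in inner_space) coercive_equation_solvable:
  fixes A :: "'a \<Rightarrow> 'a \<Rightarrow> real"
  assumes linA: "\<And>u. u \<in> W \<Longrightarrow> lin_on W (A u)"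
    and cont: "\<And>e N c c' v. (\<And>i::nat. i < N \<Longrightarrow> e i \<in> W) \<Longrightarrow> v \<in> W \<Longrightarrow> (\<And>i. i < N \<Longrightarrow> (\<lambda>n. c n i) \<longlonglongrightarrow> c' i) \<Longrightarrow>
      (\<lambda>n. A (\<Sum>i<N. c n i *\<^sub>R e i) v) \<longlonglongrightarrow> A (\<Sum>i<N. c' i *\<^sub>R e i) v"
    and L: "lin_on W L" and m: "m > 0"
    and coercive: "\<And>u. u \<in> W \<Longrightarrow> A u u \<ge> m * q u u"
  shows "\<exists>u\<in>W. \<forall>v\<in>W. A u v = L v"
proof -
  obtain e :: "nat \<Rightarrow> 'a" and N where e: "\<And>i. i < N \<Longrightarrow> e i \<in> W"
    "\<And>i j. i < N \<Longrightarrow> j < N \<Longrightarrow> q (e i) (e j) = (if i = j then 1 else 0)"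
    "\<And>u. u \<in> W \<Longrightarrow> u = (\<Sum>i<N. q u (e i) *\<^sub>R e i)" by (rule orthonormal_basis) (rule that)
  define comb where "comb c = (\<Sum>i<N. c i *\<^sub>R e i)" for c
  have combW: "comb c \<in> W" for c unfolding comb_def
    by (auto intro!: subspace_sum[OF subspace] subspace_scale[OF subspace] e)
  define g where "g c i = (if i < N then A (comb c) (e i) - L (e i) else 0)" for c i
  have q_comb: "q (comb c) (comb c) = (\<Sum>i<N. (c i)\<^sup>2)" for c
  proof -
    have 1: "q (comb c) (e j) = c j" if "j < N" for j
    proof -
      have "q (comb c) (e j) = (\<Sum>i<N. c i *\<^sub>R q (e i) (e j))"
        unfolding comb_def using e that by (intro lin_on_sum[OF lin_left subspace]) auto
      also have "\<dots> = (\<Sum>i<N. if i = j then c i else 0)"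
        using e(2) that by (intro sum.cong) auto
      finally show ?thesis using that by simp
    qed
    have "q (comb c) (comb c) = (\<Sum>i<N. c i *\<^sub>R q (comb c) (e i))"
      unfolding comb_def[of c] by (subst lin_on_sum[OF lin_right subspace]) (use combW e in \<open>auto simp: comb_def\<close>)
    then show ?thesis using 1 by (simp add: power2_eq_square)
  qed
  have g_comb: "(\<Sum>i<N. g c i * d i) = A (comb c) (comb d) - L (comb d)" for c d
  proof -
    have "A (comb c) (comb d) = (\<Sum>i<N. d i *\<^sub>R A (comb c) (e i))"
      unfolding comb_def[of d] using e by (intro lin_on_sum[OF linA[OF combW] subspace]) auto
    moreover have "L (comb d) = (\<Sum>i<N. d i *\<^sub>R L (e i))"
      unfolding comb_def[of d] using e by (intro lin_on_sum[OF L subspace]) auto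
    ultimately show ?thesis by (simp add: g_def sum_subtractf algebra_simps flip: sum_subtractf)
  qed
  define C where "C = (\<Sum>i<N. \<bar>L (e i)\<bar>)"
  \<comment> \<open>On the sphere of this radius \<open>L (comb c)\<close> is at most
    \<open>R * C\<close>, while \<open>A (comb c) (comb c)\<close> is at least
    \<open>m * R * R = R * (C + m)\<close>. The summand 1 makes the comparison strict.\<close>
  define R where "R = C / m + 1"
  have C: "C \<ge> 0" by (simp add: C_def sum_nonneg)
  have R: "R > 0" using C m by (auto simp: R_def intro: add_nonneg_pos)
  have "\<exists>c. \<forall>i<N. g c i = 0"
  proof (rule coercive_zero_exists[OF _ R])
    show "continuous_map (powertop_real UNIV) (powertop_real UNIV) g"
      unfolding continuous_map_powertop_component
    proof
      fix i
      have "continuous_on UNIV (\<lambda>x. g x i)"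
        unfolding continuous_on_sequentially
      proof (intro ballI allI impI)
        fix c :: "nat \<Rightarrow> nat \<Rightarrow> real" and c' assume "(\<forall>n. c n \<in> UNIV) \<and> c \<longlonglongrightarrow> c'"
        then have "(\<lambda>n. c n i) \<longlonglongrightarrow> c' i" for i
          using continuous_on_tendsto_compose[of UNIV "\<lambda>x::nat\<Rightarrow>real. x i"] continuous_on_product_coordinates
          by auto
        then show "((\<lambda>x. g x i) \<circ> c) \<longlonglongrightarrow> g c' i"
          by (cases "i < N") (auto simp: g_def o_def comb_def intro!: tendsto_intros cont e)
      qed
      then show "continuous_map (powertop_real UNIV) euclideanreal (\<lambda>x. g x i)"
        by (simp add: powertop_real_eq_euclidean)
    qed
    fix c assume c: "(\<Sum>i<N. (c i)\<^sup>2) = R\<^sup>2"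
    have "\<bar>c i\<bar> \<le> R" if "i < N" for i
    proof -
      have "(c i)\<^sup>2 \<le> (\<Sum>i<N. (c i)\<^sup>2)" using that by (intro member_le_sum) auto
      then show ?thesis using c R abs_le_square_iff[of "c i" R] by simp
    qed
    then have "\<bar>L (comb c)\<bar> \<le> R * C"
    proof -
      have "L (comb c) = (\<Sum>i<N. c i *\<^sub>R L (e i))"
        unfolding comb_def using e by (intro lin_on_sum[OF L subspace]) auto
      then have "\<bar>L (comb c)\<bar> \<le> (\<Sum>i<N. \<bar>c i\<bar> * \<bar>L (e i)\<bar>)"
        using sum_abs[of "\<lambda>i. c i * L (e i)" "{..<N}"] by (simp add: abs_mult)
      also have "\<dots> \<le> (\<Sum>i<N. R * \<bar>L (e i)\<bar>)"
        using \<open>\<And>i. i < N \<Longrightarrow> \<bar>c i\<bar> \<le> R\<close> by (intro sum_mono mult_right_mono) auto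
      finally show ?thesis by (simp add: C_def sum_distrib_left)
    qed
    moreover have "A (comb c) (comb c) \<ge> m * R\<^sup>2" using coercive[OF combW[of c]] q_comb[of c] c by simp
    moreover have "m * R = C + m" using m by (simp add: R_def field_simps)
    then have "m * R\<^sup>2 = R * C + R * m" by (simp add: power2_eq_square algebra_simps)
    then have "m * R\<^sup>2 > R * C" using R m by simp
    ultimately show "(\<Sum>i<N. g c i * c i) > 0" unfolding g_comb by linarith
  qed
  then obtain c where c: "\<And>i. i < N \<Longrightarrow> g c i = 0" by blast
  have "A (comb c) v = L v" if v: "v \<in> W" for v
    using g_comb[of c "\<lambda>i. q v (e i)"] e(3)[OF v] c by (simp add: comb_def)
  then show ?thesis using combW by blast
qed

section \<open>Polynomials\<close>

abbreviation mono_fn :: "('n::finite \<Rightarrow> nat) \<Rightarrow> real^'n \<Rightarrow> real" where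
  "mono_fn \<alpha> x \<equiv> (\<Prod>i\<in>UNIV. x $ i ^ \<alpha> i)"

lemma finite_multi_indices: "finite {\<alpha> :: 'n::finite \<Rightarrow> nat. (\<Sum>i\<in>UNIV. \<alpha> i) \<le> l}"
proof (rule finite_subset)
  show "{\<alpha> :: 'n \<Rightarrow> nat. (\<Sum>i\<in>UNIV. \<alpha> i) \<le> l} \<subseteq> PiE UNIV (\<lambda>_. {..l})"
  proof safe
    fix \<alpha> :: "'n \<Rightarrow> nat" and i assume "(\<Sum>i\<in>UNIV. \<alpha> i) \<le> l"
    then show "\<alpha> i \<le> l" using member_le_sum[of i UNIV \<alpha>] by simp
  qed auto
qed (auto intro!: finite_PiE)

lemma polysE:
  assumes "p \<in> polys l V"
  obtains c where "\<And>\<alpha>. c \<alpha> \<in> V"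
    and "p = (\<lambda>x. \<Sum>\<alpha> | (\<Sum>i\<in>UNIV. \<alpha> i) \<le> l. mono_fn \<alpha> x *\<^sub>R c \<alpha>)"
  using assms by (auto simp: polys_def)

lemma polys_monom:
  assumes "(\<Sum>i\<in>UNIV. \<alpha> i) \<le> l" "v \<in> V" "subspace V"
  shows "(\<lambda>x. mono_fn \<alpha> x *\<^sub>R v) \<in> polys l V"
proof -
  have "(\<lambda>x. mono_fn \<alpha> x *\<^sub>R v) =
    (\<lambda>x. \<Sum>\<beta> | (\<Sum>i\<in>UNIV. \<beta> i) \<le> l. mono_fn \<beta> x *\<^sub>R (if \<beta> = \<alpha> then v else 0))"
    using assms(1) by (simp add: if_distrib sum.delta' finite_multi_indices cong: if_cong)
  then show ?thesis unfolding polys_def using assms(2,3)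
    by (intro CollectI exI[of _ "\<lambda>\<beta>. if \<beta> = \<alpha> then v else 0"]) (auto simp: subspace_0)
qed

lemma subspace_polys:
  assumes "subspace V" shows "subspace (polys l V :: (real^'n \<Rightarrow> 'v::real_vector) set)"
  unfolding subspace_def
proof (intro conjI ballI allI)
  show "0 \<in> (polys l V :: (real^'n \<Rightarrow> 'v) set)"
    unfolding polys_def using subspace_0[OF assms] by (auto intro!: exI[of _ "\<lambda>_. 0"])
next
  fix p q :: "real^'n \<Rightarrow> 'v" assume "p \<in> polys l V" "q \<in> polys l V"
  then obtain c d where cd: "\<And>\<alpha>. c \<alpha> \<in> V" "\<And>\<alpha>. d \<alpha> \<in> V"
    "p = (\<lambda>x. \<Sum>\<alpha> | (\<Sum>i\<in>UNIV. \<alpha> i) \<le> l. mono_fn \<alpha> x *\<^sub>R c \<alpha>)"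
    "q = (\<lambda>x. \<Sum>\<alpha> | (\<Sum>i\<in>UNIV. \<alpha> i) \<le> l. mono_fn \<alpha> x *\<^sub>R d \<alpha>)" by (auto simp: polys_def)
  have "p + q = (\<lambda>x. \<Sum>\<alpha> | (\<Sum>i\<in>UNIV. \<alpha> i) \<le> l. mono_fn \<alpha> x *\<^sub>R (c \<alpha> + d \<alpha>))"
    by (auto simp: cd fun_eq_iff scaleR_add_right sum.distrib)
  then show "p + q \<in> polys l V"
    unfolding polys_def using cd subspace_add[OF assms] by (auto intro!: exI[of _ "\<lambda>\<alpha>. c \<alpha> + d \<alpha>"])
next
  fix r and p :: "real^'n \<Rightarrow> 'v" assume "p \<in> polys l V"
  then obtain c where c: "\<And>\<alpha>. c \<alpha> \<in> V"
    "p = (\<lambda>x. \<Sum>\<alpha> | (\<Sum>i\<in>UNIV. \<alpha> i) \<le> l. mono_fn \<alpha> x *\<^sub>R c \<alpha>)" by (auto simp: polys_def)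
  have "r *\<^sub>R p = (\<lambda>x. \<Sum>\<alpha> | (\<Sum>i\<in>UNIV. \<alpha> i) \<le> l. mono_fn \<alpha> x *\<^sub>R (r *\<^sub>R c \<alpha>))"
    by (auto simp: c fun_eq_iff scaleR_sum_right mult.commute)
  then show "r *\<^sub>R p \<in> polys l V"
    unfolding polys_def using c subspace_scale[OF assms] by (auto intro!: exI[of _ "\<lambda>\<alpha>. r *\<^sub>R c \<alpha>"])
qed

lemma polys_sum_fn:
  assumes "subspace V" "\<And>i. i \<in> I \<Longrightarrow> (f i :: real^'n \<Rightarrow> 'v::real_vector) \<in> polys l V"
  shows "(\<lambda>x. \<Sum>i\<in>I. f i x) \<in> polys l V"
proof -
  have "(\<Sum>i\<in>I. f i) \<in> polys l V" by (intro subspace_sum[OF subspace_polys[OF assms(1)]] assms(2))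
  moreover have "(\<Sum>i\<in>I. f i) = (\<lambda>x. \<Sum>i\<in>I. f i x)" by (auto simp: fun_eq_iff sum_fun_apply)
  ultimately show ?thesis by simp
qed

lemma polys_mono:
  assumes "l \<le> l'" "subspace V" shows "polys l V \<subseteq> polys l' V"
proof
  fix p assume "p \<in> polys l V"
  then obtain c where c: "\<And>\<alpha>. c \<alpha> \<in> V"
    "p = (\<lambda>x. \<Sum>\<alpha> | (\<Sum>i\<in>UNIV. \<alpha> i) \<le> l. mono_fn \<alpha> x *\<^sub>R c \<alpha>)" by (rule polysE) (rule that)
  show "p \<in> polys l' V" unfolding c(2)
    using assms c(1) by (intro polys_sum_fn polys_monom) auto
qed

lemma polys_compose_linear:
  assumes "p \<in> polys l V" "linear L" "L ` V \<subseteq> V'"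
  shows "(\<lambda>x. L (p x)) \<in> polys l V'"
proof -
  obtain c where c: "\<And>\<alpha>. c \<alpha> \<in> V"
    "p = (\<lambda>x. \<Sum>\<alpha> | (\<Sum>i\<in>UNIV. \<alpha> i) \<le> l. mono_fn \<alpha> x *\<^sub>R c \<alpha>)" using assms(1) by (rule polysE) (rule that)
  have "(\<lambda>x. L (p x)) = (\<lambda>x. \<Sum>\<alpha> | (\<Sum>i\<in>UNIV. \<alpha> i) \<le> l. mono_fn \<alpha> x *\<^sub>R L (c \<alpha>))"
    by (simp add: c linear_sum[OF assms(2)] linear_scale[OF assms(2)])
  then show ?thesis
    unfolding polys_def using c assms(3) by (auto intro!: exI[of _ "\<lambda>\<alpha>. L (c \<alpha>)"])
qed

lemma polys_component: "p \<in> polys l UNIV \<Longrightarrow> (\<lambda>x. p x $ j) \<in> polys l UNIV"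
  for p :: "real^'n \<Rightarrow> 'v::real_normed_vector^'m"
  by (rule polys_compose_linear[where L="\<lambda>v. v $ j" and V=UNIV]) (auto simp: bounded_linear.linear bounded_linear_vec_nth)

lemma linear_axis: "linear (axis j :: 'v::real_vector \<Rightarrow> 'v^'m)"
  by (auto intro!: linearI simp: vec_eq_iff axis_def)

lemma polys_vec:
  fixes f :: "real^'n \<Rightarrow> 'v::real_normed_vector^'m"
  assumes "\<And>j. (\<lambda>x. f x $ j) \<in> polys l UNIV" shows "f \<in> polys l UNIV"
proof -
  have "f = (\<lambda>x. \<Sum>j\<in>UNIV. axis j (f x $ j))"
    by (auto simp: fun_eq_iff vec_eq_iff axis_def if_distrib cong: if_cong)
  also have "\<dots> \<in> polys l UNIV"
    by (intro polys_sum_fn polys_compose_linear[OF assms linear_axis]) auto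
  finally show ?thesis .
qed

lemma polys_const: "v \<in> V \<Longrightarrow> subspace V \<Longrightarrow> (\<lambda>x. v) \<in> polys l V"
  using polys_monom[of "\<lambda>_. 0" l v V] by simp

lemma polys_coord: "1 \<le> l \<Longrightarrow> (\<lambda>x::real^'m. x $ i) \<in> polys l (UNIV :: real set)"
proof -
  assume l: "1 \<le> l"
  have "mono_fn (\<lambda>j. if j = i then 1 else 0) x = x $ i" for x :: "real^'m"
    by (simp add: if_distrib cong: if_cong)
  then show ?thesis using polys_monom[of "\<lambda>j. if j = i then 1 else 0" l "1::real" UNIV] l by simp
qed

lemma polys_affine:
  fixes A :: "real^'n^'m"
  assumes "1 \<le> l" shows "(\<lambda>x. A *v x + b) \<in> polys l (UNIV :: (real^'m) set)"
proof (rule polys_vec)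
  fix j
  have "(\<lambda>x. \<Sum>i\<in>UNIV. A $ j $ i *\<^sub>R x $ i) \<in> polys l (UNIV :: real set)"
  proof (rule polys_sum_fn)
    fix i
    have "A $ j $ i *\<^sub>R (\<lambda>x. x $ i) \<in> polys l (UNIV :: real set)"
      using assms by (intro subspace_scale[OF subspace_polys] polys_coord) auto
    then show "(\<lambda>x. A $ j $ i *\<^sub>R x $ i) \<in> polys l (UNIV :: real set)" by (simp add: scaleR_fun_def)
  qed auto
  from subspace_add[OF subspace_polys this polys_const[of "b $ j"]]
  show "(\<lambda>x. (A *v x + b) $ j) \<in> polys l UNIV"
    by (simp add: plus_fun_def matrix_vector_mult_def)
qed

lemma polynomial_function_mono_fn: "real_polynomial_function (\<lambda>x. mono_fn \<alpha> x)"
proof -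
  have "real_polynomial_function (\<lambda>x::real^'n. x $ i)" for i
    by (rule real_polynomial_function.intros(1)[OF bounded_linear_vec_nth])
  then show ?thesis by (intro real_polynomial_function_prod real_polynomial_function_power) auto
qed

lemma polynomial_function_polys:
  fixes p :: "real^'n \<Rightarrow> 'v::euclidean_space"
  assumes "p \<in> polys l V" shows "polynomial_function p"
proof -
  obtain c where c: "p = (\<lambda>x. \<Sum>\<alpha> | (\<Sum>i\<in>UNIV. \<alpha> i) \<le> l. mono_fn \<alpha> x *\<^sub>R c \<alpha>)"
    using assms by (rule polysE) (rule that)
  have "polynomial_function (\<lambda>x. mono_fn \<alpha> x)" for \<alpha> :: "'n \<Rightarrow> nat"
    using polynomial_function_mono_fn by (simp add: real_polynomial_function_eq)
  then show ?thesis
    unfolding c by (intro polynomial_function_sum finite_multi_indices polynomial_function_mult) auto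
qed

lemma fin_dim_polys: "fin_dim (polys l V :: (real^'n \<Rightarrow> 'v::euclidean_space) set)"
proof -
  let ?I = "{\<alpha> :: 'n \<Rightarrow> nat. (\<Sum>i\<in>UNIV. \<alpha> i) \<le> l}"
  let ?m = "\<lambda>(\<alpha>, b). (\<lambda>x. mono_fn \<alpha> x *\<^sub>R b) :: real^'n \<Rightarrow> 'v"
  have "p \<in> span (?m ` (?I \<times> Basis))" if p: "p \<in> polys l V" for p :: "real^'n \<Rightarrow> 'v"
  proof -
    obtain c where c: "p = (\<lambda>x. \<Sum>\<alpha> | (\<Sum>i\<in>UNIV. \<alpha> i) \<le> l. mono_fn \<alpha> x *\<^sub>R c \<alpha>)"
      using p by (rule polysE) (rule that)
    have "p = (\<Sum>\<alpha>\<in>?I. \<Sum>b\<in>Basis. (c \<alpha> \<bullet> b) *\<^sub>R ?m (\<alpha>, b))"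
    proof
      fix x
      have "p x = (\<Sum>\<alpha>\<in>?I. mono_fn \<alpha> x *\<^sub>R (\<Sum>b\<in>Basis. (c \<alpha> \<bullet> b) *\<^sub>R b))"
        by (simp add: c euclidean_representation)
      also have "\<dots> = (\<Sum>\<alpha>\<in>?I. \<Sum>b\<in>Basis. (c \<alpha> \<bullet> b) *\<^sub>R ?m (\<alpha>, b)) x"
        by (simp add: sum_fun_apply scaleR_sum_right mult.commute)
      finally show "p x = (\<Sum>\<alpha>\<in>?I. \<Sum>b\<in>Basis. (c \<alpha> \<bullet> b) *\<^sub>R ?m (\<alpha>, b)) x" .
    qed
    also have "\<dots> \<in> span (?m ` (?I \<times> Basis))"
      by (intro span_sum span_scale span_base) (auto intro!: rev_image_eqI)
    finally show ?thesis .
  qed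
  then show ?thesis unfolding fin_dim_def
    by (intro exI[of _ "?m ` (?I \<times> Basis)"]) (auto intro!: finite_imageI finite_cartesian_product finite_multi_indices)
qed

subsection \<open>Partial derivatives\<close>

text \<open>The choice made by \<open>frechet_derivative\<close> depends only on which derivatives
  exist at the point, and near \<open>x\<close> the two functions share them, differentiable or not.
  So derivatives in an open element ignore the value \<open>undefined\<close> that a restriction
  takes outside it.\<close>

lemma frechet_derivative_cong_open:
  assumes "open T" "x \<in> T" "\<And>y. y \<in> T \<Longrightarrow> f y = g y"
  shows "frechet_derivative f (at x) = frechet_derivative g (at x)"
proof -
  have "(f has_derivative D) (at x) \<longleftrightarrow> (g has_derivative D) (at x)" for D
    using has_derivative_transform_within_open[OF _ assms(1,2)] assms(3) by metis
  then show ?thesis by (simp add: frechet_derivative_def)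
qed

lemma partial_cong_open:
  "open T \<Longrightarrow> x \<in> T \<Longrightarrow> (\<And>y. y \<in> T \<Longrightarrow> f y = g y) \<Longrightarrow> partial i f x = partial i g x"
  unfolding partial_def using frechet_derivative_cong_open by metis

lemma has_derivative_partial:
  fixes p :: "real^'n \<Rightarrow> 'v::real_normed_vector"
  assumes "p differentiable (at x)"
  shows "(p has_derivative (\<lambda>h. \<Sum>i\<in>UNIV. h $ i *\<^sub>R partial i p x)) (at x)"
proof -
  have D: "(p has_derivative frechet_derivative p (at x)) (at x)"
    using assms by (simp add: frechet_derivative_works)
  then have lin: "linear (frechet_derivative p (at x))"
    by (rule has_derivative_linear)
  have "frechet_derivative p (at x) h = (\<Sum>i\<in>UNIV. h $ i *\<^sub>R partial i p x)" for h
  proof -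
    have "h = (\<Sum>i\<in>UNIV. h $ i *\<^sub>R axis i 1)" by (simp add: basis_expansion flip: scalar_mult_eq_scaleR)
    then have "frechet_derivative p (at x) h = frechet_derivative p (at x) (\<Sum>i\<in>UNIV. h $ i *\<^sub>R axis i 1)" by simp
    then show ?thesis by (simp add: linear_sum[OF lin] linear_scale[OF lin] partial_def)
  qed
  then show ?thesis using D by (metis (no_types, lifting) ext)
qed

lemma partial_eqI:
  "(p has_derivative D) (at x) \<Longrightarrow> partial i p x = D (axis i 1)"
  unfolding partial_def by (simp add: frechet_derivative_at[symmetric])

lemma partial_lincomb:
  assumes "p differentiable (at x)" "q differentiable (at x)"
  shows "partial i (\<alpha> *\<^sub>R p + \<beta> *\<^sub>R q) x = \<alpha> *\<^sub>R partial i p x + \<beta> *\<^sub>R partial i q x"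
proof -
  have "(\<alpha> *\<^sub>R p + \<beta> *\<^sub>R q has_derivative
    (\<lambda>h. \<alpha> *\<^sub>R frechet_derivative p (at x) h + \<beta> *\<^sub>R frechet_derivative q (at x) h)) (at x)"
    using assms unfolding plus_fun_def scaleR_fun_def frechet_derivative_works
    by (intro derivative_intros)
  from partial_eqI[OF this] show ?thesis by (simp add: partial_def)
qed

text \<open>When \<open>\<alpha> i = 0\<close>, truncated subtraction leaves the monomial unchanged
  and the factor \<open>real (\<alpha> i)\<close> removes the term.\<close>

lemma has_derivative_mono_fn:
  "((\<lambda>x::real^'n. mono_fn \<alpha> x) has_derivative
     (\<lambda>h. \<Sum>i\<in>UNIV. (real (\<alpha> i) * h $ i) * mono_fn (\<alpha>(i := \<alpha> i - 1)) x)) (at x)"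
proof -
  have 1: "((\<lambda>x::real^'n. x $ i ^ \<alpha> i) has_derivative (\<lambda>h. of_nat (\<alpha> i) * h $ i * x $ i ^ (\<alpha> i - 1))) (at x)" for i
    using has_derivative_power[OF bounded_linear_imp_has_derivative[OF bounded_linear_vec_nth], where n="\<alpha> i"]
    by (simp add: mult_ac)
  have 2: "mono_fn (\<alpha>(i := \<alpha> i - 1)) x = x $ i ^ (\<alpha> i - 1) * (\<Prod>j\<in>UNIV - {i}. x $ j ^ \<alpha> j)" for i
    by (subst prod.remove[of _ i]) (auto intro!: arg_cong2[of _ _ _ _ "(*)"] prod.cong)
  show ?thesis
    by (rule has_derivative_eq_rhs[OF has_derivative_prod[OF 1]]) (simp only: 2, simp add: mult_ac)
qed

lemma partial_mono_fn:
  "partial i (\<lambda>x. mono_fn \<alpha> x *\<^sub>R v) x = mono_fn (\<alpha>(i := \<alpha> i - 1)) x *\<^sub>R (real (\<alpha> i) *\<^sub>R v)"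
proof -
  have "((\<lambda>x. mono_fn \<alpha> x *\<^sub>R v) has_derivative
     (\<lambda>h. (\<Sum>i\<in>UNIV. (real (\<alpha> i) * h $ i) * mono_fn (\<alpha>(i := \<alpha> i - 1)) x) *\<^sub>R v)) (at x)"
    by (intro has_derivative_scaleR_left has_derivative_mono_fn)
  from partial_eqI[OF this, of i] show ?thesis
    by (simp add: axis_def if_distrib if_distribR mult.commute cong: if_cong)
qed

lemma differentiable_polys:
  fixes p :: "real^'n \<Rightarrow> 'v::euclidean_space"
  assumes "p \<in> polys l V" shows "p differentiable (at x within S)"
  using differentiable_at_polynomial_function[OF polynomial_function_polys[OF assms]] by blast

lemma continuous_polys:
  fixes p :: "real^'n \<Rightarrow> 'v::euclidean_space"
  assumes "p \<in> polys l V" shows "continuous_on S p"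
  using continuous_on_polymonial_function[OF polynomial_function_polys[OF assms]] .

lemma partial_polys:
  fixes p :: "real^'n \<Rightarrow> 'v::euclidean_space"
  assumes "p \<in> polys l V" "subspace V" shows "partial i p \<in> polys l V"
proof -
  let ?I = "{\<alpha> :: 'n \<Rightarrow> nat. (\<Sum>i\<in>UNIV. \<alpha> i) \<le> l}"
  obtain c where c: "\<And>\<alpha>. c \<alpha> \<in> V" "p = (\<lambda>x. \<Sum>\<alpha>\<in>?I. mono_fn \<alpha> x *\<^sub>R c \<alpha>)"
    using assms(1) by (rule polysE) (rule that)
  have "partial i p x = (\<Sum>\<alpha>\<in>?I. partial i (\<lambda>x. mono_fn \<alpha> x *\<^sub>R c \<alpha>) x)" for x
  proof -
    have "(\<lambda>x. mono_fn \<alpha> x *\<^sub>R c \<alpha>) differentiable (at x)" for \<alpha>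
      using has_derivative_scaleR_left[OF has_derivative_mono_fn] unfolding differentiable_def by blast
    then have "(p has_derivative (\<lambda>h. \<Sum>\<alpha>\<in>?I. frechet_derivative (\<lambda>x. mono_fn \<alpha> x *\<^sub>R c \<alpha>) (at x) h)) (at x)"
      unfolding c(2) by (intro has_derivative_sum) (simp add: frechet_derivative_works)
    from partial_eqI[OF this] show ?thesis by (simp add: partial_def)
  qed
  then have "partial i p = (\<lambda>x. \<Sum>\<alpha>\<in>?I. mono_fn (\<alpha>(i := \<alpha> i - 1)) x *\<^sub>R (real (\<alpha> i) *\<^sub>R c \<alpha>))"
    by (auto simp: partial_mono_fn)
  also have "\<dots> \<in> polys l V"
  proof (intro polys_sum_fn polys_monom assms subspace_scale[OF assms(2)] c)
    fix \<alpha> :: "'n \<Rightarrow> nat" assume "\<alpha> \<in> ?I"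
    moreover have "(\<Sum>j\<in>UNIV. (\<alpha>(i := \<alpha> i - 1)) j) \<le> (\<Sum>j\<in>UNIV. \<alpha> j)" by (intro sum_mono) auto
    ultimately show "(\<Sum>j\<in>UNIV. (\<alpha>(i := \<alpha> i - 1)) j) \<le> l" by simp
  qed
  finally show ?thesis .
qed

lemma partial_component:
  fixes w :: "real^'n \<Rightarrow> 'v::real_normed_vector^'m"
  assumes "w differentiable (at x)" shows "partial i w x $ j = partial i (\<lambda>y. w y $ j) x"
proof -
  have "((\<lambda>y. w y $ j) has_derivative (\<lambda>h. frechet_derivative w (at x) h $ j)) (at x)"
    using assms unfolding frechet_derivative_works by (rule bounded_linear.has_derivative[OF bounded_linear_vec_nth])
  from partial_eqI[OF this] show ?thesis by (simp add: partial_def)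
qed

subsection \<open>Zeros of polynomials\<close>

text \<open>Along the line \<open>p\<close> is a univariate polynomial whose value at parameter 0 is
  \<open>p a\<close>, hence not the zero polynomial.\<close>

lemma line_zeros_finite:
  fixes p :: "'a::euclidean_space \<Rightarrow> real"
  assumes "real_polynomial_function p" "p a \<noteq> 0"
  shows "finite {s. p (a + s *\<^sub>R y) = 0}"
proof -
  have "polynomial_function (\<lambda>s::real. a + s *\<^sub>R y)"
    by (intro polynomial_function_add polynomial_function_const polynomial_function_mult polynomial_function_id)
  from real_polynomial_function_compose[OF this assms(1)]
  have "real_polynomial_function (\<lambda>s. p (a + s *\<^sub>R y))" by (simp add: o_def)
  then obtain c n where c: "\<And>s. p (a + s *\<^sub>R y) = (\<Sum>i\<le>n. c i * s ^ i)"
    unfolding real_polynomial_function_iff_sum by metis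
  have "\<exists>k\<le>n. c k \<noteq> 0"
  proof (rule ccontr)
    assume "\<not> ?thesis"
    then have "p (a + 0 *\<^sub>R y) = 0" unfolding c by simp
    then show False using assms(2) by simp
  qed
  then obtain k where "c k \<noteq> 0" "k \<le> n" by blast
  then show ?thesis unfolding c by (rule polyfun_roots_finite)
qed

text \<open>Almost every dilation about a point outside the zero set \<open>Z\<close> takes \<open>Z\<close> to a null set,
  since each ray meets \<open>Z\<close> finitely often.\<close>

lemma polynomial_zeros_null:
  fixes p :: "'a::euclidean_space \<Rightarrow> real"
  assumes p: "real_polynomial_function p" and a: "p a \<noteq> 0"
  shows "{x. p x = 0} \<in> null_sets lborel"
proof -
  have "continuous_on UNIV p"
    using p by (simp add: continuous_on_polymonial_function real_polynomial_function_eq)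
  then have [measurable]: "p \<in> borel_measurable borel" by (rule borel_measurable_continuous_onI)
  let ?f = "\<lambda>s y. indicator {x. p x = 0} (a + s *\<^sub>R y) :: ennreal"
  have "(\<integral>\<^sup>+s. \<integral>\<^sup>+y. ?f s y \<partial>lborel \<partial>lborel) = (\<integral>\<^sup>+y. \<integral>\<^sup>+s. ?f s y \<partial>lborel \<partial>lborel)"
    by (rule lborel_pair.Fubini') measurable
  also have "\<dots> = (\<integral>\<^sup>+y. 0 \<partial>(lborel :: 'a measure))"
  proof (rule nn_integral_cong)
    fix y
    have fin: "finite {s. p (a + s *\<^sub>R y) = 0}" by (rule line_zeros_finite[OF p a])
    have "(\<integral>\<^sup>+s. ?f s y \<partial>lborel) = (\<integral>\<^sup>+s. indicator {s. p (a + s *\<^sub>R y) = 0} s \<partial>lborel)"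
      by (auto intro!: nn_integral_cong simp: indicator_def)
    also have "\<dots> = emeasure lborel {s. p (a + s *\<^sub>R y) = 0}" by (rule nn_integral_indicator) measurable
    finally show "(\<integral>\<^sup>+s. ?f s y \<partial>lborel) = 0"
      using fin by (simp add: emeasure_lborel_countable countable_finite)
  qed
  finally have "(\<integral>\<^sup>+s. \<integral>\<^sup>+y. ?f s y \<partial>lborel \<partial>lborel) = 0" by simp
  then have "AE s in lborel. (\<integral>\<^sup>+y. ?f s y \<partial>lborel) = 0"
    by (subst (asm) nn_integral_0_iff_AE) measurable
  then have "AE s in lborel. (\<integral>\<^sup>+y. ?f s y \<partial>lborel) = 0 \<and> s \<noteq> 0"
    using AE_lborel_singleton[of "0::real"] by auto
  then have "ae_filter (lborel :: real measure) = bot \<or> (\<exists>s. (\<integral>\<^sup>+y. ?f s y \<partial>lborel) = 0 \<and> s \<noteq> 0)"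
    by (rule eventually_happens)
  \<comment> \<open>One good scale is enough: \<open>s \<noteq> 0\<close> makes the dilation
    invertible, and the substitution rule turns the vanishing inner integral into the measure of the
    zero set.\<close>
  then obtain s where s: "(\<integral>\<^sup>+y. ?f s y \<partial>lborel) = 0" "s \<noteq> 0"
    by (auto simp: ae_filter_eq_bot_iff)
  have "emeasure lborel {x. p x = 0} = (\<integral>\<^sup>+x. indicator {x. p x = 0} x \<partial>lborel)"
    by (rule nn_integral_indicator[symmetric]) measurable
  also have "\<dots> = (\<integral>\<^sup>+y. \<bar>s\<bar> ^ DIM('a) * ?f s y \<partial>lborel)"
    by (subst lborel_affine[OF s(2), of a]) (simp add: nn_integral_density nn_integral_distr del: nn_integral_indicator)
  also have "\<dots> = 0" using s by (simp add: nn_integral_cmult)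
  finally show ?thesis by (simp add: null_sets_def)
qed

text \<open>A nonzero polynomial has a null zero set, which cannot contain almost all of a set of
  positive measure.\<close>

lemma polynomial_zero_AE:
  fixes p :: "'a::euclidean_space \<Rightarrow> 'b::euclidean_space"
  assumes p: "polynomial_function p" and A: "A \<in> sets lborel" "emeasure lborel A > 0"
    and z: "AE x in lborel. x \<in> A \<longrightarrow> p x = 0"
  shows "p x = 0"
proof (rule ccontr)
  assume "p x \<noteq> 0"
  then obtain b where b: "b \<in> Basis" "p x \<bullet> b \<noteq> 0" using euclidean_all_zero_iff[of "p x"] by blast
  have "real_polynomial_function (\<lambda>x. p x \<bullet> b)" using p b by (simp add: polynomial_function_iff_Basis_inner)
  from polynomial_zeros_null[OF this b(2)] have "AE x in lborel. p x \<bullet> b \<noteq> 0"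
    by (rule AE_not_in[THEN eventually_mono]) auto
  with z have "AE x in lborel. x \<notin> A" by eventually_elim auto
  then have "emeasure lborel A = 0" using A by (simp add: AE_iff_null_sets[symmetric] null_setsD1)
  then show False using A by simp
qed

lemma polynomial_zero_open:
  fixes p :: "'a::euclidean_space \<Rightarrow> 'b::euclidean_space"
  assumes "polynomial_function p" "open T" "T \<noteq> {}" "\<And>x. x \<in> T \<Longrightarrow> p x = 0"
  shows "p x = 0"
proof (rule polynomial_zero_AE[OF assms(1)])
  show "emeasure lborel T > 0" using assms open_not_negligible[of T]
    by (metis borel_open null_setsI not_gr_zero negligible_iff_null_sets null_sets_completionI sets_lborel)
qed (use assms in auto)

section \<open>Slabs, prisms and hyperplane measures\<close>

lemma nn_integral_line_interval:
  assumes "b \<noteq> 0" "l \<le> u"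
  shows "(\<integral>\<^sup>+t. indicator {l..u} (\<beta> + t * b :: real) \<partial>lborel) = ennreal ((u - l) / \<bar>b\<bar>)"
proof -
  have "ennreal (u - l) = (\<integral>\<^sup>+s. indicator {l..u} s \<partial>lborel)"
    using assms by simp
  also have "\<dots> = \<bar>b\<bar> * (\<integral>\<^sup>+t. indicator {l..u} (\<beta> + b * t) \<partial>lborel)"
    using assms by (intro nn_integral_real_affine) auto
  finally have *: "ennreal (u - l) = ennreal \<bar>b\<bar> * (\<integral>\<^sup>+t. indicator {l..u} (\<beta> + t * b) \<partial>lborel)"
    by (simp add: mult.commute)
  have "ennreal ((u - l) / \<bar>b\<bar>) = ennreal (u - l) / ennreal \<bar>b\<bar>"
    using assms by (simp add: divide_ennreal)
  also have "\<dots> = (\<integral>\<^sup>+t. indicator {l..u} (\<beta> + t * b) \<partial>lborel)"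
    unfolding * using assms by (simp add: ennreal_mult_divide_eq mult.commute[of "ennreal \<bar>b\<bar>"])
  finally show ?thesis by simp
qed

text \<open>Each line parallel to \<open>e\<close> meets the slab in a segment of parameter length
  one. Integrating over the slab therefore counts every such line once, which replaces coordinates
  adapted to \<open>e\<close>.\<close>

definition unit_slab :: "'a::euclidean_space \<Rightarrow> 'a set" where
  "unit_slab e = {x. 0 \<le> e \<bullet> x \<and> e \<bullet> x \<le> e \<bullet> e}"

lemma unit_slab_borel [measurable]: "unit_slab e \<in> sets borel"
  unfolding unit_slab_def by measurable

lemma nn_integral_lborel_shift:
  fixes F :: "'a::euclidean_space \<Rightarrow> ennreal"
  assumes [measurable]: "F \<in> borel_measurable borel"
  shows "(\<integral>\<^sup>+x. F (x + v) \<partial>lborel) = (\<integral>\<^sup>+x. F x \<partial>lborel)"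
proof -
  have "(\<integral>\<^sup>+x. F x \<partial>lborel) = (\<integral>\<^sup>+x. F x \<partial>distr lborel borel ((+) v))" by (simp add: lborel_distr_plus)
  also have "\<dots> = (\<integral>\<^sup>+x. F (x + v) \<partial>lborel)" by (simp add: nn_integral_distr add.commute)
  finally show ?thesis by simp
qed

text \<open>After Fubini, a point \<open>z\<close> is counted with weight the length of the set of
  all \<open>t\<close> with \<open>z - t *\<^sub>R e\<close> in the slab, which is one.\<close>

lemma nn_integral_over_lines:
  fixes F :: "'a::euclidean_space \<Rightarrow> ennreal"
  assumes [measurable]: "F \<in> borel_measurable borel" and e: "e \<noteq> 0"
  shows "(\<integral>\<^sup>+x. F x \<partial>lborel) =
    (\<integral>\<^sup>+x. indicator (unit_slab e) x * (\<integral>\<^sup>+t. F (x + t *\<^sub>R e) \<partial>lborel) \<partial>lborel)"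
proof -
  have "(\<integral>\<^sup>+x. indicator (unit_slab e) x * (\<integral>\<^sup>+t. F (x + t *\<^sub>R e) \<partial>lborel) \<partial>lborel) =
      (\<integral>\<^sup>+x. \<integral>\<^sup>+t. indicator (unit_slab e) x * F (x + t *\<^sub>R e) \<partial>lborel \<partial>lborel)"
    by (intro nn_integral_cong nn_integral_cmult[symmetric]) measurable
  also have "\<dots> = (\<integral>\<^sup>+t. \<integral>\<^sup>+x. indicator (unit_slab e) x * F (x + t *\<^sub>R e) \<partial>lborel \<partial>lborel)"
    by (rule lborel_pair.Fubini'[symmetric]) measurable
  also have "\<dots> = (\<integral>\<^sup>+t. \<integral>\<^sup>+z. indicator (unit_slab e) (z - t *\<^sub>R e) * F z \<partial>lborel \<partial>lborel)"
  proof (rule nn_integral_cong)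
    fix t :: real
    have "(\<integral>\<^sup>+x. indicator (unit_slab e) (x + t *\<^sub>R e - t *\<^sub>R e) * F (x + t *\<^sub>R e) \<partial>lborel) =
      (\<integral>\<^sup>+z. indicator (unit_slab e) (z - t *\<^sub>R e) * F z \<partial>lborel)"
      by (rule nn_integral_lborel_shift) measurable
    then show "(\<integral>\<^sup>+x. indicator (unit_slab e) x * F (x + t *\<^sub>R e) \<partial>lborel) =
      (\<integral>\<^sup>+z. indicator (unit_slab e) (z - t *\<^sub>R e) * F z \<partial>lborel)" by simp
  qed
  also have "\<dots> = (\<integral>\<^sup>+z. \<integral>\<^sup>+t. indicator (unit_slab e) (z - t *\<^sub>R e) * F z \<partial>lborel \<partial>lborel)"
    by (rule lborel_pair.Fubini') measurable
  also have "\<dots> = (\<integral>\<^sup>+z. F z \<partial>lborel)"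
  proof (rule nn_integral_cong)
    fix z :: 'a
    have "(\<integral>\<^sup>+t. indicator (unit_slab e) (z - t *\<^sub>R e) * F z \<partial>lborel) =
      (\<integral>\<^sup>+t. indicator {0..e \<bullet> e} (e \<bullet> z + t * (- (e \<bullet> e))) \<partial>lborel) * F z"
      by (subst nn_integral_multc[symmetric])
        (auto intro!: nn_integral_cong simp: unit_slab_def indicator_def inner_diff_right)
    also have "\<dots> = F z" using e by (subst nn_integral_line_interval) auto
    finally show "(\<integral>\<^sup>+t. indicator (unit_slab e) (z - t *\<^sub>R e) * F z \<partial>lborel) = F z" .
  qed
  finally show ?thesis by simp
qed

text \<open>Because \<open>a \<bullet> u = 0\<close>, the shear moves every line parallel to
  \<open>u\<close> along itself by a constant, so the measure on each line is preserved.\<close>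

lemma nn_integral_shear:
  fixes F :: "'a::euclidean_space \<Rightarrow> ennreal"
  assumes [measurable]: "F \<in> borel_measurable borel" and u: "a \<bullet> u = 0"
  shows "(\<integral>\<^sup>+x. F (x - (a \<bullet> x - c) *\<^sub>R u) \<partial>lborel) = (\<integral>\<^sup>+x. F x \<partial>lborel)"
proof (cases "u = 0")
  case False
  have "(\<integral>\<^sup>+t. F (x + t *\<^sub>R u - (a \<bullet> (x + t *\<^sub>R u) - c) *\<^sub>R u) \<partial>lborel) = (\<integral>\<^sup>+t. F (x + t *\<^sub>R u) \<partial>lborel)" for x
  proof -
    have "(\<integral>\<^sup>+t. F (x + t *\<^sub>R u) \<partial>lborel) = ennreal \<bar>1\<bar> * (\<integral>\<^sup>+t. F (x + (- (a \<bullet> x - c) + 1 * t) *\<^sub>R u) \<partial>lborel)"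
      by (rule nn_integral_real_affine) auto
    also have "\<dots> = (\<integral>\<^sup>+t. F (x + t *\<^sub>R u - (a \<bullet> (x + t *\<^sub>R u) - c) *\<^sub>R u) \<partial>lborel)"
      using u by (auto intro!: nn_integral_cong arg_cong[of _ _ F] simp: inner_add_right algebra_simps)
    finally show ?thesis by simp
  qed
  then show ?thesis
    by (subst (1 2) nn_integral_over_lines[OF _ False]) simp_all
qed simp

section \<open>Oblique prisms over a hyperplane\<close>

definition slab_proj :: "'a::euclidean_space \<Rightarrow> real \<Rightarrow> 'a \<Rightarrow> 'a" where
  "slab_proj a c y = y - (a \<bullet> y - c) *\<^sub>R a"

text \<open>The projection onto the hyperplane along lines parallel to \<open>e\<close>; for a unit
  normal, \<open>slab_proj\<close> is the orthogonal case.\<close>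

definition line_proj :: "'a::euclidean_space \<Rightarrow> real \<Rightarrow> 'a \<Rightarrow> 'a \<Rightarrow> 'a" where
  "line_proj a c e x = x + ((c - a \<bullet> x) / (a \<bullet> e)) *\<^sub>R e"

definition plane_slab :: "'a::euclidean_space \<Rightarrow> real \<Rightarrow> 'a set" where
  "plane_slab a c = {y. c \<le> a \<bullet> y \<and> a \<bullet> y \<le> c + 1}"

lemma slab_measurables [measurable]:
  "slab_proj a c \<in> borel_measurable borel" "line_proj a c e \<in> borel_measurable borel"
  "plane_slab a c \<in> sets borel"
  unfolding slab_proj_def[abs_def] line_proj_def[abs_def] plane_slab_def by measurable

text \<open>The volume of an oblique prism. On a line parallel to \<open>e\<close> the projected
  function is constant, \<open>unit_slab e\<close> has length one, and \<open>plane_slab a c\<close>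
  has length \<open>1 / \<bar>a \<bullet> e\<bar>\<close>.\<close>

lemma nn_integral_prism:
  fixes g :: "'a::euclidean_space \<Rightarrow> ennreal"
  assumes [measurable]: "g \<in> borel_measurable borel" and a: "norm a = 1" and ae: "a \<bullet> e \<noteq> 0"
  shows "(\<integral>\<^sup>+x. indicator (unit_slab e) x * g (line_proj a c e x) \<partial>lborel) =
    ennreal \<bar>a \<bullet> e\<bar> * (\<integral>\<^sup>+y. indicator (plane_slab a c) y * g (slab_proj a c y) \<partial>lborel)"
proof -
  have aa: "a \<bullet> a = 1" using a by (simp add: norm_eq_1)
  have e: "e \<noteq> 0" using ae by auto
  \<comment> \<open>Both \<open>a\<close> and \<open>e\<close> divided by
    \<open>a \<bullet> e\<close> have inner product one with \<open>a\<close>. The shear along their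
    difference turns orthogonal projection into projection along \<open>e\<close>.\<close>
  define u where "u = (1 / (a \<bullet> e)) *\<^sub>R e - a"
  have u: "a \<bullet> u = 0" using ae aa by (simp add: u_def inner_diff_right)
  let ?S = "\<lambda>y. y - (a \<bullet> y - c) *\<^sub>R u"
  have "(\<integral>\<^sup>+y. indicator (plane_slab a c) y * g (slab_proj a c y) \<partial>lborel) =
    (\<integral>\<^sup>+y. indicator (plane_slab a c) (?S y) * g (slab_proj a c (?S y)) \<partial>lborel)"
    by (rule nn_integral_shear[OF _ u, symmetric]) measurable
  also have "\<dots> = (\<integral>\<^sup>+y. indicator (plane_slab a c) y * g (line_proj a c e y) \<partial>lborel)"
  proof (rule nn_integral_cong)
    fix y
    have 1: "a \<bullet> ?S y = a \<bullet> y" using u by (simp add: inner_diff_right)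
    have "slab_proj a c (?S y) = line_proj a c e y"
      unfolding slab_proj_def line_proj_def 1
      by (simp add: u_def scaleR_diff_right) (simp add: algebra_simps diff_divide_distrib)
    then show "indicator (plane_slab a c) (?S y) * g (slab_proj a c (?S y)) =
      indicator (plane_slab a c) y * g (line_proj a c e y)"
      using 1 by (simp add: plane_slab_def indicator_def)
  qed
  also have "\<dots> = (\<integral>\<^sup>+x. indicator (unit_slab e) x * (\<integral>\<^sup>+t. indicator (plane_slab a c) (x + t *\<^sub>R e) *
      g (line_proj a c e (x + t *\<^sub>R e)) \<partial>lborel) \<partial>lborel)"
    by (rule nn_integral_over_lines[OF _ e]) measurable
  also have "\<dots> = (\<integral>\<^sup>+x. ennreal (1 / \<bar>a \<bullet> e\<bar>) * (indicator (unit_slab e) x * g (line_proj a c e x)) \<partial>lborel)"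
  proof (rule nn_integral_cong)
    fix x :: 'a
    have "line_proj a c e (x + t *\<^sub>R e) = line_proj a c e x" for t
      using ae by (simp add: line_proj_def inner_add_right diff_divide_distrib add_divide_distrib algebra_simps)
    then have "(\<integral>\<^sup>+t. indicator (plane_slab a c) (x + t *\<^sub>R e) * g (line_proj a c e (x + t *\<^sub>R e)) \<partial>lborel) =
      (\<integral>\<^sup>+t. indicator {c..c+1} (a \<bullet> x + t * (a \<bullet> e)) \<partial>lborel) * g (line_proj a c e x)"
      by (subst nn_integral_multc[symmetric])
        (auto intro!: nn_integral_cong simp: plane_slab_def indicator_def inner_add_right)
    also have "\<dots> = ennreal (1 / \<bar>a \<bullet> e\<bar>) * g (line_proj a c e x)"
      using ae by (subst nn_integral_line_interval) auto
    finally show "indicator (unit_slab e) x * (\<integral>\<^sup>+t. indicator (plane_slab a c) (x + t *\<^sub>R e) *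
        g (line_proj a c e (x + t *\<^sub>R e)) \<partial>lborel) =
      ennreal (1 / \<bar>a \<bullet> e\<bar>) * (indicator (unit_slab e) x * g (line_proj a c e x))"
      by (simp add: mult_ac)
  qed
  also have "\<dots> = ennreal (1 / \<bar>a \<bullet> e\<bar>) * (\<integral>\<^sup>+x. indicator (unit_slab e) x * g (line_proj a c e x) \<partial>lborel)"
    by (rule nn_integral_cmult) measurable
  finally show ?thesis
    using ae by (simp add: mult.assoc[symmetric] ennreal_mult[symmetric])
qed

text \<open>\<open>hyperplane_measure\<close> before completion. Having exactly the Borel sets, it
  suits Fubini arguments and image measures; null sets and integrals pass to the completion
  afterwards.\<close>

definition plane_measure :: "real^'n \<Rightarrow> real \<Rightarrow> (real^'n) measure" where
  "plane_measure a c = distr (restrict_space lborel (plane_slab a c)) borel (slab_proj a c)"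

lemma hyperplane_measure_eq: "hyperplane_measure a c = completion (plane_measure a c)"
  unfolding hyperplane_measure_def plane_measure_def plane_slab_def slab_proj_def by simp

lemma plane_measure_simps [simp]: "space (plane_measure a c) = UNIV"
  "sets (plane_measure a c) = sets borel"
  by (simp_all add: plane_measure_def)

lemma measurable_plane_measure [measurable_cong]: "sets (plane_measure a c) = sets borel" by simp

lemma slab_proj_measurable_restrict:
  "slab_proj a c \<in> restrict_space lborel (plane_slab a c) \<rightarrow>\<^sub>M borel"
  by (intro measurable_restrict_space1) simp

lemma nn_integral_plane_measure:
  assumes [measurable]: "g \<in> borel_measurable borel"
  shows "(\<integral>\<^sup>+x. g x \<partial>plane_measure a c) =
    (\<integral>\<^sup>+y. indicator (plane_slab a c) y * g (slab_proj a c y) \<partial>lborel)"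
  unfolding plane_measure_def
  by (simp add: nn_integral_distr[OF slab_proj_measurable_restrict] nn_integral_restrict_space mult.commute)

lemma AE_plane_measure:
  assumes [measurable]: "Measurable.pred borel P"
  shows "(AE x in plane_measure a c. P x) \<longleftrightarrow> (AE y in lborel. y \<in> plane_slab a c \<longrightarrow> P (slab_proj a c y))"
  unfolding plane_measure_def
  by (subst AE_distr_iff[OF slab_proj_measurable_restrict]) (auto simp: AE_restrict_space_iff)

lemma on_plane_AE: "AE x in plane_measure a c. a \<bullet> x = c" if "norm a = 1"
proof -
  have "a \<bullet> a = 1" using that by (simp add: norm_eq_1)
  then show ?thesis
    by (subst AE_plane_measure) (auto simp: slab_proj_def inner_diff_right)
qed

text \<open>The prism formula as an identity of measures, which is the form needed for Bochner
  integrals of signed functions.\<close>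

lemma plane_measure_prism:
  fixes a e :: "real^'n"
  assumes a: "norm a = 1" and ae: "a \<bullet> e \<noteq> 0"
  shows "distr (density lborel (indicator (unit_slab e))) borel (line_proj a c e) =
    density (plane_measure a c) (\<lambda>_. ennreal \<bar>a \<bullet> e\<bar>)"
proof (rule measure_eqI)
  fix A :: "(real^'n) set" assume "A \<in> sets (distr (density lborel (indicator (unit_slab e))) borel (line_proj a c e))"
  then have [measurable]: "A \<in> sets borel" by simp
  have "emeasure (distr (density lborel (indicator (unit_slab e))) borel (line_proj a c e)) A =
    (\<integral>\<^sup>+x. indicator A x \<partial>distr (density lborel (indicator (unit_slab e))) borel (line_proj a c e))"
    by simp
  also have "\<dots> = (\<integral>\<^sup>+x. indicator (unit_slab e) x * indicator A (line_proj a c e x) \<partial>lborel)"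
    by (simp add: nn_integral_distr nn_integral_density del: nn_integral_indicator)
  also have "\<dots> = ennreal \<bar>a \<bullet> e\<bar> * (\<integral>\<^sup>+x. indicator A x \<partial>plane_measure a c)"
    by (subst nn_integral_prism[OF _ a ae, of "indicator A"]) (simp_all add: nn_integral_plane_measure del: nn_integral_indicator)
  also have "\<dots> = emeasure (density (plane_measure a c) (\<lambda>_. ennreal \<bar>a \<bullet> e\<bar>)) A"
    by (simp add: emeasure_density nn_integral_cmult del: nn_integral_indicator)
  finally show "emeasure (distr (density lborel (indicator (unit_slab e))) borel (line_proj a c e)) A =
    emeasure (density (plane_measure a c) (\<lambda>_. ennreal \<bar>a \<bullet> e\<bar>)) A" .
qed simp

lemma integral_plane_measure_prism:
  fixes a e :: "real^'n" and g :: "real^'n \<Rightarrow> real"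
  assumes a: "norm a = 1" and ae: "a \<bullet> e \<noteq> 0" and [measurable]: "g \<in> borel_measurable borel"
  shows "(\<integral>x. indicator (unit_slab e) x * g (line_proj a c e x) \<partial>lborel) = \<bar>a \<bullet> e\<bar> * (\<integral>x. g x \<partial>plane_measure a c)"
    and "integrable (plane_measure a c) g \<Longrightarrow> integrable lborel (\<lambda>x. indicator (unit_slab e) x * g (line_proj a c e x))"
proof -
  let ?D = "density lborel (\<lambda>x. ennreal (indicator (unit_slab e) x))"
  have D: "density lborel (indicator (unit_slab e)) = ?D"
    by (rule arg_cong2[of _ _ _ _ density]) (auto simp: indicator_def)
  note eq = plane_measure_prism[OF a ae, unfolded D]
  have "(\<integral>x. indicator (unit_slab e) x * g (line_proj a c e x) \<partial>lborel) = integral\<^sup>L ?D (\<lambda>x. g (line_proj a c e x))"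
    by (subst integral_density) auto
  also have "\<dots> = integral\<^sup>L (distr ?D borel (line_proj a c e)) g"
    by (subst integral_distr) auto
  also have "\<dots> = \<bar>a \<bullet> e\<bar> * (\<integral>x. g x \<partial>plane_measure a c)"
    unfolding eq by (subst integral_density) auto
  finally show "(\<integral>x. indicator (unit_slab e) x * g (line_proj a c e x) \<partial>lborel) = \<bar>a \<bullet> e\<bar> * (\<integral>x. g x \<partial>plane_measure a c)" .
  assume "integrable (plane_measure a c) g"
  then have "integrable (density (plane_measure a c) (\<lambda>_. ennreal \<bar>a \<bullet> e\<bar>)) g"
    by (subst integrable_density) auto
  then have "integrable (distr ?D borel (line_proj a c e)) g" by (simp add: eq)
  then have "integrable ?D (\<lambda>x. g (line_proj a c e x))" by (subst (asm) integrable_distr_eq) auto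
  then show "integrable lborel (\<lambda>x. indicator (unit_slab e) x * g (line_proj a c e x))"
    by (subst (asm) integrable_density) auto
qed

text \<open>\<open>nn_integral_over_lines\<close> as an image measure, again in order to reach
  signed integrands.\<close>

lemma lborel_over_lines:
  fixes e :: "'a::euclidean_space"
  assumes e: "e \<noteq> 0"
  shows "distr (density (lborel \<Otimes>\<^sub>M lborel) (\<lambda>p. ennreal (indicator (unit_slab e) (fst p)))) borel (\<lambda>p. fst p + snd p *\<^sub>R e) = lborel"
    (is "distr ?D borel ?f = _")
proof (rule measure_eqI)
  fix A :: "'a set" assume "A \<in> sets (distr ?D borel ?f)"
  then have [measurable]: "A \<in> sets borel" by simp
  have "emeasure (distr ?D borel ?f) A = (\<integral>\<^sup>+x. indicator A x \<partial>distr ?D borel ?f)"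
    by simp
  also have "\<dots> = (\<integral>\<^sup>+p. ennreal (indicator (unit_slab e) (fst p)) * indicator A (?f p) \<partial>(lborel \<Otimes>\<^sub>M lborel))"
    by (simp add: nn_integral_distr nn_integral_density del: nn_integral_indicator)
  also have "\<dots> = (\<integral>\<^sup>+x. \<integral>\<^sup>+t. ennreal (indicator (unit_slab e) x) * indicator A (x + t *\<^sub>R e) \<partial>lborel \<partial>lborel)"
    by (subst lborel.nn_integral_fst[symmetric]) auto
  also have "\<dots> = (\<integral>\<^sup>+x. indicator (unit_slab e) x * (\<integral>\<^sup>+t. indicator A (x + t *\<^sub>R e) \<partial>lborel) \<partial>lborel)"
    by (auto intro!: nn_integral_cong simp: nn_integral_cmult indicator_def)
  also have "\<dots> = emeasure lborel A"
    by (subst nn_integral_over_lines[OF _ e, symmetric]) auto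
  finally show "emeasure (distr ?D borel ?f) A = emeasure lborel A" .
qed simp

lemma integral_over_lines:
  fixes g :: "'a::euclidean_space \<Rightarrow> real"
  assumes e: "e \<noteq> 0" and [measurable]: "g \<in> borel_measurable borel" and g: "integrable lborel g"
  shows "(\<integral>x. g x \<partial>lborel) = (\<integral>x. indicator (unit_slab e) x * (\<integral>t. g (x + t *\<^sub>R e) \<partial>lborel) \<partial>lborel)"
proof -
  let ?D = "density (lborel \<Otimes>\<^sub>M lborel) (\<lambda>p. ennreal (indicator (unit_slab e) (fst p)))"
  let ?f = "\<lambda>p::'a \<times> real. fst p + snd p *\<^sub>R e"
  note eq = lborel_over_lines[OF e]
  have "integrable (distr ?D borel ?f) g" using g by (simp add: eq)
  then have "integrable ?D (\<lambda>p. g (?f p))" by (subst (asm) integrable_distr_eq) auto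
  then have int: "integrable (lborel \<Otimes>\<^sub>M lborel) (\<lambda>p. indicator (unit_slab e) (fst p) * g (?f p))"
    by (subst (asm) integrable_density) auto
  have "(\<integral>x. g x \<partial>lborel) = integral\<^sup>L (distr ?D borel ?f) g" by (simp add: eq)
  also have "\<dots> = integral\<^sup>L ?D (\<lambda>p. g (?f p))" by (subst integral_distr) auto
  also have "\<dots> = (\<integral>p. indicator (unit_slab e) (fst p) * g (?f p) \<partial>(lborel \<Otimes>\<^sub>M lborel))"
    by (subst integral_density) auto
  also have "\<dots> = (\<integral>x. (\<integral>t. indicator (unit_slab e) x * g (x + t *\<^sub>R e) \<partial>lborel) \<partial>lborel)"
    using lborel_pair.integral_fst'[OF int] by simp
  finally show ?thesis by simp
qed

lemma plane_measure_bounded_finite: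
  fixes a :: "real^'n"
  assumes a: "norm a = 1" and "bounded K" and [measurable]: "K \<in> sets borel"
  shows "emeasure (plane_measure a c) K < \<infinity>"
proof -
  obtain B where B: "\<And>x. x \<in> K \<Longrightarrow> norm x \<le> B" using assms(2) by (auto simp: bounded_iff)
  have "emeasure (plane_measure a c) K = (\<integral>\<^sup>+x. indicator K x \<partial>plane_measure a c)" by simp
  also have "\<dots> = (\<integral>\<^sup>+y. indicator (plane_slab a c) y * indicator K (slab_proj a c y) \<partial>lborel)"
    by (subst nn_integral_plane_measure) simp_all
  \<comment> \<open>The slab has height one, so projection moves its points by at most one and the
    preimage of \<open>K\<close> lies in the ball of radius \<open>B + 1\<close>.\<close>
  also have "\<dots> \<le> (\<integral>\<^sup>+y. indicator (cball (0 :: real^'n) (B + 1)) y \<partial>lborel)"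
  proof (rule nn_integral_mono)
    fix y :: "real^'n"
    have "norm y \<le> B + 1" if "y \<in> plane_slab a c" "slab_proj a c y \<in> K"
    proof -
      have "y = slab_proj a c y + (a \<bullet> y - c) *\<^sub>R a" by (simp add: slab_proj_def)
      then have "norm y \<le> norm (slab_proj a c y) + norm ((a \<bullet> y - c) *\<^sub>R a)" by (metis norm_triangle_ineq)
      also have "\<dots> \<le> B + 1" using B[OF that(2)] that(1) a by (auto simp: plane_slab_def)
      finally show ?thesis .
    qed
    then show "indicator (plane_slab a c) y * indicator K (slab_proj a c y) \<le> (indicator (cball 0 (B + 1)) y :: ennreal)"
      by (auto simp: indicator_def)
  qed
  also have "\<dots> < \<infinity>" using emeasure_bounded_finite[OF bounded_cball] by simp
  finally show ?thesis .
qed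

text \<open>Composition with the orthogonal projection gives a polynomial on the whole space that
  vanishes almost everywhere on the prism over \<open>F\<close>, a set of positive volume.\<close>

lemma polynomial_zero_plane_AE:
  fixes p :: "real^'n \<Rightarrow> 'b::euclidean_space"
  assumes p: "polynomial_function p" and a: "norm a = 1"
    and [measurable]: "F \<in> sets borel" and F: "emeasure (plane_measure a c) F > 0"
    and z: "AE x in plane_measure a c. x \<in> F \<longrightarrow> p x = 0" and x: "a \<bullet> x = c"
  shows "p x = 0"
proof -
  have "polynomial_function (slab_proj a c)"
    unfolding slab_proj_def[abs_def]
    by (intro polynomial_function_diff polynomial_function_id polynomial_function_mult polynomial_function_const polynomial_function_inner)
      (simp add: inner_commute[of a] polynomial_function_inner)
  from polynomial_function_compose[OF this p] have pp: "polynomial_function (\<lambda>y. p (slab_proj a c y))" by (simp add: o_def)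
  have [measurable]: "p \<in> borel_measurable borel"
    using continuous_on_polymonial_function[OF p] by (rule borel_measurable_continuous_onI)
  let ?A = "{y \<in> plane_slab a c. slab_proj a c y \<in> F}"
  have "emeasure (plane_measure a c) F = (\<integral>\<^sup>+x. indicator F x \<partial>plane_measure a c)" by simp
  also have "\<dots> = (\<integral>\<^sup>+y. indicator ?A y \<partial>lborel)"
    by (subst nn_integral_plane_measure) (auto intro!: nn_integral_cong simp: indicator_def simp del: nn_integral_indicator)
  finally have "emeasure lborel ?A > 0" using F by simp
  moreover have "AE y in lborel. y \<in> ?A \<longrightarrow> p (slab_proj a c y) = 0"
    using z by (subst (asm) AE_plane_measure) auto
  ultimately have "p (slab_proj a c x) = 0"
    by (intro polynomial_zero_AE[OF pp]) auto
  then show ?thesis using x by (simp add: slab_proj_def)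
qed

section \<open>The divergence theorem for flat boundaries\<close>

text \<open>Where \<open>U\<close> begins or ends, the function equal to \<open>q\<close> on
  \<open>U\<close> and to 0 elsewhere jumps by the value of \<open>q\<close>. Step functions repair
  all jumps, and the resulting continuous primitive is differentiable off the finite set
  \<open>P\<close>.\<close>

lemma ftc_with_jumps:
  fixes q q' :: "real \<Rightarrow> real" and U P :: "real set" and j :: "real \<Rightarrow> real"
  assumes der: "\<And>s. (q has_real_derivative q' s) (at s)" and fin: "finite P"
    and off: "\<And>s. s \<notin> P \<Longrightarrow> \<exists>r>0. (\<forall>t. \<bar>t - s\<bar> < r \<longrightarrow> t \<in> U) \<or> (\<forall>t. \<bar>t - s\<bar> < r \<longrightarrow> t \<notin> U)"
    and on: "\<And>s. s \<in> P \<Longrightarrow> \<exists>r>0.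
      (\<forall>t. \<bar>t - s\<bar> < r \<longrightarrow> t \<in> U) \<and> j s = 0 \<or> (\<forall>t. \<bar>t - s\<bar> < r \<longrightarrow> t \<notin> U) \<and> j s = 0 \<or>
      (\<forall>t. \<bar>t - s\<bar> < r \<longrightarrow> (t \<in> U \<longleftrightarrow> t < s)) \<and> j s = 1 \<or>
      (\<forall>t. \<bar>t - s\<bar> < r \<longrightarrow> (t \<in> U \<longleftrightarrow> t > s)) \<and> j s = -1"
    and bd: "U \<subseteq> {-R<..<R}" "P \<subseteq> {-R<..<R}" and R: "R > 0"
  shows "((\<lambda>s. if s \<in> U then q' s else 0) has_integral (\<Sum>t\<in>P. j t * q t)) {-R..R}"
proof -
  \<comment> \<open>An endpoint of \<open>U\<close> does not belong to \<open>U\<close>. So the step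
    is already on at an exit point, with \<open>t \<le> s\<close>, but only after an entry point,
    with \<open>t < s\<close>; this is what makes \<open>k\<close> continuous.\<close>
  define st where "st t s = (if j t = 1 \<and> t \<le> s \<or> j t = -1 \<and> t < s then j t * q t else 0)" for t s
  define k where "k s = (if s \<in> U then q s else 0) + (\<Sum>t\<in>P. st t s)" for s
  have near: "eventually (\<lambda>t. \<bar>t - s\<bar> < r) (nhds s)" if "r > 0" for r s :: real
    using that by (auto simp: eventually_nhds_metric dist_real_def)
  have st_ev: "eventually (\<lambda>u. st t u = st t s) (nhds s)" if "t \<noteq> s" for t s
  proof (cases "t < s")
    case True
    have "eventually (\<lambda>u. t < u) (nhds s)" using True eventually_nhds_in_open[of "{t<..}" s] by simp
    then show ?thesis by eventually_elim (use True in \<open>auto simp: st_def\<close>)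
  next
    case False
    then have "s < t" using that by simp
    have "eventually (\<lambda>u. u < t) (nhds s)" using \<open>s < t\<close> eventually_nhds_in_open[of "{..<t}" s] by simp
    then show ?thesis by eventually_elim (use \<open>s < t\<close> in \<open>auto simp: st_def\<close>)
  qed
  have sum_ev: "eventually (\<lambda>u. (\<Sum>t\<in>P - {s}. st t u) = (\<Sum>t\<in>P - {s}. st t s)) (nhds s)" for s
  proof -
    have "eventually (\<lambda>u. \<forall>t\<in>P - {s}. st t u = st t s) (nhds s)"
      using fin st_ev by (intro eventually_ball_finite) auto
    then show ?thesis by eventually_elim (auto intro: sum.cong)
  qed
  have contq: "isCont q s" for s using der DERIV_isCont by blast
  have dk: "(k has_real_derivative (if s \<in> U then q' s else 0)) (at s)" if s: "s \<notin> P" for s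
  proof -
    obtain r where r: "r > 0" "(\<forall>t. \<bar>t - s\<bar> < r \<longrightarrow> t \<in> U) \<or> (\<forall>t. \<bar>t - s\<bar> < r \<longrightarrow> t \<notin> U)"
      using off[OF s] by blast
    have sU: "t \<in> U \<longleftrightarrow> s \<in> U" if "\<bar>t - s\<bar> < r" for t
    proof -
      have "\<bar>s - s\<bar> < r" using r by simp
      then show ?thesis using r(2) that by blast
    qed
    have Ps: "P - {s} = P" using s by simp
    have "eventually (\<lambda>u. k u = (if s \<in> U then q u else 0) + (\<Sum>t\<in>P. st t s)) (nhds s)"
      using near[OF r(1)] sum_ev[of s, unfolded Ps]
    proof eventually_elim
      case (elim u)
      then show ?case using sU[OF elim(1)] by (simp add: k_def)
    qed
    moreover have "((\<lambda>u. (if s \<in> U then q u else 0) + (\<Sum>t\<in>P. st t s)) has_real_derivative (if s \<in> U then q' s else 0)) (at s)"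
      using der[of s] by (cases "s \<in> U") (auto intro!: derivative_eq_intros)
    ultimately show ?thesis by (subst DERIV_cong_ev[OF refl _ refl])
  qed
  have ck: "isCont k s" for s
  proof (cases "s \<in> P")
    case False then show ?thesis using dk DERIV_isCont by blast
  next
    case True
    define m where "m u = (if u \<in> U then q u else 0) + st s u" for u
    have k: "k u = m u + (\<Sum>t\<in>P - {s}. st t u)" for u
      unfolding k_def m_def using fin True by (simp add: sum.remove)
    have "isCont m s"
    proof -
      obtain r where r: "r > 0" and
        "(\<forall>t. \<bar>t - s\<bar> < r \<longrightarrow> t \<in> U) \<and> j s = 0 \<or> (\<forall>t. \<bar>t - s\<bar> < r \<longrightarrow> t \<notin> U) \<and> j s = 0 \<or>
        (\<forall>t. \<bar>t - s\<bar> < r \<longrightarrow> (t \<in> U \<longleftrightarrow> t < s)) \<and> j s = 1 \<or>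
        (\<forall>t. \<bar>t - s\<bar> < r \<longrightarrow> (t \<in> U \<longleftrightarrow> t > s)) \<and> j s = -1"
        using on[OF True] by blast
      then consider "\<forall>t. \<bar>t - s\<bar> < r \<longrightarrow> t \<in> U" "j s = 0" | "\<forall>t. \<bar>t - s\<bar> < r \<longrightarrow> t \<notin> U" "j s = 0"
        | "\<forall>t. \<bar>t - s\<bar> < r \<longrightarrow> (t \<in> U \<longleftrightarrow> t < s)" "j s = 1"
        | "\<forall>t. \<bar>t - s\<bar> < r \<longrightarrow> (t \<in> U \<longleftrightarrow> t > s)" "j s = -1" by blast
      then show ?thesis
      proof cases
        case 1
        have "eventually (\<lambda>u. m u = q u) (nhds s)"
          using near[OF r] by eventually_elim (use 1 in \<open>auto simp: m_def st_def\<close>)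
        from isCont_cong[OF this] show ?thesis using contq by simp
      next
        case 2
        have "eventually (\<lambda>u. m u = 0) (nhds s)"
          using near[OF r] by eventually_elim (use 2 in \<open>auto simp: m_def st_def\<close>)
        from isCont_cong[OF this] show ?thesis by simp
      next
        case 3
        have "eventually (\<lambda>u. m u = q (min u s)) (nhds s)"
          using near[OF r] by eventually_elim (use 3 in \<open>auto simp: m_def st_def min_def\<close>)
        moreover have "isCont (\<lambda>u. q (min u s)) s"
          using contq by (intro isCont_o2[of _ "\<lambda>u. min u s" q] continuous_intros) auto
        ultimately show ?thesis using isCont_cong[of m] by simp
      next
        case 4
        have "eventually (\<lambda>u. m u = q (max u s) - q s) (nhds s)"
          using near[OF r] by eventually_elim (use 4 in \<open>auto simp: m_def st_def max_def\<close>)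
        moreover have "isCont (\<lambda>u. q (max u s) - q s) s"
          using contq by (intro isCont_diff isCont_o2[of _ "\<lambda>u. max u s" q] continuous_intros) auto
        ultimately show ?thesis using isCont_cong[of m] by simp
      qed
    qed
    moreover have "isCont (\<lambda>u. \<Sum>t\<in>P - {s}. st t u) s"
      using isCont_cong[OF sum_ev[of s]] by simp
    ultimately show ?thesis unfolding k[abs_def] by (rule isCont_add)
  qed
  have "((\<lambda>s. if s \<in> U then q' s else 0) has_integral (k R - k (-R))) {-R..R}"
  proof (rule fundamental_theorem_of_calculus_strong[OF fin])
    show "continuous_on {-R..R} k" using ck by (simp add: continuous_at_imp_continuous_on)
  qed (use dk R in \<open>auto simp: has_real_derivative_iff_has_vector_derivative\<close>)
  \<comment> \<open>At \<open>R\<close> all steps are on and at \<open>-R\<close> none is, both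
    points lying outside \<open>U\<close>; the increase of \<open>k\<close> is the sum of the
    steps.\<close>
  moreover have "k R = (\<Sum>t\<in>P. j t * q t)"
  proof -
    have "st t R = j t * q t" if "t \<in> P" for t
    proof -
      have "j t = 0 \<or> j t = 1 \<or> j t = -1" using on[OF that] by blast
      moreover have "t < R" using bd that by auto
      ultimately show ?thesis by (auto simp: st_def)
    qed
    then show ?thesis using bd by (auto simp: k_def)
  qed
  moreover have "k (-R) = 0"
  proof -
    have "st t (-R) = 0" if "t \<in> P" for t
      using bd that by (auto simp: st_def)
    then show ?thesis using bd by (auto simp: k_def)
  qed
  ultimately show ?thesis by simp
qed

section \<open>Generic points and the local shape of an open set\<close>

definition hyp :: "(real^'n) \<times> real \<Rightarrow> (real^'n) set" where
  "hyp h = {x. fst h \<bullet> x = snd h}"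

definition generic :: "((real^'n) \<times> real) set \<Rightarrow> (real^'n) \<times> real \<Rightarrow> real^'n \<Rightarrow> bool" where
  "generic Hs h x \<longleftrightarrow> x \<in> hyp h \<and> (\<forall>h'\<in>Hs. h' \<noteq> h \<longrightarrow> x \<notin> hyp h')"

text \<open>\<open>hyp_inj\<close> forbids that \<open>(a, c)\<close> and \<open>(- a, - c)\<close>
  both belong to the family: no point of their common hyperplane would be generic.\<close>

locale hyperplanes =
  fixes Hs :: "((real^'n) \<times> real) set"
  assumes finite_Hs: "finite Hs"
    and unit: "h \<in> Hs \<Longrightarrow> norm (fst h) = 1"
    and hyp_inj: "h \<in> Hs \<Longrightarrow> h' \<in> Hs \<Longrightarrow> h \<noteq> h' \<Longrightarrow> hyp h \<noteq> hyp h'"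

text \<open>\<open>regular\<close> excludes slits, that is, pieces of a hyperplane missing from
  \<open>T\<close> with \<open>T\<close> on both sides; they would be frontier without a definite
  outward normal.\<close>

locale flat_boundary = hyperplanes Hs for Hs :: "((real^'n) \<times> real) set" +
  fixes T :: "(real^'n) set"
  assumes open_T: "open T" and bounded_T: "bounded T" and regular: "interior (closure T) = T"
    and frontier_T: "frontier T \<subseteq> (\<Union>h\<in>Hs. hyp h)"

lemma closed_hyp: "closed (hyp h)"
  unfolding hyp_def by (rule closed_hyperplane)

lemma hyperplane_side_points:
  fixes a :: "'a::euclidean_space"
  assumes "open U" "y \<in> U" "norm a = 1" "a \<bullet> y = c"
  shows "\<exists>z\<in>U. a \<bullet> z < c" "\<exists>z\<in>U. a \<bullet> z > c"
proof -
  have aa: "a \<bullet> a = 1" using assms by (simp add: norm_eq_1)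
  obtain r where r: "r > 0" "ball y r \<subseteq> U" using assms openE by blast
  have "y - (r/2) *\<^sub>R a \<in> ball y r" "y + (r/2) *\<^sub>R a \<in> ball y r"
    using r(1) assms(3) by (auto simp: dist_norm)
  then have U: "y - (r/2) *\<^sub>R a \<in> U" "y + (r/2) *\<^sub>R a \<in> U" using r(2) by blast+
  show "\<exists>z\<in>U. a \<bullet> z < c" using U(1) r(1) assms(4) aa by (intro bexI[OF _ U(1)]) (simp add: inner_diff_right)
  show "\<exists>z\<in>U. a \<bullet> z > c" using U(2) r(1) assms(4) aa by (intro bexI[OF _ U(2)]) (simp add: inner_add_right)
qed

context flat_boundary
begin

text \<open>A small ball around \<open>x\<close> meets \<open>frontier T\<close> only inside
  \<open>hyp h\<close>. Its two open halves are connected and avoid the frontier, so each is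
  contained in \<open>T\<close> or disjoint from it; the four cases are the combinations.\<close>

lemma local_structure:
  assumes h: "h \<in> Hs" and gen: "generic Hs h x"
  obtains r where "r > 0" "ball x r \<subseteq> T"
  | r where "r > 0" "ball x r \<inter> T = {}"
  | r where "r > 0" "\<And>y. y \<in> ball x r \<Longrightarrow> y \<in> T \<longleftrightarrow> fst h \<bullet> y < snd h"
  | r where "r > 0" "\<And>y. y \<in> ball x r \<Longrightarrow> y \<in> T \<longleftrightarrow> fst h \<bullet> y > snd h"
proof -
  obtain a c where hac: "h = (a, c)" by (cases h)
  have a: "norm a = 1" using unit[OF h] hac by simp
  have ax: "a \<bullet> x = c" using gen hac by (simp add: generic_def hyp_def)
  define S where "S = (\<Union>h'\<in>Hs - {h}. hyp h')"
  have "closed S" unfolding S_def using finite_Hs closed_hyp by (intro closed_UN) auto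
  moreover have "x \<notin> S" using gen by (auto simp: generic_def S_def)
  ultimately obtain r where r: "r > 0" "ball x r \<subseteq> - S"
    by (metis ComplI open_Compl openE)
  have off: "y \<notin> frontier T" if "y \<in> ball x r" "a \<bullet> y \<noteq> c" for y
  proof
    assume "y \<in> frontier T"
    then obtain h' where h': "h' \<in> Hs" "y \<in> hyp h'" using frontier_T by blast
    then have "h' \<noteq> h" using that(2) by (auto simp: hac hyp_def)
    then have "y \<in> S" using h' unfolding S_def by blast
    then show False using r(2) that(1) by blast
  qed
  let ?L = "ball x r \<inter> {y. a \<bullet> y < c}" and ?G = "ball x r \<inter> {y. a \<bullet> y > c}"
  have conv: "connected ?L" "connected ?G"
    by (intro convex_connected convex_Int convex_ball convex_halfspace_lt convex_halfspace_gt)+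
  have L: "?L \<subseteq> T \<or> ?L \<inter> T = {}"
    using connected_Int_frontier[OF conv(1), of T] off by blast
  have G: "?G \<subseteq> T \<or> ?G \<inter> T = {}"
    using connected_Int_frontier[OF conv(2), of T] off by blast
  have oT: "open (T \<inter> ball x r)" using open_T by auto
  \<comment> \<open>An open set containing a point of the hyperplane meets both halves. If one half
    misses \<open>T\<close>, then \<open>T\<close> has no point on the hyperplane inside the
    ball.\<close>
  have side: "a \<bullet> y \<noteq> c" if "y \<in> T" "y \<in> ball x r" "?L \<inter> T = {} \<or> ?G \<inter> T = {}" for y
    using hyperplane_side_points[OF oT, of y a c] that a by blast
  show thesis
  proof (cases "?L \<subseteq> T")
    case True
    show thesis
    proof (cases "?G \<subseteq> T")
      case G': True
      \<comment> \<open>With both halves in \<open>T\<close>, the piece of the hyperplane between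
        them lies in the closure, and \<open>regular\<close> returns it to \<open>T\<close>.\<close>
      have "ball x r \<subseteq> closure T"
      proof
        fix y assume y: "y \<in> ball x r"
        show "y \<in> closure T"
        proof (cases "a \<bullet> y = c")
          case eq: True
          have "\<exists>z\<in>T. z \<in> V" if V: "open V" "y \<in> V" for V
            using hyperplane_side_points(1)[of "V \<inter> ball x r" y a c] V y a eq True by blast
          then show ?thesis by (meson closure_iff_nhds_not_empty disjoint_iff open_contains_ball subsetI subset_eq IntI)
        next
          case False
          then have "y \<in> T" using True G' y by (auto simp: neq_iff)
          then show ?thesis using closure_subset by blast
        qed
      qed
      then have "ball x r \<subseteq> T" using regular interior_maximal[OF _ open_ball] by blast
      then show thesis using that(1) r by blast
    next
      case False
      then have G': "?G \<inter> T = {}" using G by blast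
      show thesis
      proof (rule that(3)[OF r(1)])
        fix y assume y: "y \<in> ball x r"
        show "y \<in> T \<longleftrightarrow> fst h \<bullet> y < snd h"
          using side[of y] y G' True by (cases "a \<bullet> y" c rule: linorder_cases) (auto simp: hac)
      qed
    qed
  next
    case False
    then have L': "?L \<inter> T = {}" using L by blast
    show thesis
    proof (cases "?G \<subseteq> T")
      case True
      show thesis
      proof (rule that(4)[OF r(1)])
        fix y assume y: "y \<in> ball x r"
        show "y \<in> T \<longleftrightarrow> fst h \<bullet> y > snd h"
          using side[of y] y L' True by (cases "a \<bullet> y" c rule: linorder_cases) (auto simp: hac)
      qed
    next
      case False
      then have G': "?G \<inter> T = {}" using G by blast
      have "y \<notin> T" if "y \<in> ball x r" for y
        using side[of y] that L' G' by (cases "a \<bullet> y" c rule: linorder_cases) auto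
      then show thesis using that(2) r by blast
    qed
  qed
qed

end

text \<open>Testing only the steps \<open>1 / real (Suc n)\<close> makes this a countable condition,
  hence a Borel set. At a generic point \<open>T\<close> is locally full, empty or a half-space, so
  for a transversal \<open>e\<close> the choice of the steps does not matter.\<close>

definition exits :: "'a::real_normed_vector set \<Rightarrow> 'a \<Rightarrow> 'a set" where
  "exits T e = {x. eventually (\<lambda>n. x - (1 / real (Suc n)) *\<^sub>R e \<in> T \<and> x + (1 / real (Suc n)) *\<^sub>R e \<notin> T) sequentially}"

text \<open>At a generic frontier point and for a transversal \<open>e\<close> this is the sign of
  \<open>e\<close> against the outward normal: 1 on leaving \<open>T\<close>, -1 on
  entering.\<close>

definition jump :: "'a::real_normed_vector set \<Rightarrow> 'a \<Rightarrow> 'a \<Rightarrow> real" where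
  "jump T e x = indicator (exits T e) x - indicator (exits T (- e)) x"

lemma exits_borel:
  fixes T :: "'a::euclidean_space set"
  assumes [measurable]: "T \<in> sets borel" shows "exits T e \<in> sets borel"
  unfolding exits_def by measurable

lemma jump_borel [measurable (raw)]:
  fixes T :: "'a::euclidean_space set"
  assumes "T \<in> sets borel" shows "jump T e \<in> borel_measurable borel"
  unfolding jump_def[abs_def] using exits_borel[OF assms] by measurable

lemma abs_jump_le: "\<bar>jump T e x\<bar> \<le> 1"
  by (auto simp: jump_def indicator_def)

lemma step_tendsto: "(\<lambda>n. x + (1 / real (Suc n)) *\<^sub>R e) \<longlonglongrightarrow> x" for x e :: "'a::real_normed_vector"
proof -
  have "(\<lambda>n. x + (1 / real (Suc n)) *\<^sub>R e) \<longlonglongrightarrow> x + 0 *\<^sub>R e"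
    using LIMSEQ_inverse_real_of_nat by (intro tendsto_intros) (simp add: inverse_eq_divide)
  then show ?thesis by simp
qed

lemma exits_subset_closure: "exits T e \<subseteq> closure T"
proof
  fix x assume x: "x \<in> exits T e"
  have "(\<lambda>n. x - (1 / real (Suc n)) *\<^sub>R e) \<longlonglongrightarrow> x" using step_tendsto[of x "-e"] by simp
  moreover have "eventually (\<lambda>n. x - (1 / real (Suc n)) *\<^sub>R e \<in> closure T) sequentially"
    using x closure_subset unfolding exits_def by (auto elim!: eventually_mono)
  ultimately show "x \<in> closure T"
    by (intro Lim_in_closed_set[OF closed_closure]) auto
qed

lemma jump_support: "jump T e x \<noteq> 0 \<Longrightarrow> x \<in> closure T"
proof (rule ccontr)
  assume *: "jump T e x \<noteq> 0" "x \<notin> closure T"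
  then have "x \<notin> exits T e" "x \<notin> exits T (- e)" using exits_subset_closure by blast+
  then show False using * by (simp add: jump_def)
qed

lemma jump_inside:
  assumes "r > 0" "ball x r \<subseteq> T" shows "jump T e x = 0"
proof -
  have *: "eventually (\<lambda>n. x + (1 / real (Suc n)) *\<^sub>R e \<in> T) sequentially" for e
    using step_tendsto[of x e, THEN topological_tendstoD, of "ball x r"] assms by (auto elim!: eventually_mono)
  have "x \<notin> exits T e" for e
  proof
    assume "x \<in> exits T e"
    then have "eventually (\<lambda>n. x - (1 / real (Suc n)) *\<^sub>R e \<in> T \<and> x + (1 / real (Suc n)) *\<^sub>R e \<notin> T) sequentially"
      by (simp add: exits_def)
    with *[of e] have "eventually (\<lambda>n. False) sequentially" by eventually_elim auto
    then show False by simp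
  qed
  then show ?thesis by (simp add: jump_def)
qed

lemma jump_outside:
  assumes "r > 0" "ball x r \<inter> T = {}" shows "jump T e x = 0"
proof -
  have "ball x r \<inter> closure T = {}" using assms by (simp add: open_Int_closure_eq_empty)
  then have "x \<notin> closure T" using centre_in_ball[of x r] assms(1) by blast
  then show ?thesis using jump_support by blast
qed

lemma jump_halfspace:
  fixes a :: "'a::euclidean_space"
  assumes r: "r > 0" and T: "\<And>y. y \<in> ball x r \<Longrightarrow> y \<in> T \<longleftrightarrow> a \<bullet> y < c" and x: "a \<bullet> x = c" and ae: "a \<bullet> e \<noteq> 0"
  shows "jump T e x = sgn (a \<bullet> e)"
proof -
  have ev: "eventually (\<lambda>n. x + (1 / real (Suc n)) *\<^sub>R v \<in> T \<longleftrightarrow> a \<bullet> v < 0) sequentially" for v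
  proof -
    have "eventually (\<lambda>n. x + (1 / real (Suc n)) *\<^sub>R v \<in> ball x r) sequentially"
      using step_tendsto[of x v, THEN topological_tendstoD, of "ball x r"] r by auto
    then show ?thesis
      by eventually_elim (subst T, assumption, simp add: x inner_add_right divide_less_0_iff)
  qed
  have "x \<in> exits T e \<longleftrightarrow> a \<bullet> e > 0" if "a \<bullet> e \<noteq> 0" for e
  proof -
    have "eventually (\<lambda>n. (x - (1 / real (Suc n)) *\<^sub>R e \<in> T \<and> x + (1 / real (Suc n)) *\<^sub>R e \<notin> T) \<longleftrightarrow> a \<bullet> e > 0) sequentially"
      using ev[of e] ev[of "-e"] by eventually_elim (use that in auto)
    then have "x \<in> exits T e \<longleftrightarrow> eventually (\<lambda>n. a \<bullet> e > 0) sequentially"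
      unfolding exits_def mem_Collect_eq by (rule eventually_cong) simp
    then show ?thesis by simp
  qed
  from this[of e] this[of "-e"] show ?thesis using ae by (auto simp: jump_def sgn_if)
qed

context hyperplanes
begin

text \<open>Landing on \<open>hyp h'\<close> under projection along \<open>e\<close> is one affine
  condition on \<open>x\<close>. Were it trivial, \<open>hyp h'\<close> would equal
  \<open>hyp h\<close>; otherwise it describes a null set.\<close>

lemma line_proj_meets_other_null:
  assumes h: "h \<in> Hs" and h': "h' \<in> Hs" "h' \<noteq> h" and e: "fst h \<bullet> e \<noteq> 0"
  shows "AE x in lborel. line_proj (fst h) (snd h) e x \<notin> hyp h'"
proof -
  obtain a c a' c' where hh: "h = (a, c)" "h' = (a', c')" by (cases h; cases h')
  have a: "norm a = 1" "norm a' = 1" using unit h h' hh by force+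
  \<comment> \<open>Chosen so that \<open>a' - \<kappa> *\<^sub>R a\<close> is orthogonal to
    \<open>e\<close>, since the condition has to be constant along the lines.\<close>
  define \<kappa> where "\<kappa> = (a' \<bullet> e) / (a \<bullet> e)"
  have iff: "line_proj a c e x \<in> hyp h' \<longleftrightarrow> (a' - \<kappa> *\<^sub>R a) \<bullet> x = c' - \<kappa> * c" for x
  proof -
    have "(c - a \<bullet> x) / (a \<bullet> e) * (a' \<bullet> e) = \<kappa> * (c - a \<bullet> x)" by (simp add: \<kappa>_def)
    then show ?thesis
      by (auto simp: line_proj_def hyp_def hh inner_add_right inner_diff_left algebra_simps)
  qed
  have ne: "a' - \<kappa> *\<^sub>R a \<noteq> 0 \<or> c' - \<kappa> * c \<noteq> 0"
  proof (rule ccontr)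
    assume "\<not> ?thesis"
    then have eq: "a' = \<kappa> *\<^sub>R a" "c' = \<kappa> * c" by auto
    then have "\<kappa> \<noteq> 0" using a by auto
    then have "hyp h' = hyp h" by (auto simp: hyp_def hh eq)
    then show False using hyp_inj h h' by blast
  qed
  have "negligible {x. (a' - \<kappa> *\<^sub>R a) \<bullet> x = c' - \<kappa> * c}" using ne by (rule negligible_hyperplane)
  then have "{x. (a' - \<kappa> *\<^sub>R a) \<bullet> x = c' - \<kappa> * c} \<in> null_sets lebesgue" by (simp add: negligible_iff_null_sets)
  moreover have "{x. (a' - \<kappa> *\<^sub>R a) \<bullet> x = c' - \<kappa> * c} \<in> sets lborel" by measurable
  ultimately have "{x. (a' - \<kappa> *\<^sub>R a) \<bullet> x = c' - \<kappa> * c} \<in> null_sets lborel"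
    using null_sets_completion_iff by blast
  from AE_not_in[OF this] show ?thesis using iff by (simp add: hh)
qed

lemma AE_generic:
  assumes h: "h \<in> Hs" shows "AE x in plane_measure (fst h) (snd h). generic Hs h x"
proof -
  have n: "norm (fst h) = 1" using unit h by simp
  \<comment> \<open>Orthogonal projection is projection along the unit normal, so the oblique
    statement applies with \<open>e = fst h\<close>.\<close>
  have sl: "slab_proj (fst h) (snd h) = line_proj (fst h) (snd h) (fst h)"
    using n by (auto simp: slab_proj_def line_proj_def norm_eq_1 fun_eq_iff algebra_simps)
  have "AE x in plane_measure (fst h) (snd h). x \<notin> hyp h'" if "h' \<in> Hs - {h}" for h'
  proof (subst AE_plane_measure)
    show "Measurable.pred borel (\<lambda>x. x \<notin> hyp h')" unfolding hyp_def by measurable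
    have "fst h \<bullet> fst h \<noteq> 0" using n by auto
    from line_proj_meets_other_null[OF h _ _ this, of h']
    show "AE y in lborel. y \<in> plane_slab (fst h) (snd h) \<longrightarrow> slab_proj (fst h) (snd h) y \<notin> hyp h'"
      using that by (auto simp: sl elim!: eventually_mono)
  qed
  then have "AE x in plane_measure (fst h) (snd h). \<forall>h'\<in>Hs - {h}. x \<notin> hyp h'"
    using finite_Hs by (intro AE_finite_allI) auto
  then show ?thesis using on_plane_AE[OF n, of "snd h"]
    by eventually_elim (auto simp: generic_def hyp_def)
qed

end

context flat_boundary
begin

lemma T_borel [measurable]: "T \<in> sets borel" using open_T by auto

text \<open>Trades the jump along an arbitrary transversal direction for the one along the normal,
  which does not depend on \<open>e\<close>. Only in this form is the boundary term linear in
  \<open>e\<close>.\<close>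

lemma jump_transversal:
  assumes h: "h \<in> Hs" and gen: "generic Hs h x" and e: "fst h \<bullet> e \<noteq> 0"
  shows "jump T e x = sgn (fst h \<bullet> e) * jump T (fst h) x"
proof -
  have x: "fst h \<bullet> x = snd h" using gen by (simp add: generic_def hyp_def)
  have x': "(- fst h) \<bullet> x = - snd h" using x by simp
  have aa: "fst h \<bullet> fst h = 1" using unit[OF h] by (simp add: norm_eq_1)
  from h gen show ?thesis
  proof (cases rule: local_structure)
    case (3 r)
    show ?thesis using jump_halfspace[OF 3(1) _ x e] jump_halfspace[OF 3(1) _ x, of T "fst h"] 3(2) aa by simp
  next
    case (4 r)
    have "\<And>y. y \<in> ball x r \<Longrightarrow> y \<in> T \<longleftrightarrow> (- fst h) \<bullet> y < - snd h" using 4(2) by simp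
    from jump_halfspace[OF 4(1) this x'] show ?thesis using e aa by (auto simp: sgn_minus)
  qed (simp_all add: jump_inside jump_outside)
qed

text \<open>A transversal line meets \<open>hyp h\<close> exactly once, at parameter
  \<open>th h\<close>. By \<open>good\<close> the crossing points are distinct and generic, so at
  each of them one of the four cases required by \<open>ftc_with_jumps\<close> holds.\<close>

lemma integral_line:
  fixes p :: "real^'n \<Rightarrow> real" and d :: "real^'n \<Rightarrow> real"
  assumes der: "\<And>x t. ((\<lambda>t. p (x + t *\<^sub>R e)) has_real_derivative d (x + t *\<^sub>R e)) (at t)"
    and d: "continuous_on UNIV d"
    and e: "\<And>h. h \<in> Hs \<Longrightarrow> fst h \<bullet> e \<noteq> 0" "e \<noteq> 0"
    and good: "\<And>h h'. h \<in> Hs \<Longrightarrow> h' \<in> Hs \<Longrightarrow> h \<noteq> h' \<Longrightarrow> line_proj (fst h) (snd h) e x \<notin> hyp h'"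
  shows "(\<integral>t. indicator T (x + t *\<^sub>R e) * d (x + t *\<^sub>R e) \<partial>lborel) =
    (\<Sum>h\<in>Hs. p (line_proj (fst h) (snd h) e x) * jump T e (line_proj (fst h) (snd h) e x))"
proof -
  define th where "th h = (snd h - fst h \<bullet> x) / (fst h \<bullet> e)" for h :: "(real^'n) \<times> real"
  have lp: "line_proj (fst h) (snd h) e x = x + th h *\<^sub>R e" for h
    by (simp add: line_proj_def th_def)
  have on_hyp: "x + t *\<^sub>R e \<in> hyp h \<longleftrightarrow> t = th h" if "h \<in> Hs" for h t
    using e(1)[OF that] by (auto simp: hyp_def th_def inner_add_right field_simps)
  have inj: "inj_on th Hs"
  proof (rule inj_onI, rule ccontr)
    fix h h' assume *: "h \<in> Hs" "h' \<in> Hs" "th h = th h'" "h \<noteq> h'"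
    show False using good[OF *(1,2,4)] on_hyp[OF *(2), of "th h"] *(3) by (simp add: lp)
  qed
  have gen: "generic Hs h (x + th h *\<^sub>R e)" if "h \<in> Hs" for h
    using that on_hyp[OF that] good[OF that] by (auto simp: generic_def lp)
  define U where "U = {t. x + t *\<^sub>R e \<in> T}"
  define P where "P = th ` Hs"
  obtain B where B: "\<And>y. y \<in> T \<Longrightarrow> norm y \<le> B" using bounded_T by (auto simp: bounded_iff)
  have finP: "finite P" using finite_Hs by (simp add: P_def)
  \<comment> \<open>Larger than every crossing parameter and every parameter at which the line is in
    \<open>T\<close>. The last summand keeps \<open>R\<close> positive when \<open>B\<close> is
    negative, which is possible for empty \<open>T\<close>.\<close>
  define R where "R = (B + norm x) / norm e + (\<Sum>t\<in>P. \<bar>t\<bar>) + 1 + \<bar>B\<bar> / norm e"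
  have sumP: "(\<Sum>t\<in>P. \<bar>t\<bar>) \<ge> 0" by (simp add: sum_nonneg)
  have Bx: "(B + norm x) / norm e + \<bar>B\<bar> / norm e \<ge> 0"
    by (simp flip: add_divide_distrib) (smt (verit) divide_nonneg_nonneg norm_ge_zero)
  have UR: "U \<subseteq> {-R<..<R}"
  proof
    fix t assume "t \<in> U"
    then have "norm (x + t *\<^sub>R e) \<le> B" using B by (simp add: U_def)
    then have "\<bar>t\<bar> * norm e \<le> B + norm x" using norm_triangle_ineq4[of "x + t *\<^sub>R e" x] by simp
    then have "\<bar>t\<bar> \<le> (B + norm x) / norm e" using e(2) by (simp add: field_simps)
    moreover have "\<bar>B\<bar> / norm e \<ge> 0" by simp
    ultimately have "\<bar>t\<bar> < R" using sumP unfolding R_def by linarith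
    then show "t \<in> {-R<..<R}" by (auto simp: abs_less_iff)
  qed
  have PR: "P \<subseteq> {-R<..<R}"
  proof
    fix t assume "t \<in> P"
    then have "\<bar>t\<bar> \<le> (\<Sum>t\<in>P. \<bar>t\<bar>)" using finP by (intro member_le_sum) auto
    then have "\<bar>t\<bar> < R" using Bx unfolding R_def by linarith
    then show "t \<in> {-R<..<R}" by (auto simp: abs_less_iff)
  qed
  have ballI: "x + t *\<^sub>R e \<in> ball (x + s *\<^sub>R e) r" if "\<bar>t - s\<bar> < r / norm e" for t s r
  proof -
    have "dist (x + s *\<^sub>R e) (x + t *\<^sub>R e) = \<bar>t - s\<bar> * norm e"
      by (simp add: dist_norm abs_minus_commute flip: scaleR_diff_left)
    then show ?thesis using that e(2) by (simp add: pos_less_divide_eq)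
  qed
  have int: "((\<lambda>s. if s \<in> U then d (x + s *\<^sub>R e) else 0) has_integral
     (\<Sum>t\<in>P. jump T e (x + t *\<^sub>R e) * p (x + t *\<^sub>R e))) {-R..R}"
  proof (rule ftc_with_jumps[OF der finP _ _ UR PR])
    show "R > 0" using Bx sumP unfolding R_def by linarith
    fix s assume s: "s \<notin> P"
    then have "x + s *\<^sub>R e \<notin> frontier T" using frontier_T on_hyp by (auto simp: P_def)
    then have "x + s *\<^sub>R e \<in> T \<or> x + s *\<^sub>R e \<in> - closure T"
      using open_T by (auto simp: frontier_def interior_open)
    then obtain r where r: "r > 0" "ball (x + s *\<^sub>R e) r \<subseteq> T \<or> ball (x + s *\<^sub>R e) r \<subseteq> - closure T"
      using openE[OF open_T] openE[OF open_Compl[OF closed_closure[of T]]] by metis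
    have "r / norm e > 0" using r(1) e(2) by simp
    moreover have "x + t *\<^sub>R e \<in> ball (x + s *\<^sub>R e) r" if "\<bar>t - s\<bar> < r / norm e" for t
      using ballI[OF that] .
    ultimately show "\<exists>r>0. (\<forall>t. \<bar>t - s\<bar> < r \<longrightarrow> t \<in> U) \<or> (\<forall>t. \<bar>t - s\<bar> < r \<longrightarrow> t \<notin> U)"
      using r(2) closure_subset[of T] unfolding U_def mem_Collect_eq by blast
  next
    fix s assume "s \<in> P"
    then obtain h where h: "h \<in> Hs" "s = th h" by (auto simp: P_def)
    let ?y = "x + s *\<^sub>R e"
    have g: "generic Hs h ?y" using gen h by simp
    then have y: "fst h \<bullet> ?y = snd h" by (simp add: generic_def hyp_def)
    have yt: "fst h \<bullet> (x + t *\<^sub>R e) = snd h + (t - s) * (fst h \<bullet> e)" for t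
      using y by (simp add: inner_add_right algebra_simps)
    have ae: "fst h \<bullet> e \<noteq> 0" using e h by simp
    have y': "(- fst h) \<bullet> ?y = - snd h" using y by simp
    from h(1) g show "\<exists>r>0.
      (\<forall>t. \<bar>t - s\<bar> < r \<longrightarrow> t \<in> U) \<and> jump T e ?y = 0 \<or> (\<forall>t. \<bar>t - s\<bar> < r \<longrightarrow> t \<notin> U) \<and> jump T e ?y = 0 \<or>
      (\<forall>t. \<bar>t - s\<bar> < r \<longrightarrow> (t \<in> U \<longleftrightarrow> t < s)) \<and> jump T e ?y = 1 \<or>
      (\<forall>t. \<bar>t - s\<bar> < r \<longrightarrow> (t \<in> U \<longleftrightarrow> t > s)) \<and> jump T e ?y = -1"
    proof (cases rule: local_structure)
      case (1 r)
      have "t \<in> U" if "\<bar>t - s\<bar> < r / norm e" for t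
        using ballI[OF that] 1(2) by (auto simp: U_def)
      moreover have "r / norm e > 0" using 1(1) e(2) by simp
      ultimately show ?thesis using jump_inside[OF 1, of e] by blast
    next
      case (2 r)
      have "t \<notin> U" if "\<bar>t - s\<bar> < r / norm e" for t
        using ballI[OF that] 2(2) unfolding U_def by blast
      moreover have "r / norm e > 0" using 2(1) e(2) by simp
      ultimately show ?thesis using jump_outside[OF 2, of e] by blast
    next
      case (3 r)
      have "jump T e ?y = sgn (fst h \<bullet> e)" using jump_halfspace[OF 3 y ae] .
      moreover have "t \<in> U \<longleftrightarrow> (t - s) * (fst h \<bullet> e) < 0" if "\<bar>t - s\<bar> < r / norm e" for t
        using 3(2)[OF ballI[OF that]] yt[of t] by (simp add: U_def)
      ultimately show ?thesis using ae e(2) 3(1)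
        by (intro exI[of _ "r / norm e"]) (auto simp: sgn_if mult_less_0_iff)
    next
      case (4 r)
      have opp: "\<And>y. y \<in> ball ?y r \<Longrightarrow> y \<in> T \<longleftrightarrow> (- fst h) \<bullet> y < - snd h" using 4(2) by simp
      have "jump T e ?y = sgn ((- fst h) \<bullet> e)" using jump_halfspace[OF 4(1) opp y'] ae by simp
      moreover have "t \<in> U \<longleftrightarrow> (t - s) * (fst h \<bullet> e) > 0" if "\<bar>t - s\<bar> < r / norm e" for t
        using 4(2)[OF ballI[OF that]] yt[of t] by (simp add: U_def)
      ultimately show ?thesis using ae e(2) 4(1)
        by (intro exI[of _ "r / norm e"]) (auto simp: sgn_if zero_less_mult_iff)
    qed
  qed
  let ?G = "\<lambda>t. indicator T (x + t *\<^sub>R e) * d (x + t *\<^sub>R e)"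
  have [measurable]: "d \<in> borel_measurable borel" using d by (rule borel_measurable_continuous_onI)
  have "((\<lambda>s. if s \<in> U then d (x + s *\<^sub>R e) else 0) has_integral
     (\<Sum>t\<in>P. jump T e (x + t *\<^sub>R e) * p (x + t *\<^sub>R e))) UNIV"
    using UR by (intro has_integral_on_superset[OF int]) auto
  moreover have "(\<lambda>s. if s \<in> U then d (x + s *\<^sub>R e) else 0) = ?G" by (auto simp: U_def indicator_def)
  ultimately have 1: "(?G has_integral (\<Sum>t\<in>P. jump T e (x + t *\<^sub>R e) * p (x + t *\<^sub>R e))) UNIV" by simp
  have "continuous_on {-R..R} (\<lambda>t. d (x + t *\<^sub>R e))"
    by (intro continuous_on_compose2[OF d] continuous_intros) auto
  then have "set_integrable lborel {-R..R} (\<lambda>t. d (x + t *\<^sub>R e))" by (rule borel_integrable_atLeastAtMost')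
  then have "set_integrable lborel ({-R..R} \<inter> U) (\<lambda>t. d (x + t *\<^sub>R e))"
    by (rule set_integrable_subset) (auto simp: U_def)
  moreover have "{-R..R} \<inter> U = U" using UR by auto
  ultimately have "set_integrable lborel U (\<lambda>t. d (x + t *\<^sub>R e))" by simp
  then have "integrable lborel ?G"
    unfolding set_integrable_def
    by (rule back_subst[of "integrable lborel"]) (auto simp: U_def indicator_def fun_eq_iff)
  from has_integral_integral_lborel[OF this] 1
  have "(\<integral>t. ?G t \<partial>lborel) = (\<Sum>t\<in>P. jump T e (x + t *\<^sub>R e) * p (x + t *\<^sub>R e))"
    using has_integral_unique by blast
  also have "\<dots> = (\<Sum>h\<in>Hs. p (line_proj (fst h) (snd h) e x) * jump T e (line_proj (fst h) (snd h) e x))"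
    unfolding P_def by (simp add: sum.reindex[OF inj] lp mult.commute)
  finally show ?thesis .
qed

section \<open>From lines to volume integrals\<close>

lemma continuous_bounded_on_closure:
  fixes g :: "real^'n \<Rightarrow> 'b::real_normed_vector"
  assumes "continuous_on UNIV g"
  obtains B where "\<And>x. x \<in> closure T \<Longrightarrow> norm (g x) \<le> B"
proof -
  have "compact (g ` closure T)"
    using bounded_T by (intro compact_continuous_image continuous_on_subset[OF assms]) (auto simp: compact_closure)
  then show ?thesis using that compact_imp_bounded by (force simp: bounded_iff)
qed

lemma integrable_T:
  fixes g :: "real^'n \<Rightarrow> real"
  assumes g: "continuous_on UNIV g"
  shows "integrable lborel (\<lambda>x. indicator T x * g x)"
proof -
  obtain B where B: "\<And>x. x \<in> closure T \<Longrightarrow> norm (g x) \<le> B" using continuous_bounded_on_closure[OF g] by blast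
  have [measurable]: "g \<in> borel_measurable borel" using g by (rule borel_measurable_continuous_onI)
  have "emeasure lborel T < \<infinity>" using emeasure_bounded_finite[OF bounded_T] by simp
  then show ?thesis
    by (intro integrableI_bounded_set[where A=T and B=B]) (use B closure_subset[of T] in \<open>auto simp: indicator_def\<close>)
qed

lemma integrable_jump:
  fixes p :: "real^'n \<Rightarrow> real"
  assumes h: "h \<in> Hs" and p: "continuous_on UNIV p"
  shows "integrable (plane_measure (fst h) (snd h)) (\<lambda>x. p x * jump T e x)"
proof -
  obtain B where B: "\<And>x. x \<in> closure T \<Longrightarrow> norm (p x) \<le> B" using continuous_bounded_on_closure[OF p] by blast
  have [measurable]: "p \<in> borel_measurable borel" using p by (rule borel_measurable_continuous_onI)
  have "emeasure (plane_measure (fst h) (snd h)) (closure T) < \<infinity>"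
    using bounded_T by (intro plane_measure_bounded_finite unit h bounded_closure) auto
  moreover have "norm (p x * jump T e x) \<le> B" if "x \<in> closure T" for x
    using B[OF that] abs_jump_le[of T e x] mult_mono[of "\<bar>p x\<bar>" B "\<bar>jump T e x\<bar>" 1] by (simp add: abs_mult)
  ultimately show ?thesis using jump_support[of T e]
    by (intro integrableI_bounded_set[where A="closure T" and B=B]) auto
qed

text \<open>In a direction \<open>e\<close> transversal to all hyperplanes, Fubini's theorem reduces the formula to the
  fundamental theorem of calculus on lines. Both sides are linear in \<open>e\<close>, which removes the
  restriction on \<open>e\<close> in \<open>divergence_flat\<close>.\<close>

lemma divergence_transversal:
  fixes p :: "real^'n \<Rightarrow> real" and g :: "real^'n \<Rightarrow> real^'n"
  assumes der: "\<And>x. (p has_derivative (\<lambda>h. g x \<bullet> h)) (at x)" and g: "continuous_on UNIV g"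
    and e: "\<And>h. h \<in> Hs \<Longrightarrow> fst h \<bullet> e \<noteq> 0" "e \<noteq> 0"
  shows "(\<integral>x. indicator T x * (g x \<bullet> e) \<partial>lborel) =
    (\<Sum>h\<in>Hs. (fst h \<bullet> e) * (\<integral>x. p x * jump T (fst h) x \<partial>plane_measure (fst h) (snd h)))"
proof -
  have contp: "continuous_on UNIV p"
    using der by (intro continuous_at_imp_continuous_on ballI has_derivative_continuous) auto
  define d where "d x = g x \<bullet> e" for x
  have d: "continuous_on UNIV d" unfolding d_def[abs_def] using g by (intro continuous_intros)
  have [measurable]: "p \<in> borel_measurable borel" using contp by (rule borel_measurable_continuous_onI)
  have [measurable]: "d \<in> borel_measurable borel" using d by (rule borel_measurable_continuous_onI)
  have line_der: "((\<lambda>t. p (x + t *\<^sub>R e)) has_real_derivative d (x + t *\<^sub>R e)) (at t)" for x t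
  proof -
    have "((\<lambda>t. x + t *\<^sub>R e) has_derivative (\<lambda>s. s *\<^sub>R e)) (at t)"
      by (auto intro!: derivative_eq_intros)
    from has_derivative_compose[OF this der[of "x + t *\<^sub>R e"]]
    show ?thesis by (simp add: has_field_derivative_def mult_commute_abs d_def)
  qed
  have good: "AE x in lborel. \<forall>h\<in>Hs. \<forall>h'\<in>Hs. h \<noteq> h' \<longrightarrow> line_proj (fst h) (snd h) e x \<notin> hyp h'"
  proof (intro AE_finite_allI finite_Hs)
    fix h h' assume "h \<in> Hs" "h' \<in> Hs"
    then show "AE x in lborel. h \<noteq> h' \<longrightarrow> line_proj (fst h) (snd h) e x \<notin> hyp h'"
      using line_proj_meets_other_null[of h h' e] e by (cases "h = h'") auto
  qed
  let ?f = "\<lambda>h x. indicator (unit_slab e) x * (p (line_proj (fst h) (snd h) e x) * jump T e (line_proj (fst h) (snd h) e x))"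
  have f: "(\<integral>x. ?f h x \<partial>lborel) = \<bar>fst h \<bullet> e\<bar> * (\<integral>x. p x * jump T e x \<partial>plane_measure (fst h) (snd h))"
    "integrable lborel (?f h)" if "h \<in> Hs" for h
    using integral_plane_measure_prism[OF unit[OF that] e(1)[OF that], of "\<lambda>x. p x * jump T e x" "snd h"]
      integrable_jump[OF that contp] by auto
  have "(\<integral>x. indicator T x * d x \<partial>lborel) =
    (\<integral>x. indicator (unit_slab e) x * (\<integral>t. indicator T (x + t *\<^sub>R e) * d (x + t *\<^sub>R e) \<partial>lborel) \<partial>lborel)"
    by (rule integral_over_lines[OF e(2)]) (use integrable_T[OF d] in auto)
  \<comment> \<open>Lines that meet two hyperplanes in the same point form a null set; on all other
    lines \<open>integral_line\<close> applies.\<close>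
  also have "\<dots> = (\<integral>x. (\<Sum>h\<in>Hs. ?f h x) \<partial>lborel)"
  proof (rule integral_cong_AE)
    show "AE x in lborel. indicator (unit_slab e) x * (\<integral>t. indicator T (x + t *\<^sub>R e) * d (x + t *\<^sub>R e) \<partial>lborel) = (\<Sum>h\<in>Hs. ?f h x)"
      using good
    proof eventually_elim
      case (elim x)
      then show ?case by (subst integral_line[OF line_der d e]) (auto simp: sum_distrib_left)
    qed
    show "(\<lambda>x. \<Sum>h\<in>Hs. ?f h x) \<in> borel_measurable lborel"
      by (intro borel_measurable_sum borel_measurable_integrable f)
  qed measurable
  also have "\<dots> = (\<Sum>h\<in>Hs. \<integral>x. ?f h x \<partial>lborel)"
    by (rule Bochner_Integration.integral_sum) (use f in auto)
  also have "\<dots> = (\<Sum>h\<in>Hs. (fst h \<bullet> e) * (\<integral>x. p x * jump T (fst h) x \<partial>plane_measure (fst h) (snd h)))"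
  proof (rule sum.cong[OF refl])
    fix h assume h: "h \<in> Hs"
    have "(\<integral>x. p x * jump T e x \<partial>plane_measure (fst h) (snd h)) =
      (\<integral>x. sgn (fst h \<bullet> e) * (p x * jump T (fst h) x) \<partial>plane_measure (fst h) (snd h))"
    proof (rule integral_cong_AE)
      show "AE x in plane_measure (fst h) (snd h). p x * jump T e x = sgn (fst h \<bullet> e) * (p x * jump T (fst h) x)"
        using AE_generic[OF h] by eventually_elim (use jump_transversal[OF h _ e(1)[OF h]] in simp)
    qed measurable
    also have "\<dots> = sgn (fst h \<bullet> e) * (\<integral>x. p x * jump T (fst h) x \<partial>plane_measure (fst h) (snd h))"
      by simp
    finally have eq: "(\<integral>x. p x * jump T e x \<partial>plane_measure (fst h) (snd h)) =
      sgn (fst h \<bullet> e) * (\<integral>x. p x * jump T (fst h) x \<partial>plane_measure (fst h) (snd h))" .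
    \<comment> \<open>The prism contributes \<open>\<bar>fst h \<bullet> e\<bar>\<close> and the
      change of direction a sign; together they give the linear factor
      \<open>fst h \<bullet> e\<close>.\<close>
    have "\<bar>y\<bar> * (sgn y * I) = y * I" for y I :: real by (simp add: sgn_if)
    then show "(\<integral>x. ?f h x \<partial>lborel) = (fst h \<bullet> e) * (\<integral>x. p x * jump T (fst h) x \<partial>plane_measure (fst h) (snd h))"
      unfolding f(1)[OF h] eq by simp
  qed
  finally show ?thesis by (simp add: d_def)
qed

theorem divergence_flat:
  fixes p :: "real^'n \<Rightarrow> real" and g :: "real^'n \<Rightarrow> real^'n"
  assumes der: "\<And>x. (p has_derivative (\<lambda>h. g x \<bullet> h)) (at x)" and g: "continuous_on UNIV g"
  shows "(\<integral>x. indicator T x * (g x \<bullet> e) \<partial>lborel) =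
    (\<Sum>h\<in>Hs. (fst h \<bullet> e) * (\<integral>x. p x * jump T (fst h) x \<partial>plane_measure (fst h) (snd h)))"
proof -
  let ?I = "\<lambda>h. \<integral>x. p x * jump T (fst h) x \<partial>plane_measure (fst h) (snd h)"
  define w :: "real^'n" where "w = (\<chi> i. \<integral>x. indicator T x * g x $ i \<partial>lborel) - (\<Sum>h\<in>Hs. ?I h *\<^sub>R fst h)"
  have w: "w \<bullet> e = (\<integral>x. indicator T x * (g x \<bullet> e) \<partial>lborel) - (\<Sum>h\<in>Hs. (fst h \<bullet> e) * ?I h)" for e
  proof -
    have "integrable lborel (\<lambda>x. indicator T x * g x $ i)" for i
      using g by (intro integrable_T continuous_intros)
    then have "(\<integral>x. (\<Sum>i\<in>UNIV. e $ i * (indicator T x * g x $ i)) \<partial>lborel) = (\<Sum>i\<in>UNIV. e $ i * (\<integral>x. indicator T x * g x $ i \<partial>lborel))"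
      by (subst Bochner_Integration.integral_sum) auto
    then have "(\<integral>x. indicator T x * (g x \<bullet> e) \<partial>lborel) = (\<chi> i. \<integral>x. indicator T x * g x $ i \<partial>lborel) \<bullet> e"
      by (simp add: inner_vec_def sum_distrib_left mult_ac)
    then show ?thesis
      by (simp add: w_def inner_diff_left inner_sum_left mult.commute)
  qed
  have "w = 0"
  proof (rule ccontr)
    assume "w \<noteq> 0"
    \<comment> \<open>Directions parallel to a hyperplane of the family or orthogonal to
      \<open>w\<close> fill only finitely many hyperplanes through 0. Any other direction is
      transversal with \<open>w \<bullet> e \<noteq> 0\<close>, against the transversal
      formula.\<close>
    let ?N = "{e. w \<bullet> e = 0} \<union> (\<Union>h\<in>Hs. {e. fst h \<bullet> e = 0})"
    have "fst h \<noteq> 0" if "h \<in> Hs" for h using unit[OF that] by auto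
    then have "negligible ?N" using \<open>w \<noteq> 0\<close> finite_Hs
      by (intro negligible_Un negligible_Union negligible_hyperplane) (auto intro!: negligible_hyperplane)
    moreover have "\<not> negligible (UNIV :: (real^'n) set)" using open_not_negligible[OF open_UNIV] by auto
    ultimately have "?N \<noteq> UNIV" by metis
    then obtain e where "w \<bullet> e \<noteq> 0" "\<And>h. h \<in> Hs \<Longrightarrow> fst h \<bullet> e \<noteq> 0" by blast
    then show False using divergence_transversal[OF der g, of e] w[of e] by fastforce
  qed
  then show ?thesis using w[of e] by simp
qed

end

section \<open>Faces\<close>

text \<open>Literally the choice made inside \<open>face_measure\<close>, named in order to speak
  about the chosen normal and offset.\<close>

definition face_plane :: "(real^'n) set \<Rightarrow> (real^'n) \<times> real" where
  "face_plane F = (SOME (a, c). norm a = 1 \<and> F \<subseteq> {x. a \<bullet> x = c})"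

lemma face_measure_eq:
  "face_measure F = restrict_space (completion (plane_measure (fst (face_plane F)) (snd (face_plane F)))) F"
  unfolding face_measure_def face_plane_def[symmetric] by (simp add: Let_def hyperplane_measure_eq split_beta)

lemma face_plane_props:
  assumes "hyperplanar F"
  shows "norm (fst (face_plane F)) = 1" "F \<subseteq> hyp (face_plane F)"
proof -
  obtain a c where a: "a \<noteq> 0" "F \<subseteq> {x. a \<bullet> x = c}" using assms by (auto simp: hyperplanar_def)
  have "norm ((1 / norm a) *\<^sub>R a) = 1 \<and> F \<subseteq> {x. ((1 / norm a) *\<^sub>R a) \<bullet> x = c / norm a}"
    using a by auto
  then have "\<exists>p. case p of (a, c) \<Rightarrow> norm a = 1 \<and> F \<subseteq> {x. a \<bullet> x = c}" by blast
  then have "case face_plane F of (a, c) \<Rightarrow> norm a = 1 \<and> F \<subseteq> {x. a \<bullet> x = c}"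
    unfolding face_plane_def by (rule someI_ex)
  then show "norm (fst (face_plane F)) = 1" "F \<subseteq> hyp (face_plane F)" by (auto simp: hyp_def)
qed

lemma hyp_subset_imp_parallel:
  assumes "norm a = 1" "norm a' = 1" "hyp (a, c) \<subseteq> hyp (a', c')"
  shows "(a', c') = (a, c) \<or> (a', c') = (- a, - c)"
proof -
  have aa: "a \<bullet> a = 1" "a' \<bullet> a' = 1" using assms by (auto simp: norm_eq_1)
  define s where "s = a' \<bullet> a"
  have "c *\<^sub>R a \<in> hyp (a, c)" using aa by (simp add: hyp_def)
  then have "c *\<^sub>R a \<in> hyp (a', c')" using assms(3) by blast
  then have x0: "a' \<bullet> (c *\<^sub>R a) = c'" by (simp only: hyp_def mem_Collect_eq fst_conv snd_conv)
  \<comment> \<open>The tangential part of \<open>a'\<close> is a direction inside the first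
    hyperplane, so \<open>a'\<close> must be orthogonal to it; this forces
    \<open>s * s = 1\<close>.\<close>
  have "a \<bullet> (c *\<^sub>R a + (a' - s *\<^sub>R a)) = c" using aa by (simp add: s_def inner_add_right inner_diff_right inner_commute)
  then have "c *\<^sub>R a + (a' - s *\<^sub>R a) \<in> hyp (a', c')" using assms(3) by (simp add: hyp_def subset_iff)
  then have "a' \<bullet> (c *\<^sub>R a + (a' - s *\<^sub>R a)) = c'" by (simp only: hyp_def mem_Collect_eq fst_conv snd_conv)
  then have "s * s = 1" using x0 aa by (simp add: inner_add_right inner_diff_right s_def)
  then have s: "s = 1 \<or> s = -1" by (simp add: square_eq_1_iff)
  have "(a' - s *\<^sub>R a) \<bullet> (a' - s *\<^sub>R a) = 1 - s * s"
    using aa by (simp add: inner_diff_left inner_diff_right inner_commute[of a a'] flip: s_def)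
  then have "a' = s *\<^sub>R a" using \<open>s * s = 1\<close> by simp
  moreover have "c' = s * c" using x0 by (simp add: s_def mult.commute)
  ultimately show ?thesis using s by auto
qed

lemma hyp_minus: "hyp (- a, - c) = hyp (a, c)"
  by (auto simp: hyp_def)

text \<open>Serves \<open>outward_normal\<close>, which is controlled only almost everywhere:
  completeness upgrades agreement with a measurable map to measurability.\<close>

lemma measurable_completion_AE:
  assumes g': "g' \<in> borel_measurable M" and ae: "AE x in M. g x = g' x"
  shows "g \<in> borel_measurable (completion M)"
proof (rule measurableI)
  fix B :: "'b set" assume "B \<in> sets borel"
  then have 1: "g' -` B \<inter> space M \<in> sets (completion M)"
    using measurable_sets[OF g'] by (intro sets_completionI_sets)
  have 2: "AE x in completion M. x \<in> g' -` B \<inter> space M \<longleftrightarrow> x \<in> g -` B \<inter> space M"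
  proof (rule AE_completion)
    show "AE x in M. x \<in> g' -` B \<inter> space M \<longleftrightarrow> x \<in> g -` B \<inter> space M"
      using ae by eventually_elim simp
  qed
  show "g -` B \<inter> space (completion M) \<in> sets (completion M)"
    using completion.in_sets_AE[OF 2 1] by simp
qed auto

text \<open>What the volume measure of an element and the surface measure of a face have in common;
  \<open>determining\<close> is the property that makes L2 products of polynomials definite on
  \<open>X\<close>.\<close>

locale poly_measure =
  fixes M :: "(real^'n) measure" and X :: "(real^'n) set"
  assumes space_M: "space M = X" and finite_M: "finite_measure M" and bounded_X: "bounded X"
    and id_M: "(\<lambda>x. x) \<in> M \<rightarrow>\<^sub>M borel"
    and determining: "real_polynomial_function p \<Longrightarrow> AE x in M. p x = 0 \<Longrightarrow> x \<in> X \<Longrightarrow> p x = 0"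
begin

lemma borel_M: "g \<in> borel_measurable borel \<Longrightarrow> g \<in> borel_measurable M"
  using measurable_compose[OF id_M] by blast

lemma continuous_M: "continuous_on UNIV g \<Longrightarrow> g \<in> borel_measurable M"
  by (intro borel_M borel_measurable_continuous_onI)

lemma bounded_on_X:
  fixes g :: "real^'n \<Rightarrow> 'b::real_normed_vector"
  assumes "continuous_on UNIV g" obtains B where "\<And>x. x \<in> X \<Longrightarrow> norm (g x) \<le> B"
proof -
  have "compact (g ` closure X)"
    using bounded_X by (intro compact_continuous_image continuous_on_subset[OF assms]) (auto simp: compact_closure)
  then obtain B where "\<And>x. x \<in> closure X \<Longrightarrow> norm (g x) \<le> B"
    using compact_imp_bounded by (force simp: bounded_iff)
  then show ?thesis using that closure_subset by blast
qed

lemma integrable_bounded: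
  fixes g :: "real^'n \<Rightarrow> 'b::{banach, second_countable_topology}"
  assumes "g \<in> borel_measurable M" "\<And>x. x \<in> X \<Longrightarrow> norm (g x) \<le> B"
  shows "integrable M g"
proof -
  interpret finite_measure M by (rule finite_M)
  show ?thesis by (rule integrable_const_bound[where B=B]) (use assms space_M in auto)
qed

lemma integrable_continuous:
  fixes g :: "real^'n \<Rightarrow> 'b::{banach, second_countable_topology}"
  assumes "continuous_on UNIV g" shows "integrable M g"
proof -
  obtain B where "\<And>x. x \<in> X \<Longrightarrow> norm (g x) \<le> B" using bounded_on_X[OF assms] by blast
  then show ?thesis by (rule integrable_bounded[OF continuous_M[OF assms]])
qed

lemma determining_vec:
  fixes p :: "real^'n \<Rightarrow> 'b::euclidean_space"
  assumes "polynomial_function p" "AE x in M. p x = 0" "x \<in> X" shows "p x = 0"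
proof (rule euclidean_eqI)
  fix b :: 'b assume b: "b \<in> Basis"
  have "AE x in M. p x \<bullet> b = 0" using assms(2) by eventually_elim simp
  then show "p x \<bullet> b = 0 \<bullet> b"
    using determining[of "\<lambda>x. p x \<bullet> b" x] assms b by (simp add: polynomial_function_iff_Basis_inner)
qed

lemma square_integral_zero:
  fixes p :: "real^'n \<Rightarrow> 'b::euclidean_space"
  assumes p: "polynomial_function p" and z: "(\<integral>x. p x \<bullet> p x \<partial>M) = 0" and x: "x \<in> X" shows "p x = 0"
proof -
  have "continuous_on UNIV (\<lambda>x. p x \<bullet> p x)"
    using continuous_on_polymonial_function[OF p] by (intro continuous_intros)
  from integrable_continuous[OF this] have "AE x in M. p x \<bullet> p x = 0"
    using z by (subst (asm) integral_nonneg_eq_0_iff_AE) auto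
  then have "AE x in M. p x = 0" by eventually_elim simp
  then show ?thesis using determining_vec[OF p _ x] by simp
qed

end

locale flat_face =
  fixes F :: "(real^'n) set"
  assumes compact_F: "compact F" and hyperplanar_F: "hyperplanar F"
    and pos_F: "emeasure (face_measure F) F > 0"
begin

abbreviation "nrm \<equiv> fst (face_plane F)"
abbreviation "off \<equiv> snd (face_plane F)"
abbreviation "PM \<equiv> plane_measure nrm off"

lemmas nrm_unit = face_plane_props(1)[OF hyperplanar_F]
lemmas F_subset = face_plane_props(2)[OF hyperplanar_F]

lemma F_borel [measurable]: "F \<in> sets borel" using compact_F by (simp add: borel_compact)

lemma F_completion: "F \<inter> space (completion PM) \<in> sets (completion PM)"
  using F_borel by (auto intro: sets_completionI_sets)

lemma emeasure_face: "A \<in> sets borel \<Longrightarrow> A \<subseteq> F \<Longrightarrow> emeasure (face_measure F) A = emeasure PM A"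
  unfolding face_measure_eq by (subst emeasure_restrict_space[OF F_completion]) auto

lemma AE_face: "(AE x in face_measure F. P x) \<longleftrightarrow> (AE x in PM. x \<in> F \<longrightarrow> P x)"
  unfolding face_measure_eq by (simp add: AE_restrict_space_iff[OF F_completion] AE_completion_iff)

lemma space_face: "space (face_measure F) = F"
  unfolding face_measure_eq by (simp add: space_restrict_space)

lemma measurable_face:
  assumes "g' \<in> borel_measurable borel" "AE x in face_measure F. g x = g' x"
  shows "g \<in> borel_measurable (face_measure F)"
proof -
  let ?g = "\<lambda>x. if x \<in> F then g x else g' x"
  have "AE x in PM. ?g x = g' x" using assms(2) unfolding AE_face by eventually_elim auto
  then have "?g \<in> borel_measurable (completion PM)"
    using assms(1) by (intro measurable_completion_AE[of g']) (simp_all add: measurable_cong_sets[OF plane_measure_simps(2) refl])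
  then have "?g \<in> borel_measurable (face_measure F)"
    unfolding face_measure_eq by (rule measurable_restrict_space1)
  then show ?thesis by (rule measurable_cong[THEN iffD1, rotated]) (simp add: space_face)
qed

lemma integral_face:
  fixes g :: "real^'n \<Rightarrow> 'b::{banach, second_countable_topology}"
  assumes [measurable]: "g \<in> borel_measurable borel"
  shows "(\<integral>x. g x \<partial>face_measure F) = (\<integral>x. indicator F x *\<^sub>R g x \<partial>PM)"
  unfolding face_measure_eq
  by (subst integral_restrict_space[OF F_completion], subst integral_completion) auto

lemma poly_measure_face: "poly_measure (face_measure F) F"
proof (rule poly_measure.intro)
  show "space (face_measure F) = F" by (rule space_face)
  show "bounded F" using compact_F by (rule compact_imp_bounded)
  have "emeasure (face_measure F) F < \<infinity>"
    using plane_measure_bounded_finite[OF nrm_unit, of F off] compact_imp_bounded[OF compact_F] by (simp add: emeasure_face)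
  then show "finite_measure (face_measure F)" by (intro finite_measureI) (simp add: space_face)
  show "(\<lambda>x. x) \<in> face_measure F \<rightarrow>\<^sub>M borel" by (rule measurable_face[of "\<lambda>x. x"]) auto
  fix p :: "real^'n \<Rightarrow> real" and x
  assume p: "real_polynomial_function p" "AE x in face_measure F. p x = 0" "x \<in> F"
  show "p x = 0"
  proof (rule polynomial_zero_plane_AE[OF _ nrm_unit F_borel])
    show "nrm \<bullet> x = off" using p F_subset by (auto simp: hyp_def)
    show "0 < emeasure PM F" using pos_F by (simp add: emeasure_face)
  qed (use p AE_face in \<open>auto simp: real_polynomial_function_eq\<close>)
qed

sublocale poly_measure "face_measure F" F by (rule poly_measure_face)

lemma polynomial_zero_on_plane:
  fixes p :: "real^'n \<Rightarrow> 'b::euclidean_space"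
  assumes p: "polynomial_function p" "\<And>x. x \<in> F \<Longrightarrow> p x = 0" and x: "x \<in> hyp (face_plane F)"
  shows "p x = 0"
proof (rule polynomial_zero_plane_AE[OF p(1) nrm_unit F_borel])
  show "nrm \<bullet> x = off" using x by (auto simp: hyp_def)
  show "0 < emeasure PM F" using pos_F by (simp add: emeasure_face)
  show "AE x in PM. x \<in> F \<longrightarrow> p x = 0" using p(2) by simp
qed

text \<open>The affine function \<open>a \<bullet> x - c\<close> is a polynomial that vanishes on
  \<open>F\<close>; since \<open>F\<close> has positive measure, it vanishes on the whole hyperplane
  of \<open>F\<close>. So the choice in \<open>face_plane\<close> is unique up to sign.\<close>

lemma plane_unique:
  assumes "norm a = 1" "F \<subseteq> hyp (a, c)"
  shows "(a, c) = face_plane F \<or> (a, c) = (- nrm, - off)"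
proof -
  have "polynomial_function (\<lambda>x. a \<bullet> x - c)"
    by (intro polynomial_function_diff polynomial_function_const)
      (simp add: inner_commute[of a] polynomial_function_inner)
  moreover have "a \<bullet> x - c = 0" if "x \<in> F" for x
    using subsetD[OF assms(2) that] by (simp add: hyp_def)
  ultimately have "a \<bullet> x - c = 0" if "x \<in> hyp (face_plane F)" for x
    by (rule polynomial_zero_on_plane[OF _ _ that])
  then have "hyp (nrm, off) \<subseteq> hyp (a, c)" by (simp add: hyp_def subset_iff)
  from hyp_subset_imp_parallel[OF nrm_unit assms(1) this] show ?thesis by simp
qed

lemma unit_normals:
  assumes "norm n = 1" "x \<in> F" "\<And>y. y \<in> F \<Longrightarrow> n \<bullet> (y - x) = 0"
  shows "n = nrm \<or> n = - nrm"
proof -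
  have "F \<subseteq> hyp (n, n \<bullet> x)" using assms(3) by (auto simp: hyp_def inner_diff_right)
  from plane_unique[OF assms(1) this] show ?thesis by (metis fst_conv)
qed

lemma nrm_normal: "x \<in> F \<Longrightarrow> y \<in> F \<Longrightarrow> nrm \<bullet> (y - x) = 0"
  using F_subset by (auto simp: hyp_def inner_diff_right subset_iff)

text \<open>The weights \<open>\<gamma> / diameter F\<close> rely on this. In dimension at least 2
  some \<open>b \<noteq> 0\<close> is parallel to the hyperplane, and on a one-point face the
  polynomial \<open>b \<bullet> (y - x)\<close> would vanish without vanishing on the
  hyperplane.\<close>

lemma diameter_pos:
  assumes "CARD('n) \<ge> 2" shows "diameter F > 0"
proof (rule ccontr)
  assume "\<not> ?thesis"
  then have d: "diameter F \<le> 0" by simp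
  have ne: "F \<noteq> {}" using pos_F by auto
  then obtain x where x: "x \<in> F" by blast
  have single: "y = x" if "y \<in> F" for y
  proof -
    have "dist y x \<le> 0" using diameter_bounded_bound[OF compact_imp_bounded[OF compact_F] that x] d by linarith
    then show ?thesis by simp
  qed
  have "2 \<le> DIM(real^'n)" using assms by simp
  then obtain b where b: "b \<noteq> 0" "nrm \<bullet> b = 0"
    using orthogonal_to_vector_exists[of nrm] by (auto simp: orthogonal_def)
  have "polynomial_function (\<lambda>y. b \<bullet> (y - x))"
    by (simp add: inner_commute[of b]) (intro polynomial_function_inner polynomial_function_diff polynomial_function_const polynomial_function_id)
  moreover have "x + b \<in> hyp (face_plane F)" using x F_subset b by (auto simp: hyp_def inner_add_right)
  moreover have "b \<bullet> (y - x) = 0" if "y \<in> F" for y using single[OF that] by simp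
  ultimately show False using polynomial_zero_on_plane[of "\<lambda>y. b \<bullet> (y - x)" "x + b"] b by simp
qed

end

text \<open>The two \<open>SOME\<close> choices are made from the same predicate, so coplanar faces
  receive equal normals and not opposite ones. This yields \<open>hyp_inj\<close> for the planes of
  a mesh.\<close>

lemma face_plane_eqI:
  assumes "flat_face F" "flat_face F'" "hyp (face_plane F) = hyp (face_plane F')"
  shows "face_plane F = face_plane F'"
proof -
  interpret F: flat_face F by fact
  interpret F': flat_face F' by fact
  have 1: "hyp (a, c) = hyp (face_plane F)" if "norm a = 1" "F \<subseteq> hyp (a, c)" for a c
    using F.plane_unique[OF that] hyp_minus[of F.nrm F.off] by (metis prod.collapse)
  have 2: "hyp (a, c) = hyp (face_plane F')" if "norm a = 1" "F' \<subseteq> hyp (a, c)" for a c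
    using F'.plane_unique[OF that] hyp_minus[of F'.nrm F'.off] by (metis prod.collapse)
  have "(norm a = 1 \<and> F \<subseteq> hyp (a, c)) = (norm a = 1 \<and> F' \<subseteq> hyp (a, c))" for a c
    using 1[of a c] 2[of a c] F.F_subset F'.F_subset assms(3) by blast
  then have "(\<lambda>(a, c). norm a = 1 \<and> F \<subseteq> {x. a \<bullet> x = c}) = (\<lambda>(a, c). norm a = 1 \<and> F' \<subseteq> {x. a \<bullet> x = c})"
    by (simp add: hyp_def)
  then show ?thesis unfolding face_plane_def by (rule arg_cong)
qed

section \<open>Meshes\<close>

locale polyhedral_mesh =
  fixes \<Omega> :: "(real^'n) set" and Th Fh :: "(real^'n) set set"
  assumes open_\<Omega>: "open \<Omega>" and bounded_\<Omega>: "bounded \<Omega>" and regular_\<Omega>: "interior (closure \<Omega>) = \<Omega>"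
    and finite_Th: "finite Th" and open_Th: "T \<in> Th \<Longrightarrow> open T" and ne_Th: "T \<in> Th \<Longrightarrow> T \<noteq> {}"
    and regular_Th: "T \<in> Th \<Longrightarrow> interior (closure T) = T"
    and disj_Th: "pairwise disjnt Th" and cover: "closure \<Omega> = (\<Union>T\<in>Th. closure T)"
    and faces: "face_mesh \<Omega> Th Fh"
begin

definition planes :: "((real^'n) \<times> real) set" where "planes = face_plane ` Fh"

lemma finite_Fh: "finite Fh" using faces by (simp add: face_mesh_def)

lemma face_props: "F \<in> Fh \<Longrightarrow> is_face \<Omega> Th F" using faces by (simp add: face_mesh_def)

lemma flat_face: "F \<in> Fh \<Longrightarrow> flat_face F"
  using face_props[of F] bounded_subset[OF bounded_closure[OF bounded_\<Omega>], of F]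
  by unfold_locales (auto simp: is_face_def compact_eq_bounded_closed)

sublocale hyperplanes planes
proof
  show "finite planes" by (simp add: planes_def finite_Fh)
  show "norm (fst h) = 1" if "h \<in> planes" for h
    using that flat_face flat_face.nrm_unit by (auto simp: planes_def)
  show "hyp h \<noteq> hyp h'" if "h \<in> planes" "h' \<in> planes" "h \<noteq> h'" for h h'
    using that unfolding planes_def by (metis face_plane_eqI flat_face imageE)
qed

text \<open>\<open>T\<close> is an open subset of \<open>closure \<Omega>\<close>, and by regularity
  \<open>\<Omega>\<close> is the largest one.\<close>

lemma T_subset: "T \<in> Th \<Longrightarrow> T \<subseteq> \<Omega>"
proof -
  assume T: "T \<in> Th"
  then have "T \<subseteq> closure \<Omega>" using cover closure_subset by blast
  then have "T \<subseteq> interior (closure \<Omega>)" using open_Th[OF T] by (rule interior_maximal)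
  then show ?thesis by (simp add: regular_\<Omega>)
qed

lemma flat_boundary: "T \<in> Th \<Longrightarrow> flat_boundary planes T"
proof unfold_locales
  assume T: "T \<in> Th"
  show "open T" "interior (closure T) = T" using T open_Th regular_Th by auto
  show "bounded T" using T_subset[OF T] bounded_\<Omega> bounded_subset by blast
  have "frontier T \<subseteq> \<Union>Fh" using faces T by (auto simp: face_mesh_def)
  moreover have "F \<subseteq> (\<Union>h\<in>planes. hyp h)" if "F \<in> Fh" for F
    using flat_face.F_subset[OF flat_face[OF that]] that by (auto simp: planes_def)
  ultimately show "frontier T \<subseteq> (\<Union>h\<in>planes. hyp h)" by blast
qed

section \<open>Elements around a generic point of the mesh skeleton\<close>

lemma frontier_not_in: "T \<in> Th \<Longrightarrow> x \<in> frontier T \<Longrightarrow> x \<notin> T \<and> x \<in> closure T"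
  using open_Th by (auto simp: frontier_def interior_open)

text \<open>A frontier point excludes the full and the empty case of \<open>local_structure\<close>;
  the sign of \<open>jump\<close> then tells on which side of the hyperplane \<open>T\<close>
  lies.\<close>

lemma frontier_side:
  assumes T: "T \<in> Th" and h: "h \<in> planes" and gen: "generic planes h x" and x: "x \<in> frontier T"
  shows "\<bar>jump T (fst h) x\<bar> = 1"
    and "\<exists>r>0. \<forall>y\<in>ball x r. y \<in> T \<longleftrightarrow> jump T (fst h) x * (fst h \<bullet> y - snd h) < 0"
proof -
  interpret flat_boundary planes T by (rule flat_boundary[OF T])
  have hx: "fst h \<bullet> x = snd h" "(- fst h) \<bullet> x = - snd h" using gen by (auto simp: generic_def hyp_def)
  have aa: "fst h \<bullet> fst h = 1" using unit[OF h] by (simp add: norm_eq_1)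
  have *: "\<bar>jump T (fst h) x\<bar> = 1 \<and> (\<exists>r>0. \<forall>y\<in>ball x r. y \<in> T \<longleftrightarrow> jump T (fst h) x * (fst h \<bullet> y - snd h) < 0)"
    using h gen
  proof (cases rule: local_structure)
    case (1 r) then show ?thesis using frontier_not_in[OF T x] centre_in_ball[of x r] by blast
  next
    case (2 r)
    then have "ball x r \<inter> closure T = {}" by (simp add: open_Int_closure_eq_empty)
    then show ?thesis using frontier_not_in[OF T x] centre_in_ball[of x r] 2(1) by blast
  next
    case (3 r)
    have "jump T (fst h) x = 1" using jump_halfspace[OF 3(1) 3(2) hx(1), of "fst h"] aa by simp
    then show ?thesis using 3 by auto
  next
    case (4 r)
    have "\<And>y. y \<in> ball x r \<Longrightarrow> y \<in> T \<longleftrightarrow> (- fst h) \<bullet> y < - snd h" using 4(2) by simp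
    then have "jump T (fst h) x = - 1" using jump_halfspace[OF 4(1) _ hx(2), of T "fst h"] aa by simp
    then show ?thesis using 4 by auto
  qed
  then show "\<bar>jump T (fst h) x\<bar> = 1"
    "\<exists>r>0. \<forall>y\<in>ball x r. y \<in> T \<longleftrightarrow> jump T (fst h) x * (fst h \<bullet> y - snd h) < 0" by blast+
qed

text \<open>With equal signs both elements would contain the same small half-ball, contradicting
  disjointness.\<close>

lemma opposite_sides:
  assumes T: "T \<in> Th" "T' \<in> Th" "T \<noteq> T'" and h: "h \<in> planes" and gen: "generic planes h x"
    and x: "x \<in> frontier T" "x \<in> frontier T'"
  shows "jump T' (fst h) x = - jump T (fst h) x"
proof (rule ccontr)
  assume *: "\<not> ?thesis"
  have abs: "\<bar>jump T (fst h) x\<bar> = 1" "\<bar>jump T' (fst h) x\<bar> = 1" using frontier_side(1) assms by blast+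
  then have eq: "jump T' (fst h) x = jump T (fst h) x" using * by (auto simp: abs_if split: if_splits)
  obtain r r' where r: "r > 0" "\<forall>y\<in>ball x r. y \<in> T \<longleftrightarrow> jump T (fst h) x * (fst h \<bullet> y - snd h) < 0"
    and r': "r' > 0" "\<forall>y\<in>ball x r'. y \<in> T' \<longleftrightarrow> jump T (fst h) x * (fst h \<bullet> y - snd h) < 0"
    using frontier_side(2)[OF T(1) h gen x(1)] frontier_side(2)[OF T(2) h gen x(2)] eq by auto
  have hx: "fst h \<bullet> x = snd h" using gen by (simp add: generic_def hyp_def)
  let ?B = "ball x r \<inter> ball x r'"
  have B: "open ?B" "x \<in> ?B" using r r' by auto
  have "\<exists>y\<in>?B. jump T (fst h) x * (fst h \<bullet> y - snd h) < 0"
  proof (cases "jump T (fst h) x = 1")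
    case True
    then show ?thesis using hyperplane_side_points(1)[OF B unit[OF h] hx] by auto
  next
    case False
    then have "jump T (fst h) x = -1" using abs by (auto simp: abs_if split: if_splits)
    then show ?thesis using hyperplane_side_points(2)[OF B unit[OF h] hx] by auto
  qed
  then obtain y where "y \<in> T" "y \<in> T'" using r r' by blast
  then show False using T disj_Th by (auto simp: pairwise_def disjnt_def)
qed

text \<open>Of three signs two agree, whereas different elements have opposite signs.\<close>

lemma no_third_element:
  assumes "T \<in> Th" "T1 \<in> Th" "T2 \<in> Th" "T1 \<noteq> T2" "h \<in> planes" "generic planes h x"
    "x \<in> frontier T" "x \<in> frontier T1" "x \<in> frontier T2"
  shows "T = T1 \<or> T = T2"
proof (rule ccontr)
  assume "\<not> ?thesis"
  then have "jump T1 (fst h) x = - jump T (fst h) x" "jump T2 (fst h) x = - jump T (fst h) x"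
    "jump T2 (fst h) x = - jump T1 (fst h) x" using opposite_sides assms by metis+
  then show False using frontier_side(1)[of T h x] assms by auto
qed

text \<open>Two elements on opposite sides would fill a ball around \<open>x\<close> up to the
  hyperplane, so the ball would lie in \<open>closure \<Omega>\<close>; regularity would then put
  \<open>x\<close> inside \<open>\<Omega>\<close>.\<close>

lemma boundary_one_sided:
  assumes T: "T \<in> Th" "T' \<in> Th" and h: "h \<in> planes" and gen: "generic planes h x"
    and x: "x \<in> frontier T" "x \<in> frontier T'" "x \<in> frontier \<Omega>"
  shows "T = T'"
proof (rule ccontr)
  assume ne: "T \<noteq> T'"
  let ?j = "jump T (fst h) x"
  obtain r r' where r: "r > 0" "\<forall>y\<in>ball x r. y \<in> T \<longleftrightarrow> ?j * (fst h \<bullet> y - snd h) < 0"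
    and r': "r' > 0" "\<forall>y\<in>ball x r'. y \<in> T' \<longleftrightarrow> - ?j * (fst h \<bullet> y - snd h) < 0"
    using frontier_side(2)[OF T(1) h gen x(1)] frontier_side(2)[OF T(2) h gen x(2)] opposite_sides[OF T ne h gen x(1,2)] by auto
  have j: "?j \<noteq> 0" using frontier_side(1)[OF T(1) h gen x(1)] by auto
  let ?B = "ball x r \<inter> ball x r'"
  have B: "open ?B" by auto
  have off: "y \<in> closure \<Omega>" if "y \<in> ?B" "fst h \<bullet> y \<noteq> snd h" for y
  proof -
    have "?j * (fst h \<bullet> y - snd h) \<noteq> 0" using j that by simp
    then have "y \<in> T \<or> y \<in> T'" using r(2) r'(2) that by auto
    then show ?thesis using T cover closure_subset by blast
  qed
  have "?B \<subseteq> closure \<Omega>"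
  proof (rule ccontr)
    assume "\<not> ?thesis"
    then obtain y where y: "y \<in> ?B" "y \<notin> closure \<Omega>" by blast
    then have "fst h \<bullet> y = snd h" using off by blast
    then obtain z where "z \<in> ?B - closure \<Omega>" "fst h \<bullet> z < snd h"
      using hyperplane_side_points(1)[of "?B - closure \<Omega>" y "fst h" "snd h"] y unit[OF h] open_Diff[OF B closed_closure] by blast
    then show False using off[of z] by auto
  qed
  then have "?B \<subseteq> \<Omega>" using interior_maximal[OF _ B] regular_\<Omega> by blast
  then have "x \<in> \<Omega>" using r r' by auto
  then show False using x(3) open_\<Omega> by (auto simp: frontier_def interior_open)
qed

text \<open>A face that touches \<open>frontier T\<close> at one generic point lies in it entirely,
  since \<open>T\<close> has to be one of the elements that make it an interface or a boundary
  face.\<close>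

lemma generic_frontier_face:
  assumes T: "T \<in> Th" and h: "h \<in> planes" and gen: "generic planes h x" and x: "x \<in> frontier T"
  shows "\<exists>F\<in>elt_faces Fh T. x \<in> F \<and> face_plane F = h"
proof -
  have "x \<in> \<Union>Fh" using faces T x by (auto simp: face_mesh_def)
  then obtain F where F: "F \<in> Fh" "x \<in> F" by blast
  have fp: "face_plane F = h"
    using gen F flat_face.F_subset[OF flat_face[OF F(1)]] by (auto simp: generic_def planes_def)
  have "F \<subseteq> frontier T"
  proof (cases "is_interface Th F")
    case True
    then obtain T1 T2 where "T1 \<in> Th" "T2 \<in> Th" "T1 \<noteq> T2" "F \<subseteq> frontier T1" "F \<subseteq> frontier T2"
      by (auto simp: is_interface_def)
    then show ?thesis using no_third_element[OF T _ _ _ h gen x, of T1 T2] F by blast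
  next
    case False
    then have "is_boundary_face \<Omega> Th F" using face_props[OF F(1)] by (auto simp: is_face_def)
    then obtain T1 where "T1 \<in> Th" "F \<subseteq> frontier T1" "F \<subseteq> frontier \<Omega>" by (auto simp: is_boundary_face_def)
    then show ?thesis using boundary_one_sided[OF T _ h gen x, of T1] F by blast
  qed
  then show ?thesis using F fp by (auto simp: elt_faces_def)
qed

section \<open>Outward normals almost everywhere on a face\<close>

lemma AE_face_generic:
  assumes F: "F \<in> Fh" shows "AE x in face_measure F. x \<in> F \<and> generic planes (face_plane F) x"
proof -
  interpret flat_face F by (rule flat_face[OF F])
  show ?thesis unfolding AE_face using AE_generic[of "face_plane F"] F by (auto simp: planes_def elim!: eventually_mono)
qed

text \<open>The unit normals of \<open>F\<close> are \<open>nrm\<close> and \<open>- nrm\<close>,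
  and exactly one of them points out of \<open>T\<close> at a generic point, so \<open>THE\<close>
  is meaningful there. The sign may vary along \<open>F\<close>.\<close>

lemma outward_normal_eq:
  assumes T: "T \<in> Th" and F: "F \<in> elt_faces Fh T" and x: "x \<in> F" and gen: "generic planes (face_plane F) x"
  shows "outward_normal T F x = jump T (fst (face_plane F)) x *\<^sub>R fst (face_plane F)"
proof -
  have F': "F \<in> Fh" "F \<subseteq> frontier T" using F by (auto simp: elt_faces_def)
  interpret flat_face F by (rule flat_face[OF F'(1)])
  have h: "face_plane F \<in> planes" using F' by (simp add: planes_def)
  let ?j = "jump T nrm x"
  have j: "\<bar>?j\<bar> = 1" and "\<exists>r>0. \<forall>y\<in>ball x r. y \<in> T \<longleftrightarrow> ?j * (nrm \<bullet> y - off) < 0"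
    using frontier_side[OF T h gen] x F' by blast+
  then obtain r where r: "r > 0" "\<And>y. y \<in> ball x r \<Longrightarrow> y \<in> T \<longleftrightarrow> ?j * (nrm \<bullet> y - off) < 0" by blast
  have hx: "nrm \<bullet> x = off" using gen by (simp add: generic_def hyp_def)
  have aa: "nrm \<bullet> nrm = 1" using nrm_unit by (simp add: norm_eq_1)
  have jj: "?j * ?j = 1" using j by (metis abs_mult_self_eq mult_1)
  have in_ball: "x + t *\<^sub>R nrm \<in> ball x r" if "\<bar>t\<bar> < r" for t
    using that nrm_unit by (simp add: dist_norm)
  have side: "x + t *\<^sub>R nrm \<in> T \<longleftrightarrow> ?j * t < 0" if "\<bar>t\<bar> < r" for t
    using r(2)[OF in_ball[OF that]] hx aa by (simp add: inner_add_right)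
  show ?thesis unfolding outward_normal_def
  proof (rule the_equality, intro conjI ballI)
    show "norm (?j *\<^sub>R nrm) = 1" using j nrm_unit by simp
    show "?j *\<^sub>R nrm \<bullet> (y - x) = 0" if "y \<in> F" for y using nrm_normal[OF x that] by simp
    show "\<exists>\<epsilon>>0. \<forall>t\<in>{0<..<\<epsilon>}. x - t *\<^sub>R ?j *\<^sub>R nrm \<in> T \<and> x + t *\<^sub>R ?j *\<^sub>R nrm \<notin> T"
    proof (intro exI[of _ r] conjI ballI)
      show "0 < r" by (rule r(1))
      fix t assume t: "t \<in> {0<..<r}"
      have "\<bar>t * ?j\<bar> < r" "\<bar>- t * ?j\<bar> < r" using t j by (auto simp: abs_mult)
      then show "x - t *\<^sub>R ?j *\<^sub>R nrm \<in> T" "x + t *\<^sub>R ?j *\<^sub>R nrm \<notin> T"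
        using side[of "- t * ?j"] side[of "t * ?j"] t jj by (auto simp: algebra_simps)
    qed
  next
    fix n assume n: "norm n = 1 \<and> (\<forall>y\<in>F. n \<bullet> (y - x) = 0) \<and>
      (\<exists>\<epsilon>>0. \<forall>t\<in>{0<..<\<epsilon>}. x - t *\<^sub>R n \<in> T \<and> x + t *\<^sub>R n \<notin> T)"
    then have "n = nrm \<or> n = - nrm" using unit_normals x by blast
    then obtain s where s: "n = s *\<^sub>R nrm" "\<bar>s\<bar> = 1" by (metis abs_minus_cancel abs_one scaleR_minus1_left scaleR_one)
    obtain \<epsilon> where e: "\<epsilon> > 0" "\<And>t. t \<in> {0<..<\<epsilon>} \<Longrightarrow> x - t *\<^sub>R n \<in> T" using n by blast
    define t where "t = min \<epsilon> r / 2"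
    have t: "0 < t" "t < \<epsilon>" "t < r" using e r by (auto simp: t_def)
    have "x + (- t * s) *\<^sub>R nrm \<in> T" using e(2)[of t] t s by simp
    moreover have "\<bar>- t * s\<bar> < r" using t s by (simp add: abs_mult)
    ultimately have "?j * (- t * s) < 0" using side by blast
    then have "?j * s > 0" using t by (simp add: zero_less_mult_iff mult_less_0_iff)
    then have "s = ?j" using s j by (auto simp: abs_if zero_less_mult_iff split: if_splits)
    then show "n = ?j *\<^sub>R nrm" using s by simp
  qed
qed

lemma AE_outward_normal:
  assumes T: "T \<in> Th" and F: "F \<in> elt_faces Fh T"
  shows "AE x in face_measure F. outward_normal T F x = jump T (fst (face_plane F)) x *\<^sub>R fst (face_plane F)"
proof -
  have "F \<in> Fh" using F by (simp add: elt_faces_def)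
  from AE_face_generic[OF this] show ?thesis by eventually_elim (use outward_normal_eq[OF T F] in blast)
qed

lemma measurable_outward_normal:
  assumes T: "T \<in> Th" and F: "F \<in> elt_faces Fh T"
  shows "outward_normal T F \<in> borel_measurable (face_measure F)"
proof -
  have "F \<in> Fh" using F by (simp add: elt_faces_def)
  have [measurable]: "T \<in> sets borel" using open_Th[OF T] by simp
  show ?thesis
    by (rule flat_face.measurable_face[OF flat_face[OF \<open>F \<in> Fh\<close>] _ AE_outward_normal[OF T F]]) measurable
qed

lemma AE_norm_outward_normal:
  assumes T: "T \<in> Th" and F: "F \<in> elt_faces Fh T"
  shows "AE x in face_measure F. norm (outward_normal T F x) \<le> 1"
proof -
  have "norm (fst (face_plane F)) = 1" using flat_face.nrm_unit[OF flat_face] F by (simp add: elt_faces_def)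
  then show ?thesis using AE_outward_normal[OF T F]
    by (auto simp: abs_jump_le elim!: eventually_mono)
qed

text \<open>\<open>divergence_flat\<close> integrates \<open>jump\<close> over whole hyperplanes.
  Almost every point with nonzero jump lies in a face of \<open>T\<close> in that hyperplane, by
  \<open>generic_frontier_face\<close>, and in only one, since faces overlap in null sets. So each
  hyperplane integral splits into face integrals.\<close>

theorem divergence_mesh:
  fixes p :: "real^'n \<Rightarrow> real" and g :: "real^'n \<Rightarrow> real^'n"
  assumes T: "T \<in> Th"
    and der: "\<And>x. (p has_derivative (\<lambda>h. g x \<bullet> h)) (at x)" and g: "continuous_on UNIV g"
  shows "(\<integral>x. indicator T x * (g x \<bullet> e) \<partial>lborel) =
    (\<Sum>F\<in>elt_faces Fh T. \<integral>x. p x * (outward_normal T F x \<bullet> e) \<partial>face_measure F)"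
proof -
  interpret flat_boundary planes T by (rule flat_boundary[OF T])
  have contp: "continuous_on UNIV p"
    using der by (intro continuous_at_imp_continuous_on ballI has_derivative_continuous) auto
  then have [measurable]: "p \<in> borel_measurable borel" by (rule borel_measurable_continuous_onI)
  let ?E = "elt_faces Fh T"
  have finE: "finite ?E" using finite_Fh by (simp add: elt_faces_def)
  have EFh: "F \<in> Fh" if "F \<in> ?E" for F using that by (simp add: elt_faces_def)
  let ?j = "\<lambda>h x. p x * jump T (fst h) x"
  have intj: "integrable (plane_measure (fst h) (snd h)) (?j h)" if "h \<in> planes" for h
    using integrable_jump[OF that contp] .
  have each: "(\<integral>x. p x * (outward_normal T F x \<bullet> e) \<partial>face_measure F) =
    (fst (face_plane F) \<bullet> e) * (\<integral>x. indicator F x * ?j (face_plane F) x \<partial>plane_measure (fst (face_plane F)) (snd (face_plane F)))"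
    if F: "F \<in> ?E" for F
  proof -
    interpret flat_face F by (rule flat_face[OF EFh[OF F]])
    have "(\<integral>x. p x * (outward_normal T F x \<bullet> e) \<partial>face_measure F) = (\<integral>x. (nrm \<bullet> e) * ?j (face_plane F) x \<partial>face_measure F)"
    proof (rule integral_cong_AE)
      show "AE x in face_measure F. p x * (outward_normal T F x \<bullet> e) = (nrm \<bullet> e) * ?j (face_plane F) x"
        using AE_outward_normal[OF T F] by eventually_elim (simp add: mult_ac)
      have [measurable]: "outward_normal T F \<in> borel_measurable (face_measure F)" by (rule measurable_outward_normal[OF T F])
      have [measurable]: "p \<in> borel_measurable (face_measure F)" by (rule borel_M) simp
      show "(\<lambda>x. p x * (outward_normal T F x \<bullet> e)) \<in> borel_measurable (face_measure F)" by measurable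
      show "(\<lambda>x. (nrm \<bullet> e) * ?j (face_plane F) x) \<in> borel_measurable (face_measure F)"
        by (rule borel_M) measurable
    qed
    also have "\<dots> = (nrm \<bullet> e) * (\<integral>x. ?j (face_plane F) x \<partial>face_measure F)" by simp
    also have "(\<integral>x. ?j (face_plane F) x \<partial>face_measure F) = (\<integral>x. indicator F x * ?j (face_plane F) x \<partial>PM)"
      by (subst integral_face) auto
    finally show ?thesis .
  qed
  have group: "(\<Sum>F\<in>{F\<in>?E. face_plane F = h}. (\<integral>x. indicator F x * ?j h x \<partial>plane_measure (fst h) (snd h))) =
    (\<integral>x. ?j h x \<partial>plane_measure (fst h) (snd h))" if h: "h \<in> planes" for h
  proof -
    let ?Eh = "{F\<in>?E. face_plane F = h}"
    have bF: "F \<in> sets borel" if "F \<in> ?Eh" for F using that flat_face.F_borel[OF flat_face[OF EFh]] by simp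
    have int: "integrable (plane_measure (fst h) (snd h)) (\<lambda>x. indicator F x * ?j h x)" if "F \<in> ?Eh" for F
      using integrable_mult_indicator[OF _ intj[OF h], of F] bF[OF that] by simp
    have uniq: "AE x in plane_measure (fst h) (snd h). \<forall>F\<in>?Eh. \<forall>F'\<in>?Eh. F \<noteq> F' \<longrightarrow> \<not> (x \<in> F \<and> x \<in> F')"
    proof (intro AE_finite_allI)
      fix F F' assume FF: "F \<in> ?Eh" "F' \<in> ?Eh"
      interpret flat_face F by (rule flat_face[OF EFh]) (use FF in simp)
      have [measurable]: "F' \<in> sets borel" using bF[OF FF(2)] .
      have "emeasure (face_measure F) (F \<inter> F') = 0" if "F \<noteq> F'"
        using faces EFh FF that by (auto simp: face_mesh_def pairwise_def)
      then have "F \<inter> F' \<in> null_sets (plane_measure (fst h) (snd h))" if "F \<noteq> F'"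
        using emeasure_face[of "F \<inter> F'"] that FF by auto
      then show "AE x in plane_measure (fst h) (snd h). F \<noteq> F' \<longrightarrow> \<not> (x \<in> F \<and> x \<in> F')"
        by (cases "F = F'") (auto dest: AE_not_in)
    qed (use finE in auto)
    have "(\<Sum>F\<in>?Eh. (\<integral>x. indicator F x * ?j h x \<partial>plane_measure (fst h) (snd h))) =
      (\<integral>x. (\<Sum>F\<in>?Eh. indicator F x * ?j h x) \<partial>plane_measure (fst h) (snd h))"
      by (rule Bochner_Integration.integral_sum[symmetric]) (use int in auto)
    also have "\<dots> = (\<integral>x. ?j h x \<partial>plane_measure (fst h) (snd h))"
    proof (rule integral_cong_AE)
      show "(\<lambda>x. \<Sum>F\<in>?Eh. indicator F x * ?j h x) \<in> borel_measurable (plane_measure (fst h) (snd h))"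
        by (intro borel_measurable_sum borel_measurable_integrable int)
      show "?j h \<in> borel_measurable (plane_measure (fst h) (snd h))" by (intro borel_measurable_integrable intj h)
      show "AE x in plane_measure (fst h) (snd h). (\<Sum>F\<in>?Eh. indicator F x * ?j h x) = ?j h x"
        using uniq AE_generic[OF h]
      proof eventually_elim
        case (elim x)
        show ?case
        proof (cases "jump T (fst h) x = 0")
          case False
          have "x \<in> frontier T"
          proof (rule ccontr)
            assume "x \<notin> frontier T"
            then have "x \<in> T" using False jump_support[of T "fst h" x] open_T by (auto simp: frontier_def interior_open)
            then obtain r where "r > 0" "ball x r \<subseteq> T" using open_T openE by blast
            then show False using False jump_inside by blast
          qed
          then obtain F where F: "F \<in> ?Eh" "x \<in> F"
            using generic_frontier_face[OF T h] elim(2) by blast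
          have "(\<Sum>F\<in>?Eh. indicator F x * ?j h x) = indicator F x * ?j h x"
            using finE F elim(1) by (subst sum.remove[of _ F]) (auto intro!: sum.neutral simp: indicator_def)
          then show ?thesis using F by simp
        qed simp
      qed
    qed
    finally show ?thesis .
  qed
  have "(\<Sum>F\<in>?E. \<integral>x. p x * (outward_normal T F x \<bullet> e) \<partial>face_measure F) =
    (\<Sum>h\<in>planes. \<Sum>F\<in>{F\<in>?E. face_plane F = h}. \<integral>x. p x * (outward_normal T F x \<bullet> e) \<partial>face_measure F)"
    by (rule sum.group[symmetric]) (use finE finite_Hs EFh in \<open>auto simp: planes_def\<close>)
  also have "\<dots> = (\<Sum>h\<in>planes. (fst h \<bullet> e) * (\<Sum>F\<in>{F\<in>?E. face_plane F = h}. (\<integral>x. indicator F x * ?j h x \<partial>plane_measure (fst h) (snd h))))"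
    unfolding sum_distrib_left by (intro sum.cong refl) (auto simp: each)
  also have "\<dots> = (\<Sum>h\<in>planes. (fst h \<bullet> e) * (\<integral>x. ?j h x \<partial>plane_measure (fst h) (snd h)))"
    by (intro sum.cong refl) (simp add: group)
  finally show ?thesis using divergence_flat[OF der g, of e] by simp
qed

text \<open>A generic point of an interface lies on the frontier of exactly two elements, which are
  on opposite sides.\<close>

lemma outward_normals_cancel:
  assumes F: "F \<in> Fh" and nb: "\<not> is_boundary_face \<Omega> Th F"
  shows "AE x in face_measure F. (\<Sum>T\<in>{T\<in>Th. F \<in> elt_faces Fh T}. outward_normal T F x) = 0"
proof -
  obtain T1 T2 where T: "T1 \<in> Th" "T2 \<in> Th" "T1 \<noteq> T2" "F \<subseteq> frontier T1" "F \<subseteq> frontier T2"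
    using face_props[OF F] nb by (auto simp: is_face_def is_interface_def)
  have h: "face_plane F \<in> planes" using F by (simp add: planes_def)
  show ?thesis using AE_face_generic[OF F]
  proof eventually_elim
    case (elim x)
    have "{T\<in>Th. F \<in> elt_faces Fh T} = {T1, T2}"
      using T F no_third_element[OF _ T(1-3) h, of _ x] elim by (auto simp: elt_faces_def)
    moreover have "outward_normal T2 F x = - outward_normal T1 F x"
      using opposite_sides[OF T(1-3) h, of x] elim T F
      by (simp add: outward_normal_eq elt_faces_def subset_iff)
    ultimately show ?case using T(3) by simp
  qed
qed

end

section \<open>Polynomial projections\<close>

text \<open>In contrast to \<open>restrict\<close>, extension by zero is a linear map, so images of
  polynomial spaces are subspaces.\<close>

definition ext0 :: "'a set \<Rightarrow> ('a \<Rightarrow> 'b::zero) \<Rightarrow> 'a \<Rightarrow> 'b" where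
  "ext0 X p = (\<lambda>x. if x \<in> X then p x else 0)"

lemma ext0_apply [simp]: "x \<in> X \<Longrightarrow> ext0 X p x = p x"
  by (simp add: ext0_def)

lemma linear_ext0: "linear (ext0 X :: ('a \<Rightarrow> 'b::real_vector) \<Rightarrow> _)"
  by (rule linearI) (auto simp: ext0_def fun_eq_iff)

lemma subspace_ext0_polys: "subspace V \<Longrightarrow> subspace (ext0 X ` polys l V)"
  by (rule linear_subspace_image[OF linear_ext0 subspace_polys])

lemma fin_dim_ext0_polys: "fin_dim (ext0 X ` (polys l V :: (real^'n \<Rightarrow> 'v::euclidean_space) set))"
  by (rule fin_dim_linear_image[OF fin_dim_polys linear_ext0])

context poly_measure
begin

lemma integral_cong_X: "(\<And>x. x \<in> X \<Longrightarrow> f x = g x) \<Longrightarrow> (\<integral>x. f x \<partial>M) = (\<integral>x. g x \<partial>M)"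
  by (rule Bochner_Integration.integral_cong) (auto simp: space_M)

lemma integrable_cong_X: "(\<And>x. x \<in> X \<Longrightarrow> f x = g x) \<Longrightarrow> integrable M f \<longleftrightarrow> integrable M g"
  by (rule Bochner_Integration.integrable_cong) (auto simp: space_M)

lemma integrable_inner_polys:
  fixes p q :: "real^'n \<Rightarrow> 'v::euclidean_space"
  assumes "p \<in> polys l V" "q \<in> polys l' V'" shows "integrable M (\<lambda>x. p x \<bullet> q x)"
  using continuous_polys[OF assms(1)] continuous_polys[OF assms(2)]
  by (intro integrable_continuous continuous_intros)

text \<open>Global polynomials would not do on a face, where a nonzero one can vanish identically.
  Extension by zero identifies polynomials that agree on \<open>X\<close>, and this makes the
  product definite.\<close>

lemma inner_space_ext0:
  "inner_space (ext0 X ` (polys l UNIV :: (real^'n \<Rightarrow> real) set)) (\<lambda>p q. \<integral>x. p x * q x \<partial>M)"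
proof
  let ?W = "ext0 X ` (polys l UNIV :: (real^'n \<Rightarrow> real) set)"
  show "subspace ?W" by (rule subspace_ext0_polys) simp
  show "fin_dim ?W" by (rule fin_dim_ext0_polys)
  have int: "integrable M (\<lambda>x. u x * v x)" if uv: "u \<in> ?W" "v \<in> ?W" for u v
  proof -
    obtain p q where pq: "p \<in> polys l UNIV" "q \<in> polys l UNIV" "u = ext0 X p" "v = ext0 X q" using uv by blast
    show ?thesis using integrable_inner_polys[OF pq(1,2)] by (subst integrable_cong_X[of _ "\<lambda>x. p x * q x"]) (auto simp: pq)
  qed
  fix u v w assume uvw: "u \<in> ?W" "v \<in> ?W" "w \<in> ?W"
  show "(\<integral>x. u x * v x \<partial>M) = (\<integral>x. v x * u x \<partial>M)" by (simp add: mult.commute)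
  show "(\<integral>x. (\<alpha> *\<^sub>R u + \<beta> *\<^sub>R v) x * w x \<partial>M) = \<alpha> * (\<integral>x. u x * w x \<partial>M) + \<beta> * (\<integral>x. v x * w x \<partial>M)" for \<alpha> \<beta>
    using int uvw by (simp add: distrib_right mult.assoc)
  show "(\<integral>x. u x * u x \<partial>M) \<ge> 0" by simp
  assume z: "(\<integral>x. u x * u x \<partial>M) = 0"
  obtain p where p: "p \<in> polys l UNIV" "u = ext0 X p" using uvw by auto
  have "(\<integral>x. p x \<bullet> p x \<partial>M) = 0" using z by (subst integral_cong_X[of _ "\<lambda>x. u x * u x"]) (auto simp: p)
  then have "\<And>x. x \<in> X \<Longrightarrow> p x = 0"
    using square_integral_zero[OF polynomial_function_polys[OF p(1)]] by blast
  then show "u = 0" by (auto simp: p ext0_def fun_eq_iff)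
qed

lemma L2_proj_unique:
  fixes g :: "real^'n \<Rightarrow> real"
  assumes g: "integrable M g" and bd: "\<And>x. x \<in> X \<Longrightarrow> \<bar>g x\<bar> \<le> B"
  shows "\<exists>!p. p \<in> poly_space l X UNIV \<and> (\<forall>q\<in>poly_space l X UNIV. (\<integral>x. (g x - p x) * q x \<partial>M) = 0)"
proof -
  let ?W = "ext0 X ` (polys l UNIV :: (real^'n \<Rightarrow> real) set)"
  interpret inner_space ?W "\<lambda>p q. \<integral>x. p x * q x \<partial>M" by (rule inner_space_ext0)
  have int: "integrable M (\<lambda>x. g x * w x)" if w: "w \<in> polys l UNIV" for w
  proof -
    obtain C where C: "\<And>x. x \<in> X \<Longrightarrow> norm (w x) \<le> C" using bounded_on_X[OF continuous_polys[OF w]] by blast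
    show ?thesis
    proof (rule integrable_bounded[where B="B * C"])
      show "(\<lambda>x. g x * w x) \<in> borel_measurable M"
        using g continuous_M[OF continuous_polys[OF w]] by (intro borel_measurable_times) auto
      show "norm (g x * w x) \<le> B * C" if "x \<in> X" for x
        using mult_mono[OF bd[OF that] C[OF that]] bd[OF that] by (simp add: abs_mult)
    qed
  qed
  have intW: "integrable M (\<lambda>x. g x * w x)" if w: "w \<in> ?W" for w
  proof -
    obtain p where "p \<in> polys l UNIV" "w = ext0 X p" using w by blast
    then show ?thesis using int by (subst integrable_cong_X[of _ "\<lambda>x. g x * p x"]) auto
  qed
  have "lin_on ?W (\<lambda>w. \<integral>x. g x * w x \<partial>M)"
    by (rule lin_onI) (simp add: intW distrib_left mult.left_commute)
  from riesz[OF this] have ex1: "\<exists>!u. u \<in> ?W \<and> (\<forall>w\<in>?W. (\<integral>x. u x * w x \<partial>M) = (\<integral>x. g x * w x \<partial>M))" .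
  \<comment> \<open>Translates the orthogonality in \<open>L2_proj\<close>, stated with
    \<open>restrict\<close>, into the Riesz equation for extensions by zero; on \<open>X\<close> the
    two encodings agree.\<close>
  have eq: "(\<forall>q\<in>poly_space l X UNIV. (\<integral>x. (g x - restrict p X x) * q x \<partial>M) = 0) \<longleftrightarrow>
     (\<forall>w\<in>?W. (\<integral>x. ext0 X p x * w x \<partial>M) = (\<integral>x. g x * w x \<partial>M))" if p: "p \<in> polys l UNIV" for p
  proof -
    have "(\<integral>x. (g x - restrict p X x) * restrict w X x \<partial>M) = (\<integral>x. g x * ext0 X w x \<partial>M) - (\<integral>x. ext0 X p x * ext0 X w x \<partial>M)"
      if w: "w \<in> polys l UNIV" for w
    proof -
      have "(\<integral>x. (g x - restrict p X x) * restrict w X x \<partial>M) = (\<integral>x. g x * w x - p x * w x \<partial>M)"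
        by (rule integral_cong_X) (simp add: left_diff_distrib)
      also have "\<dots> = (\<integral>x. g x * w x \<partial>M) - (\<integral>x. p x * w x \<partial>M)"
        using int[OF w] integrable_inner_polys[OF p w] by (intro Bochner_Integration.integral_diff) auto
      also have "(\<integral>x. g x * w x \<partial>M) = (\<integral>x. g x * ext0 X w x \<partial>M)" by (rule integral_cong_X) simp
      also have "(\<integral>x. p x * w x \<partial>M) = (\<integral>x. ext0 X p x * ext0 X w x \<partial>M)" by (rule integral_cong_X) simp
      finally show ?thesis .
    qed
    then show ?thesis unfolding poly_space_def by auto
  qed
  from ex1 obtain p where p: "p \<in> polys l UNIV" "\<forall>w\<in>?W. (\<integral>x. ext0 X p x * w x \<partial>M) = (\<integral>x. g x * w x \<partial>M)" by blast
  show ?thesis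
  proof (rule ex1I[of _ "restrict p X"])
    show "restrict p X \<in> poly_space l X UNIV \<and> (\<forall>q\<in>poly_space l X UNIV. (\<integral>x. (g x - restrict p X x) * q x \<partial>M) = 0)"
      using p eq[OF p(1)] by (auto simp: poly_space_def)
    fix p' assume p': "p' \<in> poly_space l X UNIV \<and> (\<forall>q\<in>poly_space l X UNIV. (\<integral>x. (g x - p' x) * q x \<partial>M) = 0)"
    then obtain r where r: "r \<in> polys l UNIV" "p' = restrict r X" by (auto simp: poly_space_def)
    then have "\<forall>w\<in>?W. (\<integral>x. ext0 X r x * w x \<partial>M) = (\<integral>x. g x * w x \<partial>M)" using eq[OF r(1)] p' by simp
    then have "ext0 X r = ext0 X p" using ex1 p r(1) by blast
    then have "r x = p x" if "x \<in> X" for x using that by (metis ext0_apply)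
    then show "p' = restrict p X" by (auto simp: r restrict_def)
  qed
qed

lemma L2_proj_props:
  fixes g :: "real^'n \<Rightarrow> real"
  assumes "integrable M g" "\<And>x. x \<in> X \<Longrightarrow> \<bar>g x\<bar> \<le> B"
  shows "L2_proj M X l g \<in> poly_space l X UNIV"
    "q \<in> poly_space l X UNIV \<Longrightarrow> (\<integral>x. (g x - L2_proj M X l g x) * q x \<partial>M) = 0"
  using theI'[OF L2_proj_unique[OF assms, of l]] unfolding L2_proj_def by blast+

lemma L2_proj_eqI:
  fixes g :: "real^'n \<Rightarrow> real"
  assumes "integrable M g" "\<And>x. x \<in> X \<Longrightarrow> \<bar>g x\<bar> \<le> B"
    "p \<in> poly_space l X UNIV" "\<And>q. q \<in> poly_space l X UNIV \<Longrightarrow> (\<integral>x. (g x - p x) * q x \<partial>M) = 0"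
  shows "L2_proj M X l g = p"
  using the1_equality[OF L2_proj_unique[OF assms(1,2), of l]] assms(3,4) unfolding L2_proj_def by blast

lemma L2_proj_cong: "(\<And>x. x \<in> X \<Longrightarrow> g x = g' x) \<Longrightarrow> L2_proj M X l g = L2_proj M X l g'"
proof -
  assume "\<And>x. x \<in> X \<Longrightarrow> g x = g' x"
  then have "(\<integral>x. (g x - p x) * q x \<partial>M) = (\<integral>x. (g' x - p x) * q x \<partial>M)" for p q
    by (intro integral_cong_X) simp
  then show ?thesis unfolding L2_proj_def by simp
qed

lemma L2_proj_id:
  assumes "p \<in> polys l UNIV" "\<And>x. x \<in> X \<Longrightarrow> g x = p x" "x \<in> X"
  shows "L2_proj M X l g x = g x"
proof -
  obtain B where B: "\<And>x. x \<in> X \<Longrightarrow> norm (p x) \<le> B" using bounded_on_X[OF continuous_polys[OF assms(1)]] by blast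
  have "L2_proj M X l p = restrict p X"
  proof (rule L2_proj_eqI)
    show "integrable M p" by (rule integrable_continuous[OF continuous_polys[OF assms(1)]])
    show "restrict p X \<in> poly_space l X UNIV" using assms(1) by (auto simp: poly_space_def)
    show "(\<integral>x. (p x - restrict p X x) * q x \<partial>M) = 0" for q
      by (subst integral_cong_X[of _ "\<lambda>_. 0"]) auto
  qed (use B in auto)
  moreover have "L2_proj M X l g = L2_proj M X l p" by (rule L2_proj_cong) (rule assms(2))
  ultimately show ?thesis using assms by simp
qed

text \<open>By uniqueness: the combination of the two projections satisfies the orthogonality that
  characterises the projection of the combination.\<close>

lemma L2_proj_lincomb:
  fixes g g' :: "real^'n \<Rightarrow> real"
  assumes g: "integrable M g" "\<And>x. x \<in> X \<Longrightarrow> \<bar>g x\<bar> \<le> B"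
    and g': "integrable M g'" "\<And>x. x \<in> X \<Longrightarrow> \<bar>g' x\<bar> \<le> B'" and x: "x \<in> X"
  shows "L2_proj M X l (\<lambda>x. \<alpha> * g x + \<beta> * g' x) x = \<alpha> * L2_proj M X l g x + \<beta> * L2_proj M X l g' x"
proof -
  obtain p p' where p: "p \<in> polys l UNIV" "L2_proj M X l g = restrict p X"
    and p': "p' \<in> polys l UNIV" "L2_proj M X l g' = restrict p' X"
    using L2_proj_props(1)[OF g, of l] L2_proj_props(1)[OF g', of l] unfolding poly_space_def by blast
  let ?r = "\<alpha> *\<^sub>R p + \<beta> *\<^sub>R p'"
  have r: "?r \<in> polys l UNIV" using p p' by (intro subspace_add subspace_scale subspace_polys) auto
  have int: "integrable M (\<lambda>x. (h x - s x) * w x)"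
    if h: "integrable M h" "\<And>x. x \<in> X \<Longrightarrow> \<bar>h x\<bar> \<le> C" and sw: "s \<in> polys l UNIV" "w \<in> polys l UNIV" for h s w :: "real^'n \<Rightarrow> real" and C
  proof -
    obtain D where D: "\<And>x. x \<in> X \<Longrightarrow> norm (s x) \<le> D" using bounded_on_X[OF continuous_polys[OF sw(1)]] by blast
    obtain E where E: "\<And>x. x \<in> X \<Longrightarrow> norm (w x) \<le> E" using bounded_on_X[OF continuous_polys[OF sw(2)]] by blast
    show ?thesis
    proof (rule integrable_bounded[where B="(C + D) * E"])
      show "(\<lambda>x. (h x - s x) * w x) \<in> borel_measurable M"
        using h(1) continuous_M[OF continuous_polys[OF sw(1)]] continuous_M[OF continuous_polys[OF sw(2)]]
        by (intro borel_measurable_times borel_measurable_diff) auto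
      show "norm ((h x - s x) * w x) \<le> (C + D) * E" if "x \<in> X" for x
      proof -
        have "\<bar>h x - s x\<bar> \<le> C + D" using h(2)[OF that] D[OF that] by simp
        from mult_mono[OF this E[OF that]] this show ?thesis by (simp add: abs_mult)
      qed
    qed
  qed
  have "L2_proj M X l (\<lambda>x. \<alpha> * g x + \<beta> * g' x) = restrict ?r X"
  proof (rule L2_proj_eqI[where B="\<bar>\<alpha>\<bar> * B + \<bar>\<beta>\<bar> * B'"])
    show "integrable M (\<lambda>x. \<alpha> * g x + \<beta> * g' x)" using g g' by auto
    show "\<bar>\<alpha> * g x + \<beta> * g' x\<bar> \<le> \<bar>\<alpha>\<bar> * B + \<bar>\<beta>\<bar> * B'" if "x \<in> X" for x
    proof -
      have "\<bar>\<alpha> * g x + \<beta> * g' x\<bar> \<le> \<bar>\<alpha>\<bar> * \<bar>g x\<bar> + \<bar>\<beta>\<bar> * \<bar>g' x\<bar>"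
        using abs_triangle_ineq[of "\<alpha> * g x" "\<beta> * g' x"] by (simp add: abs_mult)
      also have "\<dots> \<le> \<bar>\<alpha>\<bar> * B + \<bar>\<beta>\<bar> * B'" using g(2)[OF that] g'(2)[OF that] by (intro add_mono mult_left_mono) auto
      finally show ?thesis .
    qed
    show "restrict ?r X \<in> poly_space l X UNIV" unfolding poly_space_def using r by blast
    fix q assume q: "q \<in> poly_space l X (UNIV :: real set)"
    then obtain w where w: "w \<in> polys l UNIV" "q = restrict w X" by (auto simp: poly_space_def)
    have "(\<integral>x. (g x - p x) * w x \<partial>M) = (\<integral>x. (g x - L2_proj M X l g x) * q x \<partial>M)"
      "(\<integral>x. (g' x - p' x) * w x \<partial>M) = (\<integral>x. (g' x - L2_proj M X l g' x) * q x \<partial>M)"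
      by (rule integral_cong_X, simp add: p p' w)+
    then have z: "(\<integral>x. (g x - p x) * w x \<partial>M) = 0" "(\<integral>x. (g' x - p' x) * w x \<partial>M) = 0"
      using L2_proj_props(2)[OF g q] L2_proj_props(2)[OF g' q] by simp_all
    have "(\<integral>x. (\<alpha> * g x + \<beta> * g' x - restrict ?r X x) * q x \<partial>M) =
      (\<integral>x. \<alpha> * ((g x - p x) * w x) + \<beta> * ((g' x - p' x) * w x) \<partial>M)"
      by (rule integral_cong_X) (simp add: w algebra_simps)
    also have "\<dots> = \<alpha> * (\<integral>x. (g x - p x) * w x \<partial>M) + \<beta> * (\<integral>x. (g' x - p' x) * w x \<partial>M)"
      using int[OF g p(1) w(1)] int[OF g' p'(1) w(1)] by simp
    finally show "(\<integral>x. (\<alpha> * g x + \<beta> * g' x - restrict ?r X x) * q x \<partial>M) = 0" using z by simp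
  qed
  then show ?thesis using x by (simp add: p p')
qed

lemma vec_L2_proj_cong:
  assumes "\<And>x. x \<in> X \<Longrightarrow> g x = g' x" shows "vec_L2_proj M X l g = vec_L2_proj M X l g'"
proof -
  have "L2_proj M X l (\<lambda>y. g y $ i) = L2_proj M X l (\<lambda>y. g' y $ i)" for i
    by (rule L2_proj_cong) (simp add: assms)
  then show ?thesis by (simp add: vec_L2_proj_def)
qed

lemma vec_L2_proj_id:
  assumes "p \<in> polys l UNIV" "\<And>x. x \<in> X \<Longrightarrow> g x = p x" "x \<in> X"
  shows "vec_L2_proj M X l g x = g x"
proof -
  have "L2_proj M X l (\<lambda>y. g y $ i) x = g x $ i" for i
    by (rule L2_proj_id[OF polys_component[OF assms(1), of i]]) (use assms in auto)
  then show ?thesis using assms(3) by (simp add: vec_L2_proj_def vec_eq_iff)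
qed

lemma continuous_comp_bounds:
  fixes g :: "real^'n \<Rightarrow> real^'n"
  assumes "continuous_on UNIV p" "\<And>x. x \<in> X \<Longrightarrow> g x = p x"
  obtains B where "\<And>i. integrable M (\<lambda>x. g x $ i)" "\<And>i x. x \<in> X \<Longrightarrow> \<bar>g x $ i\<bar> \<le> B"
proof -
  obtain B where B: "\<And>x. x \<in> X \<Longrightarrow> norm (p x) \<le> B" using bounded_on_X[OF assms(1)] by blast
  have "integrable M (\<lambda>x. p x $ i)" for i using assms(1) by (intro integrable_continuous continuous_intros)
  then have "integrable M (\<lambda>x. g x $ i)" for i
    by (subst integrable_cong_X[of _ "\<lambda>x. p x $ i"]) (use assms(2) in auto)
  moreover have "\<bar>g x $ i\<bar> \<le> B" if "x \<in> X" for x i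
    using B[OF that] component_le_norm_cart[of "p x" i] assms(2)[OF that] by simp
  ultimately show ?thesis using that by blast
qed

lemma vec_L2_proj_lincomb:
  fixes g g' :: "real^'n \<Rightarrow> real^'n"
  assumes "continuous_on UNIV p" "\<And>x. x \<in> X \<Longrightarrow> g x = p x"
    and "continuous_on UNIV p'" "\<And>x. x \<in> X \<Longrightarrow> g' x = p' x" and x: "x \<in> X"
  shows "vec_L2_proj M X l (\<lambda>x. \<alpha> *\<^sub>R g x + \<beta> *\<^sub>R g' x) x = \<alpha> *\<^sub>R vec_L2_proj M X l g x + \<beta> *\<^sub>R vec_L2_proj M X l g' x"
proof -
  obtain B where B: "\<And>i. integrable M (\<lambda>x. g x $ i)" "\<And>i x. x \<in> X \<Longrightarrow> \<bar>g x $ i\<bar> \<le> B"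
    using continuous_comp_bounds[OF assms(1,2)] by blast
  obtain B' where B': "\<And>i. integrable M (\<lambda>x. g' x $ i)" "\<And>i x. x \<in> X \<Longrightarrow> \<bar>g' x $ i\<bar> \<le> B'"
    using continuous_comp_bounds[OF assms(3,4)] by blast
  show ?thesis
    using L2_proj_lincomb[OF B(1) B(2) B'(1) B'(2) x] x by (simp add: vec_L2_proj_def vec_eq_iff)
qed

lemma vec_L2_proj_poly:
  fixes g :: "real^'n \<Rightarrow> real^'n"
  assumes "continuous_on UNIV p" "\<And>x. x \<in> X \<Longrightarrow> g x = p x"
  shows "\<exists>r\<in>polys l UNIV. \<forall>x\<in>X. vec_L2_proj M X l g x = r x"
proof -
  obtain B where B: "\<And>i. integrable M (\<lambda>x. g x $ i)" "\<And>i x. x \<in> X \<Longrightarrow> \<bar>g x $ i\<bar> \<le> B"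
    using continuous_comp_bounds[OF assms] by blast
  have "\<forall>i. \<exists>r\<in>polys l UNIV. L2_proj M X l (\<lambda>y. g y $ i) = restrict r X"
    using L2_proj_props(1)[OF B(1) B(2)] by (auto simp: poly_space_def)
  then obtain r where r: "\<And>i. r i \<in> polys l UNIV" "\<And>i. L2_proj M X l (\<lambda>y. g y $ i) = restrict (r i) X" by metis
  have "(\<lambda>x. \<chi> i. r i x) \<in> polys l UNIV" by (rule polys_vec) (simp add: r)
  then show ?thesis by (intro bexI) (auto simp: vec_L2_proj_def r)
qed

end

section \<open>Traces and differential operators on polynomials\<close>

text \<open>A frontier point of an open \<open>T\<close> lies outside \<open>T\<close> but in its
  closure, so the limit within \<open>T\<close> is unique and involves only values on
  \<open>T\<close>.\<close>

lemma trace_continuous: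
  fixes p :: "real^'n \<Rightarrow> 'v::t2_space"
  assumes "open T" "x \<in> frontier T" "continuous_on UNIV p" "\<And>y. y \<in> T \<Longrightarrow> g y = p y"
  shows "trace T g x = p x"
proof -
  have x: "x \<notin> T" "x \<in> closure T" using assms(1,2) by (auto simp: frontier_def interior_open)
  then have "at x within T \<noteq> bot" by (simp add: closure_def trivial_limit_within)
  moreover have "(p \<longlongrightarrow> p x) (at x within T)"
    using assms(3) by (metis UNIV_I continuous_on_def tendsto_within_subset top_greatest)
  then have "(g \<longlongrightarrow> p x) (at x within T)"
    by (rule Lim_transform_eventually) (auto simp: eventually_at_filter assms(4))
  ultimately show ?thesis unfolding trace_def by (rule tendsto_Lim)
qed

lemma subspace_sym_mats: "subspace sym_mats"
  by (auto simp: subspace_def sym_mats_def transpose_def vec_eq_iff)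

text \<open>Symmetrising all coefficients does not change a polynomial with symmetric values, and it
  brings the coefficients into the set that \<open>polys\<close> prescribes.\<close>

lemma polys_sym_mats:
  assumes "p \<in> polys l UNIV" "\<And>x. p x \<in> sym_mats"
  shows "p \<in> polys l sym_mats"
proof -
  let ?L = "\<lambda>A::real^'m^'m. (1/2) *\<^sub>R (A + transpose A)"
  have "linear ?L" by (rule linearI) (auto simp: transpose_def vec_eq_iff algebra_simps)
  moreover have "?L ` UNIV \<subseteq> sym_mats" by (auto simp: sym_mats_def transpose_def vec_eq_iff)
  ultimately have "(\<lambda>x. ?L (p x)) \<in> polys l sym_mats" by (rule polys_compose_linear[OF assms(1)])
  moreover have "?L (p x) = p x" for x
    using assms(2)[of x] by (simp add: sym_mats_def scaleR_2[symmetric])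
  ultimately show ?thesis by simp
qed

lemma sym_grad_in_sym_mats: "sym_grad w x \<in> sym_mats"
  by (simp add: sym_grad_def sym_mats_def transpose_def vec_eq_iff add.commute)

lemma polys_half_comb:
  assumes "f \<in> polys l UNIV" "g \<in> polys l (UNIV :: real set)"
  shows "(\<lambda>x. (f x + g x) / 2) \<in> polys l UNIV" "(\<lambda>x. (f x - g x) / 2) \<in> polys l UNIV"
proof -
  have "(1/2) *\<^sub>R (f + g) \<in> polys l UNIV" "(1/2) *\<^sub>R (f - g) \<in> polys l UNIV"
    using assms by (auto intro!: subspace_scale subspace_add subspace_diff subspace_polys)
  moreover have "(1/2) *\<^sub>R (f + g) = (\<lambda>x. (f x + g x) / 2)" "(1/2) *\<^sub>R (f - g) = (\<lambda>x. (f x - g x) / 2)"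
    by (auto simp: fun_eq_iff)
  ultimately show "(\<lambda>x. (f x + g x) / 2) \<in> polys l UNIV" "(\<lambda>x. (f x - g x) / 2) \<in> polys l UNIV" by simp_all
qed

lemma sym_grad_polys: "w \<in> polys l UNIV \<Longrightarrow> sym_grad w \<in> polys l sym_mats"
proof (rule polys_sym_mats[OF _ sym_grad_in_sym_mats])
  assume w: "w \<in> polys l UNIV"
  show "sym_grad w \<in> polys l UNIV"
    by (rule polys_vec, rule polys_vec) (auto simp: sym_grad_def intro!: polys_half_comb polys_component partial_polys w)
qed

lemma skew_grad_polys: "w \<in> polys l UNIV \<Longrightarrow> skew_grad w \<in> polys l UNIV"
  by (rule polys_vec, rule polys_vec) (auto simp: skew_grad_def intro!: polys_half_comb polys_component partial_polys)

lemma divergence_polys: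
  assumes "\<tau> \<in> polys l UNIV" shows "divergence \<tau> \<in> polys l UNIV"
proof (rule polys_vec)
  fix i
  have "(\<lambda>x. \<Sum>j\<in>UNIV. partial j \<tau> x $ i $ j) \<in> polys l UNIV"
    by (intro polys_sum_fn polys_component partial_polys assms) auto
  then show "(\<lambda>x. divergence \<tau> x $ i) \<in> polys l UNIV" by (simp add: divergence_def)
qed

lemma polys_UNIV: "p \<in> polys l V \<Longrightarrow> p \<in> polys l UNIV"
  by (auto simp: polys_def)

lemma partial_polys_lincomb:
  fixes p :: "real^'n \<Rightarrow> 'v::euclidean_space"
  assumes "p \<in> polys l V" "q \<in> polys l V"
  shows "partial i (\<alpha> *\<^sub>R p + \<beta> *\<^sub>R q) x = \<alpha> *\<^sub>R partial i p x + \<beta> *\<^sub>R partial i q x"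
  using assms by (intro partial_lincomb differentiable_polys)

lemma lin_on_sym_grad: "lin_on (polys l UNIV) sym_grad"
  by (rule lin_onI) (auto simp: sym_grad_def fun_eq_iff vec_eq_iff partial_polys_lincomb algebra_simps add_divide_distrib)

lemma lin_on_skew_grad: "lin_on (polys l UNIV) skew_grad"
  by (rule lin_onI) (auto simp: skew_grad_def fun_eq_iff vec_eq_iff partial_polys_lincomb algebra_simps add_divide_distrib diff_divide_distrib)

lemma lin_on_divergence: "lin_on (polys l V) divergence"
  by (rule lin_onI) (auto simp: divergence_def fun_eq_iff vec_eq_iff partial_polys_lincomb sum.distrib sum_distrib_left)

lemma grad_affine:
  fixes A :: "real^'n^'n"
  shows "partial i (\<lambda>x. A *v x + b) x $ j = A $ j $ i"
proof -
  have "((\<lambda>x. A *v x + b) has_derivative (\<lambda>h. A *v h)) (at x)"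
    by (auto intro!: derivative_eq_intros bounded_linear_imp_has_derivative matrix_vector_mul_bounded_linear)
  from partial_eqI[OF this, of i] show ?thesis by (simp add: matrix_vector_mult_basis column_def)
qed

lemma skew_grad_affine: "skew_grad (\<lambda>x. A *v x + b) x = (1/2) *\<^sub>R (transpose A - A)"
  by (simp add: skew_grad_def grad_affine vec_eq_iff transpose_def)

lemma sym_grad_affine: "sym_grad (\<lambda>x. A *v x + b) x = (1/2) *\<^sub>R (transpose A + A)"
  by (simp add: sym_grad_def grad_affine vec_eq_iff transpose_def)

lemma quadratic_form_symmetrized:
  fixes h :: "real^'n" and P :: "'n \<Rightarrow> real^'n"
  shows "(\<Sum>i\<in>UNIV. h $ i *\<^sub>R P i) \<bullet> h = (\<Sum>i\<in>UNIV. \<Sum>j\<in>UNIV. h $ i * h $ j * ((P i $ j + P j $ i) / 2))"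
proof -
  let ?a = "\<lambda>i j. h $ i * h $ j * P i $ j / 2"
  have "(\<Sum>i\<in>UNIV. \<Sum>j\<in>UNIV. h $ i * h $ j * ((P i $ j + P j $ i) / 2)) =
    (\<Sum>i\<in>UNIV. \<Sum>j\<in>UNIV. ?a i j) + (\<Sum>i\<in>UNIV. \<Sum>j\<in>UNIV. ?a j i)"
    by (simp add: sum.distrib[symmetric] distrib_left add_divide_distrib mult.commute)
  also have "(\<Sum>i\<in>UNIV. \<Sum>j\<in>UNIV. ?a j i) = (\<Sum>i\<in>UNIV. \<Sum>j\<in>UNIV. ?a i j)" by (rule sum.swap)
  also have "(\<Sum>i\<in>UNIV. \<Sum>j\<in>UNIV. ?a i j) + (\<Sum>i\<in>UNIV. \<Sum>j\<in>UNIV. ?a i j) =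
    (\<Sum>i\<in>UNIV. \<Sum>j\<in>UNIV. h $ i * h $ j * P i $ j)"
    by (simp add: sum.distrib[symmetric] mult.assoc)
  also have "\<dots> = (\<Sum>i\<in>UNIV. h $ i * (P i \<bullet> h))"
    by (simp add: inner_vec_def sum_distrib_left mult_ac)
  also have "\<dots> = (\<Sum>i\<in>UNIV. h $ i *\<^sub>R P i) \<bullet> h" by (simp add: inner_sum_left)
  finally show ?thesis by simp
qed

text \<open>A polynomial with vanishing symmetric gradient satisfies \<open>(r x - r y) \<bullet> (x - y) = 0\<close>
  along segments; polarising at the centre of a ball shows that it is affine there.\<close>

lemma sym_grad_zero_affine:
  fixes r :: "real^'n \<Rightarrow> real^'n"
  assumes r: "r \<in> polys l UNIV" and T: "open T" "T \<noteq> {}" and z: "\<And>x. x \<in> T \<Longrightarrow> sym_grad r x = 0"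
  obtains A b where "transpose A = - A" "r = (\<lambda>x. A *v x + b)"
proof -
  obtain x0 \<delta> where \<delta>: "\<delta> > 0" "ball x0 \<delta> \<subseteq> T" using T openE by blast
  have quad: "(r x - r y) \<bullet> (x - y) = 0" if "x \<in> ball x0 \<delta>" "y \<in> ball x0 \<delta>" for x y
  proof -
    let ?h = "x - y"
    let ?f = "\<lambda>t::real. r (y + t *\<^sub>R ?h) \<bullet> ?h"
    have "(?f has_real_derivative 0) (at t within {0..1})" if t: "t \<in> {0..1}" for t
    proof -
      have "y + t *\<^sub>R ?h \<in> ball x0 \<delta>"
        using convexD_alt[OF convex_ball \<open>y \<in> ball x0 \<delta>\<close> \<open>x \<in> ball x0 \<delta>\<close>, of t] t by (simp add: algebra_simps)
      then have sg: "sym_grad r (y + t *\<^sub>R ?h) = 0" using z \<delta> by blast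
      have 1: "((\<lambda>t. y + t *\<^sub>R ?h) has_derivative (\<lambda>s. s *\<^sub>R ?h)) (at t within {0..1})"
        by (auto intro!: derivative_eq_intros)
      have 2: "(r has_derivative (\<lambda>h. \<Sum>i\<in>UNIV. h $ i *\<^sub>R partial i r (y + t *\<^sub>R ?h))) (at (y + t *\<^sub>R ?h))"
        by (rule has_derivative_partial[OF differentiable_polys[OF r]])
      have 3: "((\<lambda>t. r (y + t *\<^sub>R ?h)) has_derivative (\<lambda>s. \<Sum>i\<in>UNIV. (s *\<^sub>R ?h) $ i *\<^sub>R partial i r (y + t *\<^sub>R ?h))) (at t within {0..1})"
        using has_derivative_compose[OF 1 2] by simp
      have "(\<Sum>i\<in>UNIV. ?h $ i *\<^sub>R partial i r (y + t *\<^sub>R ?h)) \<bullet> ?h =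
        (\<Sum>i\<in>UNIV. \<Sum>j\<in>UNIV. ?h $ i * ?h $ j * sym_grad r (y + t *\<^sub>R ?h) $ i $ j)"
        unfolding quadratic_form_symmetrized by (simp add: sym_grad_def)
      then have 4: "(\<Sum>i\<in>UNIV. ?h $ i *\<^sub>R partial i r (y + t *\<^sub>R ?h)) \<bullet> ?h = 0" by (simp add: sg)
      have "(?f has_derivative (\<lambda>s. (\<Sum>i\<in>UNIV. (s *\<^sub>R ?h) $ i *\<^sub>R partial i r (y + t *\<^sub>R ?h)) \<bullet> ?h)) (at t within {0..1})"
        by (rule has_derivative_inner_left[OF 3])
      moreover have "(\<Sum>i\<in>UNIV. (s *\<^sub>R ?h) $ i *\<^sub>R partial i r (y + t *\<^sub>R ?h)) \<bullet> ?h = 0" for s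
      proof -
        have "(\<Sum>i\<in>UNIV. (s *\<^sub>R ?h) $ i *\<^sub>R partial i r (y + t *\<^sub>R ?h)) = s *\<^sub>R (\<Sum>i\<in>UNIV. ?h $ i *\<^sub>R partial i r (y + t *\<^sub>R ?h))"
          by (simp add: scaleR_sum_right)
        then show ?thesis using 4 by simp
      qed
      moreover have "(*) (0::real) = (\<lambda>s. 0)" by auto
      ultimately show ?thesis unfolding has_field_derivative_def by simp
    qed
    then have "\<exists>c. \<forall>t\<in>{0..1}. ?f t = c"
      by (intro has_field_derivative_zero_constant convex_real_interval(5))
    then obtain c where "\<And>t. t \<in> {0..1} \<Longrightarrow> ?f t = c" by blast
    from this[of 0] this[of 1] have "r x \<bullet> ?h = r y \<bullet> ?h" by simp
    then show ?thesis by (simp add: inner_diff_left)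
  qed
  define s where "s v = r (x0 + v) - r x0" for v
  have s0: "s v \<bullet> v = 0" if "norm v < \<delta>" for v
    using quad[of "x0 + v" x0] that \<delta>(1) by (simp add: s_def dist_norm)
  \<comment> \<open>Polarisation: in the expansion of
    \<open>(s v - s w) \<bullet> (v - w) = 0\<close> the diagonal terms drop out by
    \<open>s0\<close>.\<close>
  have s1: "s v \<bullet> w = - (s w \<bullet> v)" if "norm v < \<delta>" "norm w < \<delta>" for v w
  proof -
    have "(s v - s w) \<bullet> (v - w) = 0"
      using quad[of "x0 + v" "x0 + w"] that by (simp add: s_def dist_norm)
    then show ?thesis using s0[OF that(1)] s0[OF that(2)] by (simp add: inner_diff_left inner_diff_right)
  qed
  define \<epsilon> where "\<epsilon> = \<delta> / 2"
  have \<epsilon>: "\<epsilon> > 0" "\<epsilon> < \<delta>" using \<delta> by (auto simp: \<epsilon>_def)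
  \<comment> \<open>By skewness, component \<open>j\<close> of \<open>s v\<close> is the inner
    product of \<open>v\<close> with \<open>- s (\<epsilon> *\<^sub>R axis j 1)\<close>, divided by
    \<open>\<epsilon>\<close>. This dictates the rows of \<open>A\<close>; the scale
    \<open>\<epsilon>\<close> keeps the axis vectors inside the ball.\<close>
  define A :: "real^'n^'n" where "A = (\<chi> j. (- 1 / \<epsilon>) *\<^sub>R s (\<epsilon> *\<^sub>R axis j 1))"
  have sA: "s v = A *v v" if "norm v < \<delta>" for v
  proof -
    have "s v $ j = (A *v v) $ j" for j
    proof -
      have n: "norm (\<epsilon> *\<^sub>R axis j 1 :: real^'n) < \<delta>" using \<epsilon> by simp
      have "\<epsilon> * s v $ j = s v \<bullet> (\<epsilon> *\<^sub>R axis j 1)" by (simp add: inner_axis)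
      also have "\<dots> = - (s (\<epsilon> *\<^sub>R axis j 1) \<bullet> v)" by (rule s1[OF that n])
      finally have "s v $ j = (- 1 / \<epsilon>) * (s (\<epsilon> *\<^sub>R axis j 1) \<bullet> v)" using \<epsilon> by (simp add: field_simps)
      then show ?thesis by (simp add: A_def matrix_vector_mult_def inner_vec_def sum_distrib_left mult_ac)
    qed
    then show ?thesis by (simp add: vec_eq_iff)
  qed
  have skew: "transpose A = - A"
  proof -
    have "A $ i $ j = - A $ j $ i" for i j
    proof -
      have n: "norm (\<epsilon> *\<^sub>R axis j 1 :: real^'n) < \<delta>" for j :: 'n using \<epsilon> by simp
      from s1[OF n[of i] n[of j]]
      have "\<epsilon> * (s (\<epsilon> *\<^sub>R axis i 1) $ j) = - (\<epsilon> * (s (\<epsilon> *\<^sub>R axis j 1) $ i))" by (simp add: inner_axis)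
      then have "\<epsilon> * (s (\<epsilon> *\<^sub>R axis i 1) $ j + s (\<epsilon> *\<^sub>R axis j 1) $ i) = 0" by (simp add: distrib_left)
      then have "s (\<epsilon> *\<^sub>R axis i 1) $ j = - (s (\<epsilon> *\<^sub>R axis j 1) $ i)" using \<epsilon> by (simp add: eq_neg_iff_add_eq_0)
      then show ?thesis by (simp add: A_def)
    qed
    then show ?thesis unfolding vec_eq_iff transpose_def vec_lambda_beta vector_uminus_component by blast
  qed
  define b where "b = r x0 - A *v x0"
  have eq: "r x = A *v x + b" if "x \<in> ball x0 \<delta>" for x
  proof -
    have "norm (x - x0) < \<delta>" using that by (simp add: dist_norm norm_minus_commute)
    from sA[OF this] have "r x - r x0 = A *v x - A *v x0" by (simp add: s_def matrix_vector_mult_diff_distrib)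
    then show ?thesis by (simp add: b_def algebra_simps)
  qed
  \<comment> \<open>Affine maps have degree one, while \<open>l\<close> may be 0.\<close>
  let ?l = "max l 1"
  have "r \<in> polys ?l UNIV" "(\<lambda>x. A *v x + b) \<in> polys ?l UNIV"
    using r polys_mono[of l ?l UNIV] polys_affine[of ?l A b] by auto
  then have "r - (\<lambda>x. A *v x + b) \<in> polys ?l UNIV" by (rule subspace_diff[OF subspace_polys[OF subspace_UNIV]])
  then have pf: "polynomial_function (r - (\<lambda>x. A *v x + b))" by (rule polynomial_function_polys)
  have "(r - (\<lambda>x. A *v x + b)) x = 0" for x
  proof (rule polynomial_zero_open[OF pf open_ball])
    show "ball x0 \<delta> \<noteq> {}" using \<delta>(1) by simp
    show "(r - (\<lambda>x. A *v x + b)) y = 0" if "y \<in> ball x0 \<delta>" for y using eq[OF that] by simp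
  qed
  then have "r = (\<lambda>x. A *v x + b)" by (intro ext) simp
  then show ?thesis using that skew by blast
qed

section \<open>Local reconstructions\<close>

lemma bounded_linear_transpose: "bounded_linear (transpose :: real^'n^'m \<Rightarrow> real^'m^'n)"
  by (subst linear_conv_bounded_linear[symmetric], rule linearI) (auto simp: transpose_def vec_eq_iff)

lemma continuous_on_vector_matrix_mult:
  fixes v :: "'a::topological_space \<Rightarrow> real^'n" and \<tau> :: "'a \<Rightarrow> real^'n^'n"
  assumes "continuous_on S v" "continuous_on S \<tau>"
  shows "continuous_on S (\<lambda>x. v x v* \<tau> x)"
  unfolding vector_matrix_mult_def using assms by (intro continuous_intros)

lemma continuous_on_outer:
  fixes f g :: "'a::topological_space \<Rightarrow> real^'n"
  assumes "continuous_on S f" "continuous_on S g"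
  shows "continuous_on S (\<lambda>x. outer (f x) (g x))"
  unfolding outer_def using assms by (intro continuous_intros)

lemma integral_transpose_skew:
  fixes f :: "'a \<Rightarrow> real^'n^'n"
  assumes "integrable M f" "\<And>x. x \<in> space M \<Longrightarrow> transpose (f x) = - f x"
  shows "transpose (\<integral>x. f x \<partial>M) = - (\<integral>x. f x \<partial>M)"
proof -
  have "transpose (\<integral>x. f x \<partial>M) = (\<integral>x. transpose (f x) \<partial>M)"
    using integral_bounded_linear[OF bounded_linear_transpose assms(1)] by simp
  also have "\<dots> = (\<integral>x. - f x \<partial>M)" by (rule Bochner_Integration.integral_cong) (auto simp: assms(2))
  finally show ?thesis by simp
qed

lemma integral_lincomb:
  fixes f g :: "'a \<Rightarrow> 'b::{banach, second_countable_topology}"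
  assumes "integrable M f" "integrable M g"
  shows "(\<integral>x. \<alpha> *\<^sub>R f x + \<beta> *\<^sub>R g x \<partial>M) = \<alpha> *\<^sub>R (\<integral>x. f x \<partial>M) + \<beta> *\<^sub>R (\<integral>x. g x \<partial>M)"
    "integral\<^sup>L M (\<alpha> *\<^sub>R f + \<beta> *\<^sub>R g) = \<alpha> *\<^sub>R integral\<^sup>L M f + \<beta> *\<^sub>R integral\<^sup>L M g"
proof -
  show 1: "(\<integral>x. \<alpha> *\<^sub>R f x + \<beta> *\<^sub>R g x \<partial>M) = \<alpha> *\<^sub>R (\<integral>x. f x \<partial>M) + \<beta> *\<^sub>R (\<integral>x. g x \<partial>M)"
    using assms by simp
  have "\<alpha> *\<^sub>R f + \<beta> *\<^sub>R g = (\<lambda>x. \<alpha> *\<^sub>R f x + \<beta> *\<^sub>R g x)" by (simp add: fun_eq_iff)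
  then show "integral\<^sup>L M (\<alpha> *\<^sub>R f + \<beta> *\<^sub>R g) = \<alpha> *\<^sub>R integral\<^sup>L M f + \<beta> *\<^sub>R integral\<^sup>L M g"
    using 1 by simp
qed

locale hho = polyhedral_mesh \<Omega> Th Fh for \<Omega> :: "(real^'n) set" and Th Fh :: "(real^'n) set set" +
  fixes k :: nat and \<gamma> :: real
  assumes k: "k \<ge> 1" and gamma: "\<gamma> > 0" and dim: "CARD('n) \<ge> 2"
begin

lemma bounded_Th: "T \<in> Th \<Longrightarrow> bounded T"
  using T_subset bounded_\<Omega> bounded_subset by blast

lemma T_lebesgue: "T \<in> Th \<Longrightarrow> T \<in> sets lebesgue" "T \<in> Th \<Longrightarrow> T \<in> sets borel"
  using open_Th by auto

lemma poly_measure_T: assumes T: "T \<in> Th" shows "poly_measure (lebesgue_on T) T"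
proof (rule poly_measure.intro)
  show "space (lebesgue_on T) = T" by simp
  show "bounded T" by (rule bounded_Th[OF T])
  have "emeasure (lebesgue_on T) T = emeasure lborel T"
    using T_lebesgue[OF T] by (simp add: emeasure_restrict_space)
  also have "\<dots> < \<infinity>" by (rule emeasure_bounded_finite[OF bounded_Th[OF T]])
  finally show "finite_measure (lebesgue_on T)" by (intro finite_measureI) simp
  show "(\<lambda>x. x) \<in> lebesgue_on T \<rightarrow>\<^sub>M borel"
    by (intro measurable_restrict_space1 measurable_completion) simp
  fix p :: "real^'n \<Rightarrow> real" and x
  assume p: "real_polynomial_function p" "AE x in lebesgue_on T. p x = 0"
  have "AE x in lborel. x \<in> T \<longrightarrow> p x = 0"
    using p(2) T_lebesgue[OF T] by (simp add: AE_restrict_space_iff AE_completion_iff)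
  moreover have "emeasure lborel T > 0"
    using open_not_negligible[OF open_Th[OF T] ne_Th[OF T]] T_lebesgue[OF T]
    by (metis null_setsI not_gr_zero negligible_iff_null_sets null_sets_completionI sets_lborel)
  ultimately show "p x = 0"
    using T_lebesgue[OF T] p(1) by (intro polynomial_zero_AE[of p T]) (auto simp: real_polynomial_function_eq)
qed

lemma polys_zero_on_T:
  fixes p :: "real^'n \<Rightarrow> 'v::euclidean_space"
  assumes "T \<in> Th" "p \<in> polys l V" "\<And>x. x \<in> T \<Longrightarrow> p x = 0"
  shows "p = 0"
proof
  fix x show "p x = 0 x"
    using polynomial_zero_open[OF polynomial_function_polys[OF assms(2)] open_Th[OF assms(1)] ne_Th[OF assms(1)] assms(3)] by simp
qed

lemma polys_eq_on_T:
  fixes p q :: "real^'n \<Rightarrow> 'v::euclidean_space"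
  assumes "T \<in> Th" "p \<in> polys l UNIV" "q \<in> polys l UNIV" "\<And>x. x \<in> T \<Longrightarrow> p x = q x"
  shows "p = q"
proof -
  have "p - q \<in> polys l UNIV" by (rule subspace_diff[OF subspace_polys[OF subspace_UNIV] assms(2,3)])
  from polys_zero_on_T[OF assms(1) this] have "p - q = 0" using assms(4) by simp
  then show ?thesis by simp
qed

lemma vol_pos: "T \<in> Th \<Longrightarrow> measure (lebesgue_on T) T > 0"
proof -
  assume T: "T \<in> Th"
  interpret poly_measure "lebesgue_on T" T by (rule poly_measure_T[OF T])
  interpret finite_measure "lebesgue_on T" by (rule finite_M)
  have "measure (lebesgue_on T) T \<noteq> 0"
  proof
    assume "measure (lebesgue_on T) T = 0"
    then have "T \<in> null_sets (lebesgue_on T)"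
      by (intro null_setsI) (simp_all add: emeasure_eq_measure T_lebesgue[OF T] sets_restrict_space_iff)
    from AE_not_in[OF this] AE_space have "AE x in lebesgue_on T. (1::real) = 0" by eventually_elim simp
    then show False using determining[of "\<lambda>_. 1"] ne_Th[OF T] by auto
  qed
  then show ?thesis by (simp add: less_le)
qed

subsection \<open>The space of discrete unknowns\<close>

text \<open>A linear model of the space of hybrid unknowns with vanishing boundary values: element
  components are global polynomials, face components are extended by zero, instead of
  restrictions that are \<open>undefined\<close> elsewhere.\<close>

definition Z :: "'n hybrid set" where
  "Z = {z. (\<forall>T\<in>Th. fst z T \<in> polys k UNIV) \<and> (\<forall>T. T \<notin> Th \<longrightarrow> fst z T = 0) \<and>
    (\<forall>F\<in>Fh. snd z F \<in> ext0 F ` polys k UNIV) \<and> (\<forall>F\<in>Fh. is_boundary_face \<Omega> Th F \<longrightarrow> snd z F = 0) \<and>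
    (\<forall>F. F \<notin> Fh \<longrightarrow> snd z F = 0)}"

definition R :: "'n hybrid \<Rightarrow> 'n hybrid" where
  "R z = (\<lambda>T\<in>Th. restrict (fst z T) T, \<lambda>F\<in>Fh. restrict (snd z F) F)"

lemma R_apply [simp]:
  "T \<in> Th \<Longrightarrow> x \<in> T \<Longrightarrow> fst (R z) T x = fst z T x" "F \<in> Fh \<Longrightarrow> x \<in> F \<Longrightarrow> snd (R z) F x = snd z F x"
  by (simp_all add: R_def)

lemma Z_elt: "z \<in> Z \<Longrightarrow> T \<in> Th \<Longrightarrow> fst z T \<in> polys k UNIV"
  by (simp add: Z_def)

lemma Z_face: "z \<in> Z \<Longrightarrow> F \<in> Fh \<Longrightarrow> \<exists>p\<in>polys k UNIV. snd z F = ext0 F p"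
  by (auto simp: Z_def)

lemma subspace_Z: "subspace Z"
  unfolding subspace_def
proof (intro conjI ballI allI)
  have P: "subspace (polys k UNIV :: (real^'n \<Rightarrow> real^'n) set)" "subspace (ext0 F ` polys k UNIV :: (real^'n \<Rightarrow> real^'n) set)" for F
    by (auto intro: subspace_polys subspace_ext0_polys)
  show "0 \<in> Z" by (auto simp: Z_def subspace_0[OF P(1)] subspace_0[OF P(2)])
  show "u + v \<in> Z" if "u \<in> Z" "v \<in> Z" for u v
    using that unfolding Z_def by (simp add: subspace_add[OF P(1)] subspace_add[OF P(2)])
  show "c *\<^sub>R u \<in> Z" if "u \<in> Z" for u c
    using that unfolding Z_def by (simp add: subspace_scale[OF P(1)] subspace_scale[OF P(2)])
qed

lemma lincomb_Z: "u \<in> Z \<Longrightarrow> v \<in> Z \<Longrightarrow> \<alpha> *\<^sub>R u + \<beta> *\<^sub>R v \<in> Z"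
  by (intro subspace_add[OF subspace_Z] subspace_scale[OF subspace_Z])

text \<open>\<open>Z\<close> lies in a finite sum, over elements and faces, of spaces whose members
  have a single nonzero component.\<close>

lemma fin_dim_Z: "fin_dim Z"
proof -
  define I where "I = Inl ` Th \<union> Inr ` Fh"
  define s where "s T p = (\<lambda>T'. if T' = T then p else 0)" for T :: "(real^'n) set" and p :: "real^'n \<Rightarrow> real^'n"
  have lin: "linear (s T)" for T by (rule linearI) (auto simp: s_def fun_eq_iff)
  have lins: "linear (\<lambda>p. (s T p, 0) :: 'n hybrid)" "linear (\<lambda>p. (0, s T p) :: 'n hybrid)" for T
    by (auto intro!: linearI simp: linear_add[OF lin] linear_scale[OF lin])
  define W :: "(real^'n) set + (real^'n) set \<Rightarrow> 'n hybrid set" where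
    "W i = (case i of Inl T \<Rightarrow> (\<lambda>p. (s T p, 0)) ` polys k UNIV | Inr F \<Rightarrow> (\<lambda>p. (0, s F p)) ` ext0 F ` polys k UNIV)" for i
  show ?thesis
  proof (rule fin_dim_sum_image[of I W])
    show "finite I" using finite_Th finite_Fh by (simp add: I_def)
    show "fin_dim (W i)" for i
      by (cases i) (auto simp: W_def intro!: fin_dim_linear_image[OF fin_dim_polys lins(1)] fin_dim_linear_image[OF fin_dim_ext0_polys lins(2)])
    fix z assume z: "z \<in> Z"
    define f :: "(real^'n) set + (real^'n) set \<Rightarrow> 'n hybrid" where
      "f i = (case i of Inl T \<Rightarrow> (s T (fst z T), 0) | Inr F \<Rightarrow> (0, s F (snd z F)))" for i
    have "(\<Sum>i\<in>I. f i) = (\<Sum>T\<in>Th. (s T (fst z T), 0)) + (\<Sum>F\<in>Fh. (0, s F (snd z F)))"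
      unfolding I_def using finite_Th finite_Fh
      by (subst sum.union_disjoint) (auto simp: sum.reindex f_def)
    also have "\<dots> = (\<Sum>T\<in>Th. s T (fst z T), \<Sum>F\<in>Fh. s F (snd z F))"
      by (simp add: prod_eq_iff fst_sum snd_sum)
    also have "\<dots> = z"
    proof (rule prod_eqI)
      show "fst (\<Sum>T\<in>Th. s T (fst z T), \<Sum>F\<in>Fh. s F (snd z F)) = fst z"
      proof
        fix T show "fst (\<Sum>T\<in>Th. s T (fst z T), \<Sum>F\<in>Fh. s F (snd z F)) T = fst z T"
          using z finite_Th by (cases "T \<in> Th") (auto simp: sum_fun_apply s_def Z_def sum.delta)
      qed
      show "snd (\<Sum>T\<in>Th. s T (fst z T), \<Sum>F\<in>Fh. s F (snd z F)) = snd z"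
      proof
        fix F show "snd (\<Sum>T\<in>Th. s T (fst z T), \<Sum>F\<in>Fh. s F (snd z F)) F = snd z F"
          using z finite_Fh by (cases "F \<in> Fh") (auto simp: sum_fun_apply s_def Z_def sum.delta)
      qed
    qed
    finally have "z = (\<Sum>i\<in>I. f i)" by simp
    moreover have "\<forall>i\<in>I. f i \<in> W i" using z by (auto simp: I_def f_def W_def Z_def)
    ultimately show "\<exists>f. z = (\<Sum>i\<in>I. f i) \<and> (\<forall>i\<in>I. f i \<in> W i)" by blast
  qed
qed

lemma R_in: "z \<in> Z \<Longrightarrow> R z \<in> hybrid_space0 \<Omega> k Th Fh"
proof -
  assume z: "z \<in> Z"
  have 1: "restrict (fst z T) T \<in> poly_space k T UNIV" if "T \<in> Th" for T
    using Z_elt[OF z that] by (auto simp: poly_space_def)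
  have 2: "restrict (snd z F) F \<in> poly_space k F UNIV" if F: "F \<in> Fh" for F
  proof -
    obtain p where "p \<in> polys k UNIV" "snd z F = ext0 F p" using Z_face[OF z F] by blast
    then show ?thesis by (auto simp: poly_space_def intro!: image_eqI[of _ _ p])
  qed
  have 3: "snd z F x = 0" if "F \<in> Fh" "is_boundary_face \<Omega> Th F" for F x
    using z that by (simp add: Z_def)
  show ?thesis using 1 2 3 by (auto simp: R_def hybrid_space0_def hybrid_space_def)
qed

lemma R_surj:
  assumes v: "v \<in> hybrid_space0 \<Omega> k Th Fh" obtains z where "z \<in> Z" "v = R z"
proof -
  have mem: "\<And>T. T \<in> Th \<Longrightarrow> fst v T \<in> poly_space k T UNIV" "\<And>F. F \<in> Fh \<Longrightarrow> snd v F \<in> poly_space k F UNIV"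
    using v by (auto simp: hybrid_space0_def hybrid_space_def PiE_iff)
  have "\<forall>T\<in>Th. \<exists>p\<in>polys k UNIV. fst v T = restrict p T"
    using mem(1) unfolding poly_space_def by blast
  then obtain a where a: "\<And>T. T \<in> Th \<Longrightarrow> a T \<in> polys k UNIV \<and> fst v T = restrict (a T) T" by metis
  have "\<forall>F\<in>Fh. \<exists>p\<in>polys k UNIV. snd v F = restrict p F"
    using mem(2) unfolding poly_space_def by blast
  then obtain b where b: "\<And>F. F \<in> Fh \<Longrightarrow> b F \<in> polys k UNIV \<and> snd v F = restrict (b F) F" by metis
  define z where "z = (\<lambda>T. if T \<in> Th then a T else 0, \<lambda>F. if F \<in> Fh then ext0 F (b F) else 0)"
  have "ext0 F (b F) = 0" if "F \<in> Fh" "is_boundary_face \<Omega> Th F" for F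
  proof
    fix x show "ext0 F (b F) x = 0 x"
    proof (cases "x \<in> F")
      case True
      then have "snd v F x = 0" using v that by (simp add: hybrid_space0_def)
      then show ?thesis using b[OF that(1)] True by simp
    qed (simp add: ext0_def)
  qed
  then have "z \<in> Z" using a b by (auto simp: Z_def z_def)
  moreover have "v = R z"
  proof (rule prod_eqI)
    have e: "fst v \<in> extensional Th" "snd v \<in> extensional Fh"
      using v by (auto simp: hybrid_space0_def hybrid_space_def PiE_def)
    show "fst v = fst (R z)"
      using e(1) a by (intro extensionalityI[of _ Th]) (auto simp: R_def z_def)
    show "snd v = snd (R z)"
    proof
      fix F show "snd v F = snd (R z) F"
        using b[of F] extensional_arb[OF e(2), of F]
        by (cases "F \<in> Fh") (auto simp: R_def z_def restrict_def fun_eq_iff)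
    qed
  qed
  ultimately show ?thesis using that by blast
qed

subsection \<open>Integrals on faces\<close>

lemma elt_face: "F \<in> elt_faces Fh T \<Longrightarrow> F \<in> Fh \<and> F \<subseteq> frontier T"
  by (simp add: elt_faces_def)

lemma finite_elt_faces: "finite (elt_faces Fh T)"
  using finite_Fh by (simp add: elt_faces_def)

text \<open>The normal has norm at most one almost everywhere and \<open>p\<close> is bounded on
  \<open>F\<close>, so \<open>H\<close> is evaluated on a compact set.\<close>

lemma integrable_normal:
  fixes p :: "real^'n \<Rightarrow> 'c::euclidean_space" and H :: "real^'n \<Rightarrow> 'c \<Rightarrow> 'b::{banach, second_countable_topology}"
  assumes T: "T \<in> Th" and F: "F \<in> elt_faces Fh T" and p: "continuous_on UNIV p"
    and H: "continuous_on UNIV (\<lambda>(n, c). H n c)"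
  shows "integrable (face_measure F) (\<lambda>x. H (outward_normal T F x) (p x))"
proof -
  interpret flat_face F using flat_face elt_face[OF F] by blast
  interpret finite_measure "face_measure F" by (rule finite_M)
  obtain B where B: "\<And>x. x \<in> F \<Longrightarrow> norm (p x) \<le> B" using bounded_on_X[OF p] by blast
  have "compact ((\<lambda>(n, c). H n c) ` (cball 0 1 \<times> cball 0 B))"
    by (intro compact_continuous_image compact_Times continuous_on_subset[OF H]) auto
  then obtain C where C: "\<And>n c. norm n \<le> 1 \<Longrightarrow> norm c \<le> B \<Longrightarrow> norm (H n c) \<le> C"
    using compact_imp_bounded by (force simp: bounded_iff)
  show ?thesis
  proof (rule integrable_const_bound[where B=C])
    show "AE x in face_measure F. norm (H (outward_normal T F x) (p x)) \<le> C"
      using AE_norm_outward_normal[OF T F] AE_space by eventually_elim (use B C space_face in auto)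
    show "(\<lambda>x. H (outward_normal T F x) (p x)) \<in> borel_measurable (face_measure F)"
      using measurable_outward_normal[OF T F] continuous_M[OF p]
      by (rule borel_measurable_continuous_Pair) (use H in \<open>simp add: case_prod_unfold\<close>)
  qed
qed

lemma integrable_flux:
  assumes T: "T \<in> Th" and F: "F \<in> elt_faces Fh T" and z: "z \<in> Z" and \<tau>: "\<tau> \<in> polys l V"
  shows "integrable (face_measure F) (\<lambda>x. snd z F x \<bullet> (\<tau> x *v outward_normal T F x))"
proof -
  interpret flat_face F using flat_face elt_face[OF F] by blast
  obtain p where p: "p \<in> polys k UNIV" "snd z F = ext0 F p" using Z_face[OF z] elt_face[OF F] by blast
  have "continuous_on UNIV (\<lambda>x. p x v* \<tau> x)"
    using p \<tau> by (intro continuous_on_vector_matrix_mult continuous_polys)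
  from integrable_normal[OF T F this, of "\<lambda>n c. c \<bullet> n"]
  have "integrable (face_measure F) (\<lambda>x. (p x v* \<tau> x) \<bullet> outward_normal T F x)"
    by (simp add: case_prod_unfold continuous_intros)
  then show ?thesis by (subst integrable_cong_X) (auto simp: p dot_lmul_matrix)
qed

subsection \<open>Strain reconstruction\<close>

text \<open>The right-hand side in the definition of \<open>strain_rec\<close>, written for global
  polynomials, which involve neither restrictions nor traces.\<close>

definition strain_rhs :: "'n hybrid \<Rightarrow> (real^'n) set \<Rightarrow> (real^'n \<Rightarrow> real^'n^'n) \<Rightarrow> real" where
  "strain_rhs z T \<tau> = - (\<integral>x. fst z T x \<bullet> divergence \<tau> x \<partial>lebesgue_on T)
    + (\<Sum>F\<in>elt_faces Fh T. \<integral>x. snd z F x \<bullet> (\<tau> x *v outward_normal T F x) \<partial>face_measure F)"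

lemma integrable_elt:
  fixes p q :: "real^'n \<Rightarrow> 'v::euclidean_space"
  assumes "T \<in> Th" "p \<in> polys l V" "q \<in> polys l' V'"
  shows "integrable (lebesgue_on T) (\<lambda>x. p x \<bullet> q x)"
  by (rule poly_measure.integrable_inner_polys[OF poly_measure_T[OF assms(1)] assms(2,3)])

lemma inner_space_T:
  assumes T: "T \<in> Th" and V: "subspace (V :: 'v::euclidean_space set)"
  shows "inner_space (polys l V) (\<lambda>p q. \<integral>x. p x \<bullet> q x \<partial>lebesgue_on T)"
proof
  interpret poly_measure "lebesgue_on T" T by (rule poly_measure_T[OF T])
  show "subspace (polys l V :: (real^'n \<Rightarrow> 'v) set)" by (rule subspace_polys[OF V])
  show "fin_dim (polys l V :: (real^'n \<Rightarrow> 'v) set)" by (rule fin_dim_polys)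
  fix u v w :: "real^'n \<Rightarrow> 'v" assume uvw: "u \<in> polys l V" "v \<in> polys l V" "w \<in> polys l V"
  show "(\<integral>x. u x \<bullet> v x \<partial>lebesgue_on T) = (\<integral>x. v x \<bullet> u x \<partial>lebesgue_on T)" by (simp add: inner_commute)
  show "(\<integral>x. (\<alpha> *\<^sub>R u + \<beta> *\<^sub>R v) x \<bullet> w x \<partial>lebesgue_on T) =
    \<alpha> * (\<integral>x. u x \<bullet> w x \<partial>lebesgue_on T) + \<beta> * (\<integral>x. v x \<bullet> w x \<partial>lebesgue_on T)" for \<alpha> \<beta>
    using integrable_elt[OF T uvw(1,3)] integrable_elt[OF T uvw(2,3)] by (simp add: inner_add_left)
  show "(\<integral>x. u x \<bullet> u x \<partial>lebesgue_on T) \<ge> 0" by simp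
  assume "(\<integral>x. u x \<bullet> u x \<partial>lebesgue_on T) = 0"
  then show "u = 0"
    using square_integral_zero[OF polynomial_function_polys[OF uvw(1)]] polys_zero_on_T[OF T uvw(1)] by blast
qed

lemma strain_rhs_lin:
  assumes T: "T \<in> Th" and z: "z \<in> Z" shows "lin_on (polys k sym_mats) (strain_rhs z T)"
proof (rule lin_onI)
  fix \<tau> \<eta> :: "real^'n \<Rightarrow> real^'n^'n" and \<alpha> \<beta> assume \<tau>: "\<tau> \<in> polys k sym_mats" and \<eta>: "\<eta> \<in> polys k sym_mats"
  have d: "divergence (\<alpha> *\<^sub>R \<tau> + \<beta> *\<^sub>R \<eta>) = \<alpha> *\<^sub>R divergence \<tau> + \<beta> *\<^sub>R divergence \<eta>"
    by (rule lin_onD[OF lin_on_divergence \<tau> \<eta>])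
  have int: "integrable (lebesgue_on T) (\<lambda>x. fst z T x \<bullet> divergence \<tau> x)" if "\<tau> \<in> polys k sym_mats" for \<tau>
    by (rule integrable_elt[OF T Z_elt[OF z T] divergence_polys[OF polys_UNIV[OF that]]])
  show "strain_rhs z T (\<alpha> *\<^sub>R \<tau> + \<beta> *\<^sub>R \<eta>) = \<alpha> *\<^sub>R strain_rhs z T \<tau> + \<beta> *\<^sub>R strain_rhs z T \<eta>"
    unfolding strain_rhs_def d
    using int[OF \<tau>] int[OF \<eta>] integrable_flux[OF T _ z \<tau>] integrable_flux[OF T _ z \<eta>]
    by (simp add: inner_add_right matrix_vector_mult_add_rdistrib scaleR_matrix_vector_assoc[symmetric]
      sum.distrib sum_distrib_left algebra_simps)
qed

lemma strain_rhs_lin_Z: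
  assumes T: "T \<in> Th" and \<tau>: "\<tau> \<in> polys k sym_mats" shows "lin_on Z (\<lambda>z. strain_rhs z T \<tau>)"
proof (rule lin_onI)
  fix u v :: "'n hybrid" and \<alpha> \<beta> assume uv: "u \<in> Z" "v \<in> Z"
  have int: "integrable (lebesgue_on T) (\<lambda>x. fst z T x \<bullet> divergence \<tau> x)" if "z \<in> Z" for z
    by (rule integrable_elt[OF T Z_elt[OF that T] divergence_polys[OF polys_UNIV[OF \<tau>]]])
  show "strain_rhs (\<alpha> *\<^sub>R u + \<beta> *\<^sub>R v) T \<tau> = \<alpha> *\<^sub>R strain_rhs u T \<tau> + \<beta> *\<^sub>R strain_rhs v T \<tau>"
    unfolding strain_rhs_def
    using int[OF uv(1)] int[OF uv(2)] integrable_flux[OF T _ uv(1) \<tau>] integrable_flux[OF T _ uv(2) \<tau>]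
    by (simp add: inner_add_left sum.distrib sum_distrib_left algebra_simps)
qed

text \<open>The strain reconstruction as a global polynomial, so that linearity in \<open>z\<close>
  becomes an identity between functions.\<close>

definition Gp :: "'n hybrid \<Rightarrow> (real^'n) set \<Rightarrow> real^'n \<Rightarrow> real^'n^'n" where
  "Gp z T = (THE p. p \<in> polys k sym_mats \<and>
    (\<forall>\<tau>\<in>polys k sym_mats. (\<integral>x. p x \<bullet> \<tau> x \<partial>lebesgue_on T) = strain_rhs z T \<tau>))"

lemma Gp_ex1:
  assumes T: "T \<in> Th" and z: "z \<in> Z"
  shows "\<exists>!p. p \<in> polys k sym_mats \<and>
    (\<forall>\<tau>\<in>polys k sym_mats. (\<integral>x. p x \<bullet> \<tau> x \<partial>lebesgue_on T) = strain_rhs z T \<tau>)"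
  by (rule inner_space.riesz[OF inner_space_T[OF T subspace_sym_mats] strain_rhs_lin[OF T z]])

lemma Gp_props:
  assumes T: "T \<in> Th" and z: "z \<in> Z"
  shows "Gp z T \<in> polys k sym_mats"
    "\<tau> \<in> polys k sym_mats \<Longrightarrow> (\<integral>x. Gp z T x \<bullet> \<tau> x \<partial>lebesgue_on T) = strain_rhs z T \<tau>"
  using theI'[OF Gp_ex1[OF assms]] unfolding Gp_def by blast+

lemma lin_on_Gp:
  assumes T: "T \<in> Th" shows "lin_on Z (\<lambda>z. Gp z T)"
proof (rule lin_onI)
  fix u v :: "'n hybrid" and \<alpha> \<beta> assume uv: "u \<in> Z" "v \<in> Z"
  interpret inner_space "polys k sym_mats" "\<lambda>p q. \<integral>x. p x \<bullet> q x \<partial>lebesgue_on T"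
    by (rule inner_space_T[OF T subspace_sym_mats])
  note w = lincomb_Z[OF uv, of \<alpha> \<beta>]
  note G = Gp_props(1)[OF T uv(1)] Gp_props(1)[OF T uv(2)]
  show "Gp (\<alpha> *\<^sub>R u + \<beta> *\<^sub>R v) T = \<alpha> *\<^sub>R Gp u T + \<beta> *\<^sub>R Gp v T"
  proof (rule eq_if_q_eq)
    show "Gp (\<alpha> *\<^sub>R u + \<beta> *\<^sub>R v) T \<in> polys k sym_mats" by (rule Gp_props(1)[OF T w])
    show "\<alpha> *\<^sub>R Gp u T + \<beta> *\<^sub>R Gp v T \<in> polys k sym_mats"
      using G by (intro subspace_add[OF subspace] subspace_scale[OF subspace])
    fix \<tau> :: "real^'n \<Rightarrow> real^'n^'n" assume \<tau>: "\<tau> \<in> polys k sym_mats"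
    show "(\<integral>x. Gp (\<alpha> *\<^sub>R u + \<beta> *\<^sub>R v) T x \<bullet> \<tau> x \<partial>lebesgue_on T) =
      (\<integral>x. (\<alpha> *\<^sub>R Gp u T + \<beta> *\<^sub>R Gp v T) x \<bullet> \<tau> x \<partial>lebesgue_on T)"
      unfolding lin[OF G \<tau>] Gp_props(2)[OF T w \<tau>] Gp_props(2)[OF T uv(1) \<tau>] Gp_props(2)[OF T uv(2) \<tau>]
      using lin_onD[OF strain_rhs_lin_Z[OF T \<tau>] uv] by simp
  qed
qed

text \<open>The integrals see only values and derivatives on \<open>T\<close> and boundary values on
  its faces, and these are the same for a polynomial and for its restriction.\<close>

lemma strain_rec_R:
  assumes T: "T \<in> Th" and z: "z \<in> Z"
  shows "strain_rec k Fh (R z) T = restrict (Gp z T) T"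
proof -
  interpret poly_measure "lebesgue_on T" T by (rule poly_measure_T[OF T])
  have rhs: "- (\<integral>x. fst (R z) T x \<bullet> divergence (restrict \<tau> T) x \<partial>lebesgue_on T)
        + (\<Sum>F\<in>elt_faces Fh T. \<integral>x. snd (R z) F x \<bullet> (trace T (restrict \<tau> T) x *v outward_normal T F x) \<partial>face_measure F)
    = strain_rhs z T \<tau>" if \<tau>: "\<tau> \<in> polys k sym_mats" for \<tau>
  proof -
    have "divergence (restrict \<tau> T) x = divergence \<tau> x" if "x \<in> T" for x
      using partial_cong_open[OF open_Th[OF T] that, of "restrict \<tau> T" \<tau>] by (simp add: divergence_def)
    then have "(\<integral>x. fst (R z) T x \<bullet> divergence (restrict \<tau> T) x \<partial>lebesgue_on T) = (\<integral>x. fst z T x \<bullet> divergence \<tau> x \<partial>lebesgue_on T)"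
      by (intro integral_cong_X) (simp add: T)
    moreover have "(\<integral>x. snd (R z) F x \<bullet> (trace T (restrict \<tau> T) x *v outward_normal T F x) \<partial>face_measure F) =
      (\<integral>x. snd z F x \<bullet> (\<tau> x *v outward_normal T F x) \<partial>face_measure F)" if F: "F \<in> elt_faces Fh T" for F
    proof -
      interpret F: flat_face F using flat_face elt_face[OF F] by blast
      have "trace T (restrict \<tau> T) x = \<tau> x" if "x \<in> F" for x
        using that elt_face[OF F] by (intro trace_continuous[OF open_Th[OF T]] continuous_polys[OF \<tau>]) auto
      then show ?thesis using elt_face[OF F] by (intro F.integral_cong_X) simp
    qed
    ultimately show ?thesis by (simp add: strain_rhs_def)
  qed
  have lhs: "(\<integral>x. restrict p T x \<bullet> restrict \<tau> T x \<partial>lebesgue_on T) = (\<integral>x. p x \<bullet> \<tau> x \<partial>lebesgue_on T)"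
    for p \<tau> :: "real^'n \<Rightarrow> real^'n^'n" by (rule integral_cong_X) simp
  show ?thesis unfolding strain_rec_def
  proof (rule the_equality)
    show "restrict (Gp z T) T \<in> poly_space k T sym_mats \<and> (\<forall>\<tau>\<in>poly_space k T sym_mats.
      (\<integral>x. restrict (Gp z T) T x \<bullet> \<tau> x \<partial>lebesgue_on T) = - (\<integral>x. fst (R z) T x \<bullet> divergence \<tau> x \<partial>lebesgue_on T)
        + (\<Sum>F\<in>elt_faces Fh T. \<integral>x. snd (R z) F x \<bullet> (trace T \<tau> x *v outward_normal T F x) \<partial>face_measure F))"
    proof (intro conjI ballI)
      show "restrict (Gp z T) T \<in> poly_space k T sym_mats"
        using Gp_props(1)[OF T z] by (auto simp: poly_space_def)
      fix \<eta> assume "\<eta> \<in> poly_space k T (sym_mats :: (real^'n^'n) set)"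
      then obtain \<tau> where \<tau>: "\<tau> \<in> polys k sym_mats" "\<eta> = restrict \<tau> T" by (auto simp: poly_space_def)
      show "(\<integral>x. restrict (Gp z T) T x \<bullet> \<eta> x \<partial>lebesgue_on T) = - (\<integral>x. fst (R z) T x \<bullet> divergence \<eta> x \<partial>lebesgue_on T)
        + (\<Sum>F\<in>elt_faces Fh T. \<integral>x. snd (R z) F x \<bullet> (trace T \<eta> x *v outward_normal T F x) \<partial>face_measure F)"
        unfolding \<tau>(2) rhs[OF \<tau>(1)] lhs by (rule Gp_props(2)[OF T z \<tau>(1)])
    qed
    fix G assume G: "G \<in> poly_space k T sym_mats \<and> (\<forall>\<tau>\<in>poly_space k T sym_mats.
      (\<integral>x. G x \<bullet> \<tau> x \<partial>lebesgue_on T) = - (\<integral>x. fst (R z) T x \<bullet> divergence \<tau> x \<partial>lebesgue_on T)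
        + (\<Sum>F\<in>elt_faces Fh T. \<integral>x. snd (R z) F x \<bullet> (trace T \<tau> x *v outward_normal T F x) \<partial>face_measure F))"
    then obtain p where p: "p \<in> polys k sym_mats" "G = restrict p T" by (auto simp: poly_space_def)
    have "(\<integral>x. p x \<bullet> \<tau> x \<partial>lebesgue_on T) = strain_rhs z T \<tau>" if \<tau>: "\<tau> \<in> polys k sym_mats" for \<tau>
    proof -
      have "restrict \<tau> T \<in> poly_space k T sym_mats" using \<tau> by (auto simp: poly_space_def)
      from bspec[OF conjunct2[OF G[unfolded p(2)]] this] show ?thesis by (simp only: lhs rhs[OF \<tau>])
    qed
    then have "p = Gp z T" using Gp_ex1[OF T z] Gp_props[OF T z] p(1) by blast
    then show "G = restrict (Gp z T) T" by (simp add: p)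
  qed
qed

subsection \<open>Displacement reconstruction\<close>

definition skew_rhs :: "'n hybrid \<Rightarrow> (real^'n) set \<Rightarrow> real^'n^'n" where
  "skew_rhs z T = (\<Sum>F\<in>elt_faces Fh T. \<integral>x. (1/2) *\<^sub>R (outer (outward_normal T F x) (snd z F x)
      - outer (snd z F x) (outward_normal T F x)) \<partial>face_measure F)"

lemma integrable_skew:
  assumes T: "T \<in> Th" and F: "F \<in> elt_faces Fh T" and z: "z \<in> Z"
  shows "integrable (face_measure F) (\<lambda>x. (1/2) *\<^sub>R (outer (outward_normal T F x) (snd z F x)
      - outer (snd z F x) (outward_normal T F x)))"
proof -
  interpret flat_face F using flat_face elt_face[OF F] by blast
  obtain p where p: "p \<in> polys k UNIV" "snd z F = ext0 F p" using Z_face[OF z] elt_face[OF F] by blast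
  have "integrable (face_measure F) (\<lambda>x. (1/2) *\<^sub>R (outer (outward_normal T F x) (p x) - outer (p x) (outward_normal T F x)))"
    by (rule integrable_normal[OF T F continuous_polys[OF p(1)]])
      (auto simp: case_prod_unfold intro!: continuous_intros continuous_on_outer)
  then show ?thesis by (subst integrable_cong_X) (auto simp: p)
qed

lemma outer_add: "outer (a + b) c = outer a c + outer b c" "outer c (a + b) = outer c a + outer c b"
  "outer (r *\<^sub>R a) c = r *\<^sub>R outer a c" "outer c (r *\<^sub>R a) = r *\<^sub>R outer c a"
  by (simp_all add: outer_def vec_eq_iff algebra_simps)

lemma transpose_outer: "transpose (outer a b) = outer b a"
  by (simp add: outer_def transpose_def vec_eq_iff mult.commute)

lemma skew_rhs_lin:
  assumes T: "T \<in> Th" shows "lin_on Z (\<lambda>z. skew_rhs z T)"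
proof (rule lin_onI)
  fix u v :: "'n hybrid" and \<alpha> \<beta> assume uv: "u \<in> Z" "v \<in> Z"
  let ?f = "\<lambda>z F x. (1/2) *\<^sub>R (outer (outward_normal T F x) (snd z F x) - outer (snd z F x) (outward_normal T F x))"
  have f: "?f (\<alpha> *\<^sub>R u + \<beta> *\<^sub>R v) F x = \<alpha> *\<^sub>R ?f u F x + \<beta> *\<^sub>R ?f v F x" for F x
    by (simp add: outer_add scaleR_right_diff_distrib scaleR_add_right)
  have "(\<integral>x. ?f (\<alpha> *\<^sub>R u + \<beta> *\<^sub>R v) F x \<partial>face_measure F) =
    \<alpha> *\<^sub>R (\<integral>x. ?f u F x \<partial>face_measure F) + \<beta> *\<^sub>R (\<integral>x. ?f v F x \<partial>face_measure F)" if "F \<in> elt_faces Fh T" for F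
    unfolding f by (rule integral_lincomb(1)[OF integrable_skew[OF T that uv(1)] integrable_skew[OF T that uv(2)]])
  then have "skew_rhs (\<alpha> *\<^sub>R u + \<beta> *\<^sub>R v) T = (\<Sum>F\<in>elt_faces Fh T.
    \<alpha> *\<^sub>R (\<integral>x. ?f u F x \<partial>face_measure F) + \<beta> *\<^sub>R (\<integral>x. ?f v F x \<partial>face_measure F))"
    unfolding skew_rhs_def by (rule sum.cong[OF refl])
  also have "\<dots> = \<alpha> *\<^sub>R skew_rhs u T + \<beta> *\<^sub>R skew_rhs v T"
    unfolding skew_rhs_def sum.distrib scaleR_sum_right ..
  finally show "skew_rhs (\<alpha> *\<^sub>R u + \<beta> *\<^sub>R v) T = \<alpha> *\<^sub>R skew_rhs u T + \<beta> *\<^sub>R skew_rhs v T" .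
qed

lemma skew_rhs_skew:
  assumes T: "T \<in> Th" and z: "z \<in> Z" shows "transpose (skew_rhs z T) = - skew_rhs z T"
proof -
  have lin: "linear (transpose :: real^'n^'n \<Rightarrow> real^'n^'n)" using bounded_linear_transpose by (rule bounded_linear.linear)
  have "transpose (skew_rhs z T) = (\<Sum>F\<in>elt_faces Fh T. transpose (\<integral>x. (1/2) *\<^sub>R (outer (outward_normal T F x) (snd z F x)
      - outer (snd z F x) (outward_normal T F x)) \<partial>face_measure F))"
    unfolding skew_rhs_def by (rule linear_sum[OF lin])
  also have "\<dots> = (\<Sum>F\<in>elt_faces Fh T. - (\<integral>x. (1/2) *\<^sub>R (outer (outward_normal T F x) (snd z F x)
      - outer (snd z F x) (outward_normal T F x)) \<partial>face_measure F))"
    by (intro sum.cong refl integral_transpose_skew integrable_skew T z)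
      (simp_all add: linear_scale[OF lin] linear_diff[OF lin] transpose_outer flip: scaleR_minus_right)
  also have "\<dots> = - skew_rhs z T" by (simp add: skew_rhs_def sum_negf)
  finally show ?thesis .
qed

text \<open>One symmetric form combines the three conditions on the displacement reconstruction into
  a single Riesz problem. It is definite: zero symmetric gradient leaves a rigid motion, which is
  determined by its mean and the mean of its skew gradient.\<close>

definition disp_form :: "(real^'n) set \<Rightarrow> (real^'n \<Rightarrow> real^'n) \<Rightarrow> (real^'n \<Rightarrow> real^'n) \<Rightarrow> real" where
  "disp_form T r w = (\<integral>x. sym_grad r x \<bullet> sym_grad w x \<partial>lebesgue_on T)
    + (\<integral>x. r x \<partial>lebesgue_on T) \<bullet> (\<integral>x. w x \<partial>lebesgue_on T)
    + (\<integral>x. skew_grad r x \<partial>lebesgue_on T) \<bullet> (\<integral>x. skew_grad w x \<partial>lebesgue_on T)"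

lemma integrable_T_polys: "T \<in> Th \<Longrightarrow> p \<in> polys l V \<Longrightarrow> integrable (lebesgue_on T) p"
  for p :: "real^'n \<Rightarrow> 'v::euclidean_space"
  by (rule poly_measure.integrable_continuous[OF poly_measure_T continuous_polys])

lemma integral_T_const: "T \<in> Th \<Longrightarrow> (\<integral>x. c \<partial>lebesgue_on T) = measure (lebesgue_on T) T *\<^sub>R c"
  for c :: "'v::euclidean_space"
  using lebesgue_integral_const[of "lebesgue_on T" c] by simp

lemma inner_space_disp:
  assumes T: "T \<in> Th" shows "inner_space (polys l UNIV) (disp_form T)"
proof
  interpret poly_measure "lebesgue_on T" T by (rule poly_measure_T[OF T])
  show "subspace (polys l UNIV :: (real^'n \<Rightarrow> real^'n) set)" by (rule subspace_polys) simp
  show "fin_dim (polys l UNIV :: (real^'n \<Rightarrow> real^'n) set)" by (rule fin_dim_polys)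
  fix u v w :: "real^'n \<Rightarrow> real^'n" assume uvw: "u \<in> polys l UNIV" "v \<in> polys l UNIV" "w \<in> polys l UNIV"
  show "disp_form T u v = disp_form T v u" by (simp add: disp_form_def inner_commute)
  note sg = sym_grad_polys[OF uvw(1)] sym_grad_polys[OF uvw(2)] sym_grad_polys[OF uvw(3)]
  note kg = skew_grad_polys[OF uvw(1)] skew_grad_polys[OF uvw(2)] skew_grad_polys[OF uvw(3)]
  show "disp_form T (\<alpha> *\<^sub>R u + \<beta> *\<^sub>R v) w = \<alpha> * disp_form T u w + \<beta> * disp_form T v w" for \<alpha> \<beta>
    unfolding disp_form_def lin_onD[OF lin_on_sym_grad uvw(1,2)] lin_onD[OF lin_on_skew_grad uvw(1,2)]
    using integrable_elt[OF T sg(1) sg(3)] integrable_elt[OF T sg(2) sg(3)]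
      integrable_T_polys[OF T uvw(1)] integrable_T_polys[OF T uvw(2)] integrable_T_polys[OF T kg(1)] integrable_T_polys[OF T kg(2)]
    by (simp add: inner_add_left integral_lincomb(2) algebra_simps)
  have pos: "0 \<le> (\<integral>x. sym_grad u x \<bullet> sym_grad u x \<partial>lebesgue_on T)" by simp
  then show "disp_form T u u \<ge> 0" unfolding disp_form_def by (intro add_nonneg_nonneg) auto
  assume "disp_form T u u = 0"
  then have z: "(\<integral>x. sym_grad u x \<bullet> sym_grad u x \<partial>lebesgue_on T) = 0" "(\<integral>x. u x \<partial>lebesgue_on T) = 0"
      "(\<integral>x. skew_grad u x \<partial>lebesgue_on T) = 0"
    using pos unfolding disp_form_def by (smt (verit) inner_ge_zero inner_eq_zero_iff)+
  have "sym_grad u x = 0" if "x \<in> T" for x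
    using square_integral_zero[OF polynomial_function_polys[OF sg(1)] z(1) that] .
  then obtain A b where Ab: "transpose A = - A" "u = (\<lambda>x. A *v x + b)"
    using sym_grad_zero_affine[OF uvw(1) open_Th[OF T] ne_Th[OF T]] by blast
  have "skew_grad u x = - A" for x unfolding Ab(2) skew_grad_affine Ab(1) by (simp add: vec_eq_iff)
  then have "measure (lebesgue_on T) T *\<^sub>R (- A) = 0" using z(3) integral_T_const[OF T, of "- A"] by simp
  then have "A = 0" using vol_pos[OF T] by simp
  then have "u = (\<lambda>x. b)" using Ab by simp
  moreover have "b = 0" using z(2) integral_T_const[OF T, of b] vol_pos[OF T] calculation by simp
  ultimately show "u = 0" by (simp add: fun_eq_iff)
qed

definition disp_rhs :: "'n hybrid \<Rightarrow> (real^'n) set \<Rightarrow> (real^'n \<Rightarrow> real^'n) \<Rightarrow> real" where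
  "disp_rhs z T w = (\<integral>x. Gp z T x \<bullet> sym_grad w x \<partial>lebesgue_on T)
    + (\<integral>x. fst z T x \<partial>lebesgue_on T) \<bullet> (\<integral>x. w x \<partial>lebesgue_on T)
    + skew_rhs z T \<bullet> (\<integral>x. skew_grad w x \<partial>lebesgue_on T)"

lemma disp_rhs_lin:
  assumes T: "T \<in> Th" and z: "z \<in> Z" shows "lin_on (polys l UNIV) (disp_rhs z T)"
proof (rule lin_onI)
  fix u v :: "real^'n \<Rightarrow> real^'n" and \<alpha> \<beta> assume uv: "u \<in> polys l UNIV" "v \<in> polys l UNIV"
  note sg = sym_grad_polys[OF uv(1)] sym_grad_polys[OF uv(2)] and kg = skew_grad_polys[OF uv(1)] skew_grad_polys[OF uv(2)]
  show "disp_rhs z T (\<alpha> *\<^sub>R u + \<beta> *\<^sub>R v) = \<alpha> *\<^sub>R disp_rhs z T u + \<beta> *\<^sub>R disp_rhs z T v"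
    unfolding disp_rhs_def lin_onD[OF lin_on_sym_grad uv] lin_onD[OF lin_on_skew_grad uv]
    using integrable_elt[OF T Gp_props(1)[OF T z] sg(1)] integrable_elt[OF T Gp_props(1)[OF T z] sg(2)]
      integrable_T_polys[OF T uv(1)] integrable_T_polys[OF T uv(2)] integrable_T_polys[OF T kg(1)] integrable_T_polys[OF T kg(2)]
    by (simp add: inner_add_right integral_lincomb(2) algebra_simps)
qed

lemma disp_rhs_lin_Z:
  assumes T: "T \<in> Th" and w: "w \<in> polys l UNIV" shows "lin_on Z (\<lambda>z. disp_rhs z T w)"
proof (rule lin_onI)
  fix u v :: "'n hybrid" and \<alpha> \<beta> assume uv: "u \<in> Z" "v \<in> Z"
  show "disp_rhs (\<alpha> *\<^sub>R u + \<beta> *\<^sub>R v) T w = \<alpha> *\<^sub>R disp_rhs u T w + \<beta> *\<^sub>R disp_rhs v T w"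
    unfolding disp_rhs_def lin_onD[OF lin_on_Gp[OF T] uv] lin_onD[OF skew_rhs_lin[OF T] uv]
    using integrable_elt[OF T Gp_props(1)[OF T uv(1)] sym_grad_polys[OF w]] integrable_elt[OF T Gp_props(1)[OF T uv(2)] sym_grad_polys[OF w]]
      integrable_T_polys[OF T Z_elt[OF uv(1) T]] integrable_T_polys[OF T Z_elt[OF uv(2) T]]
    by (simp add: inner_add_left integral_lincomb(2) algebra_simps)
qed

definition rp :: "'n hybrid \<Rightarrow> (real^'n) set \<Rightarrow> real^'n \<Rightarrow> real^'n" where
  "rp z T = (THE r. r \<in> polys (k + 1) UNIV \<and> (\<forall>w\<in>polys (k + 1) UNIV. disp_form T r w = disp_rhs z T w))"

lemma rp_ex1:
  assumes T: "T \<in> Th" and z: "z \<in> Z"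
  shows "\<exists>!r. r \<in> polys (k + 1) UNIV \<and> (\<forall>w\<in>polys (k + 1) UNIV. disp_form T r w = disp_rhs z T w)"
  by (rule inner_space.riesz[OF inner_space_disp[OF T] disp_rhs_lin[OF T z]])

lemma rp_props:
  assumes T: "T \<in> Th" and z: "z \<in> Z"
  shows "rp z T \<in> polys (k + 1) UNIV" "w \<in> polys (k + 1) UNIV \<Longrightarrow> disp_form T (rp z T) w = disp_rhs z T w"
  using theI'[OF rp_ex1[OF assms]] unfolding rp_def by blast+

lemma lin_on_rp:
  assumes T: "T \<in> Th" shows "lin_on Z (\<lambda>z. rp z T)"
proof (rule lin_onI)
  fix u v :: "'n hybrid" and \<alpha> \<beta> assume uv: "u \<in> Z" "v \<in> Z"
  interpret inner_space "polys (k + 1) UNIV" "disp_form T" by (rule inner_space_disp[OF T])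
  note w = lincomb_Z[OF uv, of \<alpha> \<beta>]
  note r = rp_props(1)[OF T uv(1)] rp_props(1)[OF T uv(2)]
  show "rp (\<alpha> *\<^sub>R u + \<beta> *\<^sub>R v) T = \<alpha> *\<^sub>R rp u T + \<beta> *\<^sub>R rp v T"
  proof (rule eq_if_q_eq)
    show "rp (\<alpha> *\<^sub>R u + \<beta> *\<^sub>R v) T \<in> polys (k + 1) UNIV" by (rule rp_props(1)[OF T w])
    show "\<alpha> *\<^sub>R rp u T + \<beta> *\<^sub>R rp v T \<in> polys (k + 1) UNIV"
      using r by (intro subspace_add[OF subspace] subspace_scale[OF subspace])
    fix t :: "real^'n \<Rightarrow> real^'n" assume t: "t \<in> polys (k + 1) UNIV"
    show "disp_form T (rp (\<alpha> *\<^sub>R u + \<beta> *\<^sub>R v) T) t = disp_form T (\<alpha> *\<^sub>R rp u T + \<beta> *\<^sub>R rp v T) t"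
      unfolding lin[OF r t] rp_props(2)[OF T w t] rp_props(2)[OF T uv(1) t] rp_props(2)[OF T uv(2) t]
      using lin_onD[OF disp_rhs_lin_Z[OF T t] uv] by simp
  qed
qed

text \<open>Testing with constants and with infinitesimal rotations separates the three conditions
  defining the displacement reconstruction.\<close>

lemma disp_form_iff:
  assumes T: "T \<in> Th" and z: "z \<in> Z" and r: "r \<in> polys (k + 1) UNIV"
  shows "(\<forall>w\<in>polys (k + 1) UNIV. disp_form T r w = disp_rhs z T w) \<longleftrightarrow>
    (\<forall>w\<in>polys (k + 1) UNIV. (\<integral>x. (sym_grad r x - Gp z T x) \<bullet> sym_grad w x \<partial>lebesgue_on T) = 0) \<and>
    (\<integral>x. r x \<partial>lebesgue_on T) = (\<integral>x. fst z T x \<partial>lebesgue_on T) \<and>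
    (\<integral>x. skew_grad r x \<partial>lebesgue_on T) = skew_rhs z T" (is "?L \<longleftrightarrow> ?R")
proof -
  let ?v = "measure (lebesgue_on T) T"
  have split: "(\<integral>x. (sym_grad r x - Gp z T x) \<bullet> sym_grad w x \<partial>lebesgue_on T) =
    (\<integral>x. sym_grad r x \<bullet> sym_grad w x \<partial>lebesgue_on T) - (\<integral>x. Gp z T x \<bullet> sym_grad w x \<partial>lebesgue_on T)"
    if "w \<in> polys (k + 1) UNIV" for w
    using integrable_elt[OF T sym_grad_polys[OF r] sym_grad_polys[OF that]] integrable_elt[OF T Gp_props(1)[OF T z] sym_grad_polys[OF that]]
    by (simp add: inner_diff_left)
  show ?thesis
  proof
    assume ?R then show ?L using split by (auto simp: disp_form_def disp_rhs_def)
  next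
    assume L: ?L
    have aff: "(\<lambda>x. A *v x + b) \<in> polys (k + 1) UNIV" for A :: "real^'n^'n" and b by (rule polys_affine) simp
    have m: "(\<integral>x. r x \<partial>lebesgue_on T) = (\<integral>x. fst z T x \<partial>lebesgue_on T)"
    proof -
      let ?d = "(\<integral>x. r x \<partial>lebesgue_on T) - (\<integral>x. fst z T x \<partial>lebesgue_on T)"
      \<comment> \<open>A constant field has zero gradient, so only the terms with mean values
        survive. Taking the difference of the means as the constant yields the square of its
        norm.\<close>
      have "disp_form T r (\<lambda>x. 0 *v x + ?d) = disp_rhs z T (\<lambda>x. 0 *v x + ?d)" using L aff by blast
      then have "(\<integral>x. r x \<partial>lebesgue_on T) \<bullet> (?v *\<^sub>R ?d) = (\<integral>x. fst z T x \<partial>lebesgue_on T) \<bullet> (?v *\<^sub>R ?d)"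
        unfolding disp_form_def disp_rhs_def sym_grad_affine skew_grad_affine
        by (simp add: integral_T_const[OF T] transpose_def zero_vec_def[symmetric] matrix_vector_mult_0)
      then have "?v * (?d \<bullet> ?d) = 0" by (simp add: inner_diff_left algebra_simps)
      then show ?thesis using vol_pos[OF T] by simp
    qed
    have s: "(\<integral>x. skew_grad r x \<partial>lebesgue_on T) = skew_rhs z T"
    proof -
      let ?S = "(\<integral>x. skew_grad r x \<partial>lebesgue_on T)"
      let ?A = "?S - skew_rhs z T"
      have lin: "linear (transpose :: real^'n^'n \<Rightarrow> real^'n^'n)" using bounded_linear_transpose by (rule bounded_linear.linear)
      have "transpose ?S = - ?S"
        by (intro integral_transpose_skew integrable_T_polys[OF T skew_grad_polys[OF r]])
          (simp add: skew_grad_def transpose_def vec_eq_iff minus_divide_left)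
      then have A: "transpose ?A = - ?A" using skew_rhs_skew[OF T z] by (simp add: linear_diff[OF lin])
      \<comment> \<open>The rotation field of \<open>?A\<close> has zero symmetric gradient because
        \<open>?A\<close> is skew, and the mean-value terms agree by \<open>m\<close>. What remains
        is the square of the defect \<open>?A\<close>, up to the volume and a sign.\<close>
      have "disp_form T r (\<lambda>x. ?A *v x + 0) = disp_rhs z T (\<lambda>x. ?A *v x + 0)" using L aff by blast
      then have "?S \<bullet> (?v *\<^sub>R ((1/2) *\<^sub>R (- ?A - ?A))) = skew_rhs z T \<bullet> (?v *\<^sub>R ((1/2) *\<^sub>R (- ?A - ?A)))"
        unfolding disp_form_def disp_rhs_def sym_grad_affine skew_grad_affine A m integral_T_const[OF T] by simp
      then have "?v * (?A \<bullet> ?A) = 0"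
        by (simp add: inner_diff_left inner_diff_right algebra_simps)
      then show ?thesis using vol_pos[OF T] by simp
    qed
    show ?R using L m s split by (auto simp: disp_form_def disp_rhs_def)
  qed
qed

lemma sym_grad_cong_T:
  assumes "T \<in> Th" "x \<in> T"
  shows "sym_grad (restrict r T) x = sym_grad r x" "skew_grad (restrict r T) x = skew_grad r x"
  using partial_cong_open[OF open_Th[OF assms(1)] assms(2), of "restrict r T" r]
  by (simp_all add: sym_grad_def skew_grad_def)

lemma disp_rec_R:
  assumes T: "T \<in> Th" and z: "z \<in> Z"
  shows "disp_rec k Fh (R z) T = restrict (rp z T) T"
proof -
  interpret poly_measure "lebesgue_on T" T by (rule poly_measure_T[OF T])
  let ?P = "\<lambda>r. (\<forall>w\<in>poly_space (k + 1) T UNIV.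
        (\<integral>x. (sym_grad r x - strain_rec k Fh (R z) T x) \<bullet> sym_grad w x \<partial>lebesgue_on T) = 0) \<and>
     (\<integral>x. r x \<partial>lebesgue_on T) = (\<integral>x. fst (R z) T x \<partial>lebesgue_on T) \<and>
     (\<integral>x. skew_grad r x \<partial>lebesgue_on T) =
       (\<Sum>F\<in>elt_faces Fh T.
          \<integral>x. (1/2) *\<^sub>R (outer (outward_normal T F x) (snd (R z) F x)
                        - outer (snd (R z) F x) (outward_normal T F x)) \<partial>face_measure F)"
  have P: "?P (restrict r T) \<longleftrightarrow> (\<forall>w\<in>polys (k + 1) UNIV. disp_form T r w = disp_rhs z T w)"
    if r: "r \<in> polys (k + 1) UNIV" for r
  proof -
    have "(\<integral>x. (sym_grad (restrict r T) x - strain_rec k Fh (R z) T x) \<bullet> sym_grad (restrict w T) x \<partial>lebesgue_on T) =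
      (\<integral>x. (sym_grad r x - Gp z T x) \<bullet> sym_grad w x \<partial>lebesgue_on T)" for w
      by (rule integral_cong_X) (simp add: sym_grad_cong_T[OF T] strain_rec_R[OF T z])
    moreover have "(\<integral>x. restrict r T x \<partial>lebesgue_on T) = (\<integral>x. r x \<partial>lebesgue_on T)"
      "(\<integral>x. fst (R z) T x \<partial>lebesgue_on T) = (\<integral>x. fst z T x \<partial>lebesgue_on T)"
      "(\<integral>x. skew_grad (restrict r T) x \<partial>lebesgue_on T) = (\<integral>x. skew_grad r x \<partial>lebesgue_on T)"
      by (rule integral_cong_X, simp add: T sym_grad_cong_T[OF T])+
    moreover have "(\<Sum>F\<in>elt_faces Fh T. \<integral>x. (1/2) *\<^sub>R (outer (outward_normal T F x) (snd (R z) F x)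
                        - outer (snd (R z) F x) (outward_normal T F x)) \<partial>face_measure F) = skew_rhs z T"
      unfolding skew_rhs_def
    proof (rule sum.cong[OF refl])
      fix F assume F: "F \<in> elt_faces Fh T"
      interpret F: flat_face F using flat_face elt_face[OF F] by blast
      show "(\<integral>x. (1/2) *\<^sub>R (outer (outward_normal T F x) (snd (R z) F x) - outer (snd (R z) F x) (outward_normal T F x)) \<partial>face_measure F) =
        (\<integral>x. (1/2) *\<^sub>R (outer (outward_normal T F x) (snd z F x) - outer (snd z F x) (outward_normal T F x)) \<partial>face_measure F)"
        using elt_face[OF F] by (intro F.integral_cong_X) simp
    qed
    ultimately show ?thesis unfolding disp_form_iff[OF T z r] poly_space_def by simp
  qed
  show ?thesis unfolding disp_rec_def
  proof (rule the_equality)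
    show "restrict (rp z T) T \<in> poly_space (k + 1) T UNIV \<and> ?P (restrict (rp z T) T)"
      using rp_props[OF T z] P by (auto simp: poly_space_def)
    fix r' assume r': "r' \<in> poly_space (k + 1) T UNIV \<and> ?P r'"
    then obtain r where r: "r \<in> polys (k + 1) UNIV" "r' = restrict r T" by (auto simp: poly_space_def)
    then have "\<forall>w\<in>polys (k + 1) UNIV. disp_form T r w = disp_rhs z T w" using P[OF r(1)] r' by blast
    then have "r = rp z T" using rp_ex1[OF T z] rp_props[OF T z] r(1) by blast
    then show "r' = restrict (rp z T) T" by (simp add: r)
  qed
qed

text \<open>The reconstruction is an admissible test function for its own defining equation; this is
  why its symmetric gradient vanishes.\<close>

lemma rp_affine:
  assumes T: "T \<in> Th" and z: "z \<in> Z" and G: "Gp z T = 0"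
  shows "rp z T \<in> polys k UNIV"
proof -
  interpret poly_measure "lebesgue_on T" T by (rule poly_measure_T[OF T])
  note r = rp_props(1)[OF T z]
  have "\<forall>w\<in>polys (k + 1) UNIV. (\<integral>x. (sym_grad (rp z T) x - Gp z T x) \<bullet> sym_grad w x \<partial>lebesgue_on T) = 0"
    using disp_form_iff[OF T z r] rp_props(2)[OF T z] by blast
  then have "(\<integral>x. sym_grad (rp z T) x \<bullet> sym_grad (rp z T) x \<partial>lebesgue_on T) = 0" using r G by auto
  then have "sym_grad (rp z T) x = 0" if "x \<in> T" for x
    using square_integral_zero[OF polynomial_function_polys[OF sym_grad_polys[OF r]]] that by blast
  then obtain A b where "rp z T = (\<lambda>x. A *v x + b)"
    using sym_grad_zero_affine[OF r open_Th[OF T] ne_Th[OF T]] by blast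
  then show ?thesis using polys_affine[OF k] by simp
qed

subsection \<open>Stabilisation\<close>

text \<open>The two projections are returned as separate polynomials because linearity of the first
  is proved on \<open>F\<close> and that of the second on \<open>T\<close>. As \<open>e\<close> is a
  global polynomial, the trace on \<open>F\<close> is simply its value.\<close>

lemma face_residual_props:
  assumes T: "T \<in> Th" and F: "F \<in> elt_faces Fh T" and z: "z \<in> Z"
  obtains p e where "p \<in> polys k UNIV" "e \<in> polys k UNIV"
    "\<And>x. x \<in> F \<Longrightarrow> face_proj k F (\<lambda>y. rp z T y - snd z F y) x = p x"
    "\<And>x. x \<in> T \<Longrightarrow> elt_proj k T (\<lambda>y. rp z T y - fst z T y) x = e x"
    "\<And>x. x \<in> F \<Longrightarrow> face_residual k Fh (R z) T F x = p x - e x"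
proof -
  interpret poly_measure "lebesgue_on T" T by (rule poly_measure_T[OF T])
  interpret F: flat_face F using flat_face elt_face[OF F] by blast
  obtain b where b: "b \<in> polys k UNIV" "snd z F = ext0 F b" using Z_face[OF z] elt_face[OF F] by blast
  have r: "continuous_on UNIV (rp z T)" by (rule continuous_polys[OF rp_props(1)[OF T z]])
  have "continuous_on UNIV (\<lambda>y. rp z T y - b y)" "continuous_on UNIV (\<lambda>y. rp z T y - fst z T y)"
    using r continuous_polys[OF b(1)] continuous_polys[OF Z_elt[OF z T]] by (auto intro!: continuous_intros)
  from F.vec_L2_proj_poly[OF this(1), of "\<lambda>y. rp z T y - snd z F y" k] vec_L2_proj_poly[OF this(2) refl, of k]
  obtain p e where p: "p \<in> polys k UNIV" "\<And>x. x \<in> F \<Longrightarrow> face_proj k F (\<lambda>y. rp z T y - snd z F y) x = p x"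
    and e: "e \<in> polys k UNIV" "\<And>x. x \<in> T \<Longrightarrow> elt_proj k T (\<lambda>y. rp z T y - fst z T y) x = e x"
    by (auto simp: face_proj_def elt_proj_def b)
  have on_F: "trace T (disp_rec k Fh (R z) T) y - snd (R z) F y = rp z T y - snd z F y" if "y \<in> F" for y
    using that elt_face[OF F] trace_continuous[OF open_Th[OF T] _ r, of y "restrict (rp z T) T"]
    by (auto simp: disp_rec_R[OF T z])
  have "elt_proj k T (\<lambda>y. disp_rec k Fh (R z) T y - fst (R z) T y) = elt_proj k T (\<lambda>y. rp z T y - fst z T y)"
    unfolding elt_proj_def by (rule vec_L2_proj_cong) (simp add: disp_rec_R[OF T z] T)
  moreover have "face_proj k F (\<lambda>y. trace T (disp_rec k Fh (R z) T) y - snd (R z) F y) = face_proj k F (\<lambda>y. rp z T y - snd z F y)"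
    unfolding face_proj_def by (rule F.vec_L2_proj_cong) (rule on_F)
  moreover have "trace T (elt_proj k T (\<lambda>y. rp z T y - fst z T y)) x = e x" if "x \<in> F" for x
    using that elt_face[OF F] e by (intro trace_continuous[OF open_Th[OF T] _ continuous_polys[OF e(1)]]) auto
  ultimately have "face_residual k Fh (R z) T F x = p x - e x" if "x \<in> F" for x
    using that p(2) by (simp add: face_residual_def)
  then show ?thesis using that p e by blast
qed

lemma face_residual_poly:
  assumes T: "T \<in> Th" and F: "F \<in> elt_faces Fh T" and z: "z \<in> Z"
  obtains p where "p \<in> polys k UNIV" "\<And>x. x \<in> F \<Longrightarrow> face_residual k Fh (R z) T F x = p x"
proof -
  obtain p e where pe: "p \<in> polys k UNIV" "e \<in> polys k UNIV"
    "\<And>x. x \<in> F \<Longrightarrow> face_residual k Fh (R z) T F x = p x - e x"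
    by (rule face_residual_props[OF assms]) (rule that)
  have "p - e \<in> polys k UNIV" by (rule subspace_diff[OF subspace_polys[OF subspace_UNIV] pe(1,2)])
  then show ?thesis using that[of "p - e"] pe(3) by simp
qed

lemma face_residual_lin:
  assumes T: "T \<in> Th" and F: "F \<in> elt_faces Fh T" and uv: "u \<in> Z" "v \<in> Z" and x: "x \<in> F"
  shows "face_residual k Fh (R (\<alpha> *\<^sub>R u + \<beta> *\<^sub>R v)) T F x =
    \<alpha> *\<^sub>R face_residual k Fh (R u) T F x + \<beta> *\<^sub>R face_residual k Fh (R v) T F x"
proof -
  interpret poly_measure "lebesgue_on T" T by (rule poly_measure_T[OF T])
  interpret F: flat_face F using flat_face elt_face[OF F] by blast
  let ?w = "\<alpha> *\<^sub>R u + \<beta> *\<^sub>R v"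
  note w = lincomb_Z[OF uv, of \<alpha> \<beta>]
  have rw: "rp ?w T = \<alpha> *\<^sub>R rp u T + \<beta> *\<^sub>R rp v T" by (rule lin_onD[OF lin_on_rp[OF T] uv])
  have cont: "\<exists>c. continuous_on UNIV c \<and> (\<forall>x\<in>F. rp z T x - snd z F x = c x)"
    "continuous_on UNIV (\<lambda>y. rp z T y - fst z T y)" if z: "z \<in> Z" for z
  proof -
    obtain b where b: "b \<in> polys k UNIV" "snd z F = ext0 F b" using Z_face[OF z] elt_face[OF F] by blast
    have "continuous_on UNIV (\<lambda>y. rp z T y - b y)"
      by (intro continuous_intros continuous_polys[OF rp_props(1)[OF T z]] continuous_polys[OF b(1)])
    then show "\<exists>c. continuous_on UNIV c \<and> (\<forall>x\<in>F. rp z T x - snd z F x = c x)"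
      by (intro exI[of _ "\<lambda>y. rp z T y - b y"]) (simp add: b)
    show "continuous_on UNIV (\<lambda>y. rp z T y - fst z T y)"
      by (intro continuous_intros continuous_polys[OF rp_props(1)[OF T z]] continuous_polys[OF Z_elt[OF z T]])
  qed
  obtain pu eu where u: "pu \<in> polys k UNIV" "eu \<in> polys k UNIV"
    "\<And>x. x \<in> F \<Longrightarrow> face_proj k F (\<lambda>y. rp u T y - snd u F y) x = pu x"
    "\<And>x. x \<in> T \<Longrightarrow> elt_proj k T (\<lambda>y. rp u T y - fst u T y) x = eu x"
    "\<And>x. x \<in> F \<Longrightarrow> face_residual k Fh (R u) T F x = pu x - eu x"
    by (rule face_residual_props[OF T F uv(1)]) (rule that)
  obtain pv ev where v: "pv \<in> polys k UNIV" "ev \<in> polys k UNIV"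
    "\<And>x. x \<in> F \<Longrightarrow> face_proj k F (\<lambda>y. rp v T y - snd v F y) x = pv x"
    "\<And>x. x \<in> T \<Longrightarrow> elt_proj k T (\<lambda>y. rp v T y - fst v T y) x = ev x"
    "\<And>x. x \<in> F \<Longrightarrow> face_residual k Fh (R v) T F x = pv x - ev x"
    by (rule face_residual_props[OF T F uv(2)]) (rule that)
  obtain pw ew where pw: "pw \<in> polys k UNIV" "ew \<in> polys k UNIV"
    "\<And>x. x \<in> F \<Longrightarrow> face_proj k F (\<lambda>y. rp ?w T y - snd ?w F y) x = pw x"
    "\<And>x. x \<in> T \<Longrightarrow> elt_proj k T (\<lambda>y. rp ?w T y - fst ?w T y) x = ew x"
    "\<And>x. x \<in> F \<Longrightarrow> face_residual k Fh (R ?w) T F x = pw x - ew x"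
    by (rule face_residual_props[OF T F w]) (rule that)
  have "(\<lambda>y. rp ?w T y - snd ?w F y) = (\<lambda>y. \<alpha> *\<^sub>R (rp u T y - snd u F y) + \<beta> *\<^sub>R (rp v T y - snd v F y))"
    by (auto simp: rw fun_eq_iff algebra_simps)
  moreover obtain cu where cu: "continuous_on UNIV cu" "\<And>x. x \<in> F \<Longrightarrow> rp u T x - snd u F x = cu x" using cont(1)[OF uv(1)] by blast
  moreover obtain cv where cv: "continuous_on UNIV cv" "\<And>x. x \<in> F \<Longrightarrow> rp v T x - snd v F x = cv x" using cont(1)[OF uv(2)] by blast
  ultimately have 1: "pw x = \<alpha> *\<^sub>R pu x + \<beta> *\<^sub>R pv x"
    using F.vec_L2_proj_lincomb[OF cu cv x, of k \<alpha> \<beta>] pw(3)[OF x] u(3)[OF x] v(3)[OF x] by (simp add: face_proj_def)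
  have eq: "(\<lambda>y. rp ?w T y - fst ?w T y) = (\<lambda>y. \<alpha> *\<^sub>R (rp u T y - fst u T y) + \<beta> *\<^sub>R (rp v T y - fst v T y))"
    by (auto simp: rw fun_eq_iff algebra_simps)
  \<comment> \<open>The projection identity is available only on the open set \<open>T\<close>;
    polynomials that agree there agree everywhere, in particular on \<open>F\<close>.\<close>
  have "ew = \<alpha> *\<^sub>R eu + \<beta> *\<^sub>R ev"
  proof (rule polys_eq_on_T[OF T pw(2)])
    show "\<alpha> *\<^sub>R eu + \<beta> *\<^sub>R ev \<in> polys k UNIV" using u(2) v(2) by (intro subspace_add subspace_scale subspace_polys) auto
    fix y assume y: "y \<in> T"
    show "ew y = (\<alpha> *\<^sub>R eu + \<beta> *\<^sub>R ev) y"
      using vec_L2_proj_lincomb[OF cont(2)[OF uv(1)] refl cont(2)[OF uv(2)] refl y, of k \<alpha> \<beta>]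
        pw(4)[OF y] u(4)[OF y] v(4)[OF y] eq by (simp add: elt_proj_def)
  qed
  then show ?thesis unfolding pw(5)[OF x] u(5)[OF x] v(5)[OF x] 1 by (simp add: algebra_simps)
qed

lemma face_residual_affine:
  assumes T: "T \<in> Th" and F: "F \<in> elt_faces Fh T" and z: "z \<in> Z" and G: "Gp z T = 0" and x: "x \<in> F"
  shows "face_residual k Fh (R z) T F x = fst z T x - snd z F x"
proof -
  interpret poly_measure "lebesgue_on T" T by (rule poly_measure_T[OF T])
  interpret F: flat_face F using flat_face elt_face[OF F] by blast
  obtain p e where pe: "p \<in> polys k UNIV" "e \<in> polys k UNIV"
    "\<And>x. x \<in> F \<Longrightarrow> face_proj k F (\<lambda>y. rp z T y - snd z F y) x = p x"
    "\<And>x. x \<in> T \<Longrightarrow> elt_proj k T (\<lambda>y. rp z T y - fst z T y) x = e x"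
    "\<And>x. x \<in> F \<Longrightarrow> face_residual k Fh (R z) T F x = p x - e x"
    by (rule face_residual_props[OF T F z]) (rule that)
  obtain b where b: "b \<in> polys k UNIV" "snd z F = ext0 F b" using Z_face[OF z] elt_face[OF F] by blast
  have r: "rp z T \<in> polys k UNIV" by (rule rp_affine[OF T z G])
  have sub: "subspace (polys k UNIV :: (real^'n \<Rightarrow> real^'n) set)" by (rule subspace_polys) simp
  have "p x = rp z T x - snd z F x"
    using F.vec_L2_proj_id[OF subspace_diff[OF sub r b(1)], of "\<lambda>y. rp z T y - snd z F y" x] pe(3)[OF x] x by (simp add: face_proj_def b)
  moreover have "e = rp z T - fst z T"
  proof (rule polys_eq_on_T[OF T pe(2)])
    show d: "rp z T - fst z T \<in> polys k UNIV" by (rule subspace_diff[OF sub r Z_elt[OF z T]])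
    show "e y = (rp z T - fst z T) y" if "y \<in> T" for y
      using vec_L2_proj_id[OF d, of "\<lambda>y. rp z T y - fst z T y" y] pe(4)[OF that] that by (simp add: elt_proj_def)
  qed
  ultimately show ?thesis using pe(5)[OF x] by simp
qed

definition st :: "'n hybrid \<Rightarrow> 'n hybrid \<Rightarrow> real" where
  "st u v = stab \<gamma> k Th Fh (R u) (R v)"

lemma integrable_residual:
  assumes T: "T \<in> Th" and F: "F \<in> elt_faces Fh T" and uv: "u \<in> Z" "v \<in> Z"
  shows "integrable (face_measure F) (\<lambda>x. face_residual k Fh (R u) T F x \<bullet> face_residual k Fh (R v) T F x)"
proof -
  interpret F: flat_face F using flat_face elt_face[OF F] by blast
  obtain p where p: "p \<in> polys k UNIV" "\<And>x. x \<in> F \<Longrightarrow> face_residual k Fh (R u) T F x = p x"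
    by (rule face_residual_poly[OF T F uv(1)]) (rule that)
  obtain q where q: "q \<in> polys k UNIV" "\<And>x. x \<in> F \<Longrightarrow> face_residual k Fh (R v) T F x = q x"
    by (rule face_residual_poly[OF T F uv(2)]) (rule that)
  show ?thesis using F.integrable_inner_polys[OF p(1) q(1)]
    by (subst F.integrable_cong_X[of _ "\<lambda>x. p x \<bullet> q x"]) (auto simp: p q)
qed

lemma st_sym: "st u v = st v u"
  by (simp add: st_def stab_def local_stab_def inner_commute)

lemma lin_on_st: assumes w: "w \<in> Z" shows "lin_on Z (\<lambda>u. st u w)"
proof (rule lin_onI)
  fix u v :: "'n hybrid" and \<alpha> \<beta> assume uv: "u \<in> Z" "v \<in> Z"
  let ?r = "\<lambda>z T F x. face_residual k Fh (R z) T F x"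
  have "(\<integral>x. ?r (\<alpha> *\<^sub>R u + \<beta> *\<^sub>R v) T F x \<bullet> ?r w T F x \<partial>face_measure F) =
    \<alpha> * (\<integral>x. ?r u T F x \<bullet> ?r w T F x \<partial>face_measure F) + \<beta> * (\<integral>x. ?r v T F x \<bullet> ?r w T F x \<partial>face_measure F)"
    if T: "T \<in> Th" and F: "F \<in> elt_faces Fh T" for T F
  proof -
    interpret F: flat_face F using flat_face elt_face[OF F] by blast
    have "(\<integral>x. ?r (\<alpha> *\<^sub>R u + \<beta> *\<^sub>R v) T F x \<bullet> ?r w T F x \<partial>face_measure F) =
      (\<integral>x. \<alpha> * (?r u T F x \<bullet> ?r w T F x) + \<beta> * (?r v T F x \<bullet> ?r w T F x) \<partial>face_measure F)"
      by (rule F.integral_cong_X) (simp add: face_residual_lin[OF T F uv] inner_add_left)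
    then show ?thesis using integrable_residual[OF T F uv(1) w] integrable_residual[OF T F uv(2) w] by simp
  qed
  then show "st (\<alpha> *\<^sub>R u + \<beta> *\<^sub>R v) w = \<alpha> *\<^sub>R st u w + \<beta> *\<^sub>R st v w"
    unfolding st_def stab_def local_stab_def
    by (simp add: sum_distrib_left sum.distrib[symmetric] algebra_simps cong: sum.cong)
qed

lemma weight_pos: "F \<in> Fh \<Longrightarrow> \<gamma> / diameter F > 0"
  using flat_face.diameter_pos[OF flat_face dim] gamma by simp

lemma st_nonneg: "st u u \<ge> 0"
  unfolding st_def stab_def local_stab_def
  using weight_pos elt_face by (intro sum_nonneg mult_nonneg_nonneg) (auto intro: less_imp_le)

lemma st_zero:
  assumes u: "u \<in> Z" and z: "st u u = 0" and T: "T \<in> Th" and F: "F \<in> elt_faces Fh T" and x: "x \<in> F"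
  shows "face_residual k Fh (R u) T F x = 0"
proof -
  interpret F: flat_face F using flat_face elt_face[OF F] by blast
  let ?I = "\<lambda>T F. \<integral>x. face_residual k Fh (R u) T F x \<bullet> face_residual k Fh (R u) T F x \<partial>face_measure F"
  have nn: "\<gamma> / diameter F * ?I T F \<ge> 0" if "F \<in> elt_faces Fh T" for T F
    using weight_pos elt_face[OF that] by (intro mult_nonneg_nonneg) (auto intro: less_imp_le)
  have "local_stab \<gamma> k Fh (R u) (R u) T = 0"
    using z T finite_Th nn unfolding st_def stab_def
    by (subst (asm) sum_nonneg_eq_0_iff) (auto simp: local_stab_def intro!: sum_nonneg)
  then have "\<gamma> / diameter F * ?I T F = 0"
    using F finite_elt_faces nn unfolding local_stab_def by (subst (asm) sum_nonneg_eq_0_iff) auto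
  then have I: "?I T F = 0" using weight_pos[of F] elt_face[OF F] by auto
  obtain p where p: "p \<in> polys k UNIV" "\<And>x. x \<in> F \<Longrightarrow> face_residual k Fh (R u) T F x = p x"
    by (rule face_residual_poly[OF T F u]) (rule that)
  have "(\<integral>x. p x \<bullet> p x \<partial>face_measure F) = 0"
    using I by (subst F.integral_cong_X[of _ "\<lambda>x. face_residual k Fh (R u) T F x \<bullet> face_residual k Fh (R u) T F x"]) (auto simp: p)
  then show ?thesis using F.square_integral_zero[OF polynomial_function_polys[OF p(1)] _ x] p(2)[OF x] by simp
qed

end

section \<open>Gradients and integration by parts\<close>

definition has_gradient :: "(real^'n \<Rightarrow> real) \<Rightarrow> (real^'n \<Rightarrow> real^'n) \<Rightarrow> bool" where
  "has_gradient p g \<longleftrightarrow> continuous_on UNIV p \<and> continuous_on UNIV g \<and>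
    (\<forall>x. (p has_derivative (\<lambda>h. g x \<bullet> h)) (at x))"

lemma has_gradient_polys:
  assumes "p \<in> polys l (UNIV :: real set)"
  shows "has_gradient p (\<lambda>x. \<chi> i. partial i p x)"
  unfolding has_gradient_def
proof (intro conjI allI)
  show "continuous_on UNIV p" by (rule continuous_polys[OF assms])
  show "continuous_on UNIV (\<lambda>x. \<chi> i. partial i p x)"
    by (intro continuous_on_vec_lambda continuous_polys[OF partial_polys[OF assms]]) simp
  fix x
  have "(p has_derivative (\<lambda>h. \<Sum>i\<in>UNIV. h $ i *\<^sub>R partial i p x)) (at x)"
    by (rule has_derivative_partial[OF differentiable_polys[OF assms]])
  then show "(p has_derivative (\<lambda>h. (\<chi> i. partial i p x) \<bullet> h)) (at x)"
    by (simp add: inner_vec_def mult.commute)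
qed

lemma has_gradient_mult:
  assumes "has_gradient p g" "has_gradient q h"
  shows "has_gradient (\<lambda>x. p x * q x) (\<lambda>x. p x *\<^sub>R h x + q x *\<^sub>R g x)"
  unfolding has_gradient_def
proof (intro conjI allI)
  fix x
  have "(p has_derivative (\<lambda>v. g x \<bullet> v)) (at x)" "(q has_derivative (\<lambda>v. h x \<bullet> v)) (at x)"
    using assms by (auto simp: has_gradient_def)
  from has_derivative_mult[OF this]
  show "((\<lambda>x. p x * q x) has_derivative (\<lambda>v. (p x *\<^sub>R h x + q x *\<^sub>R g x) \<bullet> v)) (at x)"
    by (rule has_derivative_eq_rhs) (simp add: inner_add_left fun_eq_iff mult.commute)
qed (use assms in \<open>auto simp: has_gradient_def intro!: continuous_intros\<close>)

lemma has_gradient_sum: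
  assumes "\<And>i. i \<in> I \<Longrightarrow> has_gradient (p i) (g i)"
  shows "has_gradient (\<lambda>x. \<Sum>i\<in>I. p i x) (\<lambda>x. \<Sum>i\<in>I. g i x)"
  unfolding has_gradient_def
proof (intro conjI allI)
  fix x
  have "((\<lambda>x. \<Sum>i\<in>I. p i x) has_derivative (\<lambda>v. \<Sum>i\<in>I. g i x \<bullet> v)) (at x)"
    using assms by (intro has_derivative_sum) (auto simp: has_gradient_def)
  then show "((\<lambda>x. \<Sum>i\<in>I. p i x) has_derivative (\<lambda>v. (\<Sum>i\<in>I. g i x) \<bullet> v)) (at x)"
    by (simp add: inner_sum_left)
qed (use assms in \<open>auto simp: has_gradient_def intro!: continuous_on_sum\<close>)

lemma has_gradient_coordinate_prod:
  fixes \<psi> \<psi>' :: "'n::finite \<Rightarrow> real \<Rightarrow> real"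
  assumes "\<And>j s. (\<psi> j has_real_derivative \<psi>' j s) (at s)" "\<And>j. continuous_on UNIV (\<psi>' j)"
  shows "has_gradient (\<lambda>x. \<Prod>j\<in>UNIV. \<psi> j (x $ j))
    (\<lambda>x. \<chi> j. \<psi>' j (x $ j) * (\<Prod>m\<in>UNIV - {j}. \<psi> m (x $ m)))"
  unfolding has_gradient_def
proof (intro conjI allI)
  have c: "continuous_on UNIV (\<psi> j)" for j
    using assms(1) by (meson DERIV_isCont continuous_at_imp_continuous_on)
  have cc: "continuous_on UNIV (\<lambda>x::real^'n. \<psi> j (x $ j))" "continuous_on UNIV (\<lambda>x::real^'n. \<psi>' j (x $ j))" for j
    by (rule continuous_on_compose2[OF c], auto intro!: continuous_intros)
      (rule continuous_on_compose2[OF assms(2)], auto intro!: continuous_intros)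
  show "continuous_on UNIV (\<lambda>x::real^'n. \<Prod>j\<in>UNIV. \<psi> j (x $ j))"
    by (intro continuous_on_prod cc)
  show "continuous_on UNIV (\<lambda>x::real^'n. \<chi> j. \<psi>' j (x $ j) * (\<Prod>m\<in>UNIV - {j}. \<psi> m (x $ m)))"
    by (intro continuous_on_vec_lambda continuous_on_mult continuous_on_prod cc)
  fix x :: "real^'n"
  have "((\<lambda>x::real^'n. \<psi> j (x $ j)) has_derivative (\<lambda>h. \<psi>' j (x $ j) * h $ j)) (at x)" for j
  proof -
    have 1: "((\<lambda>x::real^'n. x $ j) has_derivative (\<lambda>h. h $ j)) (at x)"
      by (rule bounded_linear_imp_has_derivative[OF bounded_linear_vec_nth])
    have "(\<psi> j has_derivative (\<lambda>s. \<psi>' j (x $ j) * s)) (at (x $ j))"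
      using assms(1) by (simp add: has_field_derivative_def)
    from has_derivative_compose[OF 1 this] show ?thesis .
  qed
  from has_derivative_prod[of UNIV, OF this]
  show "((\<lambda>x::real^'n. \<Prod>j\<in>UNIV. \<psi> j (x $ j)) has_derivative
      (\<lambda>h. (\<chi> j. \<psi>' j (x $ j) * (\<Prod>m\<in>UNIV - {j}. \<psi> m (x $ m))) \<bullet> h)) (at x)"
    by (rule has_derivative_eq_rhs) (simp add: fun_eq_iff inner_vec_def mult_ac)
qed

subsection \<open>Test functions\<close>

text \<open>Squaring makes the truncation continuously differentiable at 0; all factors of the test
  functions are built from this one.\<close>

lemma truncated_square_derivative:
  "((\<lambda>s. (max 0 s)\<^sup>2) has_real_derivative 2 * max 0 s) (at s)" for s :: real
proof (cases s "0::real" rule: linorder_cases)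
  case less
  have "((\<lambda>s. 0) has_real_derivative 0) (at s)" by simp
  moreover have "eventually (\<lambda>t. (max 0 t)\<^sup>2 = 0) (nhds s)"
    using eventually_nhds_in_open[of "{..<0}" s] less by (auto elim!: eventually_mono)
  ultimately show ?thesis using less by (subst DERIV_cong_ev[OF refl _ refl, of _ "\<lambda>_. 0"]) auto
next
  case greater
  have "((\<lambda>s. s\<^sup>2) has_real_derivative 2 * s) (at s)" by (auto intro!: derivative_eq_intros)
  moreover have "eventually (\<lambda>t. (max 0 t)\<^sup>2 = t\<^sup>2) (nhds s)"
    using eventually_nhds_in_open[of "{0<..}" s] greater by (auto elim!: eventually_mono simp: max_def)
  ultimately show ?thesis using greater by (subst DERIV_cong_ev[OF refl _ refl, of _ "\<lambda>s. s\<^sup>2"]) (auto simp: max_def)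
next
  case equal
  have "((\<lambda>h. ((max 0 (0 + h))\<^sup>2 - (max 0 0)\<^sup>2) / h) \<longlongrightarrow> 0) (at (0::real))"
  proof (rule Lim_null_comparison)
    show "eventually (\<lambda>h. norm (((max 0 (0 + h))\<^sup>2 - (max 0 0)\<^sup>2) / h) \<le> \<bar>h\<bar>) (at (0::real))"
      by (auto intro!: always_eventually simp: max_def power2_eq_square)
    show "((\<lambda>h. \<bar>h\<bar>) \<longlongrightarrow> 0) (at (0::real))" by (rule tendsto_eq_intros) (auto intro!: tendsto_eq_intros)
  qed
  then show ?thesis using equal by (simp add: DERIV_def)
qed

lemma bump_derivative:
  "((\<lambda>s. (max 0 (\<delta>\<^sup>2 - (s - c)\<^sup>2))\<^sup>2) has_real_derivative 2 * max 0 (\<delta>\<^sup>2 - (s - c)\<^sup>2) * (- 2 * (s - c))) (at s)"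
  for s :: real
proof -
  have "((\<lambda>s. \<delta>\<^sup>2 - (s - c)\<^sup>2) has_real_derivative - 2 * (s - c)) (at s)"
    by (auto intro!: derivative_eq_intros)
  from DERIV_chain[OF truncated_square_derivative this] show ?thesis by (simp add: o_def)
qed

text \<open>A second difference of \<open>max 0\<close>: for positive \<open>\<delta>\<close>, the
  tent of height \<open>\<delta>\<close> over the interval of radius \<open>\<delta>\<close> around
  \<open>c\<close>.\<close>

definition hat :: "real \<Rightarrow> real \<Rightarrow> real \<Rightarrow> real" where
  "hat c \<delta> s = max 0 (s - c + \<delta>) - 2 * max 0 (s - c) + max 0 (s - c - \<delta>)"

text \<open>The antiderivative of \<open>hat\<close>, as the same second difference of truncated
  squares. It rises from 0 to the constant \<open>\<delta>\<^sup>2\<close>, so it does not have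
  compact support.\<close>

definition hat_int :: "real \<Rightarrow> real \<Rightarrow> real \<Rightarrow> real" where
  "hat_int c \<delta> s = ((max 0 (s - c + \<delta>))\<^sup>2 - 2 * (max 0 (s - c))\<^sup>2 + (max 0 (s - c - \<delta>))\<^sup>2) / 2"

lemma hat_int_derivative: "(hat_int c \<delta> has_real_derivative hat c \<delta> s) (at s)"
proof -
  have "((\<lambda>s. (max 0 (s - c + a))\<^sup>2) has_real_derivative 2 * max 0 (s - c + a)) (at s)" for a
  proof -
    have "((\<lambda>s. s - c + a) has_real_derivative 1) (at s)" by (auto intro!: derivative_eq_intros)
    from DERIV_chain[OF truncated_square_derivative this] show ?thesis by (simp add: o_def)
  qed
  note d = this
  from DERIV_cdivide[OF DERIV_add[OF DERIV_diff[OF d[of \<delta>] DERIV_cmult[OF d[of 0], of 2]] d[of "- \<delta>"]], of 2]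
  have "(hat_int c \<delta> has_real_derivative
      (2 * max 0 (s - c + \<delta>) - 2 * (2 * max 0 (s - c)) + 2 * max 0 (s - c - \<delta>)) / 2) (at s)"
    unfolding hat_int_def[abs_def] by simp
  then show ?thesis by (rule DERIV_cong) (simp add: hat_def field_simps)
qed

lemma hat_props:
  assumes "\<delta> > 0"
  shows "hat c \<delta> s \<ge> 0" "hat c \<delta> c > 0" "\<bar>s - c\<bar> \<ge> \<delta> \<Longrightarrow> hat c \<delta> s = 0" "continuous_on UNIV (hat c \<delta>)"
proof -
  show "hat c \<delta> s \<ge> 0" "hat c \<delta> c > 0" "\<bar>s - c\<bar> \<ge> \<delta> \<Longrightarrow> hat c \<delta> s = 0"
    using assms by (auto simp: hat_def max_def)
  show "continuous_on UNIV (hat c \<delta>)" unfolding hat_def[abs_def] by (intro continuous_intros)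
qed

text \<open>Take \<open>hat_int\<close> in coordinate \<open>i\<close> and compactly supported bumps
  in the others. The derivative in direction \<open>i\<close> replaces \<open>hat_int\<close> by
  \<open>hat\<close>, so it is a product of nonnegative bumps, although the function itself extends
  along the \<open>i\<close>-axis.\<close>

lemma partial_bump_exists:
  fixes c :: "real^'n" and i :: 'n
  assumes \<delta>: "\<delta> > 0"
  obtains \<phi> g where "has_gradient \<phi> g" "\<And>x. g x $ i \<ge> 0" "g c $ i > 0"
    "\<And>x. g x $ i \<noteq> 0 \<Longrightarrow> \<forall>j. \<bar>x $ j - c $ j\<bar> < \<delta>"
proof -
  define \<psi> where "\<psi> j s = (if j = i then hat_int (c $ i) \<delta> s else (max 0 (\<delta>\<^sup>2 - (s - c $ j)\<^sup>2))\<^sup>2)" for j s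
  define \<psi>' where "\<psi>' j s = (if j = i then hat (c $ i) \<delta> s else 2 * max 0 (\<delta>\<^sup>2 - (s - c $ j)\<^sup>2) * (- 2 * (s - c $ j)))" for j s
  have der: "(\<psi> j has_real_derivative \<psi>' j s) (at s)" for j s
    unfolding \<psi>_def[abs_def] \<psi>'_def using hat_int_derivative bump_derivative by (cases "j = i") simp_all
  have cont: "continuous_on UNIV (\<psi>' j)" for j
    unfolding \<psi>'_def[abs_def] using hat_props(4)[OF \<delta>] by (cases "j = i") (auto intro!: continuous_intros)
  let ?g = "\<lambda>x::real^'n. \<chi> j. \<psi>' j (x $ j) * (\<Prod>m\<in>UNIV - {j}. \<psi> m (x $ m))"
  have gi: "?g x $ i = hat (c $ i) \<delta> (x $ i) * (\<Prod>m\<in>UNIV - {i}. (max 0 (\<delta>\<^sup>2 - (x $ m - c $ m)\<^sup>2))\<^sup>2)" for x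
  proof -
    have "(\<Prod>m\<in>UNIV - {i}. \<psi> m (x $ m)) = (\<Prod>m\<in>UNIV - {i}. (max 0 (\<delta>\<^sup>2 - (x $ m - c $ m)\<^sup>2))\<^sup>2)"
      by (rule prod.cong) (auto simp: \<psi>_def)
    then show ?thesis by (simp add: \<psi>'_def)
  qed
  show ?thesis
  proof (rule that[OF has_gradient_coordinate_prod[OF der cont]])
    show "?g x $ i \<ge> 0" for x unfolding gi using hat_props(1)[OF \<delta>] by (intro mult_nonneg_nonneg prod_nonneg) auto
    show "?g c $ i > 0" unfolding gi using hat_props(2)[OF \<delta>] \<delta> by (intro mult_pos_pos prod_pos) auto
    fix x assume nz: "?g x $ i \<noteq> 0"
    show "\<forall>j. \<bar>x $ j - c $ j\<bar> < \<delta>"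
    proof
      fix j
      show "\<bar>x $ j - c $ j\<bar> < \<delta>"
      proof (cases "j = i")
        case True
        then show ?thesis using nz hat_props(3)[OF \<delta>, of "x $ i" "c $ i"] unfolding gi by force
      next
        case False
        then have "(max 0 (\<delta>\<^sup>2 - (x $ j - c $ j)\<^sup>2))\<^sup>2 \<noteq> 0" using nz unfolding gi by auto
        then have "(x $ j - c $ j)\<^sup>2 < \<delta>\<^sup>2" by (auto simp: max_def split: if_splits)
        then show ?thesis using \<delta> by (metis abs_of_pos power2_abs power2_less_imp_less abs_ge_zero less_imp_le)
      qed
    qed
  qed
qed

section \<open>The kernel of the energy form\<close>

context hho
begin

lemma integral_T_lborel:
  fixes g :: "real^'n \<Rightarrow> real"
  assumes T: "T \<in> Th" and g: "continuous_on UNIV g"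
  shows "(\<integral>x. g x \<partial>lebesgue_on T) = (\<integral>x. indicator T x * g x \<partial>lborel)"
proof -
  have [measurable]: "g \<in> borel_measurable borel" using g by (rule borel_measurable_continuous_onI)
  have [measurable]: "T \<in> sets borel" by (rule T_lebesgue[OF T])
  have "(\<integral>x. g x \<partial>lebesgue_on T) = (\<integral>x. indicator T x *\<^sub>R g x \<partial>lebesgue)"
    using T_lebesgue[OF T] by (subst integral_restrict_space) auto
  also have "\<dots> = (\<integral>x. indicator T x *\<^sub>R g x \<partial>lborel)" by (rule integral_completion) measurable
  finally show ?thesis by simp
qed

lemma integration_by_parts:
  assumes T: "T \<in> Th" and p: "has_gradient p g"
  shows "(\<integral>x. g x \<bullet> e \<partial>lebesgue_on T) = (\<Sum>F\<in>elt_faces Fh T. \<integral>x. p x * (outward_normal T F x \<bullet> e) \<partial>face_measure F)"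
proof -
  have "continuous_on UNIV (\<lambda>x. g x \<bullet> e)" using p by (auto simp: has_gradient_def intro!: continuous_intros)
  from integral_T_lborel[OF T this] show ?thesis
    using divergence_mesh[OF T, of p g e] p by (simp add: has_gradient_def)
qed

lemma integrable_face_normal_component:
  assumes T: "T \<in> Th" and F: "F \<in> elt_faces Fh T" and p: "continuous_on UNIV p"
  shows "integrable (face_measure F) (\<lambda>x. p x * (outward_normal T F x \<bullet> e))"
  by (rule integrable_normal[OF T F p, of "\<lambda>n c. c * (n \<bullet> e)"]) (auto simp: case_prod_unfold intro!: continuous_intros)

text \<open>If the face components are the boundary values of \<open>v\<close>, the right-hand side
  is the divergence theorem for the vector field \<open>\<tau> v\<close>, read backwards.\<close>

lemma strain_rhs_conforming:
  assumes T: "T \<in> Th" and z: "z \<in> Z" and tr: "\<And>F x. F \<in> elt_faces Fh T \<Longrightarrow> x \<in> F \<Longrightarrow> snd z F x = fst z T x"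
    and \<tau>: "\<tau> \<in> polys k sym_mats"
  shows "strain_rhs z T \<tau> = (\<integral>x. sym_grad (fst z T) x \<bullet> \<tau> x \<partial>lebesgue_on T)"
proof -
  define v where "v = fst z T"
  have v: "v \<in> polys k UNIV" unfolding v_def by (rule Z_elt[OF z T])
  have vi: "(\<lambda>x. v x $ i) \<in> polys k UNIV" for i by (rule polys_component[OF v])
  have \<tau>ij: "(\<lambda>x. \<tau> x $ i $ j) \<in> polys k UNIV" for i j
    using polys_component[OF polys_component[OF polys_UNIV[OF \<tau>], of i], of j] .
  have sym: "\<tau> x $ i $ j = \<tau> x $ j $ i" for x i j
  proof -
    have "\<tau> x \<in> sym_mats"
    proof -
      obtain c where "\<And>\<alpha>. c \<alpha> \<in> sym_mats" "\<tau> = (\<lambda>x. \<Sum>\<alpha> | (\<Sum>i\<in>UNIV. \<alpha> i) \<le> k. mono_fn \<alpha> x *\<^sub>R c \<alpha>)"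
        using \<tau> by (rule polysE) (rule that)
      then show ?thesis by (auto intro!: subspace_sum[OF subspace_sym_mats] subspace_scale[OF subspace_sym_mats])
    qed
    then have "transpose (\<tau> x) $ i $ j = \<tau> x $ i $ j" by (simp add: sym_mats_def)
    then show ?thesis by (simp add: transpose_def)
  qed
  \<comment> \<open>The components of the field \<open>\<tau> v\<close>, with gradients
    \<open>g j\<close>; integration by parts is applied to them one at a time.\<close>
  define p where "p j x = (\<Sum>i\<in>UNIV. v x $ i * \<tau> x $ i $ j)" for j x
  define g where "g j x = (\<Sum>i\<in>UNIV. v x $ i *\<^sub>R (\<chi> m. partial m (\<lambda>x. \<tau> x $ i $ j) x) + \<tau> x $ i $ j *\<^sub>R (\<chi> m. partial m (\<lambda>x. v x $ i) x))" for j x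
  have grad: "has_gradient (p j) (g j)" for j
    unfolding p_def[abs_def] g_def[abs_def] by (intro has_gradient_sum has_gradient_mult[OF has_gradient_polys[OF vi] has_gradient_polys[OF \<tau>ij]])
  have pc: "continuous_on UNIV (p j)" and gc: "continuous_on UNIV (g j)" for j using grad by (auto simp: has_gradient_def)
  have pv: "partial m (\<lambda>x. v x $ i) x = partial m v x $ i" for m i x
    by (rule partial_component[OF differentiable_polys[OF v], symmetric])
  have pt: "partial m (\<lambda>x. \<tau> x $ i $ j) x = partial m \<tau> x $ i $ j" for m i j x
  proof -
    have "partial m \<tau> x $ i = partial m (\<lambda>x. \<tau> x $ i) x"
      by (rule partial_component[OF differentiable_polys[OF \<tau>]])
    moreover have "partial m (\<lambda>x. \<tau> x $ i) x $ j = partial m (\<lambda>x. \<tau> x $ i $ j) x"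
      by (rule partial_component[OF differentiable_polys[OF polys_component[OF polys_UNIV[OF \<tau>], of i]]])
    ultimately show ?thesis by simp
  qed
  \<comment> \<open>The product rule for the divergence of \<open>\<tau> v\<close>. Symmetry of
    \<open>\<tau>\<close> replaces the gradient of \<open>v\<close> by its symmetric part.\<close>
  have div: "(\<Sum>j\<in>UNIV. g j x \<bullet> axis j 1) = sym_grad v x \<bullet> \<tau> x + v x \<bullet> divergence \<tau> x" for x
  proof -
    have "(\<Sum>j\<in>UNIV. g j x \<bullet> axis j 1) = (\<Sum>j\<in>UNIV. \<Sum>i\<in>UNIV. v x $ i * partial j \<tau> x $ i $ j) + (\<Sum>j\<in>UNIV. \<Sum>i\<in>UNIV. \<tau> x $ i $ j * partial j v x $ i)"
      by (simp add: g_def inner_axis sum.distrib pv pt)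
    also have "(\<Sum>j\<in>UNIV. \<Sum>i\<in>UNIV. v x $ i * partial j \<tau> x $ i $ j) = v x \<bullet> divergence \<tau> x"
      by (subst sum.swap) (simp add: divergence_def inner_vec_def sum_distrib_left)
    also have "(\<Sum>j\<in>UNIV. \<Sum>i\<in>UNIV. \<tau> x $ i $ j * partial j v x $ i) = sym_grad v x \<bullet> \<tau> x"
    proof -
      let ?a = "\<lambda>i j. \<tau> x $ i $ j * partial j v x $ i"
      have "sym_grad v x \<bullet> \<tau> x = (\<Sum>i\<in>UNIV. \<Sum>j\<in>UNIV. (?a j i) / 2 + (?a i j) / 2)"
        unfolding inner_vec_def sym_grad_def
        by (intro sum.cong refl) (simp add: sym[of x] add_divide_distrib distrib_left mult.commute)
      also have "\<dots> = (\<Sum>i\<in>UNIV. \<Sum>j\<in>UNIV. (?a j i) / 2) + (\<Sum>i\<in>UNIV. \<Sum>j\<in>UNIV. (?a i j) / 2)"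
        by (simp add: sum.distrib)
      also have "(\<Sum>i\<in>UNIV. \<Sum>j\<in>UNIV. (?a i j) / 2) = (\<Sum>i\<in>UNIV. \<Sum>j\<in>UNIV. (?a j i) / 2)" by (rule sum.swap)
      finally show ?thesis by (simp flip: sum_divide_distrib)
    qed
    finally show ?thesis by simp
  qed
  have flux: "(\<integral>x. snd z F x \<bullet> (\<tau> x *v outward_normal T F x) \<partial>face_measure F) =
    (\<Sum>j\<in>UNIV. \<integral>x. p j x * (outward_normal T F x \<bullet> axis j 1) \<partial>face_measure F)" if F: "F \<in> elt_faces Fh T" for F
  proof -
    interpret F: flat_face F using flat_face elt_face[OF F] by blast
    have "(\<integral>x. snd z F x \<bullet> (\<tau> x *v outward_normal T F x) \<partial>face_measure F) =
      (\<integral>x. (\<Sum>j\<in>UNIV. p j x * (outward_normal T F x \<bullet> axis j 1)) \<partial>face_measure F)"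
    proof (rule F.integral_cong_X)
      fix x assume "x \<in> F"
      then have "snd z F x = v x" using tr[OF F] by (simp add: v_def)
      then have "snd z F x \<bullet> (\<tau> x *v outward_normal T F x) = (v x v* \<tau> x) \<bullet> outward_normal T F x"
        by (simp add: dot_lmul_matrix)
      also have "\<dots> = (\<Sum>j\<in>UNIV. p j x * (outward_normal T F x \<bullet> axis j 1))"
        by (simp add: vector_matrix_mult_def inner_vec_def[of "\<chi> j. _ j"] inner_axis p_def mult.commute)
      finally show "snd z F x \<bullet> (\<tau> x *v outward_normal T F x) = (\<Sum>j\<in>UNIV. p j x * (outward_normal T F x \<bullet> axis j 1))" .
    qed
    also have "\<dots> = (\<Sum>j\<in>UNIV. \<integral>x. p j x * (outward_normal T F x \<bullet> axis j 1) \<partial>face_measure F)"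
      by (rule Bochner_Integration.integral_sum) (rule integrable_face_normal_component[OF T F pc])
    finally show ?thesis .
  qed
  have "(\<Sum>F\<in>elt_faces Fh T. \<integral>x. snd z F x \<bullet> (\<tau> x *v outward_normal T F x) \<partial>face_measure F) =
    (\<Sum>j\<in>UNIV. \<Sum>F\<in>elt_faces Fh T. \<integral>x. p j x * (outward_normal T F x \<bullet> axis j 1) \<partial>face_measure F)"
    by (simp add: flux cong: sum.cong) (rule sum.swap)
  also have "\<dots> = (\<Sum>j\<in>UNIV. \<integral>x. g j x \<bullet> axis j 1 \<partial>lebesgue_on T)"
    by (simp add: integration_by_parts[OF T grad])
  also have "\<dots> = (\<integral>x. (\<Sum>j\<in>UNIV. g j x \<bullet> axis j 1) \<partial>lebesgue_on T)"
    using gc by (intro Bochner_Integration.integral_sum[symmetric] poly_measure.integrable_continuous[OF poly_measure_T[OF T]] continuous_intros)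
  also have "\<dots> = (\<integral>x. sym_grad v x \<bullet> \<tau> x \<partial>lebesgue_on T) + (\<integral>x. v x \<bullet> divergence \<tau> x \<partial>lebesgue_on T)"
    unfolding div using integrable_elt[OF T sym_grad_polys[OF v] \<tau>] integrable_elt[OF T v divergence_polys[OF polys_UNIV[OF \<tau>]]]
    by (rule Bochner_Integration.integral_add)
  finally show ?thesis by (simp add: strain_rhs_def v_def)
qed

text \<open>The symmetric gradient of the element component is itself an admissible test function,
  being symmetric of degree at most \<open>k\<close>; tested with itself, its square integral
  vanishes.\<close>

lemma conforming_sym_grad_zero:
  assumes T: "T \<in> Th" and z: "z \<in> Z" and tr: "\<And>F x. F \<in> elt_faces Fh T \<Longrightarrow> x \<in> F \<Longrightarrow> snd z F x = fst z T x"
    and G: "Gp z T = 0"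
  shows "sym_grad (fst z T) = 0"
proof -
  interpret poly_measure "lebesgue_on T" T by (rule poly_measure_T[OF T])
  note s = sym_grad_polys[OF Z_elt[OF z T]]
  have "(\<integral>x. sym_grad (fst z T) x \<bullet> sym_grad (fst z T) x \<partial>lebesgue_on T) = 0"
    using strain_rhs_conforming[OF T z tr s] Gp_props(2)[OF T z s] G by simp
  then have "sym_grad (fst z T) x = 0" if "x \<in> T" for x
    using square_integral_zero[OF polynomial_function_polys[OF s] _ that] by blast
  then show ?thesis by (rule polys_zero_on_T[OF T s])
qed

lemma conforming_global_identity:
  assumes z: "z \<in> Z" and tr: "\<And>T F x. T \<in> Th \<Longrightarrow> F \<in> elt_faces Fh T \<Longrightarrow> x \<in> F \<Longrightarrow> snd z F x = fst z T x"
    and sg: "\<And>T. T \<in> Th \<Longrightarrow> sym_grad (fst z T) = 0" and \<phi>: "has_gradient \<phi> g"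
  shows "(\<Sum>T\<in>Th. \<integral>x. fst z T x $ i * g x $ i \<partial>lebesgue_on T) = 0"
proof -
  have cphi: "continuous_on UNIV \<phi>" using \<phi> by (simp add: has_gradient_def)
  let ?I = "\<lambda>T F. \<integral>x. (snd z F x $ i * \<phi> x) * (outward_normal T F x \<bullet> axis i 1) \<partial>face_measure F"
  have "(\<integral>x. fst z T x $ i * g x $ i \<partial>lebesgue_on T) = (\<Sum>F\<in>elt_faces Fh T. ?I T F)" if T: "T \<in> Th" for T
  proof -
    let ?v = "\<lambda>x. fst z T x $ i"
    note v = polys_component[OF Z_elt[OF z T], of i]
    have "sym_grad (fst z T) x $ i $ i = 0" for x using sg[OF T] by simp
    then have "partial i (fst z T) x $ i = 0" for x by (simp add: sym_grad_def)
    moreover have "partial i (fst z T) x $ i = partial i ?v x" for x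
      by (rule partial_component[OF differentiable_polys[OF Z_elt[OF z T]]])
    ultimately have "partial i ?v x = 0" for x by simp
    then have gr: "(?v x *\<^sub>R g x + \<phi> x *\<^sub>R (\<chi> j. partial j ?v x)) \<bullet> axis i 1 = ?v x * g x $ i" for x
      by (simp add: inner_axis)
    have "(\<integral>x. ?v x * g x $ i \<partial>lebesgue_on T) =
      (\<Sum>F\<in>elt_faces Fh T. \<integral>x. (?v x * \<phi> x) * (outward_normal T F x \<bullet> axis i 1) \<partial>face_measure F)"
      using integration_by_parts[OF T has_gradient_mult[OF has_gradient_polys[OF v] \<phi>], of "axis i 1"] unfolding gr .
    also have "\<dots> = (\<Sum>F\<in>elt_faces Fh T. ?I T F)"
    proof (rule sum.cong[OF refl])
      fix F assume F: "F \<in> elt_faces Fh T"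
      interpret F: flat_face F using flat_face elt_face[OF F] by blast
      show "(\<integral>x. (?v x * \<phi> x) * (outward_normal T F x \<bullet> axis i 1) \<partial>face_measure F) = ?I T F"
        by (rule F.integral_cong_X) (simp add: tr[OF T F])
    qed
    finally show ?thesis .
  qed
  then have "(\<Sum>T\<in>Th. \<integral>x. fst z T x $ i * g x $ i \<partial>lebesgue_on T) = (\<Sum>T\<in>Th. \<Sum>F\<in>{F. F \<in> Fh \<and> F \<subseteq> frontier T}. ?I T F)"
    by (simp add: elt_faces_def)
  also have "\<dots> = (\<Sum>F\<in>Fh. \<Sum>T\<in>{T. T \<in> Th \<and> F \<subseteq> frontier T}. ?I T F)"
    by (rule sum.swap_restrict[OF finite_Th finite_Fh])
  also have "\<dots> = 0"
  proof (rule sum.neutral, rule ballI)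
    fix F assume F: "F \<in> Fh"
    interpret F: flat_face F using flat_face F by blast
    let ?S = "{T. T \<in> Th \<and> F \<subseteq> frontier T}"
    have S: "?S = {T\<in>Th. F \<in> elt_faces Fh T}" using F by (auto simp: elt_faces_def)
    show "(\<Sum>T\<in>?S. ?I T F) = 0"
    proof (cases "is_boundary_face \<Omega> Th F")
      case True
      then have "snd z F = 0" using z F by (simp add: Z_def)
      then show ?thesis by simp
    next
      case False
      obtain b where b: "b \<in> polys k UNIV" "snd z F = ext0 F b" using Z_face[OF z F] by blast
      have cb: "continuous_on UNIV (\<lambda>x. b x $ i * \<phi> x)"
        by (intro continuous_on_mult continuous_polys[OF polys_component[OF b(1)]] cphi)
      have int: "integrable (face_measure F) (\<lambda>x. (snd z F x $ i * \<phi> x) * (outward_normal T F x \<bullet> axis i 1))" if "T \<in> ?S" for T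
        using integrable_face_normal_component[OF _ _ cb, of T F "axis i 1"] that F
        by (subst F.integrable_cong_X[of _ "\<lambda>x. (b x $ i * \<phi> x) * (outward_normal T F x \<bullet> axis i 1)"]) (auto simp: b elt_faces_def)
      have "(\<Sum>T\<in>?S. ?I T F) = (\<integral>x. (\<Sum>T\<in>?S. (snd z F x $ i * \<phi> x) * (outward_normal T F x \<bullet> axis i 1)) \<partial>face_measure F)"
        by (rule Bochner_Integration.integral_sum[symmetric]) (rule int)
      also have "\<dots> = 0"
      proof (rule integral_eq_zero_AE)
        show "AE x in face_measure F. (\<Sum>T\<in>?S. (snd z F x $ i * \<phi> x) * (outward_normal T F x \<bullet> axis i 1)) = 0"
          using outward_normals_cancel[OF F False] unfolding S
        proof eventually_elim
          case (elim x)
          have "(\<Sum>T\<in>{T\<in>Th. F \<in> elt_faces Fh T}. (snd z F x $ i * \<phi> x) * (outward_normal T F x \<bullet> axis i 1)) =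
            (snd z F x $ i * \<phi> x) * ((\<Sum>T\<in>{T\<in>Th. F \<in> elt_faces Fh T}. outward_normal T F x) \<bullet> axis i 1)"
            by (simp add: inner_sum_left sum_distrib_left)
          then show ?case using elim by simp
        qed
      qed
      finally show ?thesis .
    qed
  qed
  finally show ?thesis .
qed

text \<open>This replaces Korn's inequality: a component \<open>v\<^sub>i\<close> that does not vanish near a point is
  excluded by a test function \<open>\<phi>\<close> with \<open>\<partial>\<^sub>i \<phi> \<ge> 0\<close> supported near that point. Here \<open>\<phi>\<close> itself need
  not have compact support, as \<open>v\<^sub>F = 0\<close> on the boundary.\<close>

lemma conforming_zero:
  assumes z: "z \<in> Z" and tr: "\<And>T F x. T \<in> Th \<Longrightarrow> F \<in> elt_faces Fh T \<Longrightarrow> x \<in> F \<Longrightarrow> snd z F x = fst z T x"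
    and sg: "\<And>T. T \<in> Th \<Longrightarrow> sym_grad (fst z T) = 0" and T: "T \<in> Th" and x: "x \<in> T"
  shows "fst z T x $ i = 0"
proof (rule ccontr)
  assume nz: "fst z T x $ i \<noteq> 0"
  interpret poly_measure "lebesgue_on T" T by (rule poly_measure_T[OF T])
  \<comment> \<open>The sign makes the component positive at \<open>x\<close>, hence on a
    neighbourhood of \<open>x\<close>.\<close>
  define s where "s = sgn (fst z T x $ i)"
  have cv: "continuous_on UNIV (\<lambda>y. s * fst z T y $ i)"
    by (intro continuous_intros continuous_polys[OF polys_component[OF Z_elt[OF z T]]])
  have "open ((\<lambda>y. s * fst z T y $ i) -` {0<..} \<inter> UNIV)"
    using cv by (subst (asm) continuous_on_open_vimage) auto
  then have "open (T \<inter> (\<lambda>y. s * fst z T y $ i) -` {0<..})" (is "open ?U") using open_Th[OF T] by auto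
  moreover have "x \<in> ?U" using x nz by (auto simp: s_def sgn_if)
  ultimately obtain r where r: "r > 0" "ball x r \<subseteq> ?U" by (rule openE)
  \<comment> \<open>The Euclidean norm is at most the sum of the moduli of the coordinates, so the
    open cube of this half-width around \<open>x\<close> lies in \<open>ball x r\<close>.\<close>
  define \<delta> where "\<delta> = r / real CARD('n)"
  have \<delta>: "\<delta> > 0" using r by (simp add: \<delta>_def)
  have box: "y \<in> ball x r" if "\<And>j. \<bar>y $ j - x $ j\<bar> < \<delta>" for y
  proof -
    have "norm (y - x) \<le> (\<Sum>j\<in>UNIV. \<bar>(y - x) $ j\<bar>)" by (rule norm_le_l1_cart)
    also have "\<dots> < (\<Sum>j\<in>(UNIV :: 'n set). \<delta>)" using that by (intro sum_strict_mono) auto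
    finally show ?thesis by (simp add: \<delta>_def dist_norm norm_minus_commute)
  qed
  obtain \<phi> g where g: "has_gradient \<phi> g" "\<And>y. g y $ i \<ge> 0" "g x $ i > 0"
    "\<And>y. g y $ i \<noteq> 0 \<Longrightarrow> \<forall>j. \<bar>y $ j - x $ j\<bar> < \<delta>"
    using partial_bump_exists[OF \<delta>, of i x] by blast
  have supp: "y \<in> ?U" if "g y $ i \<noteq> 0" for y using g(4)[OF that] box r by blast
  have "(\<Sum>T'\<in>Th. \<integral>y. fst z T' y $ i * g y $ i \<partial>lebesgue_on T') = (\<integral>y. fst z T y $ i * g y $ i \<partial>lebesgue_on T)"
  proof (subst sum.remove[OF finite_Th T], subst sum.neutral)
    show "\<forall>T'\<in>Th - {T}. (\<integral>y. fst z T' y $ i * g y $ i \<partial>lebesgue_on T') = 0"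
    proof
      fix T' assume T': "T' \<in> Th - {T}"
      then have "disjnt T' T" using disj_Th T by (auto simp: pairwise_def)
      then have "fst z T' y $ i * g y $ i = 0" if "y \<in> T'" for y using supp[of y] that by (auto simp: disjnt_def)
      then have "(\<integral>y. fst z T' y $ i * g y $ i \<partial>lebesgue_on T') = (\<integral>y. 0 \<partial>lebesgue_on T')"
        using T' by (intro poly_measure.integral_cong_X[OF poly_measure_T]) auto
      then show "(\<integral>y. fst z T' y $ i * g y $ i \<partial>lebesgue_on T') = 0" by simp
    qed
  qed simp
  then have "(\<integral>y. fst z T y $ i * g y $ i \<partial>lebesgue_on T) = 0"
    using conforming_global_identity[OF z tr sg g(1), of i] by simp
  then have "s * (\<integral>y. fst z T y $ i * g y $ i \<partial>lebesgue_on T) = 0" by simp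
  then have I: "(\<integral>y. s * fst z T y $ i * g y $ i \<partial>lebesgue_on T) = 0" by (simp add: mult.assoc)
  have cg: "continuous_on UNIV (\<lambda>y. g y $ i)" using g(1) by (auto simp: has_gradient_def intro!: continuous_intros)
  have "integrable (lebesgue_on T) (\<lambda>y. s * fst z T y $ i * g y $ i)"
    by (intro integrable_continuous continuous_on_mult cv cg)
  moreover have "s * fst z T y $ i * g y $ i \<ge> 0" for y
    using supp[of y] g(2)[of y] by (cases "g y $ i = 0") auto
  ultimately have "AE y in lebesgue_on T. s * fst z T y $ i * g y $ i = 0"
    using I by (subst (asm) integral_nonneg_eq_0_iff_AE) auto
  then have ae: "AE y in lborel. y \<in> T \<longrightarrow> s * fst z T y $ i * g y $ i = 0"
    using T_lebesgue[OF T] nz by (simp add: AE_restrict_space_iff AE_completion_iff s_def sgn_zero_iff)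
  have "open ((\<lambda>y. g y $ i) -` {0<..} \<inter> UNIV)" using cg by (subst (asm) continuous_on_open_vimage) auto
  then have oV: "open ((\<lambda>y. g y $ i) -` {0<..})" (is "open ?V") by simp
  \<comment> \<open>On \<open>?V\<close> both factors of the integrand are positive, so
    \<open>?V\<close> must be a null set; yet it is open and contains \<open>x\<close>.\<close>
  have "AE y in lborel. y \<notin> ?V"
    using ae
  proof eventually_elim
    case (elim y)
    show ?case
    proof
      assume "y \<in> ?V"
      then have "g y $ i > 0" by simp
      moreover from this have "y \<in> ?U" using supp[of y] by simp
      ultimately show False using elim by auto
    qed
  qed
  then have "?V \<in> null_sets lborel" using oV by (subst AE_iff_null_sets) auto
  then have "negligible ?V" using null_sets_completionI negligible_iff_null_sets by blast
  moreover have "x \<in> ?V" using g(3) by simp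
  ultimately show False using open_not_negligible[OF oV] by blast
qed

theorem energy_kernel:
  assumes z: "z \<in> Z" and G: "\<And>T. T \<in> Th \<Longrightarrow> Gp z T = 0" and s: "st z z = 0"
  shows "z = 0"
proof -
  have tr: "snd z F x = fst z T x" if "T \<in> Th" "F \<in> elt_faces Fh T" "x \<in> F" for T F x
    using st_zero[OF z s that] face_residual_affine[OF that(1,2) z G[OF that(1)] that(3)] by simp
  have sg: "sym_grad (fst z T) = 0" if "T \<in> Th" for T
    by (rule conforming_sym_grad_zero[OF that z tr[OF that] G[OF that]])
  have T0: "fst z T = 0" if T: "T \<in> Th" for T
  proof (rule polys_zero_on_T[OF T Z_elt[OF z T]])
    show "fst z T x = 0" if "x \<in> T" for x
      using conforming_zero[OF z tr sg T that] by (simp add: vec_eq_iff)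
  qed
  show ?thesis
  proof (rule prod_eqI)
    show "fst z = fst 0" using z T0 by (auto simp: fun_eq_iff Z_def)
    have "snd z F = 0" for F
    proof (cases "F \<in> Fh")
      case True
      \<comment> \<open>Every face is part of the frontier of some element, so its component
        inherits the zero values of the element component.\<close>
      then obtain T where T: "T \<in> Th" "F \<in> elt_faces Fh T"
        using face_props[OF True] by (auto simp: is_face_def is_interface_def is_boundary_face_def elt_faces_def)
      obtain b where "snd z F = ext0 F b" using Z_face[OF z True] by blast
      then have "snd z F x = 0" for x
        using tr[OF T, of x] T0[OF T(1)] by (cases "x \<in> F") (auto simp: ext0_def)
      then show ?thesis by (simp add: fun_eq_iff)
    qed (use z in \<open>simp add: Z_def\<close>)
    then show "snd z = snd 0" by (simp add: fun_eq_iff)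
  qed
qed

end

section \<open>Superposition with a Caratheodory function\<close>

lemma complete_measure_lebesgue_on:
  assumes "\<Omega> \<in> sets lebesgue" shows "complete_measure (lebesgue_on \<Omega>)"
proof
  fix A B :: "'a set" assume "B \<subseteq> A" "A \<in> null_sets (lebesgue_on \<Omega>)"
  then have "A \<subseteq> \<Omega>" "A \<in> null_sets lebesgue" using assms by (auto simp: null_sets_restrict_space)
  then have "B \<in> sets lebesgue" using \<open>B \<subseteq> A\<close> completion.complete by blast
  then show "B \<in> sets (lebesgue_on \<Omega>)"
    using \<open>B \<subseteq> A\<close> \<open>A \<subseteq> \<Omega>\<close> assms by (auto simp: sets_restrict_space_iff)
qed

text \<open>Completeness of the measure allows arbitrary values on the null set where the sequence
  does not converge to \<open>g x\<close>.\<close>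

lemma (in complete_measure) borel_measurable_LIMSEQ_AE:
  fixes f :: "nat \<Rightarrow> 'a \<Rightarrow> 'b::euclidean_space"
  assumes "\<And>i. f i \<in> borel_measurable M" "AE x in M. (\<lambda>i. f i x) \<longlonglongrightarrow> g x"
  shows "g \<in> borel_measurable M"
proof (rule measurableI)
  have l: "(\<lambda>x. lim (\<lambda>i. f i x)) \<in> borel_measurable M" by (rule borel_measurable_lim_metric[OF assms(1)])
  fix B :: "'b set" assume B: "B \<in> sets borel"
  show "g -` B \<inter> space M \<in> sets M"
  proof (rule in_sets_AE[OF _ measurable_sets[OF l B]])
    show "AE x in M. x \<in> (\<lambda>x. lim (\<lambda>i. f i x)) -` B \<inter> space M \<longleftrightarrow> x \<in> g -` B \<inter> space M"
      using assms(2) by eventually_elim (simp add: limI)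
  qed auto
qed auto

text \<open>The argument \<open>g x\<close> is approximated by the first member of a dense sequence that is close
  to it.\<close>

lemma (in complete_measure) caratheodory_measurable:
  fixes \<sigma> :: "'a \<Rightarrow> 'b::euclidean_space \<Rightarrow> 'c::euclidean_space"
  assumes cont: "AE x in M. continuous_on S (\<sigma> x)" and meas: "\<And>\<tau>. \<tau> \<in> S \<Longrightarrow> (\<lambda>x. \<sigma> x \<tau>) \<in> borel_measurable M"
    and g: "g \<in> borel_measurable M" and gS: "\<And>x. g x \<in> S"
  shows "(\<lambda>x. \<sigma> x (g x)) \<in> borel_measurable M"
proof -
  obtain D where D: "countable D" "D \<subseteq> S" "S \<subseteq> closure D" by (rule separable[of S]) (rule that)
  have "D \<noteq> {}" using D(3) gS by auto
  then obtain d :: "nat \<Rightarrow> 'b" where d: "range d = D" using D(1) by (metis range_from_nat_into)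
  \<comment> \<open>The least index is a measurable function of \<open>x\<close> with countably many
    values, so \<open>\<sigma> x (d (j m x))\<close> is measurable piece by piece.\<close>
  define j where "j m x = (LEAST i. dist (d i) (g x) < 1 / real (Suc m))" for m x
  have j: "j m \<in> M \<rightarrow>\<^sub>M count_space UNIV" for m
    unfolding j_def[abs_def] using g by measurable
  have near: "dist (d (j m x)) (g x) < 1 / real (Suc m)" for m x
  proof -
    have "g x \<in> closure D" using gS D(3) by blast
    then obtain y where "y \<in> D" "dist y (g x) < 1 / real (Suc m)"
      unfolding closure_approachable by (metis of_nat_0_less_iff zero_less_Suc zero_less_divide_1_iff)
    then have "\<exists>i. dist (d i) (g x) < 1 / real (Suc m)" using d by blast
    then show ?thesis unfolding j_def by (rule LeastI_ex)
  qed
  have lim: "(\<lambda>m. d (j m x)) \<longlonglongrightarrow> g x" for x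
  proof (rule iffD2[OF tendsto_dist_iff], rule Lim_null_comparison)
    show "(\<lambda>m. 1 / real (Suc m)) \<longlonglongrightarrow> 0" by (rule LIMSEQ_inverse_real_of_nat[unfolded inverse_eq_divide])
    show "\<forall>\<^sub>F m in sequentially. norm (dist (d (j m x)) (g x)) \<le> 1 / real (Suc m)"
      by (intro always_eventually allI) (use near[of _ x] in \<open>simp add: less_imp_le\<close>)
  qed
  have dS: "d i \<in> S" for i using d D(2) by blast
  show ?thesis
  proof (rule borel_measurable_LIMSEQ_AE)
    show "(\<lambda>x. \<sigma> x (d (j m x))) \<in> borel_measurable M" for m
      by (rule measurable_compose_countable[OF meas[OF dS] j])
    show "AE x in M. (\<lambda>m. \<sigma> x (d (j m x))) \<longlonglongrightarrow> \<sigma> x (g x)"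
      using cont by eventually_elim (rule continuous_on_tendsto_compose[OF _ lim gS], auto simp: dS)
  qed
qed

lemma polys_values: "p \<in> polys l V \<Longrightarrow> subspace V \<Longrightarrow> p x \<in> V"
  by (erule polysE) (auto intro!: subspace_sum subspace_scale)

section \<open>The discrete problem\<close>

context hho
begin

abbreviation "MO \<equiv> lebesgue_on \<Omega>"

lemma finite_MO: "finite_measure MO"
proof (rule finite_measureI)
  have "emeasure MO \<Omega> = emeasure lborel \<Omega>" using open_\<Omega> by (simp add: emeasure_restrict_space)
  also have "\<dots> < \<infinity>" by (rule emeasure_bounded_finite[OF bounded_\<Omega>])
  finally show "emeasure MO (space MO) \<noteq> \<infinity>" by simp
qed

sublocale MO: finite_measure MO by (rule finite_MO)

sublocale MO: complete_measure MO
  using open_\<Omega> by (intro complete_measure_lebesgue_on) simp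

lemma L2_on_integrable_norm:
  fixes f :: "real^'n \<Rightarrow> 'b::euclidean_space"
  assumes f: "L2_on \<Omega> f" shows "integrable MO (\<lambda>x. norm (f x))"
proof (rule Bochner_Integration.integrable_bound)
  show "integrable MO (\<lambda>x. 1 + (norm (f x))\<^sup>2)" using f by (simp add: L2_on_def)
  show "(\<lambda>x. norm (f x)) \<in> borel_measurable MO" by (rule measurable_compose[OF _ borel_measurable_norm]) (use f in \<open>simp add: L2_on_def\<close>)
  have "t \<le> 1 + t\<^sup>2" for t :: real
  proof -
    have "2 * t \<le> 1 + t\<^sup>2" using zero_le_power2[of "t - 1"] by (simp add: power2_diff)
    then show ?thesis using zero_le_power2[of t] by linarith
  qed
  then show "AE x in MO. norm (norm (f x)) \<le> norm (1 + (norm (f x))\<^sup>2)" by simp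
qed

subsection \<open>Broken polynomials\<close>

lemma broken_at:
  assumes T: "T \<in> Th" and x: "x \<in> T" shows "broken Th w x = w T x"
proof -
  have "x \<notin> T'" if "T' \<in> Th - {T}" for T' using that T x disj_Th by (auto simp: pairwise_def disjnt_def)
  then have "(\<Sum>T'\<in>Th - {T}. if x \<in> T' then w T' x else 0) = 0" by (intro sum.neutral) auto
  then show ?thesis unfolding broken_def using x by (simp add: sum.remove[OF finite_Th T])
qed

lemma broken_cong: "(\<And>T. T \<in> Th \<Longrightarrow> x \<in> T \<Longrightarrow> w T x = w' T x) \<Longrightarrow> broken Th w x = broken Th w' x"
  unfolding broken_def by (intro sum.cong) auto

lemma broken_measurable:
  fixes p :: "(real^'n) set \<Rightarrow> real^'n \<Rightarrow> 'v::euclidean_space"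
  assumes "\<And>T. T \<in> Th \<Longrightarrow> p T \<in> polys l V"
  shows "broken Th p \<in> borel_measurable MO"
proof -
  have "(\<lambda>x. if x \<in> T then p T x else 0) \<in> borel_measurable borel" if "T \<in> Th" for T
    using borel_measurable_continuous_onI[OF continuous_polys[OF polys_UNIV[OF assms[OF that]]]] T_lebesgue(2)[OF that]
    by (intro measurable_If_set) auto
  then have "broken Th p \<in> borel_measurable borel"
    unfolding broken_def[abs_def] by (rule borel_measurable_sum)
  then show ?thesis by (intro measurable_restrict_space1 measurable_completion) simp
qed

lemma broken_bounded:
  fixes p :: "(real^'n) set \<Rightarrow> real^'n \<Rightarrow> 'v::euclidean_space"
  assumes p: "\<And>T. T \<in> Th \<Longrightarrow> p T \<in> polys l V"
  obtains B where "B \<ge> 0" "\<And>x. norm (broken Th p x) \<le> B"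
proof -
  have "\<exists>B. B \<ge> 0 \<and> (\<forall>x. norm (if x \<in> T then p T x else 0) \<le> B)" if T: "T \<in> Th" for T
  proof -
    interpret poly_measure "lebesgue_on T" T by (rule poly_measure_T[OF T])
    obtain B where "\<And>x. x \<in> T \<Longrightarrow> norm (p T x) \<le> B"
      using bounded_on_X[OF continuous_polys[OF polys_UNIV[OF p[OF T]]]] by blast
    then show ?thesis by (intro exI[of _ "max 0 B"]) (auto simp: max.coboundedI2)
  qed
  then obtain B where B: "\<And>T. T \<in> Th \<Longrightarrow> B T \<ge> 0 \<and> (\<forall>x. norm (if x \<in> T then p T x else 0) \<le> B T)" by metis
  show ?thesis
  proof (rule that[of "\<Sum>T\<in>Th. B T"])
    show "(\<Sum>T\<in>Th. B T) \<ge> 0" using B by (intro sum_nonneg) auto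
    show "norm (broken Th p x) \<le> (\<Sum>T\<in>Th. B T)" for x
      unfolding broken_def using B by (intro sum_norm_le) auto
  qed
qed

definition strain :: "'n hybrid \<Rightarrow> real^'n \<Rightarrow> real^'n^'n" where
  "strain z = broken Th (Gp z)"

lemma strain_R: "z \<in> Z \<Longrightarrow> broken Th (strain_rec k Fh (R z)) = strain z"
  unfolding strain_def by (rule ext, rule broken_cong) (simp add: strain_rec_R)

lemma broken_R: "broken Th (fst (R z)) = broken Th (fst z)"
  by (rule ext, rule broken_cong) simp

lemma strain_lincomb:
  assumes "u \<in> Z" "v \<in> Z"
  shows "strain (\<alpha> *\<^sub>R u + \<beta> *\<^sub>R v) x = \<alpha> *\<^sub>R strain u x + \<beta> *\<^sub>R strain v x"
  unfolding strain_def broken_def scaleR_sum_right sum.distrib[symmetric]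
  by (intro sum.cong refl) (simp add: lin_onD[OF lin_on_Gp assms])

lemma lin_on_strain: "lin_on Z (\<lambda>z. strain z x)"
  by (rule lin_onI) (rule strain_lincomb)

lemma strain_sym: assumes "z \<in> Z" shows "strain z x \<in> sym_mats"
  unfolding strain_def broken_def using polys_values[OF Gp_props(1)[OF _ assms] subspace_sym_mats]
  by (intro subspace_sum[OF subspace_sym_mats]) (auto simp: subspace_0[OF subspace_sym_mats])

lemma strain_measurable: "z \<in> Z \<Longrightarrow> strain z \<in> borel_measurable MO"
  unfolding strain_def by (rule broken_measurable) (rule Gp_props(1))

lemma strain_bounded: assumes "z \<in> Z" obtains B where "B \<ge> 0" "\<And>x. norm (strain z x) \<le> B"
proof -
  obtain B where "B \<ge> 0" "\<And>x. norm (broken Th (Gp z) x) \<le> B"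
    by (rule broken_bounded[OF Gp_props(1)[OF _ assms]]) (assumption, rule that)
  then show ?thesis using that by (simp add: strain_def)
qed

lemma integrable_strains:
  assumes uv: "u \<in> Z" "v \<in> Z" shows "integrable MO (\<lambda>x. strain u x \<bullet> strain v x)"
proof -
  obtain B where B: "B \<ge> 0" "\<And>x. norm (strain u x) \<le> B" by (rule strain_bounded[OF uv(1)]) (rule that)
  obtain C where C: "C \<ge> 0" "\<And>x. norm (strain v x) \<le> C" by (rule strain_bounded[OF uv(2)]) (rule that)
  have "norm (strain u x \<bullet> strain v x) \<le> B * C" for x
    using Cauchy_Schwarz_ineq2[of "strain u x" "strain v x"] mult_mono[OF B(2) C(2) B(1) norm_ge_zero, of x x] by simp
  then show ?thesis
    using strain_measurable[OF uv(1)] strain_measurable[OF uv(2)]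
    by (intro MO.integrable_const_bound[of _ "B * C"]) auto
qed

subsection \<open>The energy inner product\<close>

definition energy :: "'n hybrid \<Rightarrow> 'n hybrid \<Rightarrow> real" where
  "energy u v = (\<integral>x. strain u x \<bullet> strain v x \<partial>MO) + st u v"

text \<open>On each element the strain is a polynomial, so vanishing almost everywhere makes it zero
  and \<open>energy_kernel\<close> applies.\<close>

lemma strain_zero_imp:
  assumes z: "z \<in> Z" and ae: "AE x in MO. strain z x = 0" and s: "st z z = 0"
  shows "z = 0"
proof (rule energy_kernel[OF z _ s])
  fix T assume T: "T \<in> Th"
  interpret poly_measure "lebesgue_on T" T by (rule poly_measure_T[OF T])
  have "AE x in lebesgue. x \<in> \<Omega> \<longrightarrow> strain z x = 0"
    using ae open_\<Omega> by (subst (asm) AE_restrict_space_iff) auto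
  then have "AE x in lebesgue. x \<in> T \<longrightarrow> Gp z T x = 0"
    using T_subset[OF T] broken_at[OF T, of _ "Gp z"] by (auto simp: strain_def elim!: eventually_mono)
  then have "AE x in lebesgue_on T. Gp z T x = 0"
    using T_lebesgue[OF T] by (subst AE_restrict_space_iff) auto
  then have "Gp z T x = 0" if "x \<in> T" for x
    using determining_vec[OF polynomial_function_polys[OF Gp_props(1)[OF T z]] _ that] by blast
  then show "Gp z T = 0" by (rule polys_zero_on_T[OF T Gp_props(1)[OF T z]])
qed

lemma inner_space_energy: "inner_space Z energy"
proof
  show "subspace Z" by (rule subspace_Z)
  show "fin_dim Z" by (rule fin_dim_Z)
  show "energy u v = energy v u" for u v by (simp add: energy_def inner_commute st_sym[of u v])
  show "energy (\<alpha> *\<^sub>R u + \<beta> *\<^sub>R v) w = \<alpha> * energy u w + \<beta> * energy v w" if "u \<in> Z" "v \<in> Z" "w \<in> Z" for u v w \<alpha> \<beta>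
    using integrable_strains[OF that(1,3)] integrable_strains[OF that(2,3)] lin_onD[OF lin_on_st[OF that(3)] that(1,2), of \<alpha> \<beta>]
    by (simp add: energy_def strain_lincomb[OF that(1,2)] inner_add_left algebra_simps)
  show "energy u u \<ge> 0" for u by (simp add: energy_def st_nonneg)
  show "u = 0" if u: "u \<in> Z" and z: "energy u u = 0" for u
  proof -
    have "(\<integral>x. strain u x \<bullet> strain u x \<partial>MO) \<ge> 0" by simp
    then have 0: "(\<integral>x. strain u x \<bullet> strain u x \<partial>MO) = 0" "st u u = 0"
      using z st_nonneg[of u] unfolding energy_def by linarith+
    have "AE x in MO. strain u x \<bullet> strain u x = 0"
      using 0(1) integrable_strains[OF u u] by (subst (asm) integral_nonneg_eq_0_iff_AE) auto
    then have "AE x in MO. strain u x = 0" by eventually_elim simp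
    then show ?thesis by (rule strain_zero_imp[OF u _ 0(2)])
  qed
qed

subsection \<open>The nonlinear form\<close>

context
  fixes \<sigma> :: "real^'n \<Rightarrow> real^'n^'n \<Rightarrow> real^'n^'n"
  assumes \<sigma>: "stress_strain \<Omega> \<sigma>"
begin

lemma stress_continuous: "AE x in MO. continuous_on sym_mats (\<sigma> x)"
  using \<sigma> by (simp add: stress_strain_def)

lemma stress_growth: obtains c where "c > 0" "AE x in MO. \<forall>\<tau>\<in>sym_mats. norm (\<sigma> x \<tau>) \<le> c * norm \<tau> + norm (\<sigma> x 0)"
proof -
  obtain c where c: "c > 0" "AE x in MO. \<forall>\<tau>\<in>sym_mats. norm (\<sigma> x \<tau> - \<sigma> x 0) \<le> c * norm \<tau>"
  proof -
    obtain cu cl where "cu > 0" and ae: "AE x in MO. \<forall>\<tau>\<in>sym_mats. \<forall>\<eta>\<in>sym_mats. norm (\<sigma> x \<tau> - \<sigma> x 0) \<le> cu * norm \<tau> \<and>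
       \<sigma> x \<tau> \<bullet> \<tau> \<ge> cl * (norm \<tau>)\<^sup>2 \<and> (\<sigma> x \<tau> - \<sigma> x \<eta>) \<bullet> (\<tau> - \<eta>) \<ge> 0"
      using \<sigma> unfolding stress_strain_def by blast
    moreover have "AE x in MO. \<forall>\<tau>\<in>sym_mats. norm (\<sigma> x \<tau> - \<sigma> x 0) \<le> cu * norm \<tau>"
      using ae by eventually_elim blast
    ultimately show ?thesis using that by blast
  qed
  have "AE x in MO. \<forall>\<tau>\<in>sym_mats. norm (\<sigma> x \<tau>) \<le> c * norm \<tau> + norm (\<sigma> x 0)"
    using c(2)
  proof eventually_elim
    case (elim x)
    show ?case
    proof
      fix \<tau> :: "real^'n^'n" assume "\<tau> \<in> sym_mats"
      then show "norm (\<sigma> x \<tau>) \<le> c * norm \<tau> + norm (\<sigma> x 0)"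
        using elim norm_triangle_ineq2[of "\<sigma> x \<tau>" "\<sigma> x 0"] by fastforce
    qed
  qed
  then show ?thesis using that c(1) by blast
qed

lemma stress_coercive: obtains c where "c > 0" "AE x in MO. \<forall>\<tau>\<in>sym_mats. \<sigma> x \<tau> \<bullet> \<tau> \<ge> c * (norm \<tau>)\<^sup>2"
proof -
  obtain cu cl where "cl > 0" and ae: "AE x in MO. \<forall>\<tau>\<in>sym_mats. \<forall>\<eta>\<in>sym_mats. norm (\<sigma> x \<tau> - \<sigma> x 0) \<le> cu * norm \<tau> \<and>
     \<sigma> x \<tau> \<bullet> \<tau> \<ge> cl * (norm \<tau>)\<^sup>2 \<and> (\<sigma> x \<tau> - \<sigma> x \<eta>) \<bullet> (\<tau> - \<eta>) \<ge> 0"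
    using \<sigma> unfolding stress_strain_def by blast
  moreover have "AE x in MO. \<forall>\<tau>\<in>sym_mats. \<sigma> x \<tau> \<bullet> \<tau> \<ge> cl * (norm \<tau>)\<^sup>2"
    using ae by eventually_elim blast
  ultimately show ?thesis using that by blast
qed

lemma stress_strain_measurable:
  assumes "z \<in> Z" shows "(\<lambda>x. \<sigma> x (strain z x)) \<in> borel_measurable MO"
  using \<sigma> by (intro MO.caratheodory_measurable[OF stress_continuous _ strain_measurable[OF assms] strain_sym[OF assms]])
    (simp add: stress_strain_def)

text \<open>The majorant depends only on the bounds \<open>B\<close> and \<open>C\<close>, so it
  serves a whole sequence of strains in dominated convergence. It is integrable because
  \<open>\<sigma> x 0\<close> is square integrable over a set of finite measure.\<close>

lemma stress_dominated:
  fixes B C :: real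
  obtains w where "integrable MO w" "AE x in MO. \<forall>\<tau>\<in>sym_mats. \<forall>\<eta>. norm \<tau> \<le> B \<longrightarrow> norm \<eta> \<le> C \<longrightarrow> norm (\<sigma> x \<tau> \<bullet> \<eta>) \<le> w x"
proof -
  obtain c where c: "c > 0" "AE x in MO. \<forall>\<tau>\<in>sym_mats. norm (\<sigma> x \<tau>) \<le> c * norm \<tau> + norm (\<sigma> x 0)"
    by (rule stress_growth) (rule that)
  show ?thesis
  proof (rule that[of "\<lambda>x. (c * B + norm (\<sigma> x 0)) * C"])
    have "L2_on \<Omega> (\<lambda>x. \<sigma> x 0)" using \<sigma> by (simp add: stress_strain_def)
    then show "integrable MO (\<lambda>x. (c * B + norm (\<sigma> x 0)) * C)" using L2_on_integrable_norm[of "\<lambda>x. \<sigma> x 0"] by simp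
    show "AE x in MO. \<forall>\<tau>\<in>sym_mats. \<forall>\<eta>. norm \<tau> \<le> B \<longrightarrow> norm \<eta> \<le> C \<longrightarrow> norm (\<sigma> x \<tau> \<bullet> \<eta>) \<le> (c * B + norm (\<sigma> x 0)) * C"
      using c(2)
    proof eventually_elim
      case (elim x)
      show ?case
      proof (intro ballI allI impI)
        fix \<tau> \<eta> :: "real^'n^'n" assume a: "\<tau> \<in> sym_mats" "norm \<tau> \<le> B" "norm \<eta> \<le> C"
        have "c * norm \<tau> \<le> c * B" using a c(1) by simp
        then have "norm (\<sigma> x \<tau>) \<le> c * B + norm (\<sigma> x 0)" using elim a(1) by fastforce
        from mult_mono[OF this a(3)] show "norm (\<sigma> x \<tau> \<bullet> \<eta>) \<le> (c * B + norm (\<sigma> x 0)) * C"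
          using Cauchy_Schwarz_ineq2[of "\<sigma> x \<tau>" \<eta>] order_trans[OF norm_ge_zero \<open>norm (\<sigma> x \<tau>) \<le> _\<close>] by simp
      qed
    qed
  qed
qed

lemma integrable_stress:
  assumes uv: "u \<in> Z" "v \<in> Z" shows "integrable MO (\<lambda>x. \<sigma> x (strain u x) \<bullet> strain v x)"
proof -
  obtain B where B: "B \<ge> 0" "\<And>x. norm (strain u x) \<le> B" by (rule strain_bounded[OF uv(1)]) (rule that)
  obtain C where C: "C \<ge> 0" "\<And>x. norm (strain v x) \<le> C" by (rule strain_bounded[OF uv(2)]) (rule that)
  obtain w where w: "integrable MO w" "AE x in MO. \<forall>\<tau>\<in>sym_mats. \<forall>\<eta>. norm \<tau> \<le> B \<longrightarrow> norm \<eta> \<le> C \<longrightarrow> norm (\<sigma> x \<tau> \<bullet> \<eta>) \<le> w x"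
    by (rule stress_dominated) (rule that)
  show ?thesis
  proof (rule Bochner_Integration.integrable_bound[OF w(1)])
    show "(\<lambda>x. \<sigma> x (strain u x) \<bullet> strain v x) \<in> borel_measurable MO"
      by (intro borel_measurable_inner stress_strain_measurable strain_measurable uv)
    show "AE x in MO. norm (\<sigma> x (strain u x) \<bullet> strain v x) \<le> norm (w x)"
      using w(2)
    proof eventually_elim
      case (elim x)
      then have "norm (\<sigma> x (strain u x) \<bullet> strain v x) \<le> w x" using strain_sym[OF uv(1)] B(2) C(2) by blast
      then show ?case by simp
    qed
  qed
qed

definition form :: "'n hybrid \<Rightarrow> 'n hybrid \<Rightarrow> real" where
  "form u v = (\<integral>x. \<sigma> x (strain u x) \<bullet> strain v x \<partial>MO) + st u v"

lemma lin_on_form: assumes u: "u \<in> Z" shows "lin_on Z (form u)"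
proof (rule lin_onI)
  fix v w :: "'n hybrid" and \<alpha> \<beta> assume vw: "v \<in> Z" "w \<in> Z"
  show "form u (\<alpha> *\<^sub>R v + \<beta> *\<^sub>R w) = \<alpha> *\<^sub>R form u v + \<beta> *\<^sub>R form u w"
    using integrable_stress[OF u vw(1)] integrable_stress[OF u vw(2)] lin_onD[OF lin_on_st[OF u] vw, of \<alpha> \<beta>]
    by (simp add: form_def strain_lincomb[OF vw] inner_add_right st_sym[of u] algebra_simps)
qed

text \<open>Dominated convergence: convergent coefficients are bounded, hence the strains are
  bounded uniformly in \<open>n\<close>, and continuity of \<open>\<sigma> x\<close> gives the
  pointwise limits.\<close>

lemma form_continuous:
  assumes e: "\<And>i::nat. i < N \<Longrightarrow> e i \<in> Z" and v: "v \<in> Z" and c: "\<And>i. i < N \<Longrightarrow> (\<lambda>n. c n i) \<longlonglongrightarrow> c' i"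
  shows "(\<lambda>n. form (\<Sum>i<N. c n i *\<^sub>R e i) v) \<longlonglongrightarrow> form (\<Sum>i<N. c' i *\<^sub>R e i) v"
proof -
  let ?w = "\<lambda>n. \<Sum>i<N. c n i *\<^sub>R e i" and ?w' = "\<Sum>i<N. c' i *\<^sub>R e i"
  have inZ: "(\<Sum>i<N. a i *\<^sub>R e i) \<in> Z" for a
    using e by (intro subspace_sum[OF subspace_Z] subspace_scale[OF subspace_Z]) auto
  have st: "strain (\<Sum>i<N. a i *\<^sub>R e i) x = (\<Sum>i<N. a i *\<^sub>R strain (e i) x)" for a x
    using e by (intro lin_on_sum[OF lin_on_strain subspace_Z]) auto
  have "\<exists>K. \<forall>n. norm (c n i) \<le> K" if "i < N" for i
    using convergent_imp_Bseq[of "\<lambda>n. c n i"] c[OF that] by (auto simp: convergent_def Bseq_def)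
  then obtain K where K: "\<And>i n. i < N \<Longrightarrow> norm (c n i) \<le> K i" by metis
  have "\<exists>B. \<forall>x. norm (strain (e i) x) \<le> B" if i: "i < N" for i
  proof -
    obtain B where "\<And>x. norm (strain (e i) x) \<le> B" by (rule strain_bounded[OF e[OF i]]) (rule that)
    then show ?thesis by blast
  qed
  then obtain E where E: "\<And>i x. i < N \<Longrightarrow> norm (strain (e i) x) \<le> E i" by metis
  define B where "B = (\<Sum>i<N. K i * E i)"
  have B: "norm (strain (?w n) x) \<le> B" for n x
    unfolding st B_def
  proof (rule sum_norm_le)
    fix i assume "i \<in> {..<N}"
    then have i: "i < N" by simp
    have "0 \<le> K i" using K[OF i] norm_ge_zero order_trans by blast
    from mult_mono[OF K[OF i] E[OF i] this norm_ge_zero] show "norm (c n i *\<^sub>R strain (e i) x) \<le> K i * E i" by simp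
  qed
  obtain C where C: "C \<ge> 0" "\<And>x. norm (strain v x) \<le> C" by (rule strain_bounded[OF v]) (rule that)
  obtain w where w: "integrable MO w" "AE x in MO. \<forall>\<tau>\<in>sym_mats. \<forall>\<eta>. norm \<tau> \<le> B \<longrightarrow> norm \<eta> \<le> C \<longrightarrow> norm (\<sigma> x \<tau> \<bullet> \<eta>) \<le> w x"
    by (rule stress_dominated) (rule that)
  have pw: "(\<lambda>n. strain (?w n) x) \<longlonglongrightarrow> strain ?w' x" for x
    unfolding st using c by (intro tendsto_sum tendsto_scaleR tendsto_const) auto
  have "(\<lambda>n. \<integral>x. \<sigma> x (strain (?w n) x) \<bullet> strain v x \<partial>MO) \<longlonglongrightarrow> (\<integral>x. \<sigma> x (strain ?w' x) \<bullet> strain v x \<partial>MO)"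
  proof (rule integral_dominated_convergence[OF _ _ w(1)])
    show "(\<lambda>x. \<sigma> x (strain ?w' x) \<bullet> strain v x) \<in> borel_measurable MO"
      "(\<lambda>x. \<sigma> x (strain (?w n) x) \<bullet> strain v x) \<in> borel_measurable MO" for n
      using integrable_stress[OF inZ v] by blast+
    show "AE x in MO. (\<lambda>n. \<sigma> x (strain (?w n) x) \<bullet> strain v x) \<longlonglongrightarrow> \<sigma> x (strain ?w' x) \<bullet> strain v x"
      using stress_continuous
    proof eventually_elim
      case (elim x)
      then have "(\<lambda>n. \<sigma> x (strain (?w n) x)) \<longlonglongrightarrow> \<sigma> x (strain ?w' x)"
        by (rule continuous_on_tendsto_compose[OF _ pw strain_sym[OF inZ]]) (auto simp: strain_sym[OF inZ])
      then show ?case by (intro tendsto_inner tendsto_const)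
    qed
    show "AE x in MO. norm (\<sigma> x (strain (?w n) x) \<bullet> strain v x) \<le> w x" for n
      using w(2)
    proof eventually_elim
      case (elim x)
      then show ?case using strain_sym[OF inZ] B C(2) by blast
    qed
  qed
  moreover have "(\<lambda>n. st (?w n) v) \<longlonglongrightarrow> st ?w' v"
  proof -
    have "st (\<Sum>i<N. a i *\<^sub>R e i) v = (\<Sum>i<N. a i *\<^sub>R st (e i) v)" for a
      using e by (intro lin_on_sum[OF lin_on_st[OF v] subspace_Z]) auto
    then show ?thesis using c by (simp only:) (intro tendsto_sum tendsto_scaleR tendsto_const, auto)
  qed
  ultimately show ?thesis unfolding form_def by (rule tendsto_add)
qed

lemma form_coercive: obtains m where "m > 0" "\<And>u. u \<in> Z \<Longrightarrow> form u u \<ge> m * energy u u"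
proof -
  obtain c where c: "c > 0" "AE x in MO. \<forall>\<tau>\<in>sym_mats. \<sigma> x \<tau> \<bullet> \<tau> \<ge> c * (norm \<tau>)\<^sup>2"
    by (rule stress_coercive) (rule that)
  show ?thesis
  \<comment> \<open>The strain part is coercive with constant \<open>c\<close>; the stabilisation is
    common to \<open>form\<close> and \<open>energy\<close> and contributes the constant 1.\<close>
  proof (rule that[of "min c 1"])
    show "min c 1 > 0" using c by simp
    fix u assume u: "u \<in> Z"
    have "min c 1 * (\<integral>x. strain u x \<bullet> strain u x \<partial>MO) \<le> c * (\<integral>x. strain u x \<bullet> strain u x \<partial>MO)"
      by (intro mult_right_mono) auto
    also have "\<dots> = (\<integral>x. c * (strain u x \<bullet> strain u x) \<partial>MO)" by simp
    also have "\<dots> \<le> (\<integral>x. \<sigma> x (strain u x) \<bullet> strain u x \<partial>MO)"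
    proof (rule integral_mono_AE[OF _ integrable_stress[OF u u]])
      show "integrable MO (\<lambda>x. c * (strain u x \<bullet> strain u x))" using integrable_strains[OF u u] by simp
      show "AE x in MO. c * (strain u x \<bullet> strain u x) \<le> \<sigma> x (strain u x) \<bullet> strain u x"
        using c(2)
      proof eventually_elim
        case (elim x)
        then show ?case using strain_sym[OF u, of x] by (simp add: power2_norm_eq_inner)
      qed
    qed
    finally have "min c 1 * (\<integral>x. strain u x \<bullet> strain u x \<partial>MO) \<le> (\<integral>x. \<sigma> x (strain u x) \<bullet> strain u x \<partial>MO)" .
    moreover have "min c 1 * st u u \<le> 1 * st u u" by (intro mult_right_mono st_nonneg) simp
    ultimately show "min c 1 * energy u u \<le> form u u" by (simp add: energy_def form_def distrib_left)
  qed
qed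

lemma form_strict:
  assumes mono: "strictly_monotone \<Omega> \<sigma>" and uv: "u \<in> Z" "v \<in> Z" and eq: "\<And>w. w \<in> Z \<Longrightarrow> form u w = form v w"
  shows "u = v"
proof -
  let ?d = "u - v"
  have d: "?d \<in> Z" by (rule subspace_diff[OF subspace_Z uv])
  have sd: "strain ?d x = strain u x - strain v x" for x by (rule lin_on_diff[OF lin_on_strain uv])
  have std: "st u ?d - st v ?d = st ?d ?d" using lin_on_diff[OF lin_on_st[OF d] uv] by simp
  let ?g = "\<lambda>x. (\<sigma> x (strain u x) - \<sigma> x (strain v x)) \<bullet> (strain u x - strain v x)"
  have pos: "AE x in MO. strain u x \<noteq> strain v x \<longrightarrow> ?g x > 0"
    using mono unfolding strictly_monotone_def
  proof eventually_elim
    case (elim x)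
    then show ?case using strain_sym[OF uv(1)] strain_sym[OF uv(2)] by blast
  qed
  then have nn: "AE x in MO. ?g x \<ge> 0"
  proof eventually_elim
    case (elim x)
    then show ?case by (cases "strain u x = strain v x") auto
  qed
  have ig: "integrable MO ?g" "(\<integral>x. ?g x \<partial>MO) = (\<integral>x. \<sigma> x (strain u x) \<bullet> strain ?d x \<partial>MO) - (\<integral>x. \<sigma> x (strain v x) \<bullet> strain ?d x \<partial>MO)"
    using integrable_stress[OF uv(1) d] integrable_stress[OF uv(2) d] by (auto simp: sd inner_diff_left)
  have "(\<integral>x. ?g x \<partial>MO) + st ?d ?d = 0"
    using eq[OF d] ig(2) std by (simp add: form_def)
  moreover have "(\<integral>x. ?g x \<partial>MO) \<ge> 0" using nn by (rule integral_nonneg_AE)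
  ultimately have 0: "(\<integral>x. ?g x \<partial>MO) = 0" "st ?d ?d = 0" using st_nonneg[of ?d] by auto
  then have "AE x in MO. ?g x = 0" using integral_nonneg_eq_0_iff_AE[OF ig(1) nn] by blast
  with pos have "AE x in MO. strain ?d x = 0"
  proof eventually_elim
    case (elim x)
    then show ?case by (cases "strain u x = strain v x") (auto simp: sd)
  qed
  then have "?d = 0" by (rule strain_zero_imp[OF d _ 0(2)])
  then show ?thesis by simp
qed

text \<open>A square integrable load is integrable on the bounded domain, and broken polynomials are
  bounded.\<close>

lemma lin_on_load:
  assumes f: "L2_on \<Omega> f" shows "lin_on Z (\<lambda>v. \<integral>x. f x \<bullet> broken Th (fst v) x \<partial>MO)"
proof -
  have int: "integrable MO (\<lambda>x. f x \<bullet> broken Th (fst v) x)" if v: "v \<in> Z" for v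
  proof -
    obtain B where B: "B \<ge> 0" "\<And>x. norm (broken Th (fst v) x) \<le> B" by (rule broken_bounded[OF Z_elt[OF v]]) (assumption, rule that)
    show ?thesis
    proof (rule Bochner_Integration.integrable_bound)
      show "integrable MO (\<lambda>x. norm (f x) * B)" using L2_on_integrable_norm[OF f] by simp
      show "(\<lambda>x. f x \<bullet> broken Th (fst v) x) \<in> borel_measurable MO"
        using f broken_measurable[OF Z_elt[OF v]] by (intro borel_measurable_inner) (auto simp: L2_on_def)
      have "norm (f x \<bullet> broken Th (fst v) x) \<le> norm (norm (f x) * B)" for x
        using Cauchy_Schwarz_ineq2[of "f x" "broken Th (fst v) x"] mult_left_mono[OF B(2) norm_ge_zero, of "f x" x] B(1) by simp
      then show "AE x in MO. norm (f x \<bullet> broken Th (fst v) x) \<le> norm (norm (f x) * B)" by simp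
    qed
  qed
  show ?thesis
  proof (rule lin_onI)
    fix u v :: "'n hybrid" and \<alpha> \<beta> assume uv: "u \<in> Z" "v \<in> Z"
    have "broken Th (fst (\<alpha> *\<^sub>R u + \<beta> *\<^sub>R v)) x = \<alpha> *\<^sub>R broken Th (fst u) x + \<beta> *\<^sub>R broken Th (fst v) x" for x
      unfolding broken_def scaleR_sum_right sum.distrib[symmetric] by (intro sum.cong refl) simp
    then show "(\<integral>x. f x \<bullet> broken Th (fst (\<alpha> *\<^sub>R u + \<beta> *\<^sub>R v)) x \<partial>MO) =
      \<alpha> *\<^sub>R (\<integral>x. f x \<bullet> broken Th (fst u) x \<partial>MO) + \<beta> *\<^sub>R (\<integral>x. f x \<bullet> broken Th (fst v) x \<partial>MO)"
      using int[OF uv(1)] int[OF uv(2)] by (simp add: inner_add_right)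
  qed
qed

text \<open>Since \<open>R\<close> maps \<open>Z\<close> onto the discrete unknowns, testing with
  images of members of \<open>Z\<close> is testing with everything.\<close>

lemma discrete_solution_R:
  assumes u: "u \<in> Z"
  shows "discrete_solution \<Omega> \<sigma> f \<gamma> k Th Fh (R u) \<longleftrightarrow> (\<forall>v\<in>Z. form u v = (\<integral>x. f x \<bullet> broken Th (fst v) x \<partial>MO))"
proof -
  have "(\<integral>x. \<sigma> x (broken Th (strain_rec k Fh (R u)) x) \<bullet> broken Th (strain_rec k Fh (R v)) x \<partial>MO) + stab \<gamma> k Th Fh (R u) (R v)
     = form u v" if "v \<in> Z" for v
    by (simp add: strain_R[OF u] strain_R[OF that] form_def st_def)
  moreover have "(\<forall>v\<in>hybrid_space0 \<Omega> k Th Fh. P v) \<longleftrightarrow> (\<forall>v\<in>Z. P (R v))" for P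
    using R_in R_surj by metis
  ultimately show ?thesis unfolding discrete_solution_def using R_in[OF u] by (simp add: broken_R)
qed

theorem solution_exists:
  assumes "L2_on \<Omega> f" shows "\<exists>u. discrete_solution \<Omega> \<sigma> f \<gamma> k Th Fh u"
proof -
  obtain m where m: "m > 0" "\<And>u. u \<in> Z \<Longrightarrow> form u u \<ge> m * energy u u" by (rule form_coercive) (rule that)
  have "\<exists>u\<in>Z. \<forall>v\<in>Z. form u v = (\<integral>x. f x \<bullet> broken Th (fst v) x \<partial>MO)"
    by (rule inner_space.coercive_equation_solvable[OF inner_space_energy lin_on_form form_continuous lin_on_load[OF assms] m])
  then show ?thesis using discrete_solution_R by blast
qed

text \<open>By surjectivity of \<open>R\<close> both solutions come from \<open>Z\<close>, so it is
  enough that their preimages coincide.\<close>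

theorem solution_unique:
  assumes "strictly_monotone \<Omega> \<sigma>" "discrete_solution \<Omega> \<sigma> f \<gamma> k Th Fh u" "discrete_solution \<Omega> \<sigma> f \<gamma> k Th Fh v"
  shows "u = v"
proof -
  obtain a where a: "a \<in> Z" "u = R a"
    using assms(2) R_surj[of u] by (auto simp: discrete_solution_def)
  obtain b where b: "b \<in> Z" "v = R b"
    using assms(3) R_surj[of v] by (auto simp: discrete_solution_def)
  have "a = b"
    using assms(2,3) by (intro form_strict[OF assms(1) a(1) b(1)]) (simp add: a b discrete_solution_R)
  then show ?thesis by (simp add: a b)
qed

end

end

text \<open>A finite union of polytopes is closed, and the interior of a closed set is a regular
  open set.\<close>

lemma polyhedral_regular: "polyhedral A \<Longrightarrow> interior (closure A) = A"
proof -
  assume "polyhedral A"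
  then obtain P where P: "finite P" "\<forall>p\<in>P. polytope p" "A = interior (\<Union>P)" by (auto simp: polyhedral_def)
  have cl: "closed (\<Union>P)" using P polytope_imp_closed by (intro closed_Union) auto
  show ?thesis
  proof (rule subset_antisym)
    have "closure A \<subseteq> \<Union>P" unfolding P(3) using cl interior_subset by (rule closure_minimal[rotated])
    then show "interior (closure A) \<subseteq> A" unfolding P(3) by (rule interior_mono)
    show "A \<subseteq> interior (closure A)" using closure_subset by (rule interior_maximal) (simp add: P(3))
  qed
qed

theorem theorem7:
  fixes \<Omega> :: "(real^'n) set"
    and f :: "real^'n \<Rightarrow> real^'n"
    and \<sigma> :: "real^'n \<Rightarrow> real^'n^'n \<Rightarrow> real^'n^'n"
    and \<gamma> :: real and k :: nat and H :: "real set"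
    and Th Fh :: "real \<Rightarrow> (real^'n) set set"
  assumes "CARD('n) \<in> {2, 3}"
    and "polyhedral_domain \<Omega>"
    and "L2_on \<Omega> f"
    and "\<gamma> > 0"
    and "k \<ge> 1"
    and "stress_strain \<Omega> \<sigma>"
    and "regular_mesh_sequence \<Omega> H Th Fh"
  shows "\<forall>h\<in>H. (\<exists>u. discrete_solution \<Omega> \<sigma> f \<gamma> k (Th h) (Fh h) u) \<and>
           (strictly_monotone \<Omega> \<sigma> \<longrightarrow>
             (\<exists>!u. discrete_solution \<Omega> \<sigma> f \<gamma> k (Th h) (Fh h) u))"
proof
  fix h assume "h \<in> H"
  then have mesh: "element_mesh \<Omega> h (Th h)" "face_mesh \<Omega> (Th h) (Fh h)"
    using assms(7) by (auto simp: regular_mesh_sequence_def)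
  interpret hho \<Omega> "Th h" "Fh h" k \<gamma>
  proof
    show "open \<Omega>" "bounded \<Omega>" "interior (closure \<Omega>) = \<Omega>"
      using assms(2) polyhedral_regular by (auto simp: polyhedral_domain_def)
    show "finite (Th h)" "pairwise disjnt (Th h)" "closure \<Omega> = (\<Union>T\<in>Th h. closure T)"
      using mesh(1) by (auto simp: element_mesh_def)
    show "open T" "T \<noteq> {}" "interior (closure T) = T" if "T \<in> Th h" for T
      using mesh(1) that polyhedral_regular by (auto simp: element_mesh_def)
    show "face_mesh \<Omega> (Th h) (Fh h)" by (rule mesh(2))
    show "k \<ge> 1" "\<gamma> > 0" using assms by auto
    show "CARD('n) \<ge> 2" using assms(1) by auto
  qed
  show "(\<exists>u. discrete_solution \<Omega> \<sigma> f \<gamma> k (Th h) (Fh h) u) \<and>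
      (strictly_monotone \<Omega> \<sigma> \<longrightarrow> (\<exists>!u. discrete_solution \<Omega> \<sigma> f \<gamma> k (Th h) (Fh h) u))"
    using solution_exists[OF assms(6,3)] solution_unique[OF assms(6)] by blast
qed

end
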